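(* Let $0<p,q\le\infty$ and $r:=\min(1,p)$. Let $m\in L^\infty(\mathbb{R}^d)$. (1) If $0<u\le r$, then $\|T_mf\|_{\dot B_p^{0,q}}\lesssim \mathcal{K}_u^{0,r}[m]\,\|f\|_{\dot B_p^{0,q}}$ for all $f\in\dot B_p^{0,q}$ (whenever $\mathcal{K}_u^{0,r}[m]<\infty$). (2) If $r<u\le\infty$, then $\|T_mf\|_{\dot B_p^{0,q}}\lesssim \mathcal{K}_u^{d/r-d/u,\,r}[m]\,\|f\|_{\dot B_p^{0,q}}$ for all $f\in\dot B_p^{0,q}$ (whenever $\mathcal{K}_u^{d/r-d/u,\,r}[m]<\infty$). The implicit constants depend only on $d,p,q,u$ and the fixed auxiliary functions $\phi,\varphi$, not on $m$ or $f$.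
   Context: Convention: $1/\infty=0$. Fourier transform: $\widehat f(\xi)=\int_{\mathbb{R}^d} f(x)e^{-2\pi i\langle x,\xi\rangle}dx$; $f^\vee$ is the inverse Fourier transform. Cutoff: $\varphi$ is a fixed smooth function on $\mathbb{R}^d$ with $0\le\varphi\le1$, $\varphi=1$ on $\{1/2\le|\xi|\le2\}$, $\mathrm{supp}\,\varphi\subset\{1/4\le|\xi|\le4\}$. Herz spaces: let $B_0=\{x:|x|\le2\}$ and $B_k=\{x\in\mathbb{R}^d:2^k<|x|\le2^{k+1}\}$ for $k\ge1$. For $0<u\le\infty$, $t>0$ ($t=\infty$ allowed), $s\in\mathbb{R}$, $\|f\|_{K_u^{s,t}}:=\big(\sum_{k=0}^\infty 2^{skt}\|f\|_{L^u(B_k)}^t\big)^{1/t}$ (supremum if $t=\infty$). Put $\mathcal{K}_u^{s,t}[m]:=\sup_{k\in\mathbb{Z}}\big\|(m(2^k\cdot)\varphi)^\vee\big\|_{K_u^{s,t}}$. Littlewood–Paley pieces: $\phi$ is a fixed smooth function with $\widehat\phi$ supported in $\{1/2\le|\xi|\le2\}$ and $\sum_{k\in\mathbb{Z}}\widehat{\phi_k}(\xi)=1$ for $\xi\ne0$, where $\phi_k=2^{kd}\phi(2^k\cdot)$; $\Pi_kf:=\phi_k*f$. Besov space: $\dot B_p^{0,q}$ is the space of $f\in S'/\mathcal{P}$ (tempered distributions modulo polynomials) with $\|f\|_{\dot B_p^{0,q}}:=\big\|\{\|\Pi_kf\|_{L^p}\}_{k\in\mathbb{Z}}\big\|_{\ell^q}<\infty$.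 Multiplier operator: $T_mf=(m\widehat f)^\vee$. For general $f$ in the space it is understood through its pieces: with $m_k:=m\,\varphi(\cdot/2^k)$, $\Pi_kT_mf=m_k^\vee*\Pi_kf$ and $T_mf=\sum_{k\in\mathbb{Z}}m_k^\vee*\Pi_kf$ (under the hypotheses $m_k^\vee\in L^1$). *)

theory Defs
  imports "HOL-Analysis.Analysis" "HOL-Probability.Essential_Supremum"
begin

text \<open>The space \<open>\<real>\<^sup>d\<close> is an arbitrary type \<open>'a::euclidean_space\<close> with \<open>d = DIM('a)\<close>.
  Exponents in \<open>(0, \<infinity>]\<close> have type \<^typ>\<open>ennreal\<close>, where \<open>inverse \<infinity> = 0\<close>.\<close>

section \<open>Schwartz functions and tempered distributions\<close>

definition partial_deriv ::
    "'a::euclidean_space \<Rightarrow> ('a \<Rightarrow> 'b::real_normed_vector) \<Rightarrow> 'a \<Rightarrow> 'b" where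
  "partial_deriv b f = (\<lambda>x. frechet_derivative f (at x) b)"

text \<open>Multi-indices are rendered as lists of basis vectors: the list \<open>[b\<^sub>1, \<dots>, b\<^sub>n]\<close> stands for
  the iterated derivative \<open>\<partial>\<^bsub>b\<^sub>1\<^esub> \<dots> \<partial>\<^bsub>b\<^sub>n\<^esub>\<close>.\<close>

definition partial_derivs ::
    "'a::euclidean_space list \<Rightarrow> ('a \<Rightarrow> 'b::real_normed_vector) \<Rightarrow> 'a \<Rightarrow> 'b" where
  "partial_derivs bs f = foldr partial_deriv bs f"

definition smooth :: "('a::euclidean_space \<Rightarrow> 'b::real_normed_vector) \<Rightarrow> bool" where
  "smooth f \<longleftrightarrow> (\<forall>bs\<in>lists Basis. \<forall>x. partial_derivs bs f differentiable (at x))"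

definition schwartz :: "('a::euclidean_space \<Rightarrow> complex) set" where
  "schwartz = {\<psi>. smooth \<psi> \<and>
     (\<forall>bs\<in>lists Basis. \<forall>N::nat.
        bdd_above (range (\<lambda>x. (1 + norm x) ^ N * norm (partial_derivs bs \<psi> x))))}"

definition schwartz_norm :: "nat \<Rightarrow> ('a::euclidean_space \<Rightarrow> complex) \<Rightarrow> real" where
  "schwartz_norm N \<psi> =
     (\<Sum>bs\<in>{bs\<in>lists Basis. length bs \<le> N}.
        (SUP x. (1 + norm x) ^ N * norm (partial_derivs bs \<psi> x)))"

text \<open>Tempered distributions are the linear functionals on the Schwartz space that are continuous,
  i.e. dominated by one of the (increasing, directed) Schwartz norms.  The values of the functional
  outside \<^const>\<open>schwartz\<close> are irrelevant and are identified by \<open>mod_poly\<close> below.\<close>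

type_synonym 'a functional = "('a \<Rightarrow> complex) \<Rightarrow> complex"

definition tempered :: "'a::euclidean_space functional set" where
  "tempered = {f.
     (\<forall>\<psi>\<in>schwartz. \<forall>\<theta>\<in>schwartz. f (\<lambda>x. \<psi> x + \<theta> x) = f \<psi> + f \<theta>) \<and>
     (\<forall>\<psi>\<in>schwartz. \<forall>c. f (\<lambda>x. c * \<psi> x) = c * f \<psi>) \<and>
     (\<exists>C N. \<forall>\<psi>\<in>schwartz. norm (f \<psi>) \<le> C * schwartz_norm N \<psi>)}"

definition mod_poly :: "'a::euclidean_space functional rel" where
  "mod_poly = {(f, g). f \<in> tempered \<and> g \<in> tempered \<and>
     (\<exists>P :: 'a \<Rightarrow> complex. polynomial_function P \<and>
        (\<forall>\<psi>\<in>schwartz. f \<psi> - g \<psi> = (LINT x|lebesgue. P x * \<psi> x)))}"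

text \<open>The quotient \<open>S'/\<P>\<close>; its elements are equivalence classes.  All notions below that use
  the chosen representative \<open>rep F\<close> only evaluate it at Schwartz functions annihilated by
  polynomials, hence do not depend on the choice.\<close>

definition tempered_mod_poly :: "'a::euclidean_space functional set set" where
  "tempered_mod_poly = tempered // mod_poly"

definition rep :: "'a::euclidean_space functional set \<Rightarrow> 'a functional" where
  "rep F = (SOME f. f \<in> F)"

text \<open>The Schwartz functions annihilated by all polynomials.  Testing against these functions
  gives the weak-* topology on \<open>S'/\<P>\<close>, i.e. the quotient of the weak-* topology on \<open>S'\<close>.\<close>

definition schwartz_inf :: "('a::euclidean_space \<Rightarrow> complex) set" where
  "schwartz_inf = {\<psi>\<in>schwartz. \<forall>P :: 'a \<Rightarrow> complex.
     polynomial_function P \<longrightarrow> (LINT x|lebesgue. P x * \<psi> x) = 0}"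


section \<open>Lebesgue, sequence and Herz quasi-norms\<close>

text \<open>Powers of extended nonnegative numbers, used for exponents \<open>a > 0\<close> only.\<close>

definition epowr :: "ennreal \<Rightarrow> real \<Rightarrow> ennreal" where
  "epowr x a = (if x = \<infinity> then \<infinity> else ennreal (enn2real x powr a))"

definition Lp_norm :: "ennreal \<Rightarrow> 'a::euclidean_space set \<Rightarrow> ('a \<Rightarrow> complex) \<Rightarrow> ennreal" where
  "Lp_norm p A f =
     (if p = \<infinity> then esssup (lebesgue_on A) (\<lambda>x. ennreal (norm (f x)))
      else epowr (\<integral>\<^sup>+x. ennreal (norm (f x) powr enn2real p) \<partial>lebesgue_on A) (1 / enn2real p))"

definition lq_norm :: "ennreal \<Rightarrow> ('i \<Rightarrow> ennreal) \<Rightarrow> ennreal" where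
  "lq_norm q a =
     (if q = \<infinity> then (SUP i. a i)
      else epowr (\<Sum>\<^sub>\<infinity>i. epowr (a i) (enn2real q)) (1 / enn2real q))"

definition herz_shell :: "nat \<Rightarrow> 'a::euclidean_space set" where
  "herz_shell k = (if k = 0 then {x. norm x \<le> 2}
                   else {x. 2 ^ k < norm x \<and> norm x \<le> 2 ^ (k + 1)})"

definition herz_norm ::
    "ennreal \<Rightarrow> real \<Rightarrow> ennreal \<Rightarrow> ('a::euclidean_space \<Rightarrow> complex) \<Rightarrow> ennreal" where
  "herz_norm u s t f =
     lq_norm t (\<lambda>k. ennreal (2 powr (s * real k)) * Lp_norm u (herz_shell k) f)"


section \<open>Fourier transform, Littlewood--Paley pieces and Besov spaces\<close>

definition fourier :: "('a::euclidean_space \<Rightarrow> complex) \<Rightarrow> 'a \<Rightarrow> complex" where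
  "fourier f \<xi> = (LINT x|lebesgue. f x * cis (- 2 * pi * (x \<bullet> \<xi>)))"

definition inv_fourier :: "('a::euclidean_space \<Rightarrow> complex) \<Rightarrow> 'a \<Rightarrow> complex" where
  "inv_fourier f x = (LINT \<xi>|lebesgue. f \<xi> * cis (2 * pi * (x \<bullet> \<xi>)))"

definition convolution ::
    "('a::euclidean_space \<Rightarrow> complex) \<Rightarrow> ('a \<Rightarrow> complex) \<Rightarrow> 'a \<Rightarrow> complex" where
  "convolution f g x = (LINT y|lebesgue. f (x - y) * g y)"

definition cutoff :: "('a::euclidean_space \<Rightarrow> real) \<Rightarrow> bool" where
  "cutoff \<phi> \<longleftrightarrow> smooth \<phi> \<and> (\<forall>\<xi>. 0 \<le> \<phi> \<xi> \<and> \<phi> \<xi> \<le> 1) \<and>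
     (\<forall>\<xi>. 1/2 \<le> norm \<xi> \<and> norm \<xi> \<le> 2 \<longrightarrow> \<phi> \<xi> = 1) \<and>
     closure {\<xi>. \<phi> \<xi> \<noteq> 0} \<subseteq> {\<xi>. 1/4 \<le> norm \<xi> \<and> norm \<xi> \<le> 4}"

definition dyadic :: "('a::euclidean_space \<Rightarrow> complex) \<Rightarrow> int \<Rightarrow> 'a \<Rightarrow> complex" where
  "dyadic \<Phi> k x = of_real (2 powi (k * int DIM('a))) * \<Phi> ((2 powi k) *\<^sub>R x)"

definition littlewood_paley :: "('a::euclidean_space \<Rightarrow> complex) \<Rightarrow> bool" where
  "littlewood_paley \<Phi> \<longleftrightarrow> \<Phi> \<in> schwartz \<and>
     closure {\<xi>. fourier \<Phi> \<xi> \<noteq> 0} \<subseteq> {\<xi>. 1/2 \<le> norm \<xi> \<and> norm \<xi> \<le> 2} \<and>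
     (\<forall>\<xi>. \<xi> \<noteq> 0 \<longrightarrow> ((\<lambda>k. fourier (dyadic \<Phi> k) \<xi>) has_sum 1) (UNIV :: int set))"

text \<open>The piece \<open>\<Pi>\<^sub>k F = \<Phi>\<^sub>k * F\<close>: the convolution of a Schwartz function with a tempered
  distribution is the function obtained by applying the distribution to \<open>y \<mapsto> \<Phi>\<^sub>k (x - y)\<close>.\<close>

definition LP_piece ::
    "('a::euclidean_space \<Rightarrow> complex) \<Rightarrow> int \<Rightarrow> 'a functional set \<Rightarrow> 'a \<Rightarrow> complex" where
  "LP_piece \<Phi> k F x = rep F (\<lambda>y. dyadic \<Phi> k (x - y))"

definition besov_norm ::
    "('a::euclidean_space \<Rightarrow> complex) \<Rightarrow> ennreal \<Rightarrow> ennreal \<Rightarrow> 'a functional set \<Rightarrow> ennreal" where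
  "besov_norm \<Phi> p q F = lq_norm q (\<lambda>k::int. Lp_norm p UNIV (LP_piece \<Phi> k F))"

definition besov_space ::
    "('a::euclidean_space \<Rightarrow> complex) \<Rightarrow> ennreal \<Rightarrow> ennreal \<Rightarrow> 'a functional set set" where
  "besov_space \<Phi> p q = {F\<in>tempered_mod_poly. besov_norm \<Phi> p q F < \<infinity>}"


section \<open>Fourier multipliers\<close>

definition L_infinity :: "('a::euclidean_space \<Rightarrow> complex) set" where
  "L_infinity = {m\<in>borel_measurable lebesgue. Lp_norm \<infinity> UNIV m < \<infinity>}"

definition mult_norm ::
    "('a::euclidean_space \<Rightarrow> real) \<Rightarrow> ennreal \<Rightarrow> real \<Rightarrow> ennreal \<Rightarrow> ('a \<Rightarrow> complex) \<Rightarrow> ennreal" where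
  "mult_norm \<phi> u s t m =
     (SUP k::int. herz_norm u s t (inv_fourier (\<lambda>\<xi>. m ((2 powi k) *\<^sub>R \<xi>) * of_real (\<phi> \<xi>))))"

text \<open>The kernel \<open>m\<^sub>k\<^sup>\<or>\<close>, where \<open>m\<^sub>k = m \<phi>(\<cdot>/2\<^sup>k)\<close>.\<close>

definition mult_kernel ::
    "('a::euclidean_space \<Rightarrow> real) \<Rightarrow> ('a \<Rightarrow> complex) \<Rightarrow> int \<Rightarrow> 'a \<Rightarrow> complex" where
  "mult_kernel \<phi> m k = inv_fourier (\<lambda>\<xi>. m \<xi> * of_real (\<phi> (\<xi> /\<^sub>R (2 powi k))))"

text \<open>\<open>is_multiplier_image \<phi> \<Phi> m F G\<close> states that \<open>T\<^sub>m F = G\<close> in \<open>S'/\<P>\<close>, i.e. that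
  \<open>G = \<Sum>\<^sub>k m\<^sub>k\<^sup>\<or> * \<Pi>\<^sub>k F\<close>, unconditionally in the weak-* topology of \<open>S'/\<P>\<close>.  The integrability
  conditions say that the kernels, the convolutions and their pairings with test functions
  are meaningful, as the Lebesgue integral of a non-integrable function is \<open>0\<close> by convention.\<close>

definition is_multiplier_image ::
    "('a::euclidean_space \<Rightarrow> real) \<Rightarrow> ('a \<Rightarrow> complex) \<Rightarrow> ('a \<Rightarrow> complex)
     \<Rightarrow> 'a functional set \<Rightarrow> 'a functional set \<Rightarrow> bool" where
  "is_multiplier_image \<phi> \<Phi> m F G \<longleftrightarrow>
     F \<in> tempered_mod_poly \<and> G \<in> tempered_mod_poly \<and>
     (\<forall>k. integrable lebesgue (mult_kernel \<phi> m k) \<and>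
          (\<forall>x. integrable lebesgue (\<lambda>y. mult_kernel \<phi> m k (x - y) * LP_piece \<Phi> k F y))) \<and>
     (\<forall>\<psi>\<in>schwartz_inf.
        (\<forall>k. integrable lebesgue
               (\<lambda>x. convolution (mult_kernel \<phi> m k) (LP_piece \<Phi> k F) x * \<psi> x)) \<and>
        ((\<lambda>k. LINT x|lebesgue. convolution (mult_kernel \<phi> m k) (LP_piece \<Phi> k F) x * \<psi> x)
           has_sum rep G \<psi>) (UNIV :: int set))"

end

theory Submission
  imports Defs "HOL-Probability.Probability"
begin

hide_const (open) Convolution.convolution

text \<open>The pieces \<open>\<Pi>\<^sub>k F\<close> and the rescaled kernels of \<open>m\<^sub>k\<close> are band-limited: they are reproduced by
  convolution with a fixed Schwartz function. Hence they obey Peetre's maximal inequality, and this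
  yields Bernstein--Nikolskii bounds and, with \<open>r = min 1 p\<close>, the convolution inequality
  \<open>\<parallel>K * g\<parallel>\<^sub>p \<lesssim> \<parallel>K\<parallel>\<^sub>r \<parallel>g\<parallel>\<^sub>p\<close>. The Herz quasi-norm dominates \<open>\<parallel>K\<parallel>\<^sub>r\<close>, by Hoelder's inequality on each shell if
  \<open>u > r\<close> and by Peetre's inequality, whose weight decays geometrically between shells, if \<open>u \<le> r\<close>. Since \<open>\<Pi>\<^sub>k T F\<close> is the convolution of the
  kernel of \<open>m\<^sub>k\<close> with \<open>\<Pi>\<^sub>k F\<close>, the bound follows scale by scale; \<open>T F\<close> itself is the sum of these pieces.\<close>

section \<open>Integrals over Euclidean space\<close>

text \<open>Two obstacles shape the argument. For \<open>p < 1\<close> Young's inequality fails in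
  general, because an \<open>L^p\<close> quasi-norm does not control local integrals; spectral
  localisation restores it, but with a constant tied to a fixed frequency scale. Hence estimates are
  made after dilation by \<open>2^k\<close>: the kernels of \<open>m(2^k .) \<phi>\<close> are all
  reproduced by \<open>lp_sum \<Phi> {- 2..2}\<close> and the dilated pieces by
  \<open>lp_sum \<Phi> {- 1..1}\<close>, so that constants are uniform in \<open>k\<close> and the
  Jacobian factors \<open>2^(k d/p)\<close> on both sides cancel. Secondly, \<open>F\<close> is a
  class of distributions. Moving convolutions through it requires a Fubini theorem for tempered
  functionals, and the series for the image must be shown to converge: its terms are only bounded by
  multiples of \<open>2^(k d/p)\<close>, which grows as \<open>k\<close> tends to infinity and, for
  \<open>p = \<infinity>\<close>, does not decay as \<open>k\<close> tends to minus infinity. That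
  the image has the expected pieces rests on \<phi> being 1 on the spectrum of \<Phi>: neighbouring
  kernels agree where the spectra of neighbouring pieces overlap.\<close>

lemma nn_integral_lborel_affine:
  fixes f :: "'a::euclidean_space \<Rightarrow> ennreal"
  assumes [measurable]: "f \<in> borel_measurable borel" and c: "c \<noteq> 0"
  shows "(\<integral>\<^sup>+x. f x \<partial>lborel) = ennreal (\<bar>c\<bar> ^ DIM('a)) * (\<integral>\<^sup>+x. f (t + c *\<^sub>R x) \<partial>lborel)"
  by (subst lborel_affine[OF c, of t])
     (simp add: nn_integral_density nn_integral_distr nn_integral_cmult)

lemma integrable_lborel_affine:
  fixes f :: "'a::euclidean_space \<Rightarrow> 'b::{banach, second_countable_topology}"
  assumes f: "integrable lborel f" and c: "c \<noteq> 0"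
  shows "integrable lborel (\<lambda>x. f (t + c *\<^sub>R x))"
proof -
  have [measurable]: "f \<in> borel_measurable borel" using f by auto
  have "ennreal (\<bar>c\<bar> ^ DIM('a)) * (\<integral>\<^sup>+x. norm (f (t + c *\<^sub>R x)) \<partial>lborel) < \<infinity>"
    using f by (subst nn_integral_lborel_affine[OF _ c, symmetric]) (auto simp: integrable_iff_bounded)
  then show ?thesis
    using c by (auto simp: integrable_iff_bounded ennreal_mult_less_top)
qed

lemma integrable_lborel_affine_iff:
  fixes f :: "'a::euclidean_space \<Rightarrow> 'b::{banach, second_countable_topology}"
  assumes c: "c \<noteq> 0"
  shows "integrable lborel (\<lambda>x. f (t + c *\<^sub>R x)) \<longleftrightarrow> integrable lborel f"
proof
  assume "integrable lborel (\<lambda>x. f (t + c *\<^sub>R x))"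
  from integrable_lborel_affine[OF this, of "1 / c" "- (1 / c) *\<^sub>R t"] c
  show "integrable lborel f" by (simp add: algebra_simps)
qed (use integrable_lborel_affine c in blast)

lemma integral_lborel_affine:
  fixes f :: "'a::euclidean_space \<Rightarrow> 'b::{banach, second_countable_topology}"
  assumes c: "c \<noteq> 0"
  shows "(\<integral>x. f x \<partial>lborel) = (\<bar>c\<bar> ^ DIM('a)) *\<^sub>R (\<integral>x. f (t + c *\<^sub>R x) \<partial>lborel)"
proof (cases "integrable lborel f")
  case f[measurable]: True
  have [measurable]: "f \<in> borel_measurable borel" using f by auto
  show ?thesis
    using c f integrable_lborel_affine[OF f c, of t]
    by (subst lborel_affine[OF c, of t])
       (simp add: integral_density integral_distr)
next
  case False
  then show ?thesis using integrable_lborel_affine_iff[OF c, of f t]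
    by (simp add: not_integrable_integral_eq)
qed

lemma nn_integral_lborel_reflect:
  fixes f :: "'a::euclidean_space \<Rightarrow> ennreal"
  assumes "f \<in> borel_measurable borel"
  shows "(\<integral>\<^sup>+y. f (x - y) \<partial>lborel) = (\<integral>\<^sup>+y. f y \<partial>lborel)"
  using nn_integral_lborel_affine[OF assms, of "-1" x] by simp

lemma nn_integral_lborel_shift:
  fixes f :: "'a::euclidean_space \<Rightarrow> ennreal"
  assumes "f \<in> borel_measurable borel"
  shows "(\<integral>\<^sup>+y. f (y - x) \<partial>lborel) = (\<integral>\<^sup>+y. f y \<partial>lborel)"
  using nn_integral_lborel_affine[OF assms, of "1" "-x"] by simp

lemma integral_lborel_reflect:
  fixes f :: "'a::euclidean_space \<Rightarrow> 'b::{banach, second_countable_topology}"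
  shows "(\<integral>y. f (x - y) \<partial>lborel) = (\<integral>y. f y \<partial>lborel)"
  using integral_lborel_affine[of "-1" f x] by simp

lemma integral_lborel_shift:
  fixes f :: "'a::euclidean_space \<Rightarrow> 'b::{banach, second_countable_topology}"
  shows "(\<integral>y. f (y - x) \<partial>lborel) = (\<integral>y. f y \<partial>lborel)"
  using integral_lborel_affine[of "1" f "-x"] by simp

lemma integrable_lborel_reflect:
  fixes f :: "'a::euclidean_space \<Rightarrow> 'b::{banach, second_countable_topology}"
  assumes "integrable lborel f"
  shows "integrable lborel (\<lambda>y. f (x - y))"
  using integrable_lborel_affine[OF assms, of "-1" x] by simp

lemma integrable_lborel_shift:
  fixes f :: "'a::euclidean_space \<Rightarrow> 'b::{banach, second_countable_topology}"
  assumes "integrable lborel f"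
  shows "integrable lborel (\<lambda>y. f (y - x))"
  using integrable_lborel_affine[OF assms, of "1" "-x"] by simp

section \<open>Polynomially decaying weights\<close>

definition weight :: "real \<Rightarrow> 'a::euclidean_space \<Rightarrow> real" where
  "weight a x = (1 + norm x) powr (- a)"

lemma weight_pos [simp]: "0 < weight a x"
proof -
  have "0 < 1 + norm x" by (simp add: add_pos_nonneg)
  then show ?thesis unfolding weight_def by simp
qed

lemma weight_nonneg [simp]: "0 \<le> weight a x"
  using weight_pos less_imp_le by blast

lemma weight_le_one: "0 \<le> a \<Longrightarrow> weight a x \<le> 1"
  using powr_mono[of "-a" 0 "1 + norm x"] by (simp add: weight_def add_nonneg_eq_0_iff)

lemma continuous_weight: "continuous_on A (weight a)"
  unfolding weight_def by (intro continuous_intros) (auto simp: add_nonneg_eq_0_iff)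

lemma measurable_weight [measurable]: "weight a \<in> borel_measurable borel"
  by (intro borel_measurable_continuous_onI continuous_weight)

lemma weight_minus [simp]: "weight a (- x) = weight a x"
  by (simp add: weight_def)

lemma weight_commute: "weight a (x - y) = weight a (y - x)"
  by (simp add: weight_def norm_minus_commute)

lemma weight_add: "weight (a + b) x = weight a x * weight b x"
  unfolding weight_def by (simp add: powr_add [symmetric])

lemma weight_powr: "weight a x powr b = weight (a * b) x"
  unfolding weight_def by (simp add: powr_powr)

lemma weight_mult_power: "weight (real n) x * (1 + norm x) ^ n = 1"
  unfolding weight_def by (simp add: powr_minus powr_realpow add_pos_nonneg add_nonneg_eq_0_iff)

lemma weight_nat: "weight (real n) x = inverse ((1 + norm x) ^ n)"
  unfolding weight_def by (simp add: powr_minus powr_realpow add_pos_nonneg)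

lemma one_plus_norm_add: "1 + norm (x + y) \<le> (1 + norm x) * (1 + norm (y::'a::real_normed_vector))"
proof -
  have "norm (x + y) \<le> norm x + norm y" by (rule norm_triangle_ineq)
  moreover have "0 \<le> norm x * norm y" by simp
  moreover have "(1 + norm x) * (1 + norm y) = 1 + norm x + norm y + norm x * norm y"
    by (simp add: algebra_simps)
  ultimately show ?thesis by linarith
qed

lemma weight_mono: "a \<le> b \<Longrightarrow> weight b x \<le> weight a x"
  unfolding weight_def by (rule powr_mono) auto

text \<open>Inverse form of Peetre's inequality \<open>1 + |x + y| <= (1 + |x|) (1 + |y|)\<close>.
  It trades a weight centred at one point for a weight centred at another, which is what lets the
  maximal function estimate close up.\<close>

lemma weight_submult: "0 \<le> a \<Longrightarrow> weight a x * weight a y \<le> weight a (x + y)"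
proof -
  assume a: "0 \<le> a"
  have "(1 + norm (x + y)) powr a \<le> ((1 + norm x) * (1 + norm y)) powr a"
    by (intro powr_mono2 a one_plus_norm_add) simp
  then have "inverse (((1 + norm x) * (1 + norm y)) powr a) \<le> inverse ((1 + norm (x + y)) powr a)"
    by (intro le_imp_inverse_le) (auto simp: add_nonneg_eq_0_iff)
  then show ?thesis unfolding weight_def by (simp add: powr_minus powr_mult)
qed

lemma integrable_one_dim_weight: "integrable lborel (\<lambda>x::real. (1 + \<bar>x\<bar>) powr (-2))"
proof -
  have 1: "integrable lborel (\<lambda>x::real. inverse (1 + x\<^sup>2))"
    using integrable_inverse_1_plus_square by (simp add: set_integrable_def)
  have 2: "(1 + \<bar>x\<bar>) powr (-2) \<le> inverse (1 + x\<^sup>2)" for x :: real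
    by (simp add: powr_minus powr_numeral power2_eq_square field_simps add_pos_nonneg)
  show ?thesis by (rule Bochner_Integration.integrable_bound[OF 1]) (use 2 in auto)
qed

text \<open>Comparison with a product: every factor \<open>1 + |x \<bullet> b|\<close> is at most
  \<open>1 + |x|\<close>, so the exponent \<open>2 d\<close> distributes as 2 over each coordinate
  and Tonelli reduces to dimension one. The threshold \<open>2 d\<close> is the one this product
  argument produces.\<close>

lemma integrable_weight:
  assumes a: "2 * real DIM('a) \<le> a"
  shows "integrable lborel (weight a :: 'a::euclidean_space \<Rightarrow> real)"
proof -
  have b: "weight a x \<le> (\<Prod>b\<in>Basis. (1 + \<bar>x \<bullet> b\<bar>) powr (-2))" for x :: 'a
  proof -
    have "weight a x \<le> weight (2 * real DIM('a)) x" by (rule weight_mono[OF a])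
    also have "\<dots> = (\<Prod>b\<in>(Basis :: 'a set). (1 + norm x) powr (-2))"
    proof -
      have "(1 + norm x) powr (- (2 * real DIM('a))) = ((1 + norm x) powr (-2)) powr (real DIM('a))"
        by (simp add: powr_powr)
      also have "\<dots> = ((1 + norm x) powr (-2)) ^ DIM('a)"
        by (rule powr_realpow) (simp add: add_nonneg_eq_0_iff)
      finally show ?thesis by (simp add: weight_def)
    qed
    also have "\<dots> \<le> (\<Prod>b\<in>Basis. (1 + \<bar>x \<bullet> b\<bar>) powr (-2))"
      by (intro prod_mono conjI powr_mono2') (auto simp: Basis_le_norm)
    finally show ?thesis .
  qed
  have "(\<integral>\<^sup>+x. weight a (x::'a) \<partial>lborel) \<le> (\<integral>\<^sup>+x. (\<Prod>b\<in>Basis. ennreal ((1 + \<bar>(x::'a) \<bullet> b\<bar>) powr (-2))) \<partial>lborel)"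
    using b by (intro nn_integral_mono) (auto simp: prod_ennreal intro!: ennreal_leI)
  also have "\<dots> = (\<Prod>b\<in>(Basis::'a set). \<integral>\<^sup>+x. ennreal ((1 + \<bar>x\<bar>) powr (-2)) \<partial>lborel)"
    by (rule nn_integral_lborel_prod[of "\<lambda>b x. ennreal ((1 + \<bar>x\<bar>) powr (-2))"]) auto
  also have "\<dots> < \<infinity>"
    using integrable_one_dim_weight
    by (auto simp: power_eq_top_ennreal less_top[symmetric] integrable_iff_bounded)
  finally show ?thesis by (simp add: integrable_iff_bounded)
qed

text \<open>Convexity of \<open>x powr p\<close> at \<open>A\<close>, in a multiplied out form that
  can be integrated against a weight. Young's inequality for the conjugate exponents
  \<open>p\<close> and \<open>p / (p - 1)\<close> is the same tangent inequality.\<close>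

lemma powr_tangent:
  fixes x A p :: real
  assumes "1 \<le> p" "0 \<le> x" "0 \<le> A"
  shows "p * A powr (p - 1) * x \<le> x powr p + (p - 1) * A powr p"
proof (cases "p = 1")
  case True
  then show ?thesis using assms by (cases "A = 0") auto
next
  case False
  with assms have p: "p > 1" by simp
  define q where "q = p / (p - 1)"
  have q: "q > 1" "1 / p + 1 / q = 1" using p by (auto simp: q_def field_simps)
  have "x * A powr (p - 1) \<le> x powr p / p + (A powr (p - 1)) powr q / q"
    by (rule Youngs_inequality) (use p q assms in auto)
  also have "(A powr (p - 1)) powr q = A powr p"
    using p by (simp add: powr_powr q_def)
  finally show ?thesis using p by (simp add: q_def field_simps)
qed

text \<open>Jensen for a weight of total mass \<open>W\<close> instead of 1, which accounts for the
  factor \<open>W powr (p - 1)\<close>. The tangent at the weighted mean is integrated. It is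
  applied both to Lebesgue measure and to counting measure on the shells.\<close>

lemma jensen_powr:
  fixes w f :: "'a \<Rightarrow> real"
  assumes [measurable]: "w \<in> borel_measurable M" "f \<in> borel_measurable M"
    and nn: "\<And>x. 0 \<le> w x" "\<And>x. 0 \<le> f x"
    and p: "1 \<le> p" and W: "(\<integral>\<^sup>+x. ennreal (w x) \<partial>M) = ennreal W" "0 \<le> W"
  shows "epowr (\<integral>\<^sup>+x. ennreal (w x * f x) \<partial>M) p
           \<le> ennreal (W powr (p - 1)) * (\<integral>\<^sup>+x. ennreal (w x * f x powr p) \<partial>M)"
proof -
  let ?J = "\<integral>\<^sup>+x. ennreal (w x * f x powr p) \<partial>M"
  let ?I = "\<integral>\<^sup>+x. ennreal (w x * f x) \<partial>M"
  have z: ?thesis if "?I = 0" using that by (simp add: epowr_def)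
  consider "W = 0" | "W > 0" "?J = \<infinity>" | "W > 0" "?J < \<infinity>"
    using W(2) by (cases "W = 0"; cases "?J = \<infinity>") (auto simp: less_top)
  then show ?thesis
  proof cases
    case 1
    then have "AE x in M. ennreal (w x) = 0" using W by (simp add: nn_integral_0_iff_AE)
    then have "AE x in M. ennreal (w x * f x) = 0"
      by (rule AE_mp) (use nn in \<open>auto simp: ennreal_mult\<close>)
    then have "?I = 0" by (subst nn_integral_0_iff_AE) auto
    then show ?thesis by (rule z)
  next
    case 2
    then show ?thesis by (simp add: ennreal_mult_top)
  next
    case 3
    \<comment> \<open>Only finiteness of the left integral is at stake here; without it the mean
      \<open>A\<close> would not be a real number.\<close>
    have le: "f x \<le> 1 + f x powr p" for x
    proof (cases "f x \<le> 1")
      case False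
      then have "f x powr 1 \<le> f x powr p" using p by (intro powr_mono) auto
      then show ?thesis using False by simp
    qed (simp add: add_increasing2)
    have "?I \<le> (\<integral>\<^sup>+x. ennreal (w x) + ennreal (w x * f x powr p) \<partial>M)"
    proof (intro nn_integral_mono)
      fix x
      have "w x * f x \<le> w x * (1 + f x powr p)" using le nn by (intro mult_left_mono) auto
      then show "ennreal (w x * f x) \<le> ennreal (w x) + ennreal (w x * f x powr p)"
        using nn by (subst ennreal_plus[symmetric]) (auto intro!: ennreal_leI simp: algebra_simps simp del: ennreal_plus)
    qed
    also have "\<dots> = ennreal W + ?J" by (subst nn_integral_add) (auto simp: W)
    also have "\<dots> < \<infinity>" using 3 by simp
    finally obtain I where I: "?I = ennreal I" "0 \<le> I" by (cases ?I) auto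
    obtain J where J: "?J = ennreal J" "0 \<le> J" using 3 by (cases ?J) auto
    \<comment> \<open>The weighted mean, where the tangent gives the sharp bound.\<close>
    define A where "A = I / W"
    have A: "0 \<le> A" using I 3 by (simp add: A_def)
    define c d where "c = p * A powr (p - 1)" and "d = (p - 1) * A powr p"
    have cd: "0 \<le> c" "0 \<le> d" using p by (auto simp: c_def d_def)
    have "ennreal c * ?I = (\<integral>\<^sup>+x. ennreal c * ennreal (w x * f x) \<partial>M)"
      by (rule nn_integral_cmult[symmetric]) auto
    also have "\<dots> \<le> (\<integral>\<^sup>+x. ennreal (w x * f x powr p) + ennreal d * ennreal (w x) \<partial>M)"
    proof (intro nn_integral_mono)
      fix x
      have "w x * (c * f x) \<le> w x * (f x powr p + d)"
        using powr_tangent[OF p nn(2) A] nn unfolding c_def d_def by (intro mult_left_mono) auto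
      then show "ennreal c * ennreal (w x * f x) \<le> ennreal (w x * f x powr p) + ennreal d * ennreal (w x)"
        using nn cd by (auto simp: ennreal_mult[symmetric] ennreal_plus[symmetric] algebra_simps
            simp del: ennreal_plus intro!: ennreal_leI)
    qed
    also have "\<dots> = ?J + ennreal d * ennreal W"
      by (subst nn_integral_add) (auto simp: W nn_integral_cmult)
    finally have "c * I \<le> J + d * W"
      using I J W cd by (auto simp: ennreal_mult[symmetric] ennreal_plus[symmetric] simp del: ennreal_plus)
    then have "p * A powr (p - 1) * I \<le> J + (p - 1) * A powr p * W"
      unfolding c_def d_def .
    moreover have "A powr (p - 1) * I = A powr p * W"
      using 3 A p by (cases "A = 0") (auto simp: A_def powr_diff field_simps)
    ultimately have "p * (A powr p * W) \<le> J + (p - 1) * (A powr p * W)" by (simp add: mult.assoc)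
    then have "A powr p * W \<le> J" by (simp add: left_diff_distrib)
    moreover have "A powr p * W = I powr p / W powr (p - 1)"
      using 3 I by (simp add: A_def powr_divide powr_diff field_simps)
    then have "I powr p = W powr (p - 1) * (A powr p * W)" using 3 by simp
    ultimately have "I powr p \<le> W powr (p - 1) * J" by (simp add: mult_left_mono)
    then show ?thesis using I J by (simp add: epowr_def ennreal_mult[symmetric] ennreal_leI)
  qed
qed

section \<open>Schwartz functions\<close>

lemma partial_derivs_Nil [simp]: "partial_derivs [] f = f"
  by (simp add: partial_derivs_def)

lemma partial_derivs_Cons [simp]: "partial_derivs (b # bs) f = partial_deriv b (partial_derivs bs f)"
  by (simp add: partial_derivs_def)

lemma partial_derivs_append: "partial_derivs (as @ bs) f = partial_derivs as (partial_derivs bs f)"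
  by (simp add: partial_derivs_def)

lemma partial_derivI: "(f has_derivative D) (at x) \<Longrightarrow> partial_deriv b f x = D b"
  unfolding partial_deriv_def by (drule frechet_derivative_at) simp

lemma has_derivative_partial_deriv:
  fixes f :: "'a::euclidean_space \<Rightarrow> 'b::real_normed_vector"
  assumes "f differentiable (at x)"
  shows "(f has_derivative (\<lambda>h. \<Sum>b\<in>Basis. (h \<bullet> b) *\<^sub>R partial_deriv b f x)) (at x)"
proof -
  have D: "(f has_derivative frechet_derivative f (at x)) (at x)"
    using assms frechet_derivative_works by blast
  interpret linear "frechet_derivative f (at x)"
    using assms by (rule linear_frechet_derivative)
  have "frechet_derivative f (at x) h = (\<Sum>b\<in>Basis. (h \<bullet> b) *\<^sub>R partial_deriv b f x)" for h
    unfolding partial_deriv_def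
    by (subst euclidean_representation[of h, symmetric]) (simp only: sum scaleR)
  with D show ?thesis by (simp add: fun_eq_iff has_derivative_eq_rhs)
qed

lemma smooth_differentiable:
  "smooth f \<Longrightarrow> bs \<in> lists Basis \<Longrightarrow> partial_derivs bs f differentiable (at x)"
  by (simp add: smooth_def)

lemma smooth_continuous: "smooth f \<Longrightarrow> continuous_on A f"
  using smooth_differentiable[of f "[]"]
  by (auto intro!: continuous_at_imp_continuous_on differentiable_imp_continuous_within)

lemma smooth_partial_derivs: "smooth f \<Longrightarrow> bs \<in> lists Basis \<Longrightarrow> smooth (partial_derivs bs f)"
  unfolding smooth_def by (metis append_in_lists_conv partial_derivs_append)

lemma schwartz_smooth: "\<psi> \<in> schwartz \<Longrightarrow> smooth \<psi>"
  by (simp add: schwartz_def)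

lemma schwartz_continuous: "\<psi> \<in> schwartz \<Longrightarrow> continuous_on A \<psi>"
  by (rule smooth_continuous[OF schwartz_smooth])

lemma schwartz_measurable: "\<psi> \<in> schwartz \<Longrightarrow> \<psi> \<in> borel_measurable borel"
  by (intro borel_measurable_continuous_onI schwartz_continuous)

lemma schwartz_bdd:
  "\<psi> \<in> schwartz \<Longrightarrow> bs \<in> lists Basis
    \<Longrightarrow> bdd_above (range (\<lambda>x. (1 + norm x) ^ N * norm (partial_derivs bs \<psi> x)))"
  by (auto simp: schwartz_def)

lemma schwartz_partial_derivs: "\<psi> \<in> schwartz \<Longrightarrow> bs \<in> lists Basis \<Longrightarrow> partial_derivs bs \<psi> \<in> schwartz"
  unfolding schwartz_def
  by (auto simp: smooth_partial_derivs partial_derivs_append[symmetric])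

lemma schwartz_partial_deriv: "\<psi> \<in> schwartz \<Longrightarrow> b \<in> Basis \<Longrightarrow> partial_deriv b \<psi> \<in> schwartz"
  using schwartz_partial_derivs[of \<psi> "[b]"] by simp

definition sup_weight :: "nat \<Rightarrow> ('a::euclidean_space \<Rightarrow> complex) \<Rightarrow> real" where
  "sup_weight L \<psi> = (SUP x. (1 + norm x) ^ L * norm (\<psi> x))"

lemma sup_weight_upper:
  assumes "\<psi> \<in> schwartz"
  shows "(1 + norm x) ^ L * norm (\<psi> x) \<le> sup_weight L \<psi>"
  unfolding sup_weight_def using schwartz_bdd[OF assms, of "[]" L] by (intro cSUP_upper) auto

lemma sup_weight_nonneg: "\<psi> \<in> schwartz \<Longrightarrow> 0 \<le> sup_weight L \<psi>"
  by (rule order_trans[OF _ sup_weight_upper[of \<psi> 0]]) auto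

lemma sup_weight_bound:
  assumes "\<psi> \<in> schwartz"
  shows "norm (\<psi> x) \<le> sup_weight L \<psi> * weight (real L) x"
  using sup_weight_upper[OF assms, of x L]
  by (simp add: weight_nat field_simps add_pos_nonneg)

lemma sup_weight_le:
  "(\<And>x. (1 + norm x) ^ L * norm (\<psi> x) \<le> c) \<Longrightarrow> sup_weight L \<psi> \<le> c"
  unfolding sup_weight_def by (intro cSUP_least) auto

lemma schwartz_norm_eq:
  "schwartz_norm N \<psi> = (\<Sum>bs\<in>{bs\<in>lists Basis. length bs \<le> N}. sup_weight N (partial_derivs bs \<psi>))"
  by (simp add: schwartz_norm_def sup_weight_def)

lemma finite_multi_indices: "finite {bs\<in>lists (Basis::'a::euclidean_space set). length bs \<le> N}"
  using finite_lists_length_le[of "Basis::'a set" N] by (auto simp: lists_eq_set)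

lemma sup_weight_le_schwartz_norm:
  assumes "\<psi> \<in> schwartz" "bs \<in> lists Basis" "length bs \<le> N" "L \<le> N"
  shows "sup_weight L (partial_derivs bs \<psi>) \<le> schwartz_norm N \<psi>"
proof -
  have "sup_weight L (partial_derivs bs \<psi>) \<le> sup_weight N (partial_derivs bs \<psi>)"
  proof (rule sup_weight_le)
    fix x
    have "(1 + norm x) ^ L * norm (partial_derivs bs \<psi> x) \<le> (1 + norm x) ^ N * norm (partial_derivs bs \<psi> x)"
      by (intro mult_right_mono power_increasing assms) auto
    also have "\<dots> \<le> sup_weight N (partial_derivs bs \<psi>)"
      by (intro sup_weight_upper schwartz_partial_derivs assms)
    finally show "(1 + norm x) ^ L * norm (partial_derivs bs \<psi> x) \<le> sup_weight N (partial_derivs bs \<psi>)" .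
  qed
  also have "\<dots> \<le> schwartz_norm N \<psi>"
    unfolding schwartz_norm_eq using assms
    by (intro member_le_sum finite_multi_indices sup_weight_nonneg schwartz_partial_derivs) auto
  finally show ?thesis .
qed

lemma schwartz_norm_nonneg: "\<psi> \<in> schwartz \<Longrightarrow> 0 \<le> schwartz_norm N \<psi>"
  unfolding schwartz_norm_eq by (intro sum_nonneg sup_weight_nonneg schwartz_partial_derivs) auto

lemma schwartzI:
  assumes "smooth \<psi>"
    and "\<And>bs N. bs \<in> lists Basis \<Longrightarrow> \<exists>C. \<forall>x. norm (partial_derivs bs \<psi> x) \<le> C * weight (real N) x"
  shows "\<psi> \<in> schwartz"
  unfolding schwartz_def
proof (intro CollectI conjI ballI allI)
  fix bs :: "'a list" and N :: nat assume "bs \<in> lists Basis"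
  then obtain C where C: "\<And>x. norm (partial_derivs bs \<psi> x) \<le> C * weight (real N) x"
    using assms(2)[of bs N] by blast
  have "(1 + norm x) ^ N * norm (partial_derivs bs \<psi> x) \<le> C" for x
    using C[of x] by (simp add: weight_nat field_simps add_pos_nonneg)
  then show "bdd_above (range (\<lambda>x. (1 + norm x) ^ N * norm (partial_derivs bs \<psi> x)))"
    by (intro bdd_aboveI[of _ C]) auto
qed (rule assms(1))

section \<open>First and second order Taylor estimates\<close>

lemma schwartz_has_derivative:
  assumes "\<psi> \<in> schwartz"
  shows "(\<psi> has_derivative (\<lambda>h. \<Sum>b\<in>Basis. (h \<bullet> b) *\<^sub>R partial_deriv b \<psi> x)) (at x)"
  using has_derivative_partial_deriv smooth_differentiable[OF schwartz_smooth[OF assms], of "[]"]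
  by auto

lemma norm_sum_inner_Basis_le:
  fixes v :: "'a::euclidean_space \<Rightarrow> 'b::real_normed_vector"
  assumes "\<And>b. b \<in> Basis \<Longrightarrow> norm (v b) \<le> c b"
  shows "norm (\<Sum>b\<in>Basis. (h \<bullet> b) *\<^sub>R v b) \<le> norm h * (\<Sum>b\<in>Basis. c b)"
proof -
  have "norm (\<Sum>b\<in>Basis. (h \<bullet> b) *\<^sub>R v b) \<le> (\<Sum>b\<in>Basis. norm h * c b)"
    using assms by (intro sum_norm_le) (auto intro!: mult_mono simp: Basis_le_norm)
  then show ?thesis by (simp add: sum_distrib_left)
qed

lemma weight_shift_le:
  assumes "norm (x - z) \<le> norm y"
  shows "weight (real L) z \<le> (1 + norm y) ^ L * weight (real L) x"
proof -
  have "1 + norm x \<le> (1 + norm z) * (1 + norm (x - z))"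
    using one_plus_norm_add[of z "x - z"] by simp
  also have "\<dots> \<le> (1 + norm z) * (1 + norm y)"
    using assms by (intro mult_left_mono) auto
  finally have "(1 + norm x) ^ L \<le> (1 + norm z) ^ L * (1 + norm y) ^ L"
    by (metis power_mono power_mult_distrib add_nonneg_nonneg norm_ge_zero zero_le_one)
  moreover have "0 < (1 + norm x) ^ L" "0 < (1 + norm z) ^ L" "0 < (1 + norm y) ^ L"
    by (auto intro!: zero_less_power add_pos_nonneg)
  ultimately show ?thesis by (simp add: weight_nat field_simps)
qed

text \<open>Mean value inequality along the segment from \<open>x\<close> to \<open>x - y\<close>.
  The gradient decays like the weight at the intermediate point; moving that weight back to
  \<open>x\<close> costs the factor \<open>(1 + |y|) ^ L\<close>.\<close>

lemma schwartz_weighted_lipschitz: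
  assumes \<psi>: "\<psi> \<in> schwartz"
  shows "norm (\<psi> (x - y) - \<psi> x)
    \<le> norm y * (1 + norm y) ^ L * weight (real L) x * (\<Sum>b\<in>Basis. sup_weight L (partial_deriv b \<psi>))"
proof -
  define B where "B = (1 + norm y) ^ L * weight (real L) x * (\<Sum>b\<in>Basis. sup_weight L (partial_deriv b \<psi>))"
  have "norm (\<psi> (x - y) - \<psi> x) \<le> B * norm ((x - y) - x)"
  proof (rule differentiable_bound[where S = "closed_segment x (x - y)"
        and f' = "\<lambda>z h. \<Sum>b\<in>Basis. (h \<bullet> b) *\<^sub>R partial_deriv b \<psi> z"])
    fix z assume z: "z \<in> closed_segment x (x - y)"
    show "(\<psi> has_derivative (\<lambda>h. \<Sum>b\<in>Basis. (h \<bullet> b) *\<^sub>R partial_deriv b \<psi> z)) (at z within closed_segment x (x - y))"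
      using schwartz_has_derivative[OF \<psi>] has_derivative_at_withinI by blast
    have "norm (x - z) \<le> norm y"
      using z segment_bound(1)[OF z] by (simp add: norm_minus_commute)
    note w = weight_shift_le[OF this, of L]
    show "onorm (\<lambda>h. \<Sum>b\<in>Basis. (h \<bullet> b) *\<^sub>R partial_deriv b \<psi> z) \<le> B"
    proof (rule onorm_le)
      fix h
      have "norm (\<Sum>b\<in>Basis. (h \<bullet> b) *\<^sub>R partial_deriv b \<psi> z)
         \<le> norm h * (\<Sum>b\<in>Basis. sup_weight L (partial_deriv b \<psi>) * ((1 + norm y) ^ L * weight (real L) x))"
        by (intro norm_sum_inner_Basis_le order_trans[OF sup_weight_bound[where L=L]] mult_left_mono w
            schwartz_partial_deriv \<psi> sup_weight_nonneg)
      also have "\<dots> = B * norm h" by (simp add: B_def sum_distrib_right sum_distrib_left mult_ac)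
      finally show "norm (\<Sum>b\<in>Basis. (h \<bullet> b) *\<^sub>R partial_deriv b \<psi> z) \<le> B * norm h" .
    qed
  qed auto
  then show ?thesis by (simp add: B_def mult_ac)
qed

text \<open>The gradient is Lipschitz by the weighted estimate with \<open>L = 0\<close>, so
  linearisation errs by a quadratic term. Uniformity in \<open>x\<close> is what later permits
  differentiation under a convolution integral.\<close>

lemma schwartz_second_order:
  assumes \<psi>: "\<psi> \<in> schwartz"
  obtains B where "0 \<le> B" "\<And>x h. norm (\<psi> (x + h) - \<psi> x - (\<Sum>b\<in>Basis. (h \<bullet> b) *\<^sub>R partial_deriv b \<psi> x)) \<le> B * norm h ^ 2"
proof
  define c where "c b = (\<Sum>b'\<in>Basis. sup_weight 0 (partial_deriv b' (partial_deriv b \<psi>)))" for b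
  define B where "B = (\<Sum>b\<in>(Basis::'a set). c b)"
  show B: "0 \<le> B" unfolding B_def c_def
    by (intro sum_nonneg sup_weight_nonneg schwartz_partial_deriv \<psi>)
  fix x h
  have "norm (\<psi> (x + h) - \<psi> x - (\<Sum>b\<in>Basis. (((x + h) - x) \<bullet> b) *\<^sub>R partial_deriv b \<psi> x)) \<le> norm ((x + h) - x) * (norm h * B)"
  proof (rule differentiable_bound_linearization[where S = "closed_segment x (x + h)" and ?x0.0 = x
        and f' = "\<lambda>z h. \<Sum>b\<in>Basis. (h \<bullet> b) *\<^sub>R partial_deriv b \<psi> z"])
    fix t :: real assume "t \<in> {0..1}"
    then show "x + t *\<^sub>R (x + h - x) \<in> closed_segment x (x + h)"
      by (auto simp: closed_segment_def algebra_simps)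
  next
    fix z assume z: "z \<in> closed_segment x (x + h)"
    show "(\<psi> has_derivative (\<lambda>h. \<Sum>b\<in>Basis. (h \<bullet> b) *\<^sub>R partial_deriv b \<psi> z)) (at z within closed_segment x (x + h))"
      using schwartz_has_derivative[OF \<psi>] has_derivative_at_withinI by blast
    have zx: "norm (z - x) \<le> norm h"
      using segment_bound(1)[OF z] by simp
    show "onorm ((\<lambda>h. \<Sum>b\<in>Basis. (h \<bullet> b) *\<^sub>R partial_deriv b \<psi> z)
        - (\<lambda>h. \<Sum>b\<in>Basis. (h \<bullet> b) *\<^sub>R partial_deriv b \<psi> x)) \<le> norm h * B"
    proof (rule onorm_le)
      fix k
      have "norm (\<Sum>b\<in>Basis. (k \<bullet> b) *\<^sub>R (partial_deriv b \<psi> z - partial_deriv b \<psi> x)) \<le> norm k * (\<Sum>b\<in>Basis. norm h * c b)"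
      proof (rule norm_sum_inner_Basis_le)
        fix b :: 'a assume b: "b \<in> Basis"
        have "norm (partial_deriv b \<psi> z - partial_deriv b \<psi> x) \<le> norm (z - x) * c b"
          using schwartz_weighted_lipschitz[OF schwartz_partial_deriv[OF \<psi> b], of x "x - z" 0]
          by (simp add: c_def weight_def norm_minus_commute add_nonneg_eq_0_iff)
        also have "\<dots> \<le> norm h * c b"
          unfolding c_def by (intro mult_right_mono zx sum_nonneg sup_weight_nonneg schwartz_partial_deriv \<psi> b)
        finally show "norm (partial_deriv b \<psi> z - partial_deriv b \<psi> x) \<le> norm h * c b" .
      qed
      then show "norm (((\<lambda>h. \<Sum>b\<in>Basis. (h \<bullet> b) *\<^sub>R partial_deriv b \<psi> z)
          - (\<lambda>h. \<Sum>b\<in>Basis. (h \<bullet> b) *\<^sub>R partial_deriv b \<psi> x)) k) \<le> norm h * B * norm k"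
        by (simp add: B_def scaleR_diff_right sum_subtractf sum_distrib_left mult_ac)
    qed
  qed auto
  then show "norm (\<psi> (x + h) - \<psi> x - (\<Sum>b\<in>Basis. (h \<bullet> b) *\<^sub>R partial_deriv b \<psi> x)) \<le> B * norm h ^ 2"
    by (simp add: power2_eq_square mult_ac)
qed

section \<open>Closure properties of the Schwartz class\<close>

lemma partial_derivs_affine:
  assumes f: "smooth (f :: 'a::euclidean_space \<Rightarrow> complex)" and "bs \<in> lists Basis"
  shows "partial_derivs bs (\<lambda>y. a * f (t + c *\<^sub>R y))
      = (\<lambda>y. a * of_real c ^ length bs * partial_derivs bs f (t + c *\<^sub>R y))"
    and "partial_derivs bs (\<lambda>y. a * f (t + c *\<^sub>R y)) differentiable (at x)"
proof -
  have D: "((\<lambda>y. e * partial_derivs bs f (t + c *\<^sub>R y)) has_derivative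
     (\<lambda>h. e * frechet_derivative (partial_derivs bs f) (at (t + c *\<^sub>R x)) (c *\<^sub>R h))) (at x)"
    if "bs \<in> lists Basis" for bs x e
  proof -
    have "(partial_derivs bs f has_derivative frechet_derivative (partial_derivs bs f) (at (t + c *\<^sub>R x))) (at (t + c *\<^sub>R x))"
      using smooth_differentiable[OF f that] frechet_derivative_works by blast
    moreover have "((\<lambda>y. t + c *\<^sub>R y) has_derivative (\<lambda>h. c *\<^sub>R h)) (at x)"
      by (auto intro!: derivative_eq_intros)
    ultimately have "((\<lambda>y. partial_derivs bs f (t + c *\<^sub>R y)) has_derivative
      (\<lambda>h. frechet_derivative (partial_derivs bs f) (at (t + c *\<^sub>R x)) (c *\<^sub>R h))) (at x)"
      using has_derivative_compose by blast
    then show ?thesis by (rule has_derivative_mult_right)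
  qed
  show 1: "partial_derivs bs (\<lambda>y. a * f (t + c *\<^sub>R y))
      = (\<lambda>y. a * of_real c ^ length bs * partial_derivs bs f (t + c *\<^sub>R y))"
    using assms(2)
  proof (induction bs)
    case (Cons b bs)
    then have bs: "bs \<in> lists Basis" by auto
    have IH: "partial_derivs bs (\<lambda>y. a * f (t + c *\<^sub>R y))
      = (\<lambda>y. a * of_real c ^ length bs * partial_derivs bs f (t + c *\<^sub>R y))"
      using Cons by auto
    show ?case
    proof
      fix x
      have lin: "linear (frechet_derivative (partial_derivs bs f) (at (t + c *\<^sub>R x)))"
        by (rule linear_frechet_derivative[OF smooth_differentiable[OF f bs]])
      have "partial_derivs (b # bs) (\<lambda>y. a * f (t + c *\<^sub>R y)) x =
        a * of_real c ^ length bs * frechet_derivative (partial_derivs bs f) (at (t + c *\<^sub>R x)) (c *\<^sub>R b)"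
        unfolding partial_derivs_Cons IH by (rule partial_derivI[OF D[OF bs]])
      also have "\<dots> = a * of_real c ^ length (b # bs) * partial_derivs (b # bs) f (t + c *\<^sub>R x)"
        unfolding linear_scale[OF lin] partial_derivs_Cons
        by (simp add: partial_deriv_def scaleR_conv_of_real)
      finally show "partial_derivs (b # bs) (\<lambda>y. a * f (t + c *\<^sub>R y)) x =
        a * of_real c ^ length (b # bs) * partial_derivs (b # bs) f (t + c *\<^sub>R x)" .
    qed
  qed simp
  show "partial_derivs bs (\<lambda>y. a * f (t + c *\<^sub>R y)) differentiable (at x)"
    unfolding 1 by (rule differentiableI[OF D[OF assms(2)]])
qed

lemma smooth_affine:
  "smooth (f :: 'a::euclidean_space \<Rightarrow> complex) \<Longrightarrow> smooth (\<lambda>y. a * f (t + c *\<^sub>R y))"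
  unfolding smooth_def[of "\<lambda>y. a * f (t + c *\<^sub>R y)"] using partial_derivs_affine(2) by blast

lemma schwartz_affine:
  assumes \<psi>: "\<psi> \<in> schwartz" and c: "c \<noteq> 0"
  shows "(\<lambda>y. a * \<psi> (t + c *\<^sub>R y)) \<in> schwartz"
proof (rule schwartzI[OF smooth_affine[OF schwartz_smooth[OF \<psi>]]])
  fix bs :: "'a list" and N assume bs: "bs \<in> lists Basis"
  \<comment> \<open>From \<open>y = ((t + c y) - t) / c\<close>: with this \<open>M\<close> the
    number \<open>1 + |y|\<close> is at most \<open>M (1 + |t + c y|)\<close>, and its
    \<open>N\<close>-th power transfers decay of order \<open>N\<close>.\<close>
  define M where "M = 1 + norm t / \<bar>c\<bar> + 1 / \<bar>c\<bar>"
  have M: "1 + norm y \<le> M * (1 + norm (t + c *\<^sub>R y))" for y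
  proof -
    have "\<bar>c\<bar> * norm y \<le> norm (t + c *\<^sub>R y) + norm t"
      using norm_triangle_ineq4[of "t + c *\<^sub>R y" t] by simp
    then have "norm y \<le> norm (t + c *\<^sub>R y) / \<bar>c\<bar> + norm t / \<bar>c\<bar>"
      using c by (simp add: field_simps)
    moreover have "M * (1 + norm (t + c *\<^sub>R y)) = 1 + norm t / \<bar>c\<bar> + 1 / \<bar>c\<bar> + norm (t + c *\<^sub>R y)
        + norm t / \<bar>c\<bar> * norm (t + c *\<^sub>R y) + norm (t + c *\<^sub>R y) / \<bar>c\<bar>"
      by (simp add: M_def algebra_simps)
    moreover have "0 \<le> norm t / \<bar>c\<bar> * norm (t + c *\<^sub>R y)" "0 \<le> 1 / \<bar>c\<bar>" by auto
    ultimately show ?thesis using norm_ge_zero[of "t + c *\<^sub>R y"] by linarith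
  qed
  have M0: "0 < M" by (simp add: M_def add_pos_nonneg)
  have w: "weight (real N) (t + c *\<^sub>R y) \<le> M ^ N * weight (real N) y" for y
  proof -
    have "(1 + norm y) ^ N \<le> M ^ N * (1 + norm (t + c *\<^sub>R y)) ^ N"
      using power_mono[OF M, of y N] by (simp add: power_mult_distrib)
    moreover have "0 < (1 + norm y) ^ N" "0 < (1 + norm (t + c *\<^sub>R y)) ^ N"
      by (auto intro!: zero_less_power add_pos_nonneg)
    ultimately show ?thesis by (simp add: weight_nat field_simps)
  qed
  let ?S = "sup_weight N (partial_derivs bs \<psi>)"
  have S: "0 \<le> ?S" by (intro sup_weight_nonneg schwartz_partial_derivs \<psi> bs)
  show "\<exists>C. \<forall>x. norm (partial_derivs bs (\<lambda>y. a * \<psi> (t + c *\<^sub>R y)) x) \<le> C * weight (real N) x"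
  proof (intro exI allI)
    fix x
    have "norm (partial_derivs bs \<psi> (t + c *\<^sub>R x)) \<le> ?S * (M ^ N * weight (real N) x)"
      by (intro order_trans[OF sup_weight_bound[where L=N]] mult_left_mono w S schwartz_partial_derivs \<psi> bs)
    then have "norm (a * of_real c ^ length bs) * norm (partial_derivs bs \<psi> (t + c *\<^sub>R x))
        \<le> norm (a * of_real c ^ length bs) * (?S * (M ^ N * weight (real N) x))"
      by (rule mult_left_mono) simp
    then show "norm (partial_derivs bs (\<lambda>y. a * \<psi> (t + c *\<^sub>R y)) x)
        \<le> (norm (a * of_real c ^ length bs) * ?S * M ^ N) * weight (real N) x"
      by (subst partial_derivs_affine(1)[OF schwartz_smooth[OF \<psi>] bs]) (simp add: norm_mult mult_ac)
  qed
qed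

lemma partial_derivs_add:
  fixes f g :: "'a::euclidean_space \<Rightarrow> complex"
  assumes f: "smooth f" and g: "smooth g" and "bs \<in> lists Basis"
  shows "partial_derivs bs (\<lambda>y. f y + g y) = (\<lambda>y. partial_derivs bs f y + partial_derivs bs g y)"
    and "partial_derivs bs (\<lambda>y. f y + g y) differentiable (at x)"
proof -
  show 1: "partial_derivs bs (\<lambda>y. f y + g y) = (\<lambda>y. partial_derivs bs f y + partial_derivs bs g y)"
    using assms(3)
  proof (induction bs)
    case (Cons b bs)
    then have bs: "bs \<in> lists Basis" by auto
    show ?case
    proof
      fix x
      have "((\<lambda>y. partial_derivs bs f y + partial_derivs bs g y) has_derivative
        (\<lambda>h. frechet_derivative (partial_derivs bs f) (at x) h + frechet_derivative (partial_derivs bs g) (at x) h)) (at x)"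
        using smooth_differentiable[OF f bs] smooth_differentiable[OF g bs] frechet_derivative_works
        by (intro has_derivative_add) blast+
      from partial_derivI[OF this, of b] Cons.IH bs
      show "partial_derivs (b # bs) (\<lambda>y. f y + g y) x = partial_derivs (b # bs) f x + partial_derivs (b # bs) g x"
        by (simp add: partial_deriv_def)
    qed
  qed simp
  show "partial_derivs bs (\<lambda>y. f y + g y) differentiable (at x)"
    unfolding 1 by (intro differentiable_add smooth_differentiable f g assms(3))
qed

lemma schwartz_add:
  assumes \<psi>: "\<psi> \<in> schwartz" and \<theta>: "\<theta> \<in> schwartz"
  shows "(\<lambda>x. \<psi> x + \<theta> x) \<in> schwartz"
proof (rule schwartzI)
  note S = schwartz_smooth[OF \<psi>] schwartz_smooth[OF \<theta>]
  show "smooth (\<lambda>x. \<psi> x + \<theta> x)"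
    using partial_derivs_add(2)[OF S] by (simp add: smooth_def)
  fix bs :: "'a list" and N assume bs: "bs \<in> lists Basis"
  show "\<exists>C. \<forall>x. norm (partial_derivs bs (\<lambda>x. \<psi> x + \<theta> x) x) \<le> C * weight (real N) x"
  proof (intro exI allI)
    fix x
    have "norm (partial_derivs bs \<psi> x + partial_derivs bs \<theta> x)
       \<le> sup_weight N (partial_derivs bs \<psi>) * weight (real N) x + sup_weight N (partial_derivs bs \<theta>) * weight (real N) x"
      by (intro norm_triangle_le add_mono sup_weight_bound schwartz_partial_derivs \<psi> \<theta> bs)
    then show "norm (partial_derivs bs (\<lambda>x. \<psi> x + \<theta> x) x)
      \<le> (sup_weight N (partial_derivs bs \<psi>) + sup_weight N (partial_derivs bs \<theta>)) * weight (real N) x"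
      by (simp add: partial_derivs_add(1)[OF S bs] algebra_simps)
  qed
qed

lemma schwartz_cmult: "\<psi> \<in> schwartz \<Longrightarrow> (\<lambda>x. c * \<psi> x) \<in> schwartz"
  using schwartz_affine[of \<psi> 1 c 0] by simp

lemma schwartz_diff:
  "\<psi> \<in> schwartz \<Longrightarrow> \<theta> \<in> schwartz \<Longrightarrow> (\<lambda>x. \<psi> x - \<theta> x) \<in> schwartz"
  using schwartz_add[OF _ schwartz_cmult[of \<theta> "-1"]] by simp

lemma schwartz_reflect: "\<psi> \<in> schwartz \<Longrightarrow> (\<lambda>y. \<psi> (x - y)) \<in> schwartz"
  using schwartz_affine[of \<psi> "-1" 1 x] by simp

lemma schwartz_shift: "\<psi> \<in> schwartz \<Longrightarrow> (\<lambda>y. \<psi> (y - x)) \<in> schwartz"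
  using schwartz_affine[of \<psi> 1 1 "-x"] by simp

lemma schwartz_dyadic: "\<Phi> \<in> schwartz \<Longrightarrow> dyadic \<Phi> k \<in> schwartz"
  using schwartz_affine[of \<Phi> "2 powi k" "of_real (2 powi (k * int DIM('a)))" 0]
  by (simp add: dyadic_def[abs_def])

lemma schwartz_integrable_power:
  fixes \<psi> :: "'a::euclidean_space \<Rightarrow> complex"
  assumes \<psi>: "\<psi> \<in> schwartz"
  shows "integrable lborel (\<lambda>x. (1 + norm x) ^ n * norm (\<psi> x))"
proof (rule Bochner_Integration.integrable_bound)
  show "integrable lborel (\<lambda>x::'a. sup_weight (2 * DIM('a) + n) \<psi> * weight (real (2 * DIM('a))) x)"
    by (intro integrable_mult_right integrable_weight) simp
  show "(\<lambda>x. (1 + norm x) ^ n * norm (\<psi> x)) \<in> borel_measurable lborel"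
    using schwartz_measurable[OF \<psi>] by measurable
  show "AE x in lborel. norm ((1 + norm x) ^ n * norm (\<psi> x)) \<le> norm (sup_weight (2 * DIM('a) + n) \<psi> * weight (real (2 * DIM('a))) x)"
  proof (intro AE_I2)
    fix x
    have "norm (\<psi> x) \<le> sup_weight (2 * DIM('a) + n) \<psi> * (weight (real (2 * DIM('a))) x * weight (real n) x)"
      using sup_weight_bound[OF \<psi>, of x "2 * DIM('a) + n"] by (simp only: of_nat_add weight_add)
    then have "(1 + norm x) ^ n * norm (\<psi> x) \<le> (1 + norm x) ^ n * (sup_weight (2 * DIM('a) + n) \<psi> * (weight (real (2 * DIM('a))) x * weight (real n) x))"
      by (rule mult_left_mono) simp
    also have "\<dots> = sup_weight (2 * DIM('a) + n) \<psi> * weight (real (2 * DIM('a))) x * (weight (real n) x * (1 + norm x) ^ n)"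
      by (simp only: mult_ac)
    finally show "norm ((1 + norm x) ^ n * norm (\<psi> x)) \<le> norm (sup_weight (2 * DIM('a) + n) \<psi> * weight (real (2 * DIM('a))) x)"
      unfolding weight_mult_power using sup_weight_nonneg[OF \<psi>, of "2 * DIM('a) + n"]
      by (simp del: of_nat_mult)
  qed
qed

lemma schwartz_integrable: "\<psi> \<in> schwartz \<Longrightarrow> integrable lborel \<psi>"
  using schwartz_integrable_power[of \<psi> 0] schwartz_measurable[of \<psi>]
  by (simp add: integrable_norm_iff)

section \<open>Convolution\<close>

lemma integral_lebesgue_lborel:
  fixes f :: "'a::euclidean_space \<Rightarrow> 'b::{banach, second_countable_topology}"
  shows "f \<in> borel_measurable borel \<Longrightarrow> (LINT x|lebesgue. f x) = (LINT x|lborel. f x)"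
  by (rule integral_completion) simp

lemma convolution_lborel:
  assumes [measurable]: "f \<in> borel_measurable borel" "g \<in> borel_measurable borel"
  shows "convolution f g x = (LINT y|lborel. f (x - y) * g y)"
  unfolding Defs.convolution_def by (rule integral_lebesgue_lborel) measurable

lemma convolution_lborel_fun:
  assumes "f \<in> borel_measurable borel" "g \<in> borel_measurable borel"
  shows "convolution f g = (\<lambda>x. LINT y|lborel. f (x - y) * g y)"
  using convolution_lborel[OF assms] by blast

lemma convolution_commute:
  assumes [measurable]: "f \<in> borel_measurable borel" "g \<in> borel_measurable borel"
  shows "convolution f g = convolution g f"
proof
  fix x
  have "convolution f g x = (LINT y|lborel. f (x - (x - y)) * g (x - y))"
    using convolution_lborel[OF assms, of x] integral_lborel_reflect[of "\<lambda>y. f (x - y) * g y" x] by simp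
  then show "convolution f g x = convolution g f x"
    by (simp add: convolution_lborel mult.commute)
qed

section \<open>Convolution of integrable kernels with bounded continuous functions\<close>

definition bounded_cont :: "('a::euclidean_space \<Rightarrow> complex) \<Rightarrow> bool" where
  "bounded_cont h \<longleftrightarrow> continuous_on UNIV h \<and> (\<exists>B. \<forall>x. norm (h x) \<le> B)"

text \<open>This class is closed under convolution, convolution is associative on it, and,
  continuity being included, a member is determined pointwise by its Fourier transform.\<close>

definition nice_kernel :: "('a::euclidean_space \<Rightarrow> complex) \<Rightarrow> bool" where
  "nice_kernel K \<longleftrightarrow> bounded_cont K \<and> integrable lborel K"

lemma bounded_contD:
  assumes "bounded_cont h"
  shows "\<exists>B\<ge>0. \<forall>x. norm (h x) \<le> B"
proof -
  from assms obtain B where B: "\<And>x. norm (h x) \<le> B" by (auto simp: bounded_cont_def)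
  have "0 \<le> B" by (rule order_trans[OF norm_ge_zero B])
  with B show ?thesis by blast
qed

lemma bounded_contI: "continuous_on UNIV h \<Longrightarrow> (\<And>x. norm (h x) \<le> B) \<Longrightarrow> bounded_cont h"
  by (auto simp: bounded_cont_def)

lemma bounded_cont_continuous: "bounded_cont h \<Longrightarrow> continuous_on UNIV h"
  by (simp add: bounded_cont_def)

lemma bounded_cont_measurable: "bounded_cont h \<Longrightarrow> h \<in> borel_measurable borel"
  by (simp add: bounded_cont_def borel_measurable_continuous_onI)

lemma bounded_cont_add:
  assumes f: "bounded_cont f" and g: "bounded_cont g"
  shows "bounded_cont (\<lambda>x. f x + g x)"
proof -
  obtain A B where "\<And>x. norm (f x) \<le> A" "\<And>x. norm (g x) \<le> B"
    using bounded_contD[OF f] bounded_contD[OF g] by blast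
  then have "norm (f x + g x) \<le> A + B" for x by (intro norm_triangle_mono)
  moreover have "continuous_on UNIV (\<lambda>x. f x + g x)"
    by (intro continuous_intros bounded_cont_continuous f g)
  ultimately show ?thesis by (rule bounded_contI[rotated])
qed

lemma nice_kernel_bounded_cont: "nice_kernel K \<Longrightarrow> bounded_cont K"
  by (simp add: nice_kernel_def)

lemma nice_kernel_integrable: "nice_kernel K \<Longrightarrow> integrable lborel K"
  by (simp add: nice_kernel_def)

lemma nice_kernel_measurable: "nice_kernel K \<Longrightarrow> K \<in> borel_measurable borel"
  by (simp add: nice_kernel_def bounded_cont_measurable)

lemma nice_kernel_add: "nice_kernel K \<Longrightarrow> nice_kernel L \<Longrightarrow> nice_kernel (\<lambda>x. K x + L x)"
  by (simp add: nice_kernel_def bounded_cont_add)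

lemma schwartz_nice_kernel:
  assumes "\<psi> \<in> schwartz" shows "nice_kernel \<psi>"
proof -
  have "norm (\<psi> x) \<le> sup_weight 0 \<psi>" for x using sup_weight_upper[OF assms, of x 0] by simp
  then show ?thesis using assms
    by (auto simp: nice_kernel_def schwartz_integrable intro!: bounded_contI schwartz_continuous)
qed

lemma integrable_conv_bounded:
  fixes K h :: "'a::euclidean_space \<Rightarrow> complex"
  assumes "integrable lborel K" and [measurable]: "h \<in> borel_measurable borel"
    and B: "\<And>x. norm (h x) \<le> B"
  shows "integrable lborel (\<lambda>y. K (x - y) * h y)"
proof (rule Bochner_Integration.integrable_bound)
  have [measurable]: "K \<in> borel_measurable borel" using assms(1) by auto
  show "integrable lborel (\<lambda>y. B *\<^sub>R norm (K (x - y)))"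
    using integrable_lborel_reflect[OF assms(1)] by auto
  show "(\<lambda>y. K (x - y) * h y) \<in> borel_measurable lborel" by measurable
  have "0 \<le> B" by (rule order_trans[OF norm_ge_zero B])
  then show "AE y in lborel. norm (K (x - y) * h y) \<le> norm (B *\<^sub>R norm (K (x - y)))"
    using B by (auto simp: norm_mult mult.commute[of B] intro!: mult_left_mono)
qed

lemma integrable_conv:
  "nice_kernel K \<Longrightarrow> bounded_cont h \<Longrightarrow> integrable lborel (\<lambda>y. K (x - y) * h y)"
  by (metis bounded_contD integrable_conv_bounded nice_kernel_integrable bounded_cont_measurable)

lemma norm_convolution_le:
  assumes K: "nice_kernel K" and h: "bounded_cont h" and B: "\<And>x. norm (h x) \<le> B"
  shows "norm (convolution K h x) \<le> (LINT y|lborel. norm (K y)) * B"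
proof -
  note [measurable] = nice_kernel_measurable[OF K] bounded_cont_measurable[OF h]
  have i: "integrable lborel (\<lambda>y. norm (K (x - y)))"
    using integrable_lborel_reflect[OF nice_kernel_integrable[OF K]] by auto
  have "norm (convolution K h x) \<le> (LINT y|lborel. norm (K (x - y) * h y))"
    by (simp add: convolution_lborel integral_norm_bound)
  also have "\<dots> \<le> (LINT y|lborel. norm (K (x - y)) * B)"
    using integrable_norm[OF integrable_conv[OF K h, of x]] i B
    by (intro integral_mono) (auto simp: norm_mult intro!: mult_left_mono)
  also have "\<dots> = (LINT y|lborel. norm (K y)) * B"
    using integral_lborel_reflect[of "\<lambda>y. norm (K y)" x] by simp
  finally show ?thesis .
qed

text \<open>After commuting the factors the variable \<open>x\<close> sits in the continuous factor
  \<open>h\<close>; dominated convergence with majorant \<open>B |K|\<close> then gives sequential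
  continuity.\<close>

lemma bounded_cont_convolution:
  assumes K: "nice_kernel K" and h: "bounded_cont h"
  shows "bounded_cont (convolution K h)"
proof -
  note [measurable] = nice_kernel_measurable[OF K] bounded_cont_measurable[OF h]
  obtain B where B: "0 \<le> B" "\<And>x. norm (h x) \<le> B" using bounded_contD[OF h] by blast
  have c: "isCont h x" for x
    using bounded_cont_continuous[OF h] by (simp add: continuous_on_eq_continuous_at)
  have "continuous_on UNIV (\<lambda>x. LINT y|lborel. h (x - y) * K y)"
    unfolding continuous_on_sequentially comp_def
  proof (intro ballI allI impI)
    fix u :: "nat \<Rightarrow> 'a" and a assume u: "(\<forall>n. u n \<in> UNIV) \<and> u \<longlonglongrightarrow> a"
    show "(\<lambda>n. LINT y|lborel. h (u n - y) * K y) \<longlonglongrightarrow> (LINT y|lborel. h (a - y) * K y)"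
    proof (rule integral_dominated_convergence[where w = "\<lambda>y. B * norm (K y)"])
      show "integrable lborel (\<lambda>y. B * norm (K y))" using nice_kernel_integrable[OF K] by auto
      show "AE y in lborel. (\<lambda>n. h (u n - y) * K y) \<longlonglongrightarrow> h (a - y) * K y"
        using u by (intro AE_I2 tendsto_intros isCont_tendsto_compose[OF c]) auto
    qed (use B in \<open>auto simp: norm_mult intro!: mult_right_mono\<close>)
  qed
  then have "continuous_on UNIV (convolution K h)"
    using convolution_commute[of K h] convolution_lborel_fun[of h K] by simp
  then show ?thesis using norm_convolution_le[OF K h B(2)] by (rule bounded_contI)
qed

lemma integrable_pair_shift:
  fixes g k :: "'a::euclidean_space \<Rightarrow> real"
  assumes g: "integrable lborel g" and k: "integrable lborel k"
  shows "integrable (lborel \<Otimes>\<^sub>M lborel) (\<lambda>(x, y). g x * k (y - x))"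
proof -
  have [measurable]: "g \<in> borel_measurable borel" "k \<in> borel_measurable borel" using g k by auto
  show ?thesis
  proof (rule lborel_pair.Fubini_integrable)
    show "integrable lborel (\<lambda>x. LINT y|lborel. norm (case (x, y) of (x, y) \<Rightarrow> g x * k (y - x)))"
      using g by (simp add: abs_mult integral_lborel_shift[of "\<lambda>y. \<bar>k y\<bar>"])
    show "AE x in lborel. integrable lborel (\<lambda>y. case (x, y) of (x, y) \<Rightarrow> g x * k (y - x))"
      using integrable_lborel_shift[OF k] by auto
  qed measurable
qed

lemma integrable_pair_prod:
  fixes g :: "'a::euclidean_space \<Rightarrow> real" and k :: "'b::euclidean_space \<Rightarrow> real"
  assumes g: "integrable lborel g" and k: "integrable lborel k"
  shows "integrable (lborel \<Otimes>\<^sub>M lborel) (\<lambda>(x, y). g x * k y)"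
proof -
  have [measurable]: "g \<in> borel_measurable borel" "k \<in> borel_measurable borel" using g k by auto
  show ?thesis
  proof (rule lborel_pair.Fubini_integrable)
    show "integrable lborel (\<lambda>x. LINT y|lborel. norm (case (x, y) of (x, y) \<Rightarrow> g x * k y))"
      using g by (simp add: abs_mult)
  qed (use k in \<open>auto\<close>)
qed

lemma fubini_dominated:
  fixes f :: "'a::euclidean_space \<Rightarrow> 'b::euclidean_space \<Rightarrow> complex"
  assumes "integrable (lborel \<Otimes>\<^sub>M lborel) (\<lambda>(x, y). g x y :: real)"
    and [measurable]: "case_prod f \<in> borel_measurable (borel \<Otimes>\<^sub>M borel)"
    and "\<And>x y. norm (f x y) \<le> g x y"
  shows "(LINT x|lborel. LINT y|lborel. f x y) = (LINT y|lborel. LINT x|lborel. f x y)"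
    and "integrable lborel (\<lambda>x. LINT y|lborel. f x y)"
proof -
  have "integrable (lborel \<Otimes>\<^sub>M lborel) (case_prod f)"
    by (rule Bochner_Integration.integrable_bound[OF assms(1)])
       (use assms(2) order_trans[OF assms(3) abs_ge_self] in \<open>auto simp: split_beta'\<close>)
  then show "(LINT x|lborel. LINT y|lborel. f x y) = (LINT y|lborel. LINT x|lborel. f x y)"
    and "integrable lborel (\<lambda>x. LINT y|lborel. f x y)"
    using lborel_pair.Fubini_integral lborel_pair.integrable_fst by fastforce+
qed

lemma nice_kernel_convolution:
  assumes K: "nice_kernel K" and L: "nice_kernel L"
  shows "nice_kernel (convolution K L)"
proof -
  note [measurable] = nice_kernel_measurable[OF K] nice_kernel_measurable[OF L]
  have "integrable (lborel \<Otimes>\<^sub>M lborel) (\<lambda>(y, x). norm (L y) * norm (K (x - y)))"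
    by (rule integrable_pair_shift[of "\<lambda>y. norm (L y)" "\<lambda>y. norm (K y)"])
       (use K L in \<open>auto dest: nice_kernel_integrable\<close>)
  have "integrable (lborel \<Otimes>\<^sub>M lborel) (\<lambda>(y, x). K (x - y) * L y)"
    by (rule Bochner_Integration.integrable_bound[OF \<open>integrable (lborel \<Otimes>\<^sub>M lborel) (\<lambda>(y, x). norm (L y) * norm (K (x - y)))\<close>])
       (auto simp: norm_mult split_beta')
  then have "integrable lborel (\<lambda>x. LINT y|lborel. K (x - y) * L y)"
    using lborel_pair.integrable_snd by fastforce
  then show ?thesis
    unfolding nice_kernel_def using bounded_cont_convolution[OF K nice_kernel_bounded_cont[OF L]]
    by (simp add: convolution_lborel_fun)
qed

lemma convolution_assoc:
  assumes K: "nice_kernel K" and L: "nice_kernel L" and h: "bounded_cont h"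
  shows "convolution K (convolution L h) = convolution (convolution K L) h"
proof
  fix x
  note [measurable] = nice_kernel_measurable[OF K] nice_kernel_measurable[OF L] bounded_cont_measurable[OF h]
    bounded_cont_measurable[OF bounded_cont_convolution[OF L h]]
    nice_kernel_measurable[OF nice_kernel_convolution[OF K L]]
  obtain B where B: "0 \<le> B" "\<And>x. norm (h x) \<le> B" using bounded_contD[OF h] by blast
  have "convolution K (convolution L h) x = (LINT y|lborel. LINT z|lborel. K (x - y) * L (y - z) * h z)"
    by (simp add: convolution_lborel mult.assoc)
  also have "\<dots> = (LINT z|lborel. LINT y|lborel. K (x - y) * L (y - z) * h z)"
  proof (rule fubini_dominated)
    show "integrable (lborel \<Otimes>\<^sub>M lborel) (\<lambda>(y, z). B * norm (K (x - y)) * norm (L (- (z - y))))"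
      by (rule integrable_pair_shift[of "\<lambda>y. B * norm (K (x - y))" "\<lambda>w. norm (L (- w))"])
         (use integrable_lborel_reflect[OF nice_kernel_integrable[OF K], of x]
            integrable_lborel_reflect[OF nice_kernel_integrable[OF L], of 0] in auto)
    show "norm (K (x - y) * L (y - z) * h z) \<le> B * norm (K (x - y)) * norm (L (- (z - y)))" for y z
    proof -
      have "norm (K (x - y)) * norm (L (y - z)) * norm (h z) \<le> norm (K (x - y)) * norm (L (y - z)) * B"
        by (intro mult_left_mono B) auto
      then show ?thesis by (simp add: norm_mult mult_ac)
    qed
  qed measurable
  also have "\<dots> = (LINT z|lborel. convolution K L (x - z) * h z)"
  proof (intro Bochner_Integration.integral_cong refl)
    fix z
    have "(LINT y|lborel. K (x - y) * L (y - z) * h z) = (LINT y|lborel. K (x - z - (y - z)) * L (y - z)) * h z"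
      by simp
    also have "(LINT y|lborel. K (x - z - (y - z)) * L (y - z)) = convolution K L (x - z)"
      by (subst integral_lborel_shift[of "\<lambda>y. K (x - z - y) * L y"]) (simp add: convolution_lborel)
    finally show "(LINT y|lborel. K (x - y) * L (y - z) * h z) = convolution K L (x - z) * h z" .
  qed
  also have "\<dots> = convolution (convolution K L) h x" by (simp add: convolution_lborel)
  finally show "convolution K (convolution L h) x = convolution (convolution K L) h x" .
qed

lemma convolution_add_left:
  assumes K: "nice_kernel K" and L: "nice_kernel L" and h: "bounded_cont h"
  shows "convolution (\<lambda>x. K x + L x) h x = convolution K h x + convolution L h x"
  using nice_kernel_measurable[OF K] nice_kernel_measurable[OF L] bounded_cont_measurable[OF h]
    integrable_conv[OF K h] integrable_conv[OF L h]
  by (simp add: convolution_lborel ring_distribs)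

lemma convolution_add_right:
  assumes K: "nice_kernel K" and g: "bounded_cont g" and h: "bounded_cont h"
  shows "convolution K (\<lambda>x. g x + h x) x = convolution K g x + convolution K h x"
  using nice_kernel_measurable[OF K] bounded_cont_measurable[OF g] bounded_cont_measurable[OF h]
    integrable_conv[OF K h] integrable_conv[OF K g]
  by (simp add: convolution_lborel ring_distribs)

text \<open>Functions that may be integrated against anything of polynomial growth. Unlike the
  Schwartz class it is stable under multiplication by indicators of Borel sets, on which the
  localisation in \<open>tempered_convolution\<close> relies.\<close>

definition all_moments :: "('a::euclidean_space \<Rightarrow> complex) \<Rightarrow> bool" where
  "all_moments e \<longleftrightarrow> e \<in> borel_measurable borel \<and> (\<forall>n. integrable lborel (\<lambda>u. (1 + norm u) ^ n * norm (e u)))"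

lemma all_moments_measurable: "all_moments e \<Longrightarrow> e \<in> borel_measurable borel"
  by (simp add: all_moments_def)

lemma all_moments_integrable: "all_moments e \<Longrightarrow> integrable lborel (\<lambda>u. (1 + norm u) ^ n * norm (e u))"
  by (simp add: all_moments_def)

lemma schwartz_all_moments: "\<psi> \<in> schwartz \<Longrightarrow> all_moments \<psi>"
  by (simp add: all_moments_def schwartz_measurable schwartz_integrable_power)

lemma all_moments_dominated:
  fixes f :: "'a::euclidean_space \<Rightarrow> complex"
  assumes e: "all_moments e" and [measurable]: "f \<in> borel_measurable borel"
    and le: "\<And>u. norm (f u) \<le> c * (1 + norm u) ^ n * norm (e u)"
  shows "integrable lborel f" "norm (LINT u|lborel. f u) \<le> c * (LINT u|lborel. (1 + norm u) ^ n * norm (e u))"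
proof -
  have i: "integrable lborel (\<lambda>u. c * ((1 + norm u) ^ n * norm (e u)))"
    using all_moments_integrable[OF e] by auto
  have le': "norm (f u) \<le> c * ((1 + norm u) ^ n * norm (e u))" for u
    using le[of u] by (simp add: mult_ac)
  show f: "integrable lborel f"
    by (rule Bochner_Integration.integrable_bound[OF i]) (use order_trans[OF le' abs_ge_self] in auto)
  have "norm (LINT u|lborel. f u) \<le> (LINT u|lborel. norm (f u))" by (rule integral_norm_bound)
  also have "\<dots> \<le> (LINT u|lborel. c * ((1 + norm u) ^ n * norm (e u)))"
    by (rule integral_mono[OF integrable_norm[OF f] i le'])
  finally show "norm (LINT u|lborel. f u) \<le> c * (LINT u|lborel. (1 + norm u) ^ n * norm (e u))" by simp
qed

lemma schwartz_convolution_bound: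
  assumes \<eta>: "\<eta> \<in> schwartz" and e: "all_moments e"
  shows "(1 + norm x) ^ N * norm (convolution \<eta> e x)
      \<le> sup_weight N \<eta> * (LINT u|lborel. (1 + norm u) ^ N * norm (e u))"
proof -
  note [measurable] = all_moments_measurable[OF e] schwartz_measurable[OF \<eta>]
  have "norm (of_real ((1 + norm x) ^ N) * (\<eta> (x - u) * e u)) \<le> sup_weight N \<eta> * (1 + norm u) ^ N * norm (e u)" for u
  proof -
    have "(1 + norm x) ^ N \<le> (1 + norm (x - u)) ^ N * (1 + norm u) ^ N"
      using power_mono[OF one_plus_norm_add[of "x - u" u], of N] by (simp add: power_mult_distrib)
    then have "(1 + norm x) ^ N * (norm (\<eta> (x - u)) * norm (e u))
        \<le> (1 + norm (x - u)) ^ N * (1 + norm u) ^ N * (norm (\<eta> (x - u)) * norm (e u))"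
      by (rule mult_right_mono) simp
    also have "\<dots> = ((1 + norm (x - u)) ^ N * norm (\<eta> (x - u))) * ((1 + norm u) ^ N * norm (e u))"
      by (simp add: mult_ac)
    also have "\<dots> \<le> sup_weight N \<eta> * ((1 + norm u) ^ N * norm (e u))"
      by (intro mult_right_mono sup_weight_upper \<eta>) simp
    finally show ?thesis by (simp add: norm_mult mult.assoc norm_power)
       (metis abs_of_nonneg add_nonneg_nonneg norm_ge_zero norm_of_real of_real_1 of_real_add zero_le_one)
  qed
  from all_moments_dominated(2)[OF e _ this]
  have "norm (of_real ((1 + norm x) ^ N) * convolution \<eta> e x) \<le> sup_weight N \<eta> * (LINT u|lborel. (1 + norm u) ^ N * norm (e u))"
    by (simp add: convolution_lborel)
  then show ?thesis by (simp only: norm_mult norm_of_real) simp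
qed

lemma integrable_schwartz_convolution:
  assumes \<eta>: "\<eta> \<in> schwartz" and e: "all_moments e"
  shows "integrable lborel (\<lambda>u. \<eta> (x - u) * e u)"
proof (rule all_moments_dominated(1)[OF e])
  note [measurable] = all_moments_measurable[OF e] schwartz_measurable[OF \<eta>]
  show "(\<lambda>u. \<eta> (x - u) * e u) \<in> borel_measurable borel" by measurable
  show "norm (\<eta> (x - u) * e u) \<le> sup_weight 0 \<eta> * (1 + norm u) ^ 0 * norm (e u)" for u
    using sup_weight_upper[OF \<eta>, of "x - u" 0] by (auto simp: norm_mult intro!: mult_right_mono)
qed

text \<open>The second order Taylor bound is uniform in the base point, so integrating it against
  \<open>e\<close> leaves a remainder of size \<open>M |h|^2\<close>. This gives the derivative
  directly, with no limit taken under the integral.\<close>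

lemma has_derivative_schwartz_convolution:
  assumes \<eta>: "\<eta> \<in> schwartz" and e: "all_moments e"
  shows "(convolution \<eta> e has_derivative (\<lambda>h. \<Sum>b\<in>Basis. (h \<bullet> b) *\<^sub>R convolution (partial_deriv b \<eta>) e x)) (at x)"
proof -
  note [measurable] = all_moments_measurable[OF e] schwartz_measurable[OF \<eta>]
  obtain B where B: "0 \<le> B" "\<And>x h. norm (\<eta> (x + h) - \<eta> x - (\<Sum>b\<in>Basis. (h \<bullet> b) *\<^sub>R partial_deriv b \<eta> x)) \<le> B * norm h ^ 2"
    using schwartz_second_order[OF \<eta>] by blast
  define M where "M = B * (LINT u|lborel. (1 + norm u) ^ 0 * norm (e u))"
  have rem: "norm (convolution \<eta> e (x + h) - convolution \<eta> e x - (\<Sum>b\<in>Basis. (h \<bullet> b) *\<^sub>R convolution (partial_deriv b \<eta>) e x))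
      \<le> M * norm h ^ 2" for h
  proof -
    let ?f = "\<lambda>u. (\<eta> (x - u + h) - \<eta> (x - u) - (\<Sum>b\<in>Basis. (h \<bullet> b) *\<^sub>R partial_deriv b \<eta> (x - u))) * e u"
    have m: "partial_deriv b \<eta> \<in> borel_measurable borel" if "b \<in> Basis" for b
      using that schwartz_measurable schwartz_partial_deriv[OF \<eta>] by blast
    have fm: "?f \<in> borel_measurable borel"
      using m by (intro borel_measurable_times borel_measurable_diff borel_measurable_sum borel_measurable_scaleR)
        (auto intro: measurable_compose[of "\<lambda>u. x - u"])
    have i: "integrable lborel (\<lambda>u. \<eta> (x - u) * e u)" for x by (rule integrable_schwartz_convolution[OF \<eta> e])
    have ib: "integrable lborel (\<lambda>u. (h \<bullet> b) *\<^sub>R (partial_deriv b \<eta> (x - u) * e u))" if "b \<in> Basis" for b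
      using integrable_schwartz_convolution[OF schwartz_partial_deriv[OF \<eta> that] e] by auto
    have "(LINT u|lborel. ?f u) = (LINT u|lborel. \<eta> (x + h - u) * e u - \<eta> (x - u) * e u
          - (\<Sum>b\<in>Basis. (h \<bullet> b) *\<^sub>R (partial_deriv b \<eta> (x - u) * e u)))"
      by (intro Bochner_Integration.integral_cong) (auto simp: algebra_simps sum_distrib_left scaleR_conv_of_real)
    also have "\<dots> = (LINT u|lborel. \<eta> (x + h - u) * e u) - (LINT u|lborel. \<eta> (x - u) * e u)
          - (\<Sum>b\<in>Basis. (LINT u|lborel. (h \<bullet> b) *\<^sub>R (partial_deriv b \<eta> (x - u) * e u)))"
      using ib by (simp add: Bochner_Integration.integral_diff[OF Bochner_Integration.integrable_diff[OF i i]]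
          Bochner_Integration.integral_diff[OF i i] Bochner_Integration.integral_sum)
    also have "\<dots> = convolution \<eta> e (x + h) - convolution \<eta> e x - (\<Sum>b\<in>Basis. (h \<bullet> b) *\<^sub>R convolution (partial_deriv b \<eta>) e x)"
      using m by (simp add: convolution_lborel)
    finally have eq: "(LINT u|lborel. ?f u) = \<dots>" .
    have "norm (LINT u|lborel. ?f u) \<le> (B * norm h ^ 2) * (LINT u|lborel. (1 + norm u) ^ 0 * norm (e u))"
      by (rule all_moments_dominated(2)[OF e fm]) (use B(2) in \<open>auto simp: norm_mult intro!: mult_right_mono\<close>)
    then show ?thesis unfolding eq by (simp add: M_def mult_ac)
  qed
  have M: "0 \<le> M" using B by (simp add: M_def)
  show ?thesis
    unfolding has_derivative_at
  proof
    show "bounded_linear (\<lambda>h. \<Sum>b\<in>Basis. (h \<bullet> b) *\<^sub>R convolution (partial_deriv b \<eta>) e x)"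
      by (intro bounded_linear_sum bounded_linear_scaleR_const bounded_linear_inner_left)
    show "(\<lambda>h. norm (convolution \<eta> e (x + h) - convolution \<eta> e x
        - (\<Sum>b\<in>Basis. (h \<bullet> b) *\<^sub>R convolution (partial_deriv b \<eta>) e x)) / norm h) \<midarrow>0\<rightarrow> 0"
    proof (rule Lim_null_comparison)
      have "((\<lambda>h::'a. M * norm h) \<longlongrightarrow> M * norm (0::'a)) (at 0)" by (intro tendsto_intros)
      then show "((\<lambda>h::'a. M * norm h) \<longlongrightarrow> 0) (at 0)" by simp
      show "\<forall>\<^sub>F h in at 0. norm (norm (convolution \<eta> e (x + h) - convolution \<eta> e x
        - (\<Sum>b\<in>Basis. (h \<bullet> b) *\<^sub>R convolution (partial_deriv b \<eta>) e x)) / norm h) \<le> M * norm h"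
        by (intro always_eventually allI)
          (use rem M in \<open>auto simp: divide_le_eq power2_eq_square mult.assoc\<close>)
    qed
  qed
qed

lemma partial_derivs_convolution:
  assumes \<eta>: "\<eta> \<in> schwartz" and e: "all_moments e" and "bs \<in> lists Basis"
  shows "partial_derivs bs (convolution \<eta> e) = convolution (partial_derivs bs \<eta>) e"
  using assms(3)
proof (induction bs)
  case (Cons b bs)
  then have b: "b \<in> Basis" and bs: "bs \<in> lists Basis" by auto
  have IH: "partial_derivs bs (convolution \<eta> e) = convolution (partial_derivs bs \<eta>) e"
    using Cons by auto
  show ?case
  proof
    fix x
    show "partial_derivs (b # bs) (convolution \<eta> e) x = convolution (partial_derivs (b # bs) \<eta>) e x"
      unfolding partial_derivs_Cons IH
      using partial_derivI[OF has_derivative_schwartz_convolution[OF schwartz_partial_derivs[OF \<eta> bs] e], of b x] b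
      by (simp add: inner_Basis if_distrib[of "\<lambda>r. r *\<^sub>R _"] sum.delta cong: if_cong)
  qed
qed simp

lemma schwartz_convolution:
  assumes \<eta>: "\<eta> \<in> schwartz" and e: "all_moments e"
  shows "convolution \<eta> e \<in> schwartz"
proof (rule schwartzI)
  show "smooth (convolution \<eta> e)"
    unfolding smooth_def
  proof (intro ballI allI)
    fix bs :: "'a list" and x assume bs: "bs \<in> lists Basis"
    show "partial_derivs bs (convolution \<eta> e) differentiable at x"
      unfolding partial_derivs_convolution[OF \<eta> e bs]
      by (rule differentiableI[OF has_derivative_schwartz_convolution[OF schwartz_partial_derivs[OF \<eta> bs] e]])
  qed
  fix bs :: "'a list" and N assume bs: "bs \<in> lists Basis"
  show "\<exists>C. \<forall>x. norm (partial_derivs bs (convolution \<eta> e) x) \<le> C * weight (real N) x"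
    using schwartz_convolution_bound[OF schwartz_partial_derivs[OF \<eta> bs] e, of _ N]
    unfolding partial_derivs_convolution[OF \<eta> e bs]
    by (intro exI allI) (simp add: weight_nat field_simps add_pos_nonneg)
qed

section \<open>Fourier transform\<close>

lemma fourier_lborel:
  "f \<in> borel_measurable borel \<Longrightarrow> fourier f \<xi> = (LINT x|lborel. f x * cis (- 2 * pi * (x \<bullet> \<xi>)))"
  unfolding fourier_def by (rule integral_lebesgue_lborel) (simp add: cis_conv_exp)

lemma inv_fourier_lborel:
  "f \<in> borel_measurable borel \<Longrightarrow> inv_fourier f x = (LINT \<xi>|lborel. f \<xi> * cis (2 * pi * (x \<bullet> \<xi>)))"
  unfolding inv_fourier_def by (rule integral_lebesgue_lborel) (simp add: cis_conv_exp)

lemma integrable_mult_cis: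
  fixes f :: "'a::euclidean_space \<Rightarrow> complex"
  assumes f: "integrable lborel f" and [measurable]: "a \<in> borel_measurable borel"
  shows "integrable lborel (\<lambda>x. f x * cis (a x))"
proof -
  have [measurable]: "f \<in> borel_measurable borel" using f by auto
  show ?thesis
    by (rule Bochner_Integration.integrable_bound[OF f]) (auto simp: norm_mult cis_conv_exp)
qed

lemma continuous_mult_cis_integral:
  fixes f :: "'a::euclidean_space \<Rightarrow> complex"
  assumes f: "integrable lborel f"
  shows "continuous_on UNIV (\<lambda>\<xi>. LINT x|lborel. f x * cis (c * (x \<bullet> \<xi>)))"
  unfolding continuous_on_sequentially comp_def
proof (intro ballI allI impI)
  have [measurable]: "f \<in> borel_measurable borel" using f by auto
  fix u :: "nat \<Rightarrow> 'a" and a assume u: "(\<forall>n. u n \<in> UNIV) \<and> u \<longlonglongrightarrow> a"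
  show "(\<lambda>n. LINT x|lborel. f x * cis (c * (x \<bullet> u n))) \<longlonglongrightarrow> (LINT x|lborel. f x * cis (c * (x \<bullet> a)))"
  proof (rule integral_dominated_convergence[where w = "\<lambda>x. norm (f x)"])
    show "AE x in lborel. (\<lambda>n. f x * cis (c * (x \<bullet> u n))) \<longlonglongrightarrow> f x * cis (c * (x \<bullet> a))"
      using u unfolding cis_conv_exp by (intro AE_I2 tendsto_intros) auto
  qed (use f in \<open>auto simp: norm_mult cis_conv_exp\<close>)
qed

lemma norm_mult_cis_integral_le:
  fixes f :: "'a::euclidean_space \<Rightarrow> complex"
  shows "norm (LINT x|lborel. f x * cis (a x)) \<le> (LINT x|lborel. norm (f x))"
  using integral_norm_bound[of lborel "\<lambda>x. f x * cis (a x)"] by (simp add: norm_mult)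

lemma continuous_fourier:
  assumes "integrable lborel f" shows "continuous_on UNIV (fourier f)"
proof -
  have "fourier f = (\<lambda>\<xi>. LINT x|lborel. f x * cis (- 2 * pi * (x \<bullet> \<xi>)))"
    using borel_measurable_integrable[OF assms] by (auto simp: fourier_lborel)
  then show ?thesis using continuous_mult_cis_integral[OF assms, of "- 2 * pi"] by simp
qed

lemma bounded_cont_fourier:
  assumes "integrable lborel f" shows "bounded_cont (fourier f)"
proof (rule bounded_contI[OF continuous_fourier[OF assms]])
  show "norm (fourier f x) \<le> (LINT x|lborel. norm (f x))" for x
    using borel_measurable_integrable[OF assms] by (simp add: fourier_lborel norm_mult_cis_integral_le)
qed

lemma bounded_cont_inv_fourier:
  assumes "integrable lborel f" shows "bounded_cont (inv_fourier f)"
proof -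
  have [measurable]: "f \<in> borel_measurable borel" using assms by auto
  have e: "inv_fourier f = (\<lambda>x. LINT \<xi>|lborel. f \<xi> * cis (2 * pi * (\<xi> \<bullet> x)))"
    by (rule ext) (simp add: inv_fourier_lborel inner_commute)
  show ?thesis unfolding e
    by (rule bounded_contI[OF continuous_mult_cis_integral[OF assms] norm_mult_cis_integral_le])
qed

lemma fourier_add:
  assumes "integrable lborel f" "integrable lborel g"
  shows "fourier (\<lambda>x. f x + g x) \<xi> = fourier f \<xi> + fourier g \<xi>"
  using integrable_mult_cis[OF assms(1)] integrable_mult_cis[OF assms(2)] borel_measurable_integrable[OF assms(1)]
    borel_measurable_integrable[OF assms(2)]
  by (simp add: fourier_lborel ring_distribs)

lemma fourier_cmult:
  assumes "integrable lborel f"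
  shows "fourier (\<lambda>x. c * f x) \<xi> = c * fourier f \<xi>"
  using borel_measurable_integrable[OF assms] by (simp add: fourier_lborel mult.assoc)

lemma fourier_affine:
  fixes f :: "'a::euclidean_space \<Rightarrow> complex"
  assumes [measurable]: "f \<in> borel_measurable borel" and c: "c \<noteq> 0"
  shows "(\<bar>c\<bar> ^ DIM('a)) *\<^sub>R fourier (\<lambda>y. f (t + c *\<^sub>R y)) \<xi> = cis (2 * pi * (t \<bullet> \<xi>) / c) * fourier f (\<xi> /\<^sub>R c)"
proof -
  have "fourier f (\<xi> /\<^sub>R c) = (LINT x|lborel. f x * cis (- 2 * pi * (x \<bullet> \<xi>) / c))"
    by (simp add: fourier_lborel divide_inverse mult_ac)
  also have "\<dots> = (\<bar>c\<bar> ^ DIM('a)) *\<^sub>R (LINT y|lborel. f (t + c *\<^sub>R y) * cis (- 2 * pi * ((t + c *\<^sub>R y) \<bullet> \<xi>) / c))"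
    by (rule integral_lborel_affine[OF c])
  also have "(LINT y|lborel. f (t + c *\<^sub>R y) * cis (- 2 * pi * ((t + c *\<^sub>R y) \<bullet> \<xi>) / c))
     = (LINT y|lborel. cis (- (2 * pi * (t \<bullet> \<xi>) / c)) * (f (t + c *\<^sub>R y) * cis (- 2 * pi * (y \<bullet> \<xi>))))"
  proof (intro Bochner_Integration.integral_cong refl)
    fix y
    have "- 2 * pi * ((t + c *\<^sub>R y) \<bullet> \<xi>) / c = - (2 * pi * (t \<bullet> \<xi>) / c) + (- 2 * pi * (y \<bullet> \<xi>))"
      using c by (simp add: inner_left_distrib field_simps)
    then have "cis (- 2 * pi * ((t + c *\<^sub>R y) \<bullet> \<xi>) / c) = cis (- (2 * pi * (t \<bullet> \<xi>) / c)) * cis (- 2 * pi * (y \<bullet> \<xi>))"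
      by (simp only: cis_mult)
    then show "f (t + c *\<^sub>R y) * cis (- 2 * pi * ((t + c *\<^sub>R y) \<bullet> \<xi>) / c)
      = cis (- (2 * pi * (t \<bullet> \<xi>) / c)) * (f (t + c *\<^sub>R y) * cis (- 2 * pi * (y \<bullet> \<xi>)))"
      by (simp only: mult_ac)
  qed
  also have "\<dots> = cis (- (2 * pi * (t \<bullet> \<xi>) / c)) * fourier (\<lambda>y. f (t + c *\<^sub>R y)) \<xi>"
    by (simp add: fourier_lborel)
  finally have "cis (2 * pi * (t \<bullet> \<xi>) / c) * fourier f (\<xi> /\<^sub>R c)
    = (cis (2 * pi * (t \<bullet> \<xi>) / c) * cis (- (2 * pi * (t \<bullet> \<xi>) / c))) * ((\<bar>c\<bar> ^ DIM('a)) *\<^sub>R fourier (\<lambda>y. f (t + c *\<^sub>R y)) \<xi>)"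
    by (simp add: mult_ac)
  then show ?thesis by (simp add: cis_mult)
qed

text \<open>Fubini in a form that asks no more of \<open>n\<close> than integrability. It therefore
  applies to the symbols \<open>m(2^k .) \<phi>\<close>, which are merely bounded with compact
  support, and it avoids Fourier inversion.\<close>

lemma convolution_inv_fourier:
  fixes L n :: "'a::euclidean_space \<Rightarrow> complex"
  assumes L: "nice_kernel L" and n: "integrable lborel n"
  shows "convolution L (inv_fourier n) = inv_fourier (\<lambda>\<xi>. n \<xi> * fourier L \<xi>)"
proof
  fix x
  have [measurable]: "n \<in> borel_measurable borel" using n by auto
  note [measurable] = nice_kernel_measurable[OF L] bounded_cont_measurable[OF bounded_cont_inv_fourier[OF n]]
    bounded_cont_measurable[OF bounded_cont_fourier[OF nice_kernel_integrable[OF L]]]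
  have "convolution L (inv_fourier n) x = (LINT y|lborel. LINT \<xi>|lborel. L (x - y) * (n \<xi> * cis (2 * pi * (y \<bullet> \<xi>))))"
    by (simp add: convolution_lborel inv_fourier_lborel)
  also have "\<dots> = (LINT \<xi>|lborel. LINT y|lborel. L (x - y) * (n \<xi> * cis (2 * pi * (y \<bullet> \<xi>))))"
  proof (rule fubini_dominated)
    show "integrable (lborel \<Otimes>\<^sub>M lborel) (\<lambda>(y, \<xi>). norm (L (x - y)) * norm (n \<xi>))"
      using n integrable_lborel_reflect[OF nice_kernel_integrable[OF L], of x]
      by (intro integrable_pair_prod[of "\<lambda>y. norm (L (x - y))"]) auto
  qed (auto simp: norm_mult cis_conv_exp)
  also have "\<dots> = (LINT \<xi>|lborel. (n \<xi> * fourier L \<xi>) * cis (2 * pi * (x \<bullet> \<xi>)))"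
  proof (intro Bochner_Integration.integral_cong refl)
    fix \<xi>
    have "(LINT y|lborel. L (x - y) * (n \<xi> * cis (2 * pi * (y \<bullet> \<xi>))))
      = (LINT y|lborel. L y * (n \<xi> * cis (2 * pi * ((x - y) \<bullet> \<xi>))))"
      using integral_lborel_reflect[of "\<lambda>y. L (x - y) * (n \<xi> * cis (2 * pi * (y \<bullet> \<xi>)))" x] by simp
    also have "\<dots> = (LINT y|lborel. (n \<xi> * cis (2 * pi * (x \<bullet> \<xi>))) * (L y * cis (- 2 * pi * (y \<bullet> \<xi>))))"
    proof (intro Bochner_Integration.integral_cong refl)
      fix y
      have "2 * pi * ((x - y) \<bullet> \<xi>) = 2 * pi * (x \<bullet> \<xi>) + (- 2 * pi * (y \<bullet> \<xi>))"
        by (simp add: inner_diff_left algebra_simps)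
      then have "cis (2 * pi * ((x - y) \<bullet> \<xi>)) = cis (2 * pi * (x \<bullet> \<xi>)) * cis (- 2 * pi * (y \<bullet> \<xi>))"
        by (simp only: cis_mult)
      then show "L y * (n \<xi> * cis (2 * pi * ((x - y) \<bullet> \<xi>)))
        = (n \<xi> * cis (2 * pi * (x \<bullet> \<xi>))) * (L y * cis (- 2 * pi * (y \<bullet> \<xi>)))"
        by (simp only: mult_ac)
    qed
    also have "\<dots> = (n \<xi> * cis (2 * pi * (x \<bullet> \<xi>))) * (LINT y|lborel. L y * cis (- 2 * pi * (y \<bullet> \<xi>)))"
      by (rule integral_mult_right_zero)
    also have "(LINT y|lborel. L y * cis (- 2 * pi * (y \<bullet> \<xi>))) = fourier L \<xi>"
      by (rule fourier_lborel[OF nice_kernel_measurable[OF L], symmetric])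
    also have "(n \<xi> * cis (2 * pi * (x \<bullet> \<xi>))) * fourier L \<xi> = (n \<xi> * fourier L \<xi>) * cis (2 * pi * (x \<bullet> \<xi>))"
      by (simp only: mult_ac)
    finally show "(LINT y|lborel. L (x - y) * (n \<xi> * cis (2 * pi * (y \<bullet> \<xi>)))) = (n \<xi> * fourier L \<xi>) * cis (2 * pi * (x \<bullet> \<xi>))" .
  qed
  also have "\<dots> = inv_fourier (\<lambda>\<xi>. n \<xi> * fourier L \<xi>) x" by (simp add: inv_fourier_lborel)
  finally show "convolution L (inv_fourier n) x = inv_fourier (\<lambda>\<xi>. n \<xi> * fourier L \<xi>) x" .
qed

lemma fourier_convolution:
  fixes K L :: "'a::euclidean_space \<Rightarrow> complex"
  assumes K: "nice_kernel K" and L: "nice_kernel L"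
  shows "fourier (convolution K L) \<xi> = fourier K \<xi> * fourier L \<xi>"
proof -
  note [measurable] = nice_kernel_measurable[OF K] nice_kernel_measurable[OF L]
    nice_kernel_measurable[OF nice_kernel_convolution[OF K L]]
  have "fourier (convolution K L) \<xi> = (LINT x|lborel. LINT y|lborel. K (x - y) * L y * cis (- 2 * pi * (x \<bullet> \<xi>)))"
    by (simp add: convolution_lborel fourier_lborel)
  also have "\<dots> = (LINT y|lborel. LINT x|lborel. K (x - y) * L y * cis (- 2 * pi * (x \<bullet> \<xi>)))"
  proof (rule fubini_dominated(1)[symmetric])
    show "integrable (lborel \<Otimes>\<^sub>M lborel) (\<lambda>(y, x). norm (L y) * norm (K (x - y)))"
      by (rule integrable_pair_shift[of "\<lambda>y. norm (L y)" "\<lambda>y. norm (K y)"])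
         (use K L in \<open>auto dest: nice_kernel_integrable\<close>)
  qed (auto simp: norm_mult cis_conv_exp)
  also have "\<dots> = (LINT y|lborel. fourier K \<xi> * (L y * cis (- 2 * pi * (y \<bullet> \<xi>))))"
  proof (intro Bochner_Integration.integral_cong refl)
    fix y
    have "(LINT x|lborel. K (x - y) * L y * cis (- 2 * pi * (x \<bullet> \<xi>)))
      = (LINT x|lborel. (K (x - y) * cis (- 2 * pi * ((x - y) \<bullet> \<xi>))) * (L y * cis (- 2 * pi * (y \<bullet> \<xi>))))"
    proof (intro Bochner_Integration.integral_cong refl)
      fix x
      have "- 2 * pi * (x \<bullet> \<xi>) = - 2 * pi * ((x - y) \<bullet> \<xi>) + (- 2 * pi * (y \<bullet> \<xi>))"
        by (simp add: inner_diff_left algebra_simps)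
      then have "cis (- 2 * pi * (x \<bullet> \<xi>)) = cis (- 2 * pi * ((x - y) \<bullet> \<xi>)) * cis (- 2 * pi * (y \<bullet> \<xi>))"
        by (simp only: cis_mult)
      then show "K (x - y) * L y * cis (- 2 * pi * (x \<bullet> \<xi>))
        = (K (x - y) * cis (- 2 * pi * ((x - y) \<bullet> \<xi>))) * (L y * cis (- 2 * pi * (y \<bullet> \<xi>)))"
        by (simp only: mult_ac)
    qed
    also have "\<dots> = (LINT x|lborel. K (x - y) * cis (- 2 * pi * ((x - y) \<bullet> \<xi>))) * (L y * cis (- 2 * pi * (y \<bullet> \<xi>)))"
      by (rule integral_mult_left_zero)
    also have "(LINT x|lborel. K (x - y) * cis (- 2 * pi * ((x - y) \<bullet> \<xi>))) = fourier K \<xi>"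
      by (subst integral_lborel_shift[of "\<lambda>x. K x * cis (- 2 * pi * (x \<bullet> \<xi>))"]) (simp add: fourier_lborel)
    finally show "(LINT x|lborel. K (x - y) * L y * cis (- 2 * pi * (x \<bullet> \<xi>))) = fourier K \<xi> * (L y * cis (- 2 * pi * (y \<bullet> \<xi>)))" .
  qed
  also have "\<dots> = fourier K \<xi> * fourier L \<xi>" by (simp add: fourier_lborel)
  finally show ?thesis .
qed

section \<open>Gaussians and injectivity of the Fourier transform\<close>

lemma
  fixes g :: "'a::euclidean_space \<Rightarrow> real \<Rightarrow> complex"
  assumes g: "\<And>b. b \<in> Basis \<Longrightarrow> integrable lborel (g b)"
  shows integrable_lborel_prod: "integrable lborel (\<lambda>x. \<Prod>b\<in>Basis. g b (x \<bullet> b))"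
    and integral_lborel_prod: "(LINT x|lborel. (\<Prod>b\<in>Basis. g b (x \<bullet> b))) = (\<Prod>b\<in>Basis. (LINT s|lborel. g b s))"
proof -
  interpret product_sigma_finite "\<lambda>_::'a. lborel :: real measure" ..
  have [measurable]: "b \<in> Basis \<Longrightarrow> g b \<in> borel_measurable borel" for b using g by auto
  have e: "(\<Prod>b\<in>Basis. g b ((\<Sum>b\<in>Basis. f b *\<^sub>R b) \<bullet> b)) = (\<Prod>b\<in>Basis. g b (f b))" for f :: "'a \<Rightarrow> real"
    by (intro prod.cong) auto
  have [measurable]: "(\<lambda>x. \<Prod>b\<in>Basis. g b (x \<bullet> b)) \<in> borel_measurable borel"
    by (intro borel_measurable_prod) measurable
  show "integrable lborel (\<lambda>x. \<Prod>b\<in>Basis. g b (x \<bullet> b))"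
    using product_integrable_prod[of Basis g] g
    by (subst lborel_eq) (simp add: integrable_distr_eq e del: inner_sum_left_Basis)
  show "(LINT x|lborel. (\<Prod>b\<in>Basis. g b (x \<bullet> b))) = (\<Prod>b\<in>Basis. (LINT s|lborel. g b s))"
    using product_integral_prod[of Basis g] g
    by (subst lborel_eq) (simp add: integral_distr e del: inner_sum_left_Basis)
qed

lemma gaussian_fourier_real:
  "integrable lborel (\<lambda>s::real. complex_of_real (exp (- s\<^sup>2 / 2)) * cis (t * s))"
  "(LINT s|lborel. complex_of_real (exp (- s\<^sup>2 / 2)) * cis (t * s)) = of_real (sqrt (2 * pi) * exp (- t\<^sup>2 / 2))"
proof -
  have 1: "integrable lborel (\<lambda>s::real. complex_of_real (sqrt (2 * pi) * std_normal_density s))"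
    by (intro integrable_of_real integrable_mult_right) (simp add: integrable_normal_density)
  then have 2: "integrable lborel (\<lambda>s::real. complex_of_real (exp (- s\<^sup>2 / 2)))"
    by (simp add: std_normal_density_def)
  show "integrable lborel (\<lambda>s::real. complex_of_real (exp (- s\<^sup>2 / 2)) * cis (t * s))"
    by (rule integrable_mult_cis[OF 2]) measurable
  have "of_real (exp (- t\<^sup>2 / 2)) = char std_normal_distribution t"
    by (simp add: char_std_normal_distribution)
  also have "\<dots> = (LINT s|lborel. std_normal_density s *\<^sub>R cis (t * s))"
    unfolding char_def by (subst integral_density) (auto simp: cis_conv_exp)
  also have "\<dots> = (LINT s|lborel. complex_of_real (1 / sqrt (2 * pi)) * (complex_of_real (exp (- s\<^sup>2 / 2)) * cis (t * s)))"
    by (intro Bochner_Integration.integral_cong) (auto simp: std_normal_density_def scaleR_conv_of_real)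
  finally show "(LINT s|lborel. complex_of_real (exp (- s\<^sup>2 / 2)) * cis (t * s)) = of_real (sqrt (2 * pi) * exp (- t\<^sup>2 / 2))"
    by (simp add: field_simps)
qed

text \<open>A product of one-dimensional Gaussians, whose transform is read off from the
  characteristic function of the standard normal distribution. For recovering values by dilation
  only the nonvanishing of the integral matters.\<close>

lemma ex_fourier_approximate_identity:
  obtains \<theta> :: "'a::euclidean_space \<Rightarrow> complex"
  where "integrable lborel \<theta>" "integrable lborel (inv_fourier \<theta>)" "(LINT x|lborel. inv_fourier \<theta> x) \<noteq> 0"
proof
  define \<theta> :: "'a \<Rightarrow> complex" where "\<theta> x = (\<Prod>b\<in>Basis. of_real (exp (- (x \<bullet> b)\<^sup>2 / 2)))" for x
  have g: "integrable lborel (\<lambda>s::real. complex_of_real (exp (- s\<^sup>2 / 2)))"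
    using gaussian_fourier_real(1)[of 0] by simp
  show \<theta>: "integrable lborel \<theta>"
    unfolding \<theta>_def using g by (rule integrable_lborel_prod[of "\<lambda>_ s. complex_of_real (exp (- s\<^sup>2 / 2))"])
  have [measurable]: "\<theta> \<in> borel_measurable borel" using \<theta> by auto
  have inv: "inv_fourier \<theta> = (\<lambda>x. \<Prod>b\<in>Basis. of_real (sqrt (2 * pi) * exp (- (2 * pi * (x \<bullet> b))\<^sup>2 / 2)))"
  proof
    fix x
    have "inv_fourier \<theta> x = (LINT \<xi>|lborel. (\<Prod>b\<in>Basis. complex_of_real (exp (- (\<xi> \<bullet> b)\<^sup>2 / 2)) * cis (2 * pi * (x \<bullet> b) * (\<xi> \<bullet> b))))"
    proof (subst inv_fourier_lborel, measurable, intro Bochner_Integration.integral_cong refl)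
      fix \<xi>
      have "cis (2 * pi * (x \<bullet> \<xi>)) = (\<Prod>b\<in>Basis. cis (2 * pi * (x \<bullet> b) * (\<xi> \<bullet> b)))"
        by (subst euclidean_inner[of x]) (simp add: cis_conv_exp sum_distrib_left exp_sum[symmetric] mult_ac)
      then show "\<theta> \<xi> * cis (2 * pi * (x \<bullet> \<xi>)) = (\<Prod>b\<in>Basis. complex_of_real (exp (- (\<xi> \<bullet> b)\<^sup>2 / 2)) * cis (2 * pi * (x \<bullet> b) * (\<xi> \<bullet> b)))"
        by (simp add: \<theta>_def prod.distrib)
    qed
    also have "\<dots> = (\<Prod>b\<in>Basis. (LINT s|lborel. complex_of_real (exp (- s\<^sup>2 / 2)) * cis (2 * pi * (x \<bullet> b) * s)))"
      by (rule integral_lborel_prod[of "\<lambda>b s. complex_of_real (exp (- s\<^sup>2 / 2)) * cis (2 * pi * (x \<bullet> b) * s)"])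
         (rule gaussian_fourier_real)
    finally show "inv_fourier \<theta> x = (\<Prod>b\<in>Basis. of_real (sqrt (2 * pi) * exp (- (2 * pi * (x \<bullet> b))\<^sup>2 / 2)))"
      by (simp only: gaussian_fourier_real)
  qed
  have h: "integrable lborel (\<lambda>s::real. complex_of_real (sqrt (2 * pi) * exp (- (2 * pi * s)\<^sup>2 / 2)))"
    using integrable_lborel_affine[OF g, of "2 * pi" 0] by (simp add: mult.commute)
  show "integrable lborel (inv_fourier \<theta>)"
    unfolding inv using h by (rule integrable_lborel_prod[of "\<lambda>_ s. complex_of_real (sqrt (2 * pi) * exp (- (2 * pi * s)\<^sup>2 / 2))"])
  have "(LINT s|lborel. complex_of_real (sqrt (2 * pi) * exp (- (2 * pi * s)\<^sup>2 / 2))) \<noteq> 0"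
  proof -
    have "complex_of_real (sqrt (2 * pi)) = (LINT s|lborel. complex_of_real (exp (- s\<^sup>2 / 2)))"
      using gaussian_fourier_real(2)[of 0] by simp
    also have "\<dots> = (\<bar>2 * pi\<bar> ^ DIM(real)) *\<^sub>R (LINT s|lborel. complex_of_real (exp (- (0 + (2 * pi) *\<^sub>R s)\<^sup>2 / 2)))"
      by (rule integral_lborel_affine) simp
    finally show ?thesis by auto
  qed
  moreover have "(LINT x|lborel. inv_fourier \<theta> x) = (\<Prod>b\<in>(Basis::'a set). (LINT s|lborel. complex_of_real (sqrt (2 * pi) * exp (- (2 * pi * s)\<^sup>2 / 2))))"
    unfolding inv using h by (rule integral_lborel_prod[of "\<lambda>_ s. complex_of_real (sqrt (2 * pi) * exp (- (2 * pi * s)\<^sup>2 / 2))"])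
  ultimately show "(LINT x|lborel. inv_fourier \<theta> x) \<noteq> 0" by simp
qed

text \<open>Testing \<open>g\<close> against the dilates of an integrable function that is itself an inverse Fourier
  transform recovers the values of \<open>g\<close>.\<close>

lemma fourier_eq_0_imp:
  fixes g :: "'a::euclidean_space \<Rightarrow> complex"
  assumes g: "nice_kernel g" and z: "\<And>\<xi>. fourier g \<xi> = 0"
  shows "g x = 0"
proof -
  obtain \<theta> :: "'a \<Rightarrow> complex" where \<theta>: "integrable lborel \<theta>" "integrable lborel (inv_fourier \<theta>)" "(LINT x|lborel. inv_fourier \<theta> x) \<noteq> 0"
    by (rule ex_fourier_approximate_identity)
  define t where "t n = 1 / real (Suc n)" for n
  have t: "t n \<noteq> 0" for n by (simp add: t_def)
  have t0: "t \<longlonglongrightarrow> 0" unfolding t_def by (rule LIMSEQ_Suc[OF lim_1_over_n])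
  note [measurable] = nice_kernel_measurable[OF g] bounded_cont_measurable[OF bounded_cont_inv_fourier[OF \<theta>(1)]]
  obtain B where B: "0 \<le> B" "\<And>x. norm (g x) \<le> B"
    using bounded_contD[OF nice_kernel_bounded_cont[OF g]] by blast
  have c: "isCont g x" for x
    using bounded_cont_continuous[OF nice_kernel_bounded_cont[OF g]] by (simp add: continuous_on_eq_continuous_at)
  have zero: "(LINT y|lborel. g (x - t n *\<^sub>R y) * inv_fourier \<theta> y) = 0" for n
  proof -
    \<comment> \<open>Up to scaling and a phase the transform of \<open>f\<close> is a dilate of
      that of \<open>g\<close>, so it vanishes too; convolving \<open>f\<close> with
      \<open>inv_fourier \<theta>\<close> then yields the inverse transform of the zero
      function.\<close>
    define f where "f y = g (x + t n *\<^sub>R y)" for y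
    have fz: "fourier f \<xi> = 0" for \<xi>
      using fourier_affine[of g "t n" x \<xi>] z t[of n] by (simp add: f_def[abs_def])
    have f: "nice_kernel f"
    proof -
      have "continuous_on UNIV f" unfolding f_def
        by (intro continuous_on_compose2[OF bounded_cont_continuous[OF nice_kernel_bounded_cont[OF g]]] continuous_intros) auto
      then show ?thesis
        using B integrable_lborel_affine[OF nice_kernel_integrable[OF g] t, of x]
        by (auto simp: nice_kernel_def f_def[abs_def] intro!: bounded_contI)
    qed
    have "convolution f (inv_fourier \<theta>) 0 = 0"
      by (simp add: convolution_inv_fourier[OF f \<theta>(1)] fz inv_fourier_lborel)
    then show ?thesis using nice_kernel_measurable[OF f] by (simp add: convolution_lborel f_def)
  qed
  have "(\<lambda>n. LINT y|lborel. g (x - t n *\<^sub>R y) * inv_fourier \<theta> y) \<longlonglongrightarrow> (LINT y|lborel. g x * inv_fourier \<theta> y)"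
  proof (rule integral_dominated_convergence[where w = "\<lambda>y. B * norm (inv_fourier \<theta> y)"])
    have "(\<lambda>n. x - t n *\<^sub>R y) \<longlonglongrightarrow> x - 0 *\<^sub>R y" for y by (intro tendsto_intros t0)
    then show "AE y in lborel. (\<lambda>n. g (x - t n *\<^sub>R y) * inv_fourier \<theta> y) \<longlonglongrightarrow> g x * inv_fourier \<theta> y"
      by (intro AE_I2 tendsto_intros isCont_tendsto_compose[OF c]) simp
  qed (use B \<theta> in \<open>auto simp: norm_mult intro!: mult_right_mono\<close>)
  then have "g x * (LINT y|lborel. inv_fourier \<theta> y) = 0"
    by (simp add: zero LIMSEQ_const_iff)
  with \<theta>(3) show ?thesis by simp
qed

lemma fourier_inject:
  fixes f g :: "'a::euclidean_space \<Rightarrow> complex"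
  assumes f: "nice_kernel f" and g: "nice_kernel g" and e: "\<And>\<xi>. fourier f \<xi> = fourier g \<xi>"
  shows "f = g"
proof
  fix x
  have m: "nice_kernel (\<lambda>x. - 1 * g x)"
    using g by (auto simp: nice_kernel_def bounded_cont_def intro!: continuous_intros)
  have "f x + - 1 * g x = 0"
  proof (rule fourier_eq_0_imp[OF nice_kernel_add[OF f m]])
    show "fourier (\<lambda>x. f x + - 1 * g x) \<xi> = 0" for \<xi>
      using fourier_add[OF nice_kernel_integrable[OF f] nice_kernel_integrable[OF m]]
        fourier_cmult[OF nice_kernel_integrable[OF g], of "- 1"] e by simp
  qed
  then show "f x = g x" by simp
qed

section \<open>Vanishing moments\<close>

lemma all_moments_mult:
  fixes \<psi> p :: "'a::euclidean_space \<Rightarrow> complex"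
  assumes \<psi>: "all_moments \<psi>" and [measurable]: "p \<in> borel_measurable borel"
    and p: "\<And>x. norm (p x) \<le> C * (1 + norm x) ^ n"
  shows "all_moments (\<lambda>x. p x * \<psi> x)"
  unfolding all_moments_def
proof (intro conjI allI)
  note [measurable] = all_moments_measurable[OF \<psi>]
  show "(\<lambda>x. p x * \<psi> x) \<in> borel_measurable borel" by measurable
  fix k
  have "norm (of_real (1 + norm x) ^ k * (p x * \<psi> x)) \<le> C * (1 + norm x) ^ (k + n) * norm (\<psi> x)" for x
  proof -
    have "(1 + norm x) ^ k * norm (\<psi> x) * norm (p x) \<le> (1 + norm x) ^ k * norm (\<psi> x) * (C * (1 + norm x) ^ n)"
      by (intro mult_left_mono p) auto
    then show ?thesis by (simp add: norm_mult norm_power power_add mult_ac del: of_real_add)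
  qed
  from all_moments_dominated(1)[OF \<psi> _ this]
  have "integrable lborel (\<lambda>x. norm (of_real (1 + norm x) ^ k * (p x * \<psi> x)))"
    by (intro integrable_norm) measurable
  then show "integrable lborel (\<lambda>x. (1 + norm x) ^ k * norm (p x * \<psi> x))"
    by (simp add: norm_mult norm_power del: of_real_add)
qed

lemma all_moments_integrable_self: "all_moments \<psi> \<Longrightarrow> integrable lborel \<psi>"
  using all_moments_integrable[of \<psi> 0] all_moments_measurable[of \<psi>] by (simp add: integrable_norm_iff)

lemma all_moments_add:
  assumes e: "all_moments e" and f: "all_moments f"
  shows "all_moments (\<lambda>x. e x + f x)"
  unfolding all_moments_def
proof (intro conjI allI)
  note [measurable] = all_moments_measurable[OF e] all_moments_measurable[OF f]
  show "(\<lambda>x. e x + f x) \<in> borel_measurable borel" by measurable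
  fix n
  show "integrable lborel (\<lambda>u. (1 + norm u) ^ n * norm (e u + f u))"
  proof (rule Bochner_Integration.integrable_bound)
    show "integrable lborel (\<lambda>u. (1 + norm u) ^ n * norm (e u) + (1 + norm u) ^ n * norm (f u))"
      by (intro Bochner_Integration.integrable_add all_moments_integrable e f)
  qed (auto simp: distrib_left[symmetric] intro!: mult_left_mono norm_triangle_ineq)
qed

lemma norm_cis_minus_first_order: "norm (cis a - 1 - \<i> * of_real a) \<le> a\<^sup>2 / 2"
  using iexp_approx1[of a 1] by (simp add: cis_conv_exp algebra_simps numeral_2_eq_2)

text \<open>Multiplication by a linear functional turns into differentiation of the Fourier transform,
  so it preserves the class of functions whose Fourier transform vanishes near the origin.\<close>

definition fourier_flat :: "('a::euclidean_space \<Rightarrow> complex) \<Rightarrow> bool" where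
  "fourier_flat \<psi> \<longleftrightarrow> all_moments \<psi> \<and> (\<exists>\<delta>>0. \<forall>\<xi>. norm \<xi> < \<delta> \<longrightarrow> fourier \<psi> \<xi> = 0)"

lemma fourier_flat_linear:
  assumes \<psi>: "fourier_flat \<psi>" and f: "bounded_linear f"
  shows "fourier_flat (\<lambda>x. of_real (f x) * \<psi> x)"
proof -
  have m: "all_moments \<psi>" using \<psi> by (simp add: fourier_flat_def)
  note [measurable] = all_moments_measurable[OF m]
  have fm [measurable]: "f \<in> borel_measurable borel"
    by (intro borel_measurable_continuous_onI linear_continuous_on f)
  obtain K where K: "\<And>x. norm (f x) \<le> norm x * K" "0 < K" using bounded_linear.pos_bounded[OF f] by blast
  have fK: "norm (complex_of_real (f x)) \<le> K * (1 + norm x) ^ 1" for x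
  proof -
    have "norm x * K \<le> (1 + norm x) * K" using K by (intro mult_right_mono) auto
    then show ?thesis using K(1)[of x] by (simp add: mult.commute)
  qed
  have f1: "all_moments (\<lambda>x. of_real (f x) * \<psi> x)"
    by (rule all_moments_mult[OF m _ fK]) measurable
  have "all_moments (\<lambda>x. of_real (f x) * (of_real (f x) * \<psi> x))"
    by (rule all_moments_mult[OF f1 _ fK]) measurable
  then have f2: "integrable lborel (\<lambda>x. of_real (f x) * (of_real (f x) * \<psi> x))"
    by (rule all_moments_integrable_self)
  \<comment> \<open>The vector representing the functional: multiplication by
    \<open>f x = x \<bullet> v\<close> corresponds to differentiating the transform in direction
    \<open>v\<close>.\<close>
  define v where "v = (\<Sum>b\<in>Basis. f b *\<^sub>R b)"
  have fv: "f x = x \<bullet> v" for x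
  proof -
    interpret bounded_linear f by fact
    have "f x = f (\<Sum>b\<in>Basis. (x \<bullet> b) *\<^sub>R b)" by (simp add: euclidean_representation)
    also have "\<dots> = (\<Sum>b\<in>Basis. (x \<bullet> b) * f b)" by (simp only: sum scaleR real_scaleR_def)
    finally show ?thesis by (simp add: v_def inner_sum_right mult.commute)
  qed
  obtain \<delta> where \<delta>: "\<delta> > 0" "\<And>\<xi>. norm \<xi> < \<delta> \<Longrightarrow> fourier \<psi> \<xi> = 0"
    using \<psi> by (auto simp: fourier_flat_def)
  have "fourier (\<lambda>x. of_real (f x) * \<psi> x) \<xi> = 0" if \<xi>: "norm \<xi> < \<delta>" for \<xi>
  proof -
    define c where "c = - 2 * pi"
    define M where "M = (LINT x|lborel. norm (of_real (f x) * (of_real (f x) * \<psi> x)))"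
    define I where "I = fourier (\<lambda>x. of_real (f x) * \<psi> x) \<xi>"
    have I: "I = (LINT x|lborel. of_real (f x) * \<psi> x * cis (c * (x \<bullet> \<xi>)))"
      unfolding I_def by (subst fourier_lborel) (auto simp: c_def)
    \<comment> \<open>For \<open>s < r\<close> the point \<open>\<xi> + s v\<close> stays in the
      ball where the transform of \<psi> vanishes; the 1 in the denominator covers
      \<open>v = 0\<close>.\<close>
    define r where "r = (\<delta> - norm \<xi>) / (1 + norm v)"
    have r: "0 < r" using \<xi> by (simp add: r_def add_pos_nonneg)
    \<comment> \<open>Both values in the difference quotient of the transform are 0, so the
      derivative term \<open>I\<close> is bounded by the second order remainder of the exponential,
      which is of size \<open>s\<close> after division by \<open>s\<close>.\<close>
    have main: "norm I * (2 * pi) \<le> s * ((c\<^sup>2 / 2) * M)" if s: "0 < s" "s < r" for s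
    proof -
      have "norm (\<xi> + s *\<^sub>R v) \<le> norm \<xi> + s * norm v"
        using norm_triangle_ineq[of \<xi> "s *\<^sub>R v"] s by simp
      also have "s * norm v < \<delta> - norm \<xi>"
      proof -
        have "s * norm v \<le> s * (1 + norm v)" using s by simp
        also have "\<dots> < r * (1 + norm v)" using s by (intro mult_strict_right_mono) (auto simp: add_pos_nonneg)
        also have "\<dots> = \<delta> - norm \<xi>"
        proof -
          have "1 + norm v \<noteq> 0" by (simp add: add_nonneg_eq_0_iff)
          then show ?thesis by (simp add: r_def)
        qed
        finally show ?thesis .
      qed
      finally have z: "fourier \<psi> (\<xi> + s *\<^sub>R v) = 0" by (intro \<delta>) simp
      have z0: "fourier \<psi> \<xi> = 0" by (rule \<delta>(2)[OF \<xi>])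
      let ?e = "\<lambda>x. \<psi> x * cis (c * (x \<bullet> \<xi>))"
      have i: "integrable lborel ?e" "integrable lborel (\<lambda>x. \<psi> x * cis (c * (x \<bullet> (\<xi> + s *\<^sub>R v))))"
        by (intro integrable_mult_cis all_moments_integrable_self m; measurable)+
      have i1: "integrable lborel (\<lambda>x. of_real (f x) * \<psi> x * cis (c * (x \<bullet> \<xi>)))"
        by (intro integrable_mult_cis all_moments_integrable_self f1; measurable)
      have "(LINT x|lborel. ?e x * (cis (c * s * f x) - 1 - \<i> * of_real (c * s * f x)))
        = (LINT x|lborel. \<psi> x * cis (c * (x \<bullet> (\<xi> + s *\<^sub>R v))) - ?e x - (\<i> * of_real (c * s)) * (of_real (f x) * \<psi> x * cis (c * (x \<bullet> \<xi>))))"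
      proof (intro Bochner_Integration.integral_cong refl)
        fix x
        have "c * (x \<bullet> (\<xi> + s *\<^sub>R v)) = c * (x \<bullet> \<xi>) + c * s * f x"
          by (simp add: fv inner_add_right algebra_simps)
        then have "cis (c * (x \<bullet> (\<xi> + s *\<^sub>R v))) = cis (c * (x \<bullet> \<xi>)) * cis (c * s * f x)"
          by (simp only: cis_mult)
        then show "?e x * (cis (c * s * f x) - 1 - \<i> * of_real (c * s * f x))
          = \<psi> x * cis (c * (x \<bullet> (\<xi> + s *\<^sub>R v))) - ?e x - (\<i> * of_real (c * s)) * (of_real (f x) * \<psi> x * cis (c * (x \<bullet> \<xi>)))"
          by (simp add: algebra_simps)
      qed
      also have "\<dots> = fourier \<psi> (\<xi> + s *\<^sub>R v) - fourier \<psi> \<xi> - (\<i> * of_real (c * s)) * I"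
        unfolding I using i i1 by (simp add: fourier_lborel c_def)
      finally have "norm ((\<i> * of_real (c * s)) * I) = norm (LINT x|lborel. ?e x * (cis (c * s * f x) - 1 - \<i> * of_real (c * s * f x)))"
        by (simp only: z z0) (simp add: norm_mult)
      also have "\<dots> \<le> (LINT x|lborel. norm (?e x * (cis (c * s * f x) - 1 - \<i> * of_real (c * s * f x))))"
        by (rule integral_norm_bound)
      also have "\<dots> \<le> (LINT x|lborel. ((c * s)\<^sup>2 / 2) * norm (of_real (f x) * (of_real (f x) * \<psi> x)))"
      proof (rule integral_mono_AE')
        show "integrable lborel (\<lambda>x. ((c * s)\<^sup>2 / 2) * norm (of_real (f x) * (of_real (f x) * \<psi> x)))" using f2 by auto
        show "AE x in lborel. norm (?e x * (cis (c * s * f x) - 1 - \<i> * of_real (c * s * f x))) \<le> ((c * s)\<^sup>2 / 2) * norm (of_real (f x) * (of_real (f x) * \<psi> x))"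
        proof (rule AE_I2)
          fix x
          have "norm (\<psi> x) * norm (cis (c * s * f x) - 1 - \<i> * of_real (c * s * f x)) \<le> norm (\<psi> x) * ((c * s * f x)\<^sup>2 / 2)"
            by (intro mult_left_mono norm_cis_minus_first_order) simp
          then show "norm (?e x * (cis (c * s * f x) - 1 - \<i> * of_real (c * s * f x))) \<le> ((c * s)\<^sup>2 / 2) * norm (of_real (f x) * (of_real (f x) * \<psi> x))"
            by (simp add: norm_mult power2_eq_square mult_ac abs_mult_self_eq)
        qed
      qed auto
      also have "\<dots> = ((c * s)\<^sup>2 / 2) * M" by (simp add: M_def)
      finally have "s * (norm I * (2 * pi)) \<le> s * (s * ((c\<^sup>2 / 2) * M))"
        using s by (simp add: norm_mult c_def power2_eq_square mult_ac)
      then show ?thesis using s by simp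
    qed
    have "norm I * (2 * pi) \<le> 0"
    proof (rule tendsto_lowerbound)
      have "((\<lambda>s. s * ((c\<^sup>2 / 2) * M)) \<longlongrightarrow> 0 * ((c\<^sup>2 / 2) * M)) (at_right 0)" by (intro tendsto_intros)
      then show "((\<lambda>s. s * ((c\<^sup>2 / 2) * M)) \<longlongrightarrow> 0) (at_right 0)" by simp
      show "\<forall>\<^sub>F s in at_right 0. norm I * (2 * pi) \<le> s * ((c\<^sup>2 / 2) * M)"
        using r main unfolding eventually_at_right_field by blast
    qed simp
    then have "norm I \<le> 0" using pi_gt_zero by (simp add: mult_le_0_iff)
    then show ?thesis by (simp add: I_def)
  qed
  with \<delta>(1) f1 show ?thesis unfolding fourier_flat_def by blast
qed

lemma fourier_flat_add:
  assumes "fourier_flat \<psi>" "fourier_flat \<theta>" shows "fourier_flat (\<lambda>x. \<psi> x + \<theta> x)"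
proof -
  obtain d e where de: "d > 0" "\<And>\<xi>. norm \<xi> < d \<Longrightarrow> fourier \<psi> \<xi> = 0" "e > 0" "\<And>\<xi>. norm \<xi> < e \<Longrightarrow> fourier \<theta> \<xi> = 0"
    using assms unfolding fourier_flat_def by blast
  have m: "all_moments \<psi>" "all_moments \<theta>" using assms by (auto simp: fourier_flat_def)
  have "fourier (\<lambda>x. \<psi> x + \<theta> x) \<xi> = 0" if "norm \<xi> < min d e" for \<xi>
    using de that fourier_add[OF m[THEN all_moments_integrable_self]] by simp
  moreover have "0 < min d e" using de by simp
  ultimately show ?thesis using all_moments_add[OF m] unfolding fourier_flat_def by blast
qed

lemma fourier_flat_cmult:
  assumes "fourier_flat \<psi>" shows "fourier_flat (\<lambda>x. c * \<psi> x)"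
proof -
  have m: "all_moments \<psi>" using assms by (auto simp: fourier_flat_def)
  have "all_moments (\<lambda>x. c * \<psi> x)"
    by (rule all_moments_mult[OF m, of _ "norm c" 0]) auto
  then show ?thesis
    using assms fourier_cmult[OF all_moments_integrable_self[OF m]] by (auto simp: fourier_flat_def)
qed

lemma fourier_flat_polynomial:
  assumes "real_polynomial_function p" "fourier_flat \<psi>"
  shows "fourier_flat (\<lambda>x. of_real (p x) * \<psi> x)"
  using assms
proof (induction arbitrary: \<psi>)
  case (linear f)
  then show ?case by (intro fourier_flat_linear)
next
  case (const c)
  then show ?case by (intro fourier_flat_cmult)
next
  case (add f g)
  then show ?case using fourier_flat_add[OF add.IH(1)[OF add.prems] add.IH(2)[OF add.prems]]
    by (simp add: distrib_right)
next
  case (mult f g)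
  then show ?case using mult.IH(1)[OF mult.IH(2)[OF mult.prems]] by (simp add: mult.assoc)
qed

lemma fourier_flat_integral_eq_0:
  assumes "fourier_flat \<psi>" shows "(LINT x|lborel. \<psi> x) = 0"
proof -
  have "\<psi> \<in> borel_measurable borel"
    using assms all_moments_measurable by (auto simp: fourier_flat_def)
  moreover have "fourier \<psi> 0 = 0" using assms by (auto simp: fourier_flat_def)
  ultimately show ?thesis by (simp add: fourier_lborel)
qed

text \<open>Multiplication by a polynomial keeps the transform zero near the origin, and the
  integral of a function is its transform at 0.\<close>

lemma schwartz_infI:
  assumes \<psi>: "\<psi> \<in> schwartz" and flat: "fourier_flat \<psi>"
  shows "\<psi> \<in> schwartz_inf"
  unfolding schwartz_inf_def
proof (intro CollectI conjI allI impI \<psi>)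
  fix P :: "'a \<Rightarrow> complex" assume P: "polynomial_function P"
  have "real_polynomial_function (\<lambda>x. Re (P x))" "real_polynomial_function (\<lambda>x. Im (P x))"
    using P bounded_linear_Re bounded_linear_Im unfolding polynomial_function_def comp_def by blast+
  then have fl: "fourier_flat (\<lambda>x. of_real (Re (P x)) * \<psi> x)" "fourier_flat (\<lambda>x. of_real (Im (P x)) * \<psi> x)"
    using flat by (auto intro: fourier_flat_polynomial)
  have e: "P x * \<psi> x = of_real (Re (P x)) * \<psi> x + \<i> * (of_real (Im (P x)) * \<psi> x)" for x
    by (subst complex_eq[of "P x"]) (simp add: algebra_simps)
  have f: "fourier_flat (\<lambda>x. P x * \<psi> x)"
    unfolding e by (intro fourier_flat_add fourier_flat_cmult fl)
  then have "(\<lambda>x. P x * \<psi> x) \<in> borel_measurable borel"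
    using all_moments_measurable by (auto simp: fourier_flat_def)
  then show "(LINT x|lebesgue. P x * \<psi> x) = 0"
    using fourier_flat_integral_eq_0[OF f] by (simp add: integral_lebesgue_lborel)
qed

section \<open>Littlewood--Paley decomposition\<close>

lemma nice_kernel_dyadic: "\<Phi> \<in> schwartz \<Longrightarrow> nice_kernel (dyadic \<Phi> k)"
  by (intro schwartz_nice_kernel schwartz_dyadic)

lemma fourier_dyadic:
  fixes \<Phi> :: "'a::euclidean_space \<Rightarrow> complex"
  assumes m: "\<Phi> \<in> borel_measurable borel"
  shows "fourier (dyadic \<Phi> k) \<xi> = fourier \<Phi> (\<xi> /\<^sub>R (2 powi k))"
proof -
  have c: "(2::real) powi k \<noteq> 0" by simp
  have [measurable]: "(\<lambda>y. \<Phi> (2 powi k *\<^sub>R y)) \<in> borel_measurable borel"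
    using m by measurable
  have "fourier (dyadic \<Phi> k) \<xi> = of_real (2 powi (k * int DIM('a))) * fourier (\<lambda>y. \<Phi> (0 + 2 powi k *\<^sub>R y)) \<xi>"
    unfolding dyadic_def[abs_def] by (simp add: fourier_lborel mult.assoc)
  also have "(2::real) powi (k * int DIM('a)) = \<bar>2 powi k\<bar> ^ DIM('a)"
    by (simp add: power_int_mult)
  finally show ?thesis
    using fourier_affine[OF m c, of 0 \<xi>] by (simp add: scaleR_conv_of_real)
qed

text \<open>Finite blocks of the Littlewood--Paley decomposition serve as reproducing kernels: at
  nonzero frequencies met only by indices in \<open>J\<close> the Fourier transform of the block is
  1.\<close>

definition lp_sum :: "('a::euclidean_space \<Rightarrow> complex) \<Rightarrow> int set \<Rightarrow> 'a \<Rightarrow> complex" where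
  "lp_sum \<Phi> J x = (\<Sum>j\<in>J. dyadic \<Phi> j x)"

lemma lp_sum_insert: "finite J \<Longrightarrow> k \<notin> J \<Longrightarrow> lp_sum \<Phi> (insert k J) = (\<lambda>x. dyadic \<Phi> k x + lp_sum \<Phi> J x)"
  by (simp add: lp_sum_def fun_eq_iff)

lemma schwartz_zero: "(\<lambda>x. 0) \<in> schwartz"
proof -
  have "partial_derivs bs (\<lambda>x::'a. 0::complex) = (\<lambda>x. 0)" for bs
    by (induction bs) (auto simp: partial_deriv_def)
  then show ?thesis by (auto simp: schwartz_def smooth_def)
qed


lemma schwartz_lp_sum:
  assumes \<Phi>: "\<Phi> \<in> schwartz" and "finite J"
  shows "lp_sum \<Phi> J \<in> schwartz"
  using assms(2)
proof (induction J)
  case empty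
  then show ?case using schwartz_zero by (simp add: lp_sum_def[abs_def])
next
  case (insert k J)
  then show ?case by (auto simp: lp_sum_insert intro!: schwartz_add schwartz_dyadic \<Phi>)
qed

lemma fourier_lp_sum:
  assumes \<Phi>: "\<Phi> \<in> schwartz" and "finite J"
  shows "fourier (lp_sum \<Phi> J) \<xi> = (\<Sum>j\<in>J. fourier \<Phi> (\<xi> /\<^sub>R (2 powi j)))"
  using assms(2)
proof (induction J)
  case empty
  then show ?case by (simp add: lp_sum_def[abs_def] fourier_def)
next
  case (insert k J)
  then show ?case
    by (simp add: lp_sum_insert fourier_add schwartz_integrable schwartz_dyadic schwartz_lp_sum \<Phi>
        fourier_dyadic schwartz_measurable)
qed

lemma dyadic_lp_sum: "dyadic (lp_sum \<Phi> {- 1..1}) k = lp_sum \<Phi> {k - 1..k + 1}"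
proof
  fix x :: 'a
  have d: "dyadic (dyadic \<Phi> j) k x = dyadic \<Phi> (k + j) x" for j
    by (simp add: dyadic_def power_int_add distrib_right mult.commute)
  have "dyadic (lp_sum \<Phi> {- 1..1}) k x = (\<Sum>j\<in>{- 1..1}. dyadic (dyadic \<Phi> j) k x)"
    by (simp add: dyadic_def lp_sum_def sum_distrib_left)
  also have "\<dots> = (\<Sum>j\<in>{- 1..1}. dyadic \<Phi> (k + j) x)" by (simp add: d)
  also have "\<dots> = (\<Sum>j\<in>{k - 1..k + 1}. dyadic \<Phi> j x)"
    by (rule sum.reindex_bij_witness[of _ "\<lambda>j. j - k" "\<lambda>j. k + j"]) auto
  finally show "dyadic (lp_sum \<Phi> {- 1..1}) k x = lp_sum \<Phi> {k - 1..k + 1} x" by (simp add: lp_sum_def)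
qed

lemma lp_schwartz: "littlewood_paley \<Phi> \<Longrightarrow> \<Phi> \<in> schwartz"
  by (simp add: littlewood_paley_def)

text \<open>The support condition speaks of a closed annulus. Strictness holds because the set where
  the transform is nonzero is open: moving \<open>\<xi>\<close> slightly outwards or inwards along
  its ray stays in the set. Strict bounds make spectra two scales apart disjoint, so that blocks of
  three indices suffice.\<close>

lemma lp_support:
  fixes \<Phi> :: "'a::euclidean_space \<Rightarrow> complex"
  assumes LP: "littlewood_paley \<Phi>" and nz: "fourier \<Phi> \<xi> \<noteq> 0"
  shows "1 / 2 < norm \<xi>" "norm \<xi> < 2"
proof -
  let ?U = "{\<xi>. fourier \<Phi> \<xi> \<noteq> 0}"
  have c: "continuous_on UNIV (fourier \<Phi>)"
    by (rule continuous_fourier[OF schwartz_integrable[OF lp_schwartz[OF LP]]])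
  have "open ?U" using c by (simp add: open_Collect_neq)
  moreover have sub: "?U \<subseteq> {\<xi>. 1/2 \<le> norm \<xi> \<and> norm \<xi> \<le> 2}"
    using LP subset_trans[OF closure_subset[of ?U]] unfolding littlewood_paley_def by meson
  ultimately obtain e where e: "e > 0" "ball \<xi> e \<subseteq> ?U" using nz by (auto simp: open_contains_ball)
  have n0: "0 < norm \<xi>" using sub nz by force
  define t where "t = e / 2 / norm \<xi>"
  have t: "0 < t" using e n0 by (simp add: t_def)
  have "(1 + t) *\<^sub>R \<xi> \<in> ball \<xi> e" "(1 - t) *\<^sub>R \<xi> \<in> ball \<xi> e"
    using e n0 by (auto simp: dist_norm algebra_simps t_def)
  then have "norm ((1 + t) *\<^sub>R \<xi>) \<le> 2" "1 / 2 \<le> norm ((1 - t) *\<^sub>R \<xi>)" using e sub by blast+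
  then have a: "\<bar>1 + t\<bar> * norm \<xi> \<le> 2" and b: "1 / 2 \<le> \<bar>1 - t\<bar> * norm \<xi>" by simp_all
  have "norm \<xi> < \<bar>1 + t\<bar> * norm \<xi>" using t n0 by simp
  with a show "norm \<xi> < 2" by linarith
  show "1 / 2 < norm \<xi>"
  proof (cases "t < 1")
    case True
    then have "\<bar>1 - t\<bar> * norm \<xi> < norm \<xi>" using t n0 by simp
    with b show ?thesis by linarith
  next
    case False
    \<comment> \<open>Here the ball around \<open>\<xi>\<close> reaches the origin, which is not in
      the annulus.\<close>
    have "norm \<xi> * 2 \<le> e" using False n0 by (simp add: t_def field_simps)
    with n0 have "norm \<xi> < e" by linarith
    then have "0 \<in> ball \<xi> e" by (simp add: dist_norm)
    then have "(0::'a) \<in> ?U" using e by blast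
    then show ?thesis using sub by force
  qed
qed

lemma lp_dyadic_support:
  assumes LP: "littlewood_paley \<Phi>" and nz: "fourier \<Phi> (\<xi> /\<^sub>R (2 powi k)) \<noteq> 0"
  shows "2 powi (k - 1) < norm \<xi>" "norm \<xi> < 2 powi (k + 1)"
  using lp_support[OF assms] by (simp_all add: power_int_add power_int_diff field_simps)

lemma lp_sum_eq_1:
  assumes LP: "littlewood_paley \<Phi>" and J: "finite J" and \<xi>: "\<xi> \<noteq> 0"
    and c: "\<And>j. 2 powi (j - 1) < norm \<xi> \<Longrightarrow> norm \<xi> < 2 powi (j + 1) \<Longrightarrow> j \<in> J"
  shows "fourier (lp_sum \<Phi> J) \<xi> = 1"
proof -
  have \<Phi>: "\<Phi> \<in> schwartz" by (rule lp_schwartz[OF LP])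
  have "((\<lambda>k. fourier \<Phi> (\<xi> /\<^sub>R (2 powi k))) has_sum 1) UNIV"
    using LP \<xi> by (simp add: littlewood_paley_def fourier_dyadic[OF schwartz_measurable[OF \<Phi>]])
  moreover have "((\<lambda>k. fourier \<Phi> (\<xi> /\<^sub>R (2 powi k))) has_sum 1) UNIV
      \<longleftrightarrow> ((\<lambda>k. fourier \<Phi> (\<xi> /\<^sub>R (2 powi k))) has_sum 1) J"
    by (rule has_sum_cong_neutral) (use c lp_dyadic_support[OF LP] in blast)+
  ultimately show ?thesis
    using J by (simp add: fourier_lp_sum[OF \<Phi> J] has_sum_finite_iff)
qed

lemma powi_less_iff: "(2::real) powi j < 2 powi k \<longleftrightarrow> j < k"
  using power_int_strict_increasing[of j k "2::real"] power_int_strict_increasing[of k j "2::real"]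
  by (cases j k rule: linorder_cases) auto

text \<open>The transform of the block of neighbours is 1 on the spectrum of
  \<open>dyadic \<Phi> k\<close>; injectivity of the transform turns this into an identity of
  functions.\<close>

lemma lp_sum_dyadic:
  fixes \<Phi> :: "'a::euclidean_space \<Rightarrow> complex"
  assumes LP: "littlewood_paley \<Phi>"
  shows "convolution (lp_sum \<Phi> {k - 1..k + 1}) (dyadic \<Phi> k) = dyadic \<Phi> k"
proof (rule fourier_inject)
  have \<Phi>: "\<Phi> \<in> schwartz" by (rule lp_schwartz[OF LP])
  have n: "nice_kernel (lp_sum \<Phi> {k - 1..k + 1})" "nice_kernel (dyadic \<Phi> k)"
    by (auto intro!: schwartz_nice_kernel schwartz_lp_sum schwartz_dyadic \<Phi>)
  then show "nice_kernel (convolution (lp_sum \<Phi> {k - 1..k + 1}) (dyadic \<Phi> k))" "nice_kernel (dyadic \<Phi> k)"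
    by (auto intro: nice_kernel_convolution)
  fix \<xi>
  have "fourier (lp_sum \<Phi> {k - 1..k + 1}) \<xi> = 1" if "fourier (dyadic \<Phi> k) \<xi> \<noteq> 0"
  proof (rule lp_sum_eq_1[OF LP])
    note s = lp_dyadic_support[OF LP, of k \<xi>]
    have nz: "fourier \<Phi> (\<xi> /\<^sub>R (2 powi k)) \<noteq> 0" using that by (simp add: fourier_dyadic schwartz_measurable[OF \<Phi>])
    have "0 < (2::real) powi (k - 1)" by simp
    from less_trans[OF this s(1)[OF nz]] show "\<xi> \<noteq> 0" by simp
    fix j assume "2 powi (j - 1) < norm \<xi>" "norm \<xi> < 2 powi (j + 1)"
    then have "(2::real) powi (j - 1) < 2 powi (k + 1)" "(2::real) powi (k - 1) < 2 powi (j + 1)"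
      using s[OF nz] by linarith+
    then show "j \<in> {k - 1..k + 1}" unfolding powi_less_iff by simp
  qed simp
  then show "fourier (convolution (lp_sum \<Phi> {k - 1..k + 1}) (dyadic \<Phi> k)) \<xi> = fourier (dyadic \<Phi> k) \<xi>"
    by (cases "fourier (dyadic \<Phi> k) \<xi> = 0") (auto simp: fourier_convolution n)
qed

lemma lp_dyadic_orthogonal:
  fixes \<Phi> :: "'a::euclidean_space \<Rightarrow> complex"
  assumes LP: "littlewood_paley \<Phi>" and jk: "2 \<le> \<bar>j - k\<bar>"
  shows "convolution (dyadic \<Phi> j) (dyadic \<Phi> k) = (\<lambda>x. 0)"
proof
  fix x
  have \<Phi>: "\<Phi> \<in> schwartz" by (rule lp_schwartz[OF LP])
  have n: "nice_kernel (dyadic \<Phi> j)" "nice_kernel (dyadic \<Phi> k)"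
    by (auto intro!: schwartz_nice_kernel schwartz_dyadic \<Phi>)
  show "convolution (dyadic \<Phi> j) (dyadic \<Phi> k) x = 0"
  proof (rule fourier_eq_0_imp[OF nice_kernel_convolution[OF n]])
    fix \<xi>
    show "fourier (convolution (dyadic \<Phi> j) (dyadic \<Phi> k)) \<xi> = 0"
    proof (rule ccontr)
      assume "\<not> ?thesis"
      then have nz: "fourier \<Phi> (\<xi> /\<^sub>R (2 powi j)) \<noteq> 0" "fourier \<Phi> (\<xi> /\<^sub>R (2 powi k)) \<noteq> 0"
        by (auto simp: fourier_convolution n fourier_dyadic schwartz_measurable[OF \<Phi>])
      have "(2::real) powi (j - 1) < 2 powi (k + 1)" "(2::real) powi (k - 1) < 2 powi (j + 1)"
        using lp_dyadic_support[OF LP nz(1)] lp_dyadic_support[OF LP nz(2)] by linarith+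
      then show False using jk unfolding powi_less_iff by simp
    qed
  qed
qed

lemma lp_sum_inv_fourier:
  fixes \<Phi> n :: "'a::euclidean_space \<Rightarrow> complex"
  assumes LP: "littlewood_paley \<Phi>" and n: "integrable lborel n"
    and supp: "\<And>\<xi>. n \<xi> \<noteq> 0 \<Longrightarrow> 1 / 4 \<le> norm \<xi> \<and> norm \<xi> \<le> 4"
  shows "convolution (lp_sum \<Phi> {- 2..2}) (inv_fourier n) = inv_fourier n"
proof -
  have "fourier (lp_sum \<Phi> {- 2..2}) \<xi> = 1" if "n \<xi> \<noteq> 0" for \<xi>
  proof (rule lp_sum_eq_1[OF LP])
    note s = supp[OF that]
    show "\<xi> \<noteq> 0" using s by auto
    fix j assume "2 powi (j - 1) < norm \<xi>" "norm \<xi> < 2 powi (j + 1)"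
    \<comment> \<open>The cutoff annulus, from \<open>1/4\<close> to 4, forces
      \<open>j - 1 < 2\<close> and \<open>- 2 < j + 1\<close>; hence the block
      \<open>- 2..2\<close>.\<close>
    moreover have "(2::real) powi 2 = 4" "(2::real) powi - 2 = 1 / 4" by (auto simp: power_int_minus)
    ultimately have "(2::real) powi (j - 1) < 2 powi 2" "(2::real) powi - 2 < 2 powi (j + 1)"
      using s by linarith+
    then show "j \<in> {- 2..2}" unfolding powi_less_iff by simp
  qed simp
  then have "(\<lambda>\<xi>. n \<xi> * fourier (lp_sum \<Phi> {- 2..2}) \<xi>) = n" by force
  then show ?thesis
    using convolution_inv_fourier[OF _ n, of "lp_sum \<Phi> {- 2..2}"]
    by (simp add: schwartz_nice_kernel schwartz_lp_sum lp_schwartz[OF LP])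
qed

text \<open>Pieces evaluate a distribution only at these functions. As they annihilate polynomials,
  pieces do not depend on the representative, and those of a multiplier image can be read off by
  testing its defining series.\<close>

lemma dyadic_reflect_schwartz_inf:
  fixes \<Phi> :: "'a::euclidean_space \<Rightarrow> complex"
  assumes LP: "littlewood_paley \<Phi>"
  shows "(\<lambda>y. dyadic \<Phi> k (x - y)) \<in> schwartz_inf"
proof (rule schwartz_infI)
  have \<Phi>: "\<Phi> \<in> schwartz" by (rule lp_schwartz[OF LP])
  show S: "(\<lambda>y. dyadic \<Phi> k (x - y)) \<in> schwartz" by (intro schwartz_reflect schwartz_dyadic \<Phi>)
  have "fourier (\<lambda>y. dyadic \<Phi> k (x - y)) \<xi> = 0" if "norm \<xi> < 2 powi (k - 1)" for \<xi>
  proof -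
    have "fourier (dyadic \<Phi> k) (- \<xi>) = 0"
      using that lp_dyadic_support(1)[OF LP, of k "- \<xi>"]
      by (force simp: fourier_dyadic schwartz_measurable[OF \<Phi>])
    then show ?thesis
      using fourier_affine[OF schwartz_measurable[OF schwartz_dyadic[OF \<Phi>, of k]], of "-1" x \<xi>] by simp
  qed
  moreover have "0 < (2::real) powi (k - 1)" by simp
  ultimately show "fourier_flat (\<lambda>y. dyadic \<Phi> k (x - y))"
    using schwartz_all_moments[OF S] unfolding fourier_flat_def by blast
qed

section \<open>Tempered distributions\<close>

lemma tempered_add:
  "f \<in> tempered \<Longrightarrow> \<psi> \<in> schwartz \<Longrightarrow> \<theta> \<in> schwartz \<Longrightarrow> f (\<lambda>x. \<psi> x + \<theta> x) = f \<psi> + f \<theta>"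
  by (simp add: tempered_def)

lemma tempered_cmult: "f \<in> tempered \<Longrightarrow> \<psi> \<in> schwartz \<Longrightarrow> f (\<lambda>x. c * \<psi> x) = c * f \<psi>"
  by (simp add: tempered_def)

lemma tempered_diff:
  assumes "f \<in> tempered" "\<psi> \<in> schwartz" "\<theta> \<in> schwartz"
  shows "f (\<lambda>x. \<psi> x - \<theta> x) = f \<psi> - f \<theta>"
  using tempered_add[OF assms(1,2) schwartz_cmult[OF assms(3), of "-1"]] tempered_cmult[OF assms(1,3), of "-1"]
  by simp

lemma tempered_bound:
  assumes "f \<in> tempered"
  shows "\<exists>C N. 0 \<le> C \<and> (\<forall>\<psi>\<in>schwartz. norm (f \<psi>) \<le> C * schwartz_norm N \<psi>)"
proof -
  obtain C N where C: "\<And>\<psi>. \<psi> \<in> schwartz \<Longrightarrow> norm (f \<psi>) \<le> C * schwartz_norm N \<psi>"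
    using assms unfolding tempered_def by blast
  have "norm (f \<psi>) \<le> max C 0 * schwartz_norm N \<psi>" if "\<psi> \<in> schwartz" for \<psi>
    using C[OF that] mult_right_mono[OF max.cobounded1[of C 0] schwartz_norm_nonneg[OF that, of N]] by linarith
  then show ?thesis by (meson max.cobounded2)
qed

section \<open>Translations and convolutions measured in the Schwartz norms\<close>

lemma schwartz_norm_le:
  assumes "\<And>bs x. bs \<in> lists Basis \<Longrightarrow> (1 + norm x) ^ N * norm (partial_derivs bs \<psi> x) \<le> c bs * K"
  shows "schwartz_norm N \<psi> \<le> (\<Sum>bs\<in>{bs\<in>lists Basis. length bs \<le> N}. c bs) * K"
  unfolding schwartz_norm_eq sum_distrib_right by (intro sum_mono sup_weight_le assms) auto

lemma partial_derivs_shift: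
  assumes "\<psi> \<in> schwartz" "bs \<in> lists Basis"
  shows "partial_derivs bs (\<lambda>y. \<psi> (y - x)) = (\<lambda>y. partial_derivs bs \<psi> (y - x))"
  using partial_derivs_affine(1)[OF schwartz_smooth[OF assms(1)] assms(2), of 1 "-x" 1] by simp

lemma partial_derivs_diff:
  assumes "\<psi> \<in> schwartz" "\<theta> \<in> schwartz" "bs \<in> lists Basis"
  shows "partial_derivs bs (\<lambda>y. \<psi> y - a * \<theta> y) = (\<lambda>y. partial_derivs bs \<psi> y - a * partial_derivs bs \<theta> y)"
  using partial_derivs_add(1)[OF schwartz_smooth[OF assms(1)] schwartz_smooth[OF schwartz_cmult[OF assms(2)]] assms(3), of "-a"]
    partial_derivs_affine(1)[OF schwartz_smooth[OF assms(2)] assms(3), of "-a" 0 1]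
  by simp

lemma schwartz_translation_estimate:
  assumes \<eta>: "\<eta> \<in> schwartz" and d: "norm (u - c) \<le> 1"
  shows "(1 + norm y) ^ N * norm (\<eta> (y - u) - \<eta> (y - c))
    \<le> (2 ^ N * (\<Sum>b\<in>Basis. sup_weight N (partial_deriv b \<eta>))) * (norm (u - c) * (1 + norm u) ^ N)"
proof -
  let ?S = "\<Sum>b\<in>Basis. sup_weight N (partial_deriv b \<eta>)"
  have S: "0 \<le> ?S" by (intro sum_nonneg sup_weight_nonneg schwartz_partial_deriv \<eta>)
  have "norm (\<eta> (y - u) - \<eta> (y - c)) \<le> norm (u - c) * (1 + norm (u - c)) ^ N * weight (real N) (y - u) * ?S"
    using schwartz_weighted_lipschitz[OF \<eta>, of "y - u" "c - u" N] by (simp add: norm_minus_commute)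
  also have "\<dots> \<le> norm (u - c) * 2 ^ N * ((1 + norm u) ^ N * weight (real N) y) * ?S"
    by (intro mult_mono mult_left_mono power_mono weight_shift_le S) (use d in auto)
  finally have "(1 + norm y) ^ N * norm (\<eta> (y - u) - \<eta> (y - c))
     \<le> (1 + norm y) ^ N * (norm (u - c) * 2 ^ N * ((1 + norm u) ^ N * weight (real N) y) * ?S)"
    by (rule mult_left_mono) simp
  also have "\<dots> = (2 ^ N * ?S) * (norm (u - c) * (1 + norm u) ^ N) * (weight (real N) y * (1 + norm y) ^ N)"
    by (simp only: mult_ac)
  finally show ?thesis by (simp add: weight_mult_power)
qed

lemma schwartz_norm_translation:
  assumes \<eta>: "\<eta> \<in> schwartz"
  shows "\<exists>M\<ge>0. \<forall>u c. norm (u - c) \<le> 1 \<longrightarrow>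
    schwartz_norm N (\<lambda>y. \<eta> (y - u) - \<eta> (y - c)) \<le> M * (norm (u - c) * (1 + norm u) ^ N)"
proof (intro exI conjI allI impI)
  let ?I = "{bs\<in>lists Basis. length bs \<le> N}"
  let ?c = "\<lambda>bs. 2 ^ N * (\<Sum>b\<in>Basis. sup_weight N (partial_deriv b (partial_derivs bs \<eta>)))"
  show "0 \<le> (\<Sum>bs\<in>?I. ?c bs)"
    by (intro sum_nonneg mult_nonneg_nonneg sup_weight_nonneg schwartz_partial_deriv schwartz_partial_derivs \<eta>) auto
  fix u c :: 'a assume d: "norm (u - c) \<le> 1"
  show "schwartz_norm N (\<lambda>y. \<eta> (y - u) - \<eta> (y - c)) \<le> (\<Sum>bs\<in>?I. ?c bs) * (norm (u - c) * (1 + norm u) ^ N)"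
  proof (rule schwartz_norm_le)
    fix bs :: "'a list" and y assume bs: "bs \<in> lists Basis"
    have "partial_derivs bs (\<lambda>y. \<eta> (y - u) - \<eta> (y - c)) = (\<lambda>y. partial_derivs bs \<eta> (y - u) - partial_derivs bs \<eta> (y - c))"
      using partial_derivs_diff[OF schwartz_shift[OF \<eta>, of u] schwartz_shift[OF \<eta>, of c] bs, of 1]
      by (simp add: partial_derivs_shift[OF \<eta> bs])
    then show "(1 + norm y) ^ N * norm (partial_derivs bs (\<lambda>y. \<eta> (y - u) - \<eta> (y - c)) y) \<le> ?c bs * (norm (u - c) * (1 + norm u) ^ N)"
      using schwartz_translation_estimate[OF schwartz_partial_derivs[OF \<eta> bs] d] by simp
  qed
qed

lemma schwartz_norm_shift:
  assumes \<eta>: "\<eta> \<in> schwartz"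
  shows "\<exists>M\<ge>0. \<forall>u. schwartz_norm N (\<lambda>y. \<eta> (y - u)) \<le> M * (1 + norm u) ^ N"
proof (intro exI conjI allI)
  let ?I = "{bs\<in>lists Basis. length bs \<le> N}"
  show "0 \<le> (\<Sum>bs\<in>?I. sup_weight N (partial_derivs bs \<eta>))"
    by (intro sum_nonneg sup_weight_nonneg schwartz_partial_derivs \<eta>) auto
  fix u
  show "schwartz_norm N (\<lambda>y. \<eta> (y - u)) \<le> (\<Sum>bs\<in>?I. sup_weight N (partial_derivs bs \<eta>)) * (1 + norm u) ^ N"
  proof (rule schwartz_norm_le)
    fix bs :: "'a list" and y assume bs: "bs \<in> lists Basis"
    note p = schwartz_partial_derivs[OF \<eta> bs]
    have "(1 + norm y) ^ N * norm (partial_derivs bs \<eta> (y - u)) \<le> (1 + norm y) ^ N * (sup_weight N (partial_derivs bs \<eta>) * ((1 + norm u) ^ N * weight (real N) y))"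
      by (intro mult_left_mono order_trans[OF sup_weight_bound[OF p, of _ N]] weight_shift_le sup_weight_nonneg p) auto
    also have "\<dots> = sup_weight N (partial_derivs bs \<eta>) * (1 + norm u) ^ N * (weight (real N) y * (1 + norm y) ^ N)"
      by (simp only: mult_ac)
    finally show "(1 + norm y) ^ N * norm (partial_derivs bs (\<lambda>y. \<eta> (y - u)) y) \<le> sup_weight N (partial_derivs bs \<eta>) * (1 + norm u) ^ N"
      by (simp add: partial_derivs_shift[OF \<eta> bs] weight_mult_power)
  qed
qed

lemma schwartz_norm_convolution:
  assumes \<eta>: "\<eta> \<in> schwartz"
  shows "\<exists>M\<ge>0. \<forall>e. all_moments e \<longrightarrow>
    schwartz_norm N (convolution \<eta> e) \<le> M * (LINT u|lborel. (1 + norm u) ^ N * norm (e u))"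
proof (intro exI conjI allI impI)
  let ?I = "{bs\<in>lists Basis. length bs \<le> N}"
  show "0 \<le> (\<Sum>bs\<in>?I. sup_weight N (partial_derivs bs \<eta>))"
    by (intro sum_nonneg sup_weight_nonneg schwartz_partial_derivs \<eta>) auto
  fix e :: "'a \<Rightarrow> complex" assume e: "all_moments e"
  show "schwartz_norm N (convolution \<eta> e) \<le> (\<Sum>bs\<in>?I. sup_weight N (partial_derivs bs \<eta>)) * (LINT u|lborel. (1 + norm u) ^ N * norm (e u))"
    by (intro schwartz_norm_le) (simp add: partial_derivs_convolution[OF \<eta> e] schwartz_convolution_bound[OF schwartz_partial_derivs[OF \<eta>] e])
qed

text \<open>On a small ball the translates of \<open>\<eta>\<close> hardly vary, so there \<open>\<eta> * e\<close> is close to a multiple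
  of one translate.\<close>

lemma schwartz_norm_localized_convolution:
  assumes \<eta>: "\<eta> \<in> schwartz"
  shows "\<exists>M\<ge>0. \<forall>e c \<epsilon>. all_moments e \<longrightarrow> 0 < \<epsilon> \<longrightarrow> \<epsilon> \<le> 1 \<longrightarrow> (\<forall>u. u \<notin> ball c \<epsilon> \<longrightarrow> e u = 0) \<longrightarrow>
    schwartz_norm N (\<lambda>y. convolution \<eta> e y - (LINT u|lborel. e u) * \<eta> (y - c))
      \<le> M * (\<epsilon> * (LINT u|lborel. (1 + norm u) ^ N * norm (e u)))"
proof (intro exI conjI allI impI)
  let ?I = "{bs\<in>lists Basis. length bs \<le> N}"
  let ?c = "\<lambda>bs. 2 ^ N * (\<Sum>b\<in>Basis. sup_weight N (partial_deriv b (partial_derivs bs \<eta>)))"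
  show "0 \<le> (\<Sum>bs\<in>?I. ?c bs)"
    by (intro sum_nonneg mult_nonneg_nonneg sup_weight_nonneg schwartz_partial_deriv schwartz_partial_derivs \<eta>) auto
  fix e :: "'a \<Rightarrow> complex" and c and \<epsilon> :: real
  assume e: "all_moments e" and \<epsilon>: "0 < \<epsilon>" "\<epsilon> \<le> 1" and z: "\<forall>u. u \<notin> ball c \<epsilon> \<longrightarrow> e u = 0"
  note [measurable] = all_moments_measurable[OF e]
  show "schwartz_norm N (\<lambda>y. convolution \<eta> e y - (LINT u|lborel. e u) * \<eta> (y - c))
      \<le> (\<Sum>bs\<in>?I. ?c bs) * (\<epsilon> * (LINT u|lborel. (1 + norm u) ^ N * norm (e u)))"
  proof (rule schwartz_norm_le)
    fix bs :: "'a list" and y assume bs: "bs \<in> lists Basis"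
    define \<theta> where "\<theta> = partial_derivs bs \<eta>"
    have \<theta>: "\<theta> \<in> schwartz" unfolding \<theta>_def by (rule schwartz_partial_derivs[OF \<eta> bs])
    note [measurable] = schwartz_measurable[OF \<theta>]
    have c0: "0 \<le> ?c bs"
      by (intro sum_nonneg mult_nonneg_nonneg sup_weight_nonneg schwartz_partial_deriv schwartz_partial_derivs \<eta> bs) auto
    have i: "integrable lborel (\<lambda>u. \<theta> (y - u) * e u)" by (rule integrable_schwartz_convolution[OF \<theta> e])
    have "of_real ((1 + norm y) ^ N) * partial_derivs bs (\<lambda>y. convolution \<eta> e y - (LINT u|lborel. e u) * \<eta> (y - c)) y
      = of_real ((1 + norm y) ^ N) * (convolution \<theta> e y - (LINT u|lborel. e u) * \<theta> (y - c))"
      using partial_derivs_diff[OF schwartz_convolution[OF \<eta> e] schwartz_shift[OF \<eta>, of c] bs]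
      by (simp add: partial_derivs_shift[OF \<eta> bs] partial_derivs_convolution[OF \<eta> e bs] \<theta>_def)
    also have "convolution \<theta> e y - (LINT u|lborel. e u) * \<theta> (y - c) = (LINT u|lborel. (\<theta> (y - u) - \<theta> (y - c)) * e u)"
      using i all_moments_integrable_self[OF e] by (simp add: convolution_lborel left_diff_distrib)
    also have "of_real ((1 + norm y) ^ N) * \<dots> = (LINT u|lborel. of_real ((1 + norm y) ^ N) * ((\<theta> (y - u) - \<theta> (y - c)) * e u))"
      by (rule integral_mult_right_zero[symmetric])
    finally have eq: "of_real ((1 + norm y) ^ N) * partial_derivs bs (\<lambda>y. convolution \<eta> e y - (LINT u|lborel. e u) * \<eta> (y - c)) y
      = (LINT u|lborel. of_real ((1 + norm y) ^ N) * ((\<theta> (y - u) - \<theta> (y - c)) * e u))" .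
    have "norm (LINT u|lborel. of_real ((1 + norm y) ^ N) * ((\<theta> (y - u) - \<theta> (y - c)) * e u))
      \<le> (?c bs * \<epsilon>) * (LINT u|lborel. (1 + norm u) ^ N * norm (e u))"
    proof (rule all_moments_dominated(2)[OF e])
      fix u
      show "norm (of_real ((1 + norm y) ^ N) * ((\<theta> (y - u) - \<theta> (y - c)) * e u)) \<le> ?c bs * \<epsilon> * (1 + norm u) ^ N * norm (e u)"
      proof (cases "u \<in> ball c \<epsilon>")
        case True
        then have d: "norm (u - c) \<le> \<epsilon>" by (simp add: dist_norm norm_minus_commute less_imp_le)
        have "(1 + norm y) ^ N * norm (\<theta> (y - u) - \<theta> (y - c)) \<le> ?c bs * (norm (u - c) * (1 + norm u) ^ N)"
          using schwartz_translation_estimate[OF \<theta>, of u c y N] d \<epsilon> unfolding \<theta>_def by simp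
        also have "\<dots> \<le> ?c bs * (\<epsilon> * (1 + norm u) ^ N)"
          by (intro mult_left_mono mult_right_mono d c0) simp
        finally have "(1 + norm y) ^ N * norm (\<theta> (y - u) - \<theta> (y - c)) * norm (e u) \<le> ?c bs * (\<epsilon> * (1 + norm u) ^ N) * norm (e u)"
          by (rule mult_right_mono) simp
        then show ?thesis by (simp only: norm_mult norm_of_real) (simp add: mult_ac)
      qed (use z in simp)
    qed measurable
    then have "norm (of_real ((1 + norm y) ^ N) * partial_derivs bs (\<lambda>y. convolution \<eta> e y - (LINT u|lborel. e u) * \<eta> (y - c)) y)
      \<le> ?c bs * (\<epsilon> * (LINT u|lborel. (1 + norm u) ^ N * norm (e u)))"
      unfolding eq by (simp only: mult_ac)
    then show "(1 + norm y) ^ N * norm (partial_derivs bs (\<lambda>y. convolution \<eta> e y - (LINT u|lborel. e u) * \<eta> (y - c)) y)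
      \<le> ?c bs * (\<epsilon> * (LINT u|lborel. (1 + norm u) ^ N * norm (e u)))"
      by (simp only: norm_mult norm_of_real) simp
  qed
qed

lemma tempered_translation_growth:
  assumes f: "f \<in> tempered" and \<eta>: "\<eta> \<in> schwartz"
  shows "\<exists>C N. 0 \<le> C \<and> (\<forall>u. norm (f (\<lambda>y. \<eta> (y - u))) \<le> C * (1 + norm u) ^ N)"
    and "continuous_on UNIV (\<lambda>u. f (\<lambda>y. \<eta> (y - u)))"
proof -
  obtain C N where C: "0 \<le> C" "\<And>\<psi>. \<psi> \<in> schwartz \<Longrightarrow> norm (f \<psi>) \<le> C * schwartz_norm N \<psi>"
    using tempered_bound[OF f] by blast
  obtain M where M: "0 \<le> M" "\<And>u. schwartz_norm N (\<lambda>y. \<eta> (y - u)) \<le> M * (1 + norm u) ^ N"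
    using schwartz_norm_shift[OF \<eta>] by blast
  have "norm (f (\<lambda>y. \<eta> (y - u))) \<le> (C * M) * (1 + norm u) ^ N" for u
    using order_trans[OF C(2)[OF schwartz_shift[OF \<eta>, of u]] mult_left_mono[OF M(2)[of u] C(1)]] by (simp add: mult.assoc)
  with C M show "\<exists>C N. 0 \<le> C \<and> (\<forall>u. norm (f (\<lambda>y. \<eta> (y - u))) \<le> C * (1 + norm u) ^ N)"
    by (meson mult_nonneg_nonneg)
  obtain L where L: "0 \<le> L" "\<And>u c. norm (u - c) \<le> 1 \<Longrightarrow>
    schwartz_norm N (\<lambda>y. \<eta> (y - u) - \<eta> (y - c)) \<le> L * (norm (u - c) * (1 + norm u) ^ N)"
    using schwartz_norm_translation[OF \<eta>] by blast
  have "isCont (\<lambda>u. f (\<lambda>y. \<eta> (y - u))) u" for u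
    unfolding isCont_def
  proof (rule LIM_zero_cancel, rule Lim_null_comparison)
    have "((\<lambda>c. (C * L * (1 + norm u) ^ N) * norm (u - c)) \<longlongrightarrow> (C * L * (1 + norm u) ^ N) * norm (u - u)) (at u)"
      by (intro tendsto_intros)
    then show "((\<lambda>c. (C * L * (1 + norm u) ^ N) * norm (u - c)) \<longlongrightarrow> 0) (at u)" by simp
    show "\<forall>\<^sub>F c in at u. norm (f (\<lambda>y. \<eta> (y - c)) - f (\<lambda>y. \<eta> (y - u))) \<le> (C * L * (1 + norm u) ^ N) * norm (u - c)"
      unfolding eventually_at
    proof (intro exI[of _ 1] conjI ballI impI)
      fix c assume "c \<noteq> u \<and> dist c u < 1"
      then have d: "norm (u - c) \<le> 1" by (simp add: dist_norm norm_minus_commute)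
      have "norm (f (\<lambda>y. \<eta> (y - u)) - f (\<lambda>y. \<eta> (y - c))) \<le> C * schwartz_norm N (\<lambda>y. \<eta> (y - u) - \<eta> (y - c))"
        using C(2)[OF schwartz_diff[OF schwartz_shift[OF \<eta>, of u] schwartz_shift[OF \<eta>, of c]]]
        by (simp add: tempered_diff[OF f schwartz_shift[OF \<eta>, of u] schwartz_shift[OF \<eta>, of c]])
      also have "\<dots> \<le> C * (L * (norm (u - c) * (1 + norm u) ^ N))"
        by (intro mult_left_mono L d C)
      finally show "norm (f (\<lambda>y. \<eta> (y - c)) - f (\<lambda>y. \<eta> (y - u))) \<le> (C * L * (1 + norm u) ^ N) * norm (u - c)"
        by (simp add: norm_minus_commute mult_ac)
    qed simp
  qed
  then show "continuous_on UNIV (\<lambda>u. f (\<lambda>y. \<eta> (y - u)))"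
    by (simp add: continuous_on_eq_continuous_at)
qed

lemma all_moments_restrict:
  assumes e: "all_moments e" and [measurable]: "A \<in> sets borel"
  shows "all_moments (\<lambda>u. indicator A u * e u)"
  by (rule all_moments_mult[OF e, of _ 1 0]) (auto simp: indicator_def)

text \<open>Fubini for tempered functionals, by a Riemann sum argument. The defect \<open>A\<close>
  is additive in \<open>e\<close>, of order \<epsilon> when \<open>e\<close> is supported in a ball
  of radius \<epsilon>, and bounded by a weighted \<open>L^1\<close> norm in general. Cutting
  \<open>e\<close> along a finite cover of a large ball and estimating the tail shows that the
  defect is of order \<epsilon> for every small \<epsilon>.\<close>

theorem tempered_convolution:
  fixes \<eta> e :: "'a::euclidean_space \<Rightarrow> complex"
  assumes f: "f \<in> tempered" and \<eta>: "\<eta> \<in> schwartz" and e: "all_moments e"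
  shows "f (convolution \<eta> e) = (LINT u|lborel. e u * f (\<lambda>y. \<eta> (y - u)))"
proof -
  obtain C N where C: "0 \<le> C" "\<And>\<psi>. \<psi> \<in> schwartz \<Longrightarrow> norm (f \<psi>) \<le> C * schwartz_norm N \<psi>"
    using tempered_bound[OF f] by blast
  obtain L where L: "0 \<le> L" "\<And>u c. norm (u - c) \<le> 1 \<Longrightarrow>
    schwartz_norm N (\<lambda>y. \<eta> (y - u) - \<eta> (y - c)) \<le> L * (norm (u - c) * (1 + norm u) ^ N)"
    using schwartz_norm_translation[OF \<eta>] by blast
  obtain M where M: "0 \<le> M" "\<And>e c \<epsilon>. all_moments e \<Longrightarrow> 0 < \<epsilon> \<Longrightarrow> \<epsilon> \<le> 1 \<Longrightarrow> (\<forall>u. u \<notin> ball c \<epsilon> \<longrightarrow> e u = 0) \<Longrightarrow>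
    schwartz_norm N (\<lambda>y. convolution \<eta> e y - (LINT u|lborel. e u) * \<eta> (y - c))
      \<le> M * (\<epsilon> * (LINT u|lborel. (1 + norm u) ^ N * norm (e u)))"
    using schwartz_norm_localized_convolution[OF \<eta>, of N] by blast
  obtain Q where Q: "0 \<le> Q" "\<And>e. all_moments e \<Longrightarrow> schwartz_norm N (convolution \<eta> e) \<le> Q * (LINT u|lborel. (1 + norm u) ^ N * norm (e u))"
    using schwartz_norm_convolution[OF \<eta>, of N] by blast
  define h where "h u = f (\<lambda>y. \<eta> (y - u))" for u
  obtain D K where D: "0 \<le> D" "\<And>u. norm (h u) \<le> D * (1 + norm u) ^ K"
    using tempered_translation_growth(1)[OF f \<eta>] unfolding h_def by blast
  have hm [measurable]: "h \<in> borel_measurable borel"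
    unfolding h_def by (intro borel_measurable_continuous_onI tempered_translation_growth(2) f \<eta>)
  define W where "W e = (LINT u|lborel. (1 + norm u) ^ N * norm (e u))" for e :: "'a \<Rightarrow> complex"
  define A where "A e = f (convolution \<eta> e) - (LINT u|lborel. e u * h u)" for e
  have hi: "integrable lborel (\<lambda>u. e u * h u)" if e: "all_moments e" for e
  proof (rule all_moments_dominated(1)[OF e])
    note [measurable] = all_moments_measurable[OF e]
    show "(\<lambda>u. e u * h u) \<in> borel_measurable borel" by measurable
    show "norm (e u * h u) \<le> D * (1 + norm u) ^ K * norm (e u)" for u
      using mult_right_mono[OF D(2)[of u], of "norm (e u)"] by (simp add: norm_mult mult.commute)
  qed
  have A_add: "A (\<lambda>u. d u + e u) = A d + A e" if d: "all_moments d" and e: "all_moments e" for d e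
  proof -
    note [measurable] = all_moments_measurable[OF d] all_moments_measurable[OF e] schwartz_measurable[OF \<eta>]
    have "convolution \<eta> (\<lambda>u. d u + e u) = (\<lambda>x. convolution \<eta> d x + convolution \<eta> e x)"
      using integrable_schwartz_convolution[OF \<eta> d] integrable_schwartz_convolution[OF \<eta> e]
      by (simp add: convolution_lborel fun_eq_iff distrib_left)
    then show ?thesis
      using tempered_add[OF f schwartz_convolution[OF \<eta> d] schwartz_convolution[OF \<eta> e]] hi[OF d] hi[OF e]
      by (simp add: A_def distrib_right)
  qed
  \<comment> \<open>The first summand pays for replacing the convolution by a multiple of one
    translate, the second for replacing \<open>h u\<close> by \<open>h c\<close> under the
    integral.\<close>
  define P where "P = C * M + C * L * 2 ^ N"
  have A_small: "norm (A e) \<le> P * (\<epsilon> * W e)"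
    if e: "all_moments e" and \<epsilon>: "0 < \<epsilon>" "\<epsilon> \<le> 1" and z: "\<forall>u. u \<notin> ball c \<epsilon> \<longrightarrow> e u = 0" for e c \<epsilon>
  proof -
    note [measurable] = all_moments_measurable[OF e]
    let ?J = "LINT u|lborel. e u"
    have s: "(\<lambda>y. ?J * \<eta> (y - c)) \<in> schwartz" by (intro schwartz_cmult schwartz_shift \<eta>)
    have "A e = f (\<lambda>y. convolution \<eta> e y - ?J * \<eta> (y - c)) - (LINT u|lborel. e u * (h u - h c))"
      using hi[OF e] all_moments_integrable_self[OF e]
      by (simp add: A_def tempered_diff[OF f schwartz_convolution[OF \<eta> e] s] tempered_cmult[OF f schwartz_shift[OF \<eta>]]
          right_diff_distrib h_def)
    then have "norm (A e) \<le> norm (f (\<lambda>y. convolution \<eta> e y - ?J * \<eta> (y - c))) + norm (LINT u|lborel. e u * (h u - h c))"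
      by (simp add: norm_triangle_ineq4)
    moreover have "norm (f (\<lambda>y. convolution \<eta> e y - ?J * \<eta> (y - c))) \<le> C * (M * (\<epsilon> * W e))"
      using order_trans[OF C(2)[OF schwartz_diff[OF schwartz_convolution[OF \<eta> e] s]] mult_left_mono[OF M(2)[OF e \<epsilon> z] C(1)]]
      by (simp add: W_def)
    moreover have "norm (LINT u|lborel. e u * (h u - h c)) \<le> (C * L * 2 ^ N * \<epsilon>) * W e"
      unfolding W_def
    proof (rule all_moments_dominated(2)[OF e])
      fix u
      show "norm (e u * (h u - h c)) \<le> C * L * 2 ^ N * \<epsilon> * (1 + norm u) ^ N * norm (e u)"
      proof (cases "u \<in> ball c \<epsilon>")
        case True
        then have d: "norm (u - c) \<le> \<epsilon>" by (simp add: dist_norm norm_minus_commute less_imp_le)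
        have "norm (h u - h c) \<le> C * schwartz_norm N (\<lambda>y. \<eta> (y - u) - \<eta> (y - c))"
          using C(2)[OF schwartz_diff[OF schwartz_shift[OF \<eta>, of u] schwartz_shift[OF \<eta>, of c]]]
          by (simp add: h_def tempered_diff[OF f schwartz_shift[OF \<eta>, of u] schwartz_shift[OF \<eta>, of c]])
        also have "\<dots> \<le> C * (L * (norm (u - c) * (1 + norm u) ^ N))"
          using d \<epsilon> by (intro mult_left_mono L C) auto
        also have "\<dots> \<le> C * (L * ((2 ^ N * \<epsilon>) * (1 + norm u) ^ N))"
        proof -
          have "norm (u - c) \<le> 2 ^ N * \<epsilon>" using d \<epsilon> by (meson dual_order.trans mult_le_cancel_right1 one_le_numeral one_le_power not_less less_imp_le)
          then show ?thesis by (intro mult_left_mono mult_right_mono L C) auto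
        qed
        finally have "norm (h u - h c) * norm (e u) \<le> C * (L * ((2 ^ N * \<epsilon>) * (1 + norm u) ^ N)) * norm (e u)"
          by (rule mult_right_mono) simp
        then show ?thesis by (simp add: norm_mult mult_ac)
      qed (use z in simp)
    qed measurable
    ultimately show ?thesis by (simp add: P_def algebra_simps)
  qed
  \<comment> \<open>\<open>W\<close> is additive over the disjoint parts into which \<open>e\<close>
    is cut, so the bound does not deteriorate with the number of balls.\<close>
  have A_cover: "norm (A e) \<le> P * (\<epsilon> * W e)"
    if "finite X" "all_moments e" "0 < \<epsilon>" "\<epsilon> \<le> 1" "\<forall>u. u \<notin> (\<Union>c\<in>X. ball c \<epsilon>) \<longrightarrow> e u = 0" for X e \<epsilon>
    using that
  proof (induction X arbitrary: e)
    case empty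
    then have e: "e u = 0" for u by simp
    show ?case by (rule A_small[OF empty.prems(1-3), of 0]) (simp add: e)
  next
    case (insert c X)
    define d1 d2 where "d1 u = indicator (ball c \<epsilon>) u * e u" and "d2 u = indicator (- ball c \<epsilon>) u * e u" for u
    have d1: "all_moments d1" and d2: "all_moments d2"
      unfolding d1_def d2_def by (intro all_moments_restrict insert.prems; simp)+
    have e: "e = (\<lambda>u. d1 u + d2 u)"
      by (auto simp: d1_def d2_def indicator_def fun_eq_iff)
    have "norm (A d1) \<le> P * (\<epsilon> * W d1)"
      by (rule A_small[OF d1 insert.prems(2,3), of c]) (auto simp: d1_def)
    moreover have "norm (A d2) \<le> P * (\<epsilon> * W d2)"
      by (rule insert.IH[OF d2 insert.prems(2,3)]) (use insert.prems(4) in \<open>auto simp: d2_def indicator_def\<close>)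
    moreover have "W e = W d1 + W d2"
    proof -
      have "W e = (LINT u|lborel. (1 + norm u) ^ N * norm (d1 u) + (1 + norm u) ^ N * norm (d2 u))"
        unfolding W_def by (intro Bochner_Integration.integral_cong) (auto simp: d1_def d2_def indicator_def)
      then show ?thesis using all_moments_integrable[OF d1, of N] all_moments_integrable[OF d2, of N] by (simp add: W_def)
    qed
    moreover have "norm (A e) \<le> norm (A d1) + norm (A d2)"
      by (subst e) (simp add: A_add[OF d1 d2] norm_triangle_ineq)
    ultimately show ?case by (simp add: algebra_simps)
  qed
  define T where "T = C * Q + D"
  have A_bound: "norm (A e) \<le> T * (LINT u|lborel. (1 + norm u) ^ (N + K) * norm (e u))" if e: "all_moments e" for e
  proof -
    note [measurable] = all_moments_measurable[OF e]
    let ?V = "LINT u|lborel. (1 + norm u) ^ (N + K) * norm (e u)"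
    have mono: "(LINT u|lborel. (1 + norm u) ^ n * norm (e u)) \<le> ?V" if "n \<le> N + K" for n
      by (intro integral_mono all_moments_integrable e mult_right_mono power_increasing that) auto
    have "norm (A e) \<le> norm (f (convolution \<eta> e)) + norm (LINT u|lborel. e u * h u)"
      unfolding A_def by (rule norm_triangle_ineq4)
    moreover have "norm (f (convolution \<eta> e)) \<le> C * (Q * ?V)"
      by (rule order_trans[OF C(2)[OF schwartz_convolution[OF \<eta> e]]])
         (intro mult_left_mono C order_trans[OF Q(2)[OF e]] mono Q, simp)
    moreover have "norm (LINT u|lborel. e u * h u) \<le> D * (LINT u|lborel. (1 + norm u) ^ K * norm (e u))"
    proof (rule all_moments_dominated(2)[OF e])
      show "norm (e u * h u) \<le> D * (1 + norm u) ^ K * norm (e u)" for u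
        using mult_right_mono[OF D(2)[of u], of "norm (e u)"] by (simp add: norm_mult mult.commute)
    qed measurable
    moreover have "D * (LINT u|lborel. (1 + norm u) ^ K * norm (e u)) \<le> D * ?V"
      by (intro mult_left_mono mono D) simp
    ultimately show ?thesis by (simp add: T_def algebra_simps)
  qed
  have T: "0 \<le> T" using C Q D by (simp add: T_def)
  have P: "0 \<le> P" using C M L by (simp add: P_def)
  have W: "0 \<le> W e" by (simp add: W_def)
  define V where "V = (LINT u|lborel. (1 + norm u) ^ (Suc (N + K)) * norm (e u))"
  have main: "norm (A e) \<le> \<epsilon> * (P * W e + T * V)" if \<epsilon>: "0 < \<epsilon>" "\<epsilon> \<le> 1" for \<epsilon>
  proof -
    \<comment> \<open>Outside the ball of radius \<open>R\<close> one has
      \<open>1 <= \<epsilon> (1 + |u|)\<close>, so one additional moment, the \<open>Suc\<close> in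
      \<open>V\<close>, buys the factor \<epsilon> for the tail.\<close>
    define R where "R = 1 / \<epsilon>"
    define d1 d2 where "d1 u = indicator (cball 0 R) u * e u" and "d2 u = indicator (- cball 0 R) u * e u" for u
    have d1: "all_moments d1" and d2: "all_moments d2"
      unfolding d1_def d2_def by (intro all_moments_restrict e; simp)+
    have ee: "e = (\<lambda>u. d1 u + d2 u)"
      by (auto simp: d1_def d2_def indicator_def fun_eq_iff)
    have "compact (cball (0::'a) R)" by simp
    then have "\<exists>X. finite X \<and> cball (0::'a) R \<subseteq> (\<Union>c\<in>X. ball c \<epsilon>)"
      using \<epsilon>(1) unfolding compact_eq_totally_bounded by blast
    then obtain X where X: "finite X" "cball (0::'a) R \<subseteq> (\<Union>c\<in>X. ball c \<epsilon>)" by blast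
    have "norm (A d1) \<le> P * (\<epsilon> * W d1)"
      by (rule A_cover[OF X(1) d1 \<epsilon>]) (use X(2) in \<open>auto simp: d1_def indicator_def\<close>)
    also have "\<dots> \<le> P * (\<epsilon> * W e)"
    proof -
      have "W d1 \<le> W e" unfolding W_def
        by (intro integral_mono all_moments_integrable e d1) (auto simp: d1_def indicator_def)
      then show ?thesis using P \<epsilon> by (intro mult_left_mono) auto
    qed
    finally have 1: "norm (A d1) \<le> P * (\<epsilon> * W e)" .
    have "(LINT u|lborel. (1 + norm u) ^ (N + K) * norm (d2 u)) \<le> (LINT u|lborel. \<epsilon> * ((1 + norm u) ^ (Suc (N + K)) * norm (e u)))"
    proof (rule integral_mono)
      show "integrable lborel (\<lambda>u. \<epsilon> * ((1 + norm u) ^ (Suc (N + K)) * norm (e u)))"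
        by (intro integrable_mult_right all_moments_integrable e)
      fix u
      show "(1 + norm u) ^ (N + K) * norm (d2 u) \<le> \<epsilon> * ((1 + norm u) ^ (Suc (N + K)) * norm (e u))"
      proof (cases "u \<in> cball 0 R")
        case False
        then have "1 \<le> \<epsilon> * (1 + norm u)" using \<epsilon> by (simp add: R_def field_simps)
        then have "1 * ((1 + norm u) ^ (N + K) * norm (e u)) \<le> \<epsilon> * (1 + norm u) * ((1 + norm u) ^ (N + K) * norm (e u))"
          by (rule mult_right_mono) simp
        then show ?thesis using False by (simp add: d2_def mult_ac)
      qed (use \<epsilon> in \<open>simp add: d2_def\<close>)
    qed (rule all_moments_integrable[OF d2])
    also have "\<dots> = \<epsilon> * V" unfolding V_def by (rule integral_mult_right_zero)
    finally have "norm (A d2) \<le> T * (\<epsilon> * V)"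
      using order_trans[OF A_bound[OF d2] mult_left_mono[OF _ T]] by blast
    moreover have "norm (A e) \<le> norm (A d1) + norm (A d2)"
      by (subst ee) (simp add: A_add[OF d1 d2] norm_triangle_ineq)
    ultimately show ?thesis using 1 by (simp add: algebra_simps)
  qed
  have "norm (A e) \<le> 0"
  proof (rule tendsto_lowerbound)
    have "((\<lambda>\<epsilon>. \<epsilon> * (P * W e + T * V)) \<longlongrightarrow> 0 * (P * W e + T * V)) (at_right 0)" by (intro tendsto_intros)
    then show "((\<lambda>\<epsilon>. \<epsilon> * (P * W e + T * V)) \<longlongrightarrow> 0) (at_right 0)" by simp
    show "\<forall>\<^sub>F \<epsilon> in at_right 0. norm (A e) \<le> \<epsilon> * (P * W e + T * V)"
      unfolding eventually_at_right_field using main by (intro exI[of _ 1]) auto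
  qed simp
  then have "A e = 0" by simp
  then show ?thesis by (simp add: A_def h_def)
qed

section \<open>Powers, Lebesgue and sequence quasi-norms\<close>

lemma epowr_ennreal: "0 \<le> x \<Longrightarrow> epowr (ennreal x) a = ennreal (x powr a)"
  by (simp add: epowr_def)

lemma epowr_top [simp]: "epowr \<top> a = \<top>"
  by (simp add: epowr_def)

lemma epowr_eq_top_iff [simp]: "epowr x a = \<top> \<longleftrightarrow> x = \<top>"
  by (simp add: epowr_def)

lemma epowr_zero [simp]: "epowr 0 a = 0"
  by (simp add: epowr_def)

lemma epowr_mono:
  assumes "x \<le> y" "0 \<le> a" shows "epowr x a \<le> epowr y a"
proof (cases "y = \<top>")
  case False
  then obtain y' where y: "y = ennreal y'" "0 \<le> y'" by (cases y) auto
  with assms obtain x' where x: "x = ennreal x'" "0 \<le> x'" by (cases x) (auto simp: top_unique)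
  from x y assms show ?thesis by (simp add: epowr_ennreal powr_mono2 ennreal_leI)
qed simp

lemma epowr_mult:
  assumes "0 < a" shows "epowr (x * y) a = epowr x a * epowr y a"
proof (cases "x = \<top> \<or> y = \<top>")
  case True
  have z: "epowr z a = 0 \<longleftrightarrow> z = 0" for z
    by (cases z) (auto simp: epowr_ennreal)
  show ?thesis
  proof (cases "x = 0 \<or> y = 0")
    case False
    with True have "x * y = \<top>" "epowr x a * epowr y a = \<top>"
      by (simp_all add: ennreal_mult_eq_top_iff z)
    then show ?thesis by simp
  qed auto
next
  case False
  then obtain x' y' where "x = ennreal x'" "0 \<le> x'" "y = ennreal y'" "0 \<le> y'" by (cases x; cases y) auto
  then show ?thesis by (simp add: epowr_ennreal ennreal_mult[symmetric] powr_mult)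
qed

lemma epowr_epowr: "epowr (epowr x a) b = epowr x (a * b)"
  by (cases x) (auto simp: epowr_ennreal powr_powr)

lemma epowr_one [simp]: "epowr x 1 = x"
  by (cases x) (auto simp: epowr_ennreal)

lemma epowr_le_imp:
  assumes "epowr x a \<le> y" "0 < a" shows "x \<le> epowr y (1 / a)"
  using epowr_mono[OF assms(1), of "1 / a"] assms(2) by (simp add: epowr_epowr)

lemma summable_on_ennreal_any: "(f :: 'i \<Rightarrow> ennreal) summable_on A"
  by (rule nonneg_summable_on_complete) simp

lemma infsum_cmult_ennreal:
  fixes f :: "'i \<Rightarrow> ennreal"
  assumes "c < \<top>" shows "(\<Sum>\<^sub>\<infinity>i. c * f i) = c * (\<Sum>\<^sub>\<infinity>i. f i)"
proof (rule infsumI)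
  have "(f has_sum (\<Sum>\<^sub>\<infinity>i. f i)) UNIV" by (rule has_sum_infsum[OF summable_on_ennreal_any])
  then have "((\<lambda>F. c * sum f F) \<longlongrightarrow> c * (\<Sum>\<^sub>\<infinity>i. f i)) (finite_subsets_at_top UNIV)"
    unfolding has_sum_def by (intro ennreal_tendsto_cmult assms)
  then show "((\<lambda>i. c * f i) has_sum c * (\<Sum>\<^sub>\<infinity>i. f i)) UNIV"
    unfolding has_sum_def by (simp add: sum_distrib_left)
qed

lemma infsum_suminf_ennreal:
  fixes f :: "nat \<Rightarrow> ennreal" shows "(\<Sum>\<^sub>\<infinity>i. f i) = (\<Sum>i. f i)"
proof -
  have "(f has_sum (\<Sum>\<^sub>\<infinity>i. f i)) UNIV" by (rule has_sum_infsum[OF summable_on_ennreal_any])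
  then show ?thesis using has_sum_imp_sums sums_unique by blast
qed

lemma lq_norm_cmult_le:
  assumes q: "0 < q" and c: "c < \<top>" and le: "\<And>i. a i \<le> c * b i"
  shows "lq_norm q a \<le> c * lq_norm q b"
proof (cases "q = \<infinity>")
  case True
  have "a i \<le> c * (SUP i. b i)" for i
    by (rule order_trans[OF le]) (intro mult_left_mono SUP_upper, auto)
  then show ?thesis using True by (auto simp: lq_norm_def intro: SUP_least)
next
  case False
  then obtain q' where q': "q = ennreal q'" "0 \<le> q'" by (cases q) auto
  with q have q0: "0 < q'" by (simp add: ennreal_less_zero_iff)
  have "(\<Sum>\<^sub>\<infinity>i. epowr (a i) q') \<le> (\<Sum>\<^sub>\<infinity>i. epowr c q' * epowr (b i) q')"
    by (intro infsum_mono summable_on_ennreal_any) (auto simp: epowr_mult[symmetric] q0 intro!: epowr_mono le less_imp_le[OF q0])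
  also have "\<dots> = epowr c q' * (\<Sum>\<^sub>\<infinity>i. epowr (b i) q')"
    using c by (intro infsum_cmult_ennreal) (metis epowr_eq_top_iff top.not_eq_extremum)
  finally have "epowr (\<Sum>\<^sub>\<infinity>i. epowr (a i) q') (1 / q') \<le> epowr (epowr c q' * (\<Sum>\<^sub>\<infinity>i. epowr (b i) q')) (1 / q')"
    by (rule epowr_mono) (use q0 in simp)
  also have "\<dots> = c * epowr (\<Sum>\<^sub>\<infinity>i. epowr (b i) q') (1 / q')"
    using q0 by (simp add: epowr_mult epowr_epowr)
  finally show ?thesis using q' by (simp add: lq_norm_def)
qed

lemma le_lq_norm:
  assumes q: "0 < q" shows "a i \<le> lq_norm q a"
proof (cases "q = \<infinity>")
  case True
  then show ?thesis by (auto simp: lq_norm_def intro: SUP_upper)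
next
  case False
  then obtain q' where q': "q = ennreal q'" "0 \<le> q'" by (cases q) auto
  with q have q0: "0 < q'" by (simp add: ennreal_less_zero_iff)
  have "epowr (a i) q' = infsum (\<lambda>i. epowr (a i) q') {i}" by simp
  also have "\<dots> \<le> (\<Sum>\<^sub>\<infinity>i. epowr (a i) q')" by (rule infsum_mono_neutral) (auto intro: summable_on_ennreal_any)
  finally have "a i \<le> epowr (\<Sum>\<^sub>\<infinity>i. epowr (a i) q') (1 / q')"
    by (rule epowr_le_imp[OF _ q0])
  then show ?thesis using q' by (simp add: lq_norm_def)
qed

lemma Lp_norm_finite_exponent:
  assumes p: "0 < p" and A [measurable]: "A \<in> sets borel" and [measurable]: "f \<in> borel_measurable borel"
  shows "Lp_norm (ennreal p) A f = epowr (\<integral>\<^sup>+x\<in>A. ennreal (norm (f x) powr p) \<partial>lborel) (1 / p)"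
proof -
  have "(\<integral>\<^sup>+x. ennreal (norm (f x) powr p) \<partial>lebesgue_on A) = (\<integral>\<^sup>+x\<in>A. ennreal (norm (f x) powr p) \<partial>lebesgue)"
    by (rule nn_integral_restrict_space) simp
  also have "\<dots> = (\<integral>\<^sup>+x\<in>A. ennreal (norm (f x) powr p) \<partial>lborel)"
    by (rule nn_integral_completion)
  finally show ?thesis using p by (simp add: Lp_norm_def)
qed

lemma Lp_norm_top_le:
  assumes "f \<in> borel_measurable borel" "\<And>x. ennreal (norm (f x)) \<le> c"
  shows "Lp_norm \<infinity> UNIV f \<le> c"
proof -
  have "(\<lambda>x. ennreal (norm (f x))) \<in> borel_measurable lebesgue"
    using assms(1) by (intro measurable_completion) simp
  then show ?thesis using assms(2) by (auto simp: Lp_norm_def lebesgue_on_UNIV_eq intro!: esssup_I)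
qed

lemma Lp_norm_top_AE:
  assumes [measurable]: "A \<in> sets borel"
  shows "AE x in lborel. x \<in> A \<longrightarrow> ennreal (norm (f x)) \<le> Lp_norm \<infinity> A f"
proof -
  have "AE x in lebesgue_on A. ennreal (norm (f x)) \<le> Lp_norm \<infinity> A f"
    using esssup_AE[of "\<lambda>x. ennreal (norm (f x))" "lebesgue_on A"] by (simp add: Lp_norm_def)
  then have "AE x in lebesgue. x \<in> A \<longrightarrow> ennreal (norm (f x)) \<le> Lp_norm \<infinity> A f"
    by (subst (asm) AE_restrict_space_iff) auto
  then show ?thesis by (simp add: AE_completion_iff)
qed

section \<open>The Peetre maximal inequality\<close>

text \<open>Let \<open>M\<close> be the maximal function at \<open>x\<close> and \<open>I\<close>
  the integral on the right. Splitting \<open>h = h^(1-s) h^s\<close> under the reproducing integral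
  gives \<open>M <= B M^(1-s) I\<close>, and dividing by \<open>M^(1-s)\<close> lowers the exponent
  from 1 to \<open>s\<close>. The division requires \<open>M\<close> to be finite, which is what
  \<open>growth\<close> provides; \<open>A\<close> therefore does not enter the conclusion.\<close>

lemma peetre_maximal:
  fixes h :: "'a::euclidean_space \<Rightarrow> real"
  assumes [measurable]: "h \<in> borel_measurable borel" and h0: "\<And>x. 0 \<le> h x"
    and B: "0 \<le> B" and a: "0 \<le> a" and s: "0 < s" "s \<le> 1"
    and rep: "\<And>x. ennreal (h x) \<le> ennreal B * (\<integral>\<^sup>+y. ennreal (h y * weight a (x - y)) \<partial>lborel)"
    and growth: "\<And>x. h x * weight a x \<le> A"
  shows "ennreal (h z powr s * weight (a * s) (x - z))
      \<le> ennreal B * (\<integral>\<^sup>+y. ennreal (h y powr s * weight (a * s) (x - y)) \<partial>lborel)"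
proof -
  define M where "M = (SUP y. h y * weight a (x - y))"
  have bdd: "bdd_above (range (\<lambda>y. h y * weight a (x - y)))"
  proof (rule bdd_aboveI2)
    fix y
    have "weight a (x - y) * weight a x \<le> weight a y"
      using weight_submult[OF a, of "y - x" x] by (simp add: weight_commute)
    then have "h y * (weight a (x - y) * weight a x) \<le> A"
      using order_trans[OF mult_left_mono[OF _ h0] growth] by blast
    then show "h y * weight a (x - y) \<le> A / weight a x" by (simp add: field_simps)
  qed
  have M: "h y * weight a (x - y) \<le> M" for y
    unfolding M_def using bdd by (intro cSUP_upper) auto
  have M0: "0 \<le> M" using order_trans[OF _ M[of 0]] h0 by simp
  let ?I = "\<integral>\<^sup>+y. ennreal (h y powr s * weight (a * s) (x - y)) \<partial>lborel"
  have hz: "ennreal (h z powr s * weight (a * s) (x - z)) = ennreal ((h z * weight a (x - z)) powr s)" for z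
    using h0 by (simp add: powr_mult weight_powr)
  \<comment> \<open>The weight at \<open>x - z\<close> is absorbed by submultiplicativity, so the
    integral is centred at \<open>x\<close> again and the bound is uniform in
    \<open>z\<close>.\<close>
  have step: "ennreal (h z * weight a (x - z)) \<le> ennreal B * (ennreal (M powr (1 - s)) * ?I)" for z
  proof -
    have "ennreal (h z * weight a (x - z)) = ennreal (weight a (x - z)) * ennreal (h z)"
      using h0 by (simp add: ennreal_mult[symmetric] mult.commute)
    also have "\<dots> \<le> ennreal (weight a (x - z)) * (ennreal B * (\<integral>\<^sup>+y. ennreal (h y * weight a (z - y)) \<partial>lborel))"
      by (intro mult_left_mono rep) simp
    also have "\<dots> = ennreal B * (\<integral>\<^sup>+y. ennreal (weight a (x - z)) * ennreal (h y * weight a (z - y)) \<partial>lborel)"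
      by (subst nn_integral_cmult) (auto simp: mult_ac)
    also have "\<dots> \<le> ennreal B * (\<integral>\<^sup>+y. ennreal (M powr (1 - s)) * ennreal (h y powr s * weight (a * s) (x - y)) \<partial>lborel)"
    proof (intro mult_left_mono nn_integral_mono)
      fix y
      have "weight a (x - z) * weight a (z - y) \<le> weight a (x - y)"
        using weight_submult[OF a, of "x - z" "z - y"] by simp
      from mult_left_mono[OF this h0[of y]]
      have "weight a (x - z) * (h y * weight a (z - y)) \<le> h y * weight a (x - y)"
        by (simp add: mult_ac)
      also have "\<dots> = (h y * weight a (x - y)) powr (1 - s) * (h y * weight a (x - y)) powr s"
        using h0[of y] by (simp add: powr_add[symmetric])
      also have "\<dots> \<le> M powr (1 - s) * (h y * weight a (x - y)) powr s"
        using h0 s M by (intro mult_right_mono powr_mono2) auto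
      also have "\<dots> = M powr (1 - s) * (h y powr s * weight (a * s) (x - y))"
        using h0 by (simp add: powr_mult weight_powr)
      finally show "ennreal (weight a (x - z)) * ennreal (h y * weight a (z - y))
          \<le> ennreal (M powr (1 - s)) * ennreal (h y powr s * weight (a * s) (x - y))"
        using h0 by (simp add: ennreal_mult[symmetric] ennreal_leI)
    qed simp
    also have "\<dots> = ennreal B * (ennreal (M powr (1 - s)) * ?I)" by (subst nn_integral_cmult) auto
    finally show ?thesis .
  qed
  \<comment> \<open>If \<open>B\<close> or \<open>M\<close> vanishes then \<open>h z = 0\<close>; if
    \<open>B > 0\<close> and the integral is infinite the claim is trivial; in the third case the
    division is legitimate.\<close>
  consider "B = 0 \<or> M = 0" | "B > 0" "?I = \<top>" | "M > 0" "?I < \<top>"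
    using B M0 by (metis less_le top.not_eq_extremum)
  then show ?thesis
  proof cases
    case 1
    have "h z * weight a (x - z) \<le> 0"
      using 1 step[of z] M[of z] by (auto simp: ennreal_eq_0_iff)
    then have "h z = 0" using h0[of z] weight_pos[of a "x - z"] by (simp add: mult_le_0_iff)
    then show ?thesis by simp
  next
    case 2
    then show ?thesis by (simp add: ennreal_mult_top)
  next
    case 3
    then obtain I where I: "?I = ennreal I" "0 \<le> I" by (cases ?I) auto
    have "h y * weight a (x - y) \<le> B * (M powr (1 - s) * I)" for y
      using step[of y] I B by (simp add: ennreal_mult[symmetric])
    then have "M \<le> B * (M powr (1 - s) * I)" unfolding M_def by (intro cSUP_least) auto
    moreover have "M = M powr (1 - s) * M powr s" using 3 by (simp add: powr_add[symmetric])
    ultimately have "M powr (1 - s) * M powr s \<le> M powr (1 - s) * (B * I)" by (simp add: mult_ac)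
    then have "M powr s \<le> B * I" using 3 by simp
    moreover have "(h z * weight a (x - z)) powr s \<le> M powr s"
      using h0 s M by (intro powr_mono2) auto
    ultimately show ?thesis unfolding hz[of z] I(1) using I(2) B by (simp add: ennreal_mult[symmetric] ennreal_leI)
  qed
qed

section \<open>Reproduced functions and Bernstein's inequality\<close>

lemma reproducing_bound:
  fixes \<Psi> g :: "'a::euclidean_space \<Rightarrow> complex"
  assumes \<Psi>: "\<Psi> \<in> schwartz" and [measurable]: "g \<in> borel_measurable borel" and rep: "convolution \<Psi> g = g"
  shows "ennreal (norm (g x)) \<le> ennreal (sup_weight n \<Psi>) * (\<integral>\<^sup>+y. ennreal (norm (g y) * weight (real n) (x - y)) \<partial>lborel)"
proof -
  note [measurable] = schwartz_measurable[OF \<Psi>]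
  have "g x = (LINT y|lborel. \<Psi> (x - y) * g y)"
    by (subst rep[symmetric]) (simp add: convolution_lborel)
  then have "ennreal (norm (g x)) \<le> (\<integral>\<^sup>+y. ennreal (norm (\<Psi> (x - y) * g y)) \<partial>lborel)"
    using integral_norm_bound_ennreal[of lborel "\<lambda>y. \<Psi> (x - y) * g y"]
    by (cases "integrable lborel (\<lambda>y. \<Psi> (x - y) * g y)") (auto simp: not_integrable_integral_eq)
  also have "\<dots> \<le> (\<integral>\<^sup>+y. ennreal (sup_weight n \<Psi>) * ennreal (norm (g y) * weight (real n) (x - y)) \<partial>lborel)"
  proof (intro nn_integral_mono)
    fix y
    have "norm (\<Psi> (x - y)) * norm (g y) \<le> sup_weight n \<Psi> * weight (real n) (x - y) * norm (g y)"
      by (intro mult_right_mono sup_weight_bound \<Psi>) simp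
    then show "ennreal (norm (\<Psi> (x - y) * g y)) \<le> ennreal (sup_weight n \<Psi>) * ennreal (norm (g y) * weight (real n) (x - y))"
      using sup_weight_nonneg[OF \<Psi>, of n] by (simp add: ennreal_mult[symmetric] norm_mult mult_ac ennreal_leI)
  qed
  also have "\<dots> = ennreal (sup_weight n \<Psi>) * (\<integral>\<^sup>+y. ennreal (norm (g y) * weight (real n) (x - y)) \<partial>lborel)"
    by (rule nn_integral_cmult) measurable
  finally show ?thesis .
qed

text \<open>The decay exponent \<open>n\<close> is matched to the growth of \<open>g\<close>; a
  Schwartz function \<Psi> offers decay of any order.\<close>

lemma peetre_reproducing:
  fixes \<Psi> g :: "'a::euclidean_space \<Rightarrow> complex"
  assumes \<Psi>: "\<Psi> \<in> schwartz" and [measurable]: "g \<in> borel_measurable borel" and rep: "convolution \<Psi> g = g"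
    and growth: "\<And>x. norm (g x) \<le> A * (1 + norm x) ^ n" and s: "0 < s" "s \<le> 1"
  shows "ennreal (norm (g z) powr s * weight (real n * s) (x - z))
      \<le> ennreal (sup_weight n \<Psi>) * (\<integral>\<^sup>+y. ennreal (norm (g y) powr s * weight (real n * s) (x - y)) \<partial>lborel)"
proof (rule peetre_maximal[OF _ _ sup_weight_nonneg[OF \<Psi>] _ s reproducing_bound[OF \<Psi> _ rep]])
  fix x
  have "norm (g x) * weight (real n) x \<le> A * (1 + norm x) ^ n * weight (real n) x"
    by (intro mult_right_mono growth) simp
  also have "\<dots> = A * (weight (real n) x * (1 + norm x) ^ n)" by (simp only: mult_ac)
  finally show "norm (g x) * weight (real n) x \<le> A" by (simp only: weight_mult_power mult_1_right)
qed measurable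

lemma bounded_imp_growth: "(\<And>x. norm (g x) \<le> A) \<Longrightarrow> norm (g x) \<le> A * (1 + norm x) ^ n"
proof -
  assume g: "\<And>x. norm (g x) \<le> A"
  have "0 \<le> A" by (rule order_trans[OF norm_ge_zero g])
  then have "A * 1 \<le> A * (1 + norm x) ^ n" by (intro mult_left_mono one_le_power) auto
  with g[of x] show ?thesis by simp
qed

text \<open>A bootstrap. Peetre's inequality at the growth degree \<open>n\<close> shows only that a
  \<open>g\<close> with finite integral is bounded; applied once more with degree 0 it yields a
  constant free of \<open>A\<close> and \<open>n\<close>.\<close>

lemma sup_powr_le_integral:
  fixes \<Psi> g :: "'a::euclidean_space \<Rightarrow> complex"
  assumes \<Psi>: "\<Psi> \<in> schwartz" and g [measurable]: "g \<in> borel_measurable borel" and rep: "convolution \<Psi> g = g"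
    and growth: "\<And>x. norm (g x) \<le> A * (1 + norm x) ^ n" and s: "0 < s" "s \<le> 1"
  shows "ennreal (norm (g z) powr s) \<le> ennreal (sup_weight 0 \<Psi>) * (\<integral>\<^sup>+y. ennreal (norm (g y) powr s) \<partial>lborel)"
proof -
  let ?I = "\<integral>\<^sup>+y. ennreal (norm (g y) powr s) \<partial>lborel"
  have w: "weight (real k * s) y \<le> 1" for k and y :: 'a using s by (intro weight_le_one) simp
  have le: "ennreal (norm (g z) powr s) \<le> ennreal (sup_weight k \<Psi>) * ?I"
    if growth: "\<And>x. norm (g x) \<le> A * (1 + norm x) ^ k" for k A z
  proof -
    have "ennreal (norm (g z) powr s) \<le> ennreal (sup_weight k \<Psi>) * (\<integral>\<^sup>+y. ennreal (norm (g y) powr s * weight (real k * s) (z - y)) \<partial>lborel)"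
      using peetre_reproducing[OF \<Psi> g rep growth s, of z z] by (simp add: weight_def)
    also have "\<dots> \<le> ennreal (sup_weight k \<Psi>) * ?I"
      by (intro mult_left_mono nn_integral_mono ennreal_leI mult_left_le w) auto
    finally show ?thesis .
  qed
  show ?thesis
  proof (cases "ennreal (sup_weight n \<Psi>) * ?I < \<top>")
    case True
    then obtain J where J: "ennreal (sup_weight n \<Psi>) * ?I = ennreal J" "0 \<le> J" by (cases "ennreal (sup_weight n \<Psi>) * ?I") auto
    have "norm (g x) \<le> J powr (1 / s)" for x
    proof -
      have "norm (g x) powr s \<le> J" using le[OF growth, of x] J by simp
      then have "(norm (g x) powr s) powr (1 / s) \<le> J powr (1 / s)" using s by (intro powr_mono2) auto
      then show ?thesis using s by (simp add: powr_powr)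
    qed
    then show ?thesis using le[of "J powr (1 / s)" 0 z] by simp
  next
    case False
    then have "\<not> ?I < \<top>" by (auto simp: ennreal_mult_less_top)
    then have I: "?I = \<top>" by (metis top.not_eq_extremum)
    \<comment> \<open>An infinite integral makes the claim trivial unless the constant is 0, as
      \<open>0 * \<top> = 0\<close>; in that case \<Psi> vanishes, and \<open>g\<close> with
      it.\<close>
    show ?thesis
    proof (cases "sup_weight 0 \<Psi> = 0")
      case True
      have "\<Psi> x = 0" for x using sup_weight_upper[OF \<Psi>, of x 0] True by simp
      then have "g z = 0" by (subst rep[symmetric]) (simp add: Defs.convolution_def)
      then show ?thesis by simp
    next
      case False
      then show ?thesis using I sup_weight_nonneg[OF \<Psi>, of 0] by (simp add: ennreal_mult_top)
    qed
  qed
qed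

lemma nn_integral_weight:
  assumes "2 * real DIM('a) \<le> a"
  obtains W where "0 < W" "\<And>x. (\<integral>\<^sup>+y. ennreal (weight a (x - y)) \<partial>(lborel :: 'a::euclidean_space measure)) = ennreal W"
proof -
  let ?I = "\<integral>\<^sup>+y. ennreal (weight a y) \<partial>(lborel :: 'a measure)"
  have "?I < \<top>" using integrable_weight[OF assms] by (simp add: integrable_iff_bounded)
  then obtain W where W: "?I = ennreal W" "0 \<le> W" by (cases ?I) auto
  have "W \<noteq> 0"
  proof
    assume "W = 0"
    then have "AE y in (lborel :: 'a measure). weight a y \<le> 0" using W
      by (simp add: nn_integral_0_iff_AE ennreal_eq_0_iff)
    moreover have "\<not> weight a y \<le> 0" for y :: 'a by (simp add: not_le)
    ultimately have "AE y in (lborel :: 'a measure). False" by simp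
    then show False using ae_filter_eq_bot_iff[of "lborel :: 'a measure"] by (simp add: trivial_limit_def)
  qed
  moreover have "(\<integral>\<^sup>+y. ennreal (weight a (x - y)) \<partial>(lborel :: 'a measure)) = ?I" for x
    by (rule nn_integral_lborel_reflect[of "\<lambda>y. ennreal (weight a y)"]) measurable
  ultimately show ?thesis using W by (intro that[of W]) auto
qed

text \<open>The constant must be independent of \<open>A\<close> and \<open>n\<close>, because
  pieces of a distribution grow polynomially at an unspecified rate. For \<open>p <= 1\<close> the
  bootstrap applies, for \<open>1 <= p < \<infinity>\<close> Jensen with an integrable weight, and
  for \<open>p = \<infinity>\<close> the reproducing integral is bounded directly.\<close>

lemma bernstein:
  fixes \<Psi> :: "'a::euclidean_space \<Rightarrow> complex"
  assumes \<Psi>: "\<Psi> \<in> schwartz" and p: "0 < p"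
  shows "\<exists>C\<ge>0. \<forall>g A n. g \<in> borel_measurable borel \<longrightarrow> convolution \<Psi> g = g
      \<longrightarrow> (\<forall>x. norm (g x) \<le> A * (1 + norm x) ^ n) \<longrightarrow> (\<forall>x. ennreal (norm (g x)) \<le> ennreal C * Lp_norm p UNIV g)"
proof -
  define d where "d = 2 * DIM('a)"
  define B where "B = sup_weight d \<Psi>"
  have B: "0 \<le> B" unfolding B_def by (rule sup_weight_nonneg[OF \<Psi>])
  obtain W where W: "0 < W" "\<And>x. (\<integral>\<^sup>+y. ennreal (weight (real d) (x - y)) \<partial>(lborel :: 'a measure)) = ennreal W"
    by (rule nn_integral_weight[of "real d"]) (auto simp: d_def)
  consider "p = \<infinity>" | p' where "p = ennreal p'" "0 < p'" "p' \<le> 1" | p' where "p = ennreal p'" "1 \<le> p'"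
    using p by (cases p) (force simp: ennreal_less_zero_iff)+
  then show ?thesis
  proof cases
    case 1
    show ?thesis
    proof (intro exI[of _ "B * W"] conjI allI impI)
      show "0 \<le> B * W" using B W by simp
      fix g :: "'a \<Rightarrow> complex" and x :: 'a
      assume [measurable]: "g \<in> borel_measurable borel" and rep: "convolution \<Psi> g = g"
      let ?N = "Lp_norm p UNIV g"
      have "ennreal (norm (g x)) \<le> ennreal B * (\<integral>\<^sup>+y. ennreal (norm (g y) * weight (real d) (x - y)) \<partial>lborel)"
        unfolding B_def by (rule reproducing_bound[OF \<Psi> _ rep]) measurable
      also have "\<dots> \<le> ennreal B * (\<integral>\<^sup>+y. ?N * ennreal (weight (real d) (x - y)) \<partial>lborel)"
      proof (intro mult_left_mono nn_integral_mono_AE)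
        have "AE y in lborel. ennreal (norm (g y)) \<le> ?N" using Lp_norm_top_AE[of UNIV g] 1 by simp
        then show "AE y in lborel. ennreal (norm (g y) * weight (real d) (x - y)) \<le> ?N * ennreal (weight (real d) (x - y))"
          by eventually_elim (simp add: ennreal_mult mult_right_mono)
      qed simp
      also have "\<dots> = ennreal B * (?N * ennreal W)" by (subst nn_integral_cmult) (auto simp: W)
      also have "\<dots> = ennreal (B * W) * ?N" using B W by (simp add: ennreal_mult mult_ac)
      finally show "ennreal (norm (g x)) \<le> ennreal (B * W) * ?N" .
    qed
  next
    case (2 p')
    have B0: "0 \<le> sup_weight 0 \<Psi>" by (rule sup_weight_nonneg[OF \<Psi>])
    show ?thesis
    proof (intro exI[of _ "sup_weight 0 \<Psi> powr (1 / p')"] conjI allI impI)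
      fix g :: "'a \<Rightarrow> complex" and x :: 'a and A n
      assume g [measurable]: "g \<in> borel_measurable borel" and rep: "convolution \<Psi> g = g"
        and gr: "\<forall>x. norm (g x) \<le> A * (1 + norm x) ^ n"
      let ?I = "\<integral>\<^sup>+y. ennreal (norm (g y) powr p') \<partial>lborel"
      have "epowr (ennreal (norm (g x))) p' \<le> ennreal (sup_weight 0 \<Psi>) * ?I"
      proof -
        have "ennreal (norm (g x) powr p') \<le> ennreal (sup_weight 0 \<Psi>) * ?I"
          by (rule sup_powr_le_integral[OF \<Psi> g rep, where A = A and n = n]) (use gr 2 in auto)
        then show ?thesis by (simp add: epowr_ennreal)
      qed
      from epowr_le_imp[OF this 2(2)]
      have "ennreal (norm (g x)) \<le> epowr (ennreal (sup_weight 0 \<Psi>)) (1 / p') * epowr ?I (1 / p')"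
        using 2 by (simp add: epowr_mult)
      then show "ennreal (norm (g x)) \<le> ennreal (sup_weight 0 \<Psi> powr (1 / p')) * Lp_norm p UNIV g"
        using 2 B0 by (simp add: Lp_norm_finite_exponent epowr_ennreal)
    qed simp
  next
    case (3 p')
    then have p0: "0 < p'" by simp
    \<comment> \<open>\<open>B\<close> comes from the decay of \<Psi>, the factor
      \<open>W powr (p' - 1)\<close> from Jensen with a weight of mass \<open>W\<close>.\<close>
    define C where "C = (B powr p' * W powr (p' - 1)) powr (1 / p')"
    show ?thesis
    proof (intro exI[of _ C] conjI allI impI)
      show "0 \<le> C" by (simp add: C_def)
      fix g :: "'a \<Rightarrow> complex" and x :: 'a
      assume g [measurable]: "g \<in> borel_measurable borel" and rep: "convolution \<Psi> g = g"
      let ?w = "\<lambda>y. weight (real d) (x - y)"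
      let ?I = "\<integral>\<^sup>+y. ennreal (norm (g y) powr p') \<partial>lborel"
      have "ennreal (norm (g x)) \<le> ennreal B * (\<integral>\<^sup>+y. ennreal (?w y * norm (g y)) \<partial>lborel)"
        using reproducing_bound[OF \<Psi> g rep, of x d] unfolding B_def by (simp only: mult.commute)
      then have "epowr (ennreal (norm (g x))) p' \<le> epowr (ennreal B * (\<integral>\<^sup>+y. ennreal (?w y * norm (g y)) \<partial>lborel)) p'"
        using p0 by (intro epowr_mono) auto
      also have "\<dots> = ennreal (B powr p') * epowr (\<integral>\<^sup>+y. ennreal (?w y * norm (g y)) \<partial>lborel) p'"
        using B p0 by (simp add: epowr_mult epowr_ennreal)
      also have "\<dots> \<le> ennreal (B powr p') * (ennreal (W powr (p' - 1)) * (\<integral>\<^sup>+y. ennreal (?w y * norm (g y) powr p') \<partial>lborel))"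
        using W 3 by (intro mult_left_mono jensen_powr) auto
      also have "\<dots> \<le> ennreal (B powr p') * (ennreal (W powr (p' - 1)) * ?I)"
        by (intro mult_left_mono nn_integral_mono ennreal_leI mult_left_le_one_le weight_le_one) auto
      also have "\<dots> = ennreal (B powr p' * W powr (p' - 1)) * ?I" by (simp add: ennreal_mult mult_ac)
      finally have "epowr (ennreal (norm (g x))) p' \<le> ennreal (B powr p' * W powr (p' - 1)) * ?I" .
      from epowr_le_imp[OF this p0]
      have "ennreal (norm (g x)) \<le> ennreal C * epowr ?I (1 / p')"
        using p0 by (simp add: epowr_mult epowr_ennreal C_def)
      then show "ennreal (norm (g x)) \<le> ennreal C * Lp_norm p UNIV g"
        using 3 p0 by (simp add: Lp_norm_finite_exponent)
    qed
  qed
qed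

section \<open>Convolution of band-limited functions\<close>

text \<open>Working substitute for a spectrum inside the set where the transform of \<Psi> is 1.
  Boundedness is included so that Peetre's inequality is available with every decay
  exponent.\<close>

definition reproduced_by :: "('a::euclidean_space \<Rightarrow> complex) \<Rightarrow> ('a \<Rightarrow> complex) \<Rightarrow> bool" where
  "reproduced_by \<Psi> g \<longleftrightarrow> bounded_cont g \<and> convolution \<Psi> g = g"

lemma reproduced_by_bounded_cont: "reproduced_by \<Psi> g \<Longrightarrow> bounded_cont g"
  by (simp add: reproduced_by_def)

lemma peetre_reproduced:
  assumes \<Psi>: "\<Psi> \<in> schwartz" and g: "reproduced_by \<Psi> g" and s: "0 < s" "s \<le> 1"
  shows "ennreal (norm (g z) powr s * weight (real n * s) (x - z))
      \<le> ennreal (sup_weight n \<Psi>) * (\<integral>\<^sup>+y. ennreal (norm (g y) powr s * weight (real n * s) (x - y)) \<partial>lborel)"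
proof -
  have b: "bounded_cont g" and rep: "convolution \<Psi> g = g" using g by (auto simp: reproduced_by_def)
  obtain A where A: "\<And>x. norm (g x) \<le> A" using bounded_contD[OF b] by blast
  have growth: "norm (g x) \<le> A * (1 + norm x) ^ n" for x by (rule bounded_imp_growth) (rule A)
  show ?thesis by (rule peetre_reproducing[OF \<Psi> bounded_cont_measurable[OF b] rep growth s])
qed

section \<open>Young's inequality and its band-limited replacement for exponents below 1\<close>

lemma nn_integral_convolution:
  fixes f g :: "'a::euclidean_space \<Rightarrow> ennreal"
  assumes [measurable]: "f \<in> borel_measurable borel" "g \<in> borel_measurable borel"
  shows "(\<integral>\<^sup>+x. (\<integral>\<^sup>+y. f (x - y) * g y \<partial>lborel) \<partial>lborel) = (\<integral>\<^sup>+x. f x \<partial>lborel) * (\<integral>\<^sup>+x. g x \<partial>lborel)"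
proof -
  have "(\<integral>\<^sup>+x. (\<integral>\<^sup>+y. f (x - y) * g y \<partial>lborel) \<partial>lborel) = (\<integral>\<^sup>+y. (\<integral>\<^sup>+x. f (x - y) * g y \<partial>lborel) \<partial>lborel)"
    by (rule lborel_pair.Fubini') measurable
  also have "\<dots> = (\<integral>\<^sup>+y. (\<integral>\<^sup>+x. f x \<partial>lborel) * g y \<partial>lborel)"
    by (simp add: nn_integral_multc nn_integral_lborel_shift)
  also have "\<dots> = (\<integral>\<^sup>+x. f x \<partial>lborel) * (\<integral>\<^sup>+x. g x \<partial>lborel)" by (rule nn_integral_cmult) measurable
  finally show ?thesis .
qed

text \<open>Interpolation \<open>H = H^(1-p) H^p\<close>: the first factor is bounded through the
  supremum, the second integrates to at most \<open>S\<close>, and the exponents of \<open>S\<close>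
  add up to \<open>1/p\<close>.\<close>

lemma epowr_integral_le:
  fixes H :: "'a \<Rightarrow> real"
  assumes [measurable]: "H \<in> borel_measurable M" and H0: "\<And>x. 0 \<le> H x" and p: "0 < p" "p \<le> 1"
    and sup: "\<And>x. ennreal (H x powr p) \<le> S" and int: "(\<integral>\<^sup>+x. ennreal (H x powr p) \<partial>M) \<le> S"
  shows "epowr (\<integral>\<^sup>+x. ennreal (H x) \<partial>M) p \<le> S"
proof (cases S)
  case (real s)
  have Hs: "H x \<le> s powr (1 / p)" for x
  proof -
    have "H x powr p \<le> s" using sup[of x] real by simp
    then have "(H x powr p) powr (1 / p) \<le> s powr (1 / p)" using p by (intro powr_mono2) auto
    then show ?thesis using p H0 by (simp add: powr_powr)
  qed
  have "(\<integral>\<^sup>+x. ennreal (H x) \<partial>M) \<le> (\<integral>\<^sup>+x. ennreal (s powr ((1 - p) / p)) * ennreal (H x powr p) \<partial>M)"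
  proof (intro nn_integral_mono)
    fix x
    have "H x = H x powr (1 - p) * H x powr p" using H0 by (simp add: powr_add[symmetric])
    also have "\<dots> \<le> (s powr (1 / p)) powr (1 - p) * H x powr p"
      using Hs H0 p by (intro mult_right_mono powr_mono2) auto
    finally show "ennreal (H x) \<le> ennreal (s powr ((1 - p) / p)) * ennreal (H x powr p)"
      by (simp add: ennreal_mult[symmetric] powr_powr ennreal_leI)
  qed
  also have "\<dots> = ennreal (s powr ((1 - p) / p)) * (\<integral>\<^sup>+x. ennreal (H x powr p) \<partial>M)"
    by (rule nn_integral_cmult) measurable
  also have "\<dots> \<le> ennreal (s powr ((1 - p) / p)) * S" by (intro mult_left_mono int) simp
  also have "\<dots> = ennreal (s powr (1 / p))"
  proof (cases "s = 0")
    case False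
    have "s powr ((1 - p) / p) * s = s powr ((1 - p) / p + 1)" using real False by (simp add: powr_add)
    also have "(1 - p) / p + 1 = 1 / p" using p by (simp add: field_simps)
    finally show ?thesis using real by (simp add: ennreal_mult[symmetric])
  qed (use real in simp)
  finally have "epowr (\<integral>\<^sup>+x. ennreal (H x) \<partial>M) p \<le> epowr (ennreal (s powr (1 / p))) p"
    using p by (intro epowr_mono) auto
  also have "\<dots> = S" using p real by (simp add: epowr_ennreal powr_powr)
  finally show ?thesis .
qed simp

text \<open>On a unit ball both factors are comparable to their Peetre majorants, so the supremum and
  the \<open>L\<^sup>p\<close> quasi-norm of \<open>y \<mapsto> K (x - y) g y\<close> are controlled by one and the same integral.\<close>

lemma quasi_young_inequality:
  fixes \<Psi> \<Theta> :: "'a::euclidean_space \<Rightarrow> complex"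
  assumes \<Psi>: "\<Psi> \<in> schwartz" and \<Theta>: "\<Theta> \<in> schwartz" and p: "0 < p" "p \<le> 1"
  shows "\<exists>C\<ge>0. \<forall>K g. reproduced_by \<Psi> K \<longrightarrow> reproduced_by \<Theta> g \<longrightarrow>
    (\<integral>\<^sup>+x. epowr (\<integral>\<^sup>+y. ennreal (norm (K (x - y)) * norm (g y)) \<partial>lborel) p \<partial>lborel)
      \<le> ennreal C * ((\<integral>\<^sup>+x. ennreal (norm (K x) powr p) \<partial>lborel) * (\<integral>\<^sup>+x. ennreal (norm (g x) powr p) \<partial>lborel))"
proof -
  \<comment> \<open>Large enough that the weight of exponent \<open>n p\<close> is
    integrable.\<close>
  define n where "n = nat \<lceil>2 * real DIM('a) / p\<rceil>"
  have n: "2 * real DIM('a) \<le> real n * p"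
  proof -
    have "2 * real DIM('a) / p \<le> real n" unfolding n_def by linarith
    then show ?thesis using p by (simp add: field_simps)
  qed
  obtain W where W: "0 < W" "\<And>x. (\<integral>\<^sup>+y. ennreal (weight (real n * p) (x - y)) \<partial>(lborel :: 'a measure)) = ennreal W"
    by (rule nn_integral_weight[OF n]) blast
  have W': "(\<integral>\<^sup>+y. ennreal (weight (real n * p) y) \<partial>(lborel :: 'a measure)) = ennreal W"
    using W(2)[of 0] by simp
  define A B where "A = sup_weight n \<Psi>" and "B = sup_weight n \<Theta>"
  have AB: "0 \<le> A" "0 \<le> B" unfolding A_def B_def by (auto intro: sup_weight_nonneg \<Psi> \<Theta>)
  \<comment> \<open>\<open>1 / t\<close> is the minimum of the weight on the closed unit ball,
    attained on its boundary.\<close>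
  define t where "t = 2 powr (real n * p)"
  have t: "0 < t" by (simp add: t_def)
  have near: "1 \<le> t * weight (real n * p) z" if "norm z \<le> 1" for z :: 'a
  proof -
    have "2 powr (- (real n * p)) \<le> (1 + norm z) powr (- (real n * p))"
      using that p by (intro powr_mono2') (auto simp: add_pos_nonneg)
    then have "2 powr (real n * p) * 2 powr (- (real n * p)) \<le> t * weight (real n * p) z"
      unfolding t_def weight_def by (intro mult_left_mono) auto
    then show ?thesis by (simp add: powr_add[symmetric])
  qed
  define v where "v = unit_ball_vol (real DIM('a))"
  have v: "0 < v" by (simp add: v_def)
  have vy: "emeasure lborel (ball y 1) = ennreal v" for y :: 'a
    by (simp add: v_def emeasure_ball)
  define c where "c = A * B * t * t"
  \<comment> \<open>The integral bound uses the pointwise estimate \<open>HH\<close> with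
    \<open>z = y\<close> and needs \<open>c\<close>; the supremum bound averages \<open>HH\<close>
    over the ball around \<open>y\<close>, of volume \<open>v\<close>, and needs
    \<open>c / v\<close>.\<close>
  define c' where "c' = max c (c / v)"
  have c: "0 \<le> c" using AB t by (simp add: c_def)
  have c': "0 \<le> c'" using c by (simp add: c'_def le_max_iff_disj)
  show ?thesis
  proof (intro exI[of _ "c' * W * W"] conjI allI impI)
    show "0 \<le> c' * W * W" using c' W by simp
    fix K g :: "'a \<Rightarrow> complex" assume K: "reproduced_by \<Psi> K" and g: "reproduced_by \<Theta> g"
    note [measurable] = bounded_cont_measurable[OF reproduced_by_bounded_cont[OF K]]
      bounded_cont_measurable[OF reproduced_by_bounded_cont[OF g]]
    define I where "I x = (\<integral>\<^sup>+y. ennreal (norm (K y) powr p * weight (real n * p) (x - y)) \<partial>lborel)" for x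
    define J where "J x = (\<integral>\<^sup>+y. ennreal (norm (g y) powr p * weight (real n * p) (x - y)) \<partial>lborel)" for x
    have [measurable]: "I \<in> borel_measurable borel" "J \<in> borel_measurable borel"
      unfolding I_def J_def by measurable
    have intI: "(\<integral>\<^sup>+x. I x \<partial>lborel) = ennreal W * (\<integral>\<^sup>+x. ennreal (norm (K x) powr p) \<partial>lborel)"
    proof -
      have "I = (\<lambda>x. \<integral>\<^sup>+y. ennreal (weight (real n * p) (x - y)) * ennreal (norm (K y) powr p) \<partial>lborel)"
        unfolding I_def by (intro ext nn_integral_cong) (simp add: ennreal_mult mult.commute)
      then show ?thesis
        using nn_integral_convolution[of "\<lambda>y. ennreal (weight (real n * p) y)" "\<lambda>y. ennreal (norm (K y) powr p)"]
        by (simp add: W')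
    qed
    have intJ: "(\<integral>\<^sup>+x. J x \<partial>lborel) = ennreal W * (\<integral>\<^sup>+x. ennreal (norm (g x) powr p) \<partial>lborel)"
    proof -
      have "J = (\<lambda>x. \<integral>\<^sup>+y. ennreal (weight (real n * p) (x - y)) * ennreal (norm (g y) powr p) \<partial>lborel)"
        unfolding J_def by (intro ext nn_integral_cong) (simp add: ennreal_mult mult.commute)
      then show ?thesis
        using nn_integral_convolution[of "\<lambda>y. ennreal (weight (real n * p) y)" "\<lambda>y. ennreal (norm (g y) powr p)"]
        by (simp add: W')
    qed
    have KI: "ennreal (norm (K z) powr p) \<le> ennreal (A * t) * I x" if d: "norm (x - z) \<le> 1" for x z
    proof -
      have "norm (K z) powr p * 1 \<le> norm (K z) powr p * (t * weight (real n * p) (x - z))"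
        by (intro mult_left_mono near d) simp
      then have "ennreal (norm (K z) powr p) \<le> ennreal t * ennreal (norm (K z) powr p * weight (real n * p) (x - z))"
        using t by (subst ennreal_mult[symmetric]) (auto simp: mult_ac intro!: ennreal_leI)
      also have "\<dots> \<le> ennreal t * (ennreal A * I x)"
        unfolding I_def A_def by (intro mult_left_mono peetre_reproduced[OF \<Psi> K p]) simp
      finally show ?thesis using AB t by (simp add: ennreal_mult mult_ac)
    qed
    have gJ: "ennreal (norm (g z) powr p) \<le> ennreal (B * t) * J x" if d: "norm (x - z) \<le> 1" for x z
    proof -
      have "norm (g z) powr p * 1 \<le> norm (g z) powr p * (t * weight (real n * p) (x - z))"
        by (intro mult_left_mono near d) simp
      then have "ennreal (norm (g z) powr p) \<le> ennreal t * ennreal (norm (g z) powr p * weight (real n * p) (x - z))"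
        using t by (subst ennreal_mult[symmetric]) (auto simp: mult_ac intro!: ennreal_leI)
      also have "\<dots> \<le> ennreal t * (ennreal B * J x)"
        unfolding J_def B_def by (intro mult_left_mono peetre_reproduced[OF \<Theta> g p]) simp
      finally show ?thesis using AB t by (simp add: ennreal_mult mult_ac)
    qed
    define Q where "Q x = (\<integral>\<^sup>+y. I (x - y) * J y \<partial>lborel)" for x
    have [measurable]: "Q \<in> borel_measurable borel" unfolding Q_def by measurable
    have pt: "epowr (\<integral>\<^sup>+y. ennreal (norm (K (x - y)) * norm (g y)) \<partial>lborel) p \<le> ennreal c' * Q x" for x
    proof (rule epowr_integral_le[OF _ _ p])
      have HH: "ennreal ((norm (K (x - y)) * norm (g y)) powr p) \<le> ennreal c * (I (x - z) * J z)" if d: "norm (z - y) \<le> 1" for y z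
      proof -
        have "ennreal ((norm (K (x - y)) * norm (g y)) powr p) = ennreal (norm (K (x - y)) powr p) * ennreal (norm (g y) powr p)"
          by (simp add: powr_mult ennreal_mult)
        also have "\<dots> \<le> (ennreal (A * t) * I (x - z)) * (ennreal (B * t) * J z)"
          using d by (intro mult_mono KI gJ) (auto simp: norm_minus_commute)
        also have "\<dots> = ennreal c * (I (x - z) * J z)"
          using AB t by (simp add: c_def ennreal_mult mult_ac)
        finally show ?thesis .
      qed
      show "(\<integral>\<^sup>+y. ennreal ((norm (K (x - y)) * norm (g y)) powr p) \<partial>lborel) \<le> ennreal c' * Q x"
      proof -
        have "(\<integral>\<^sup>+y. ennreal ((norm (K (x - y)) * norm (g y)) powr p) \<partial>lborel) \<le> (\<integral>\<^sup>+y. ennreal c * (I (x - y) * J y) \<partial>lborel)"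
          by (intro nn_integral_mono HH) simp
        also have "\<dots> = ennreal c * Q x" unfolding Q_def by (rule nn_integral_cmult) measurable
        also have "\<dots> \<le> ennreal c' * Q x" by (intro mult_right_mono ennreal_leI) (auto simp: c'_def)
        finally show ?thesis .
      qed
      fix y
      have "ennreal v * ennreal ((norm (K (x - y)) * norm (g y)) powr p)
          = (\<integral>\<^sup>+z. ennreal ((norm (K (x - y)) * norm (g y)) powr p) * indicator (ball y 1) z \<partial>lborel)"
        by (subst nn_integral_cmult_indicator) (auto simp: vy mult.commute)
      also have "\<dots> \<le> (\<integral>\<^sup>+z. ennreal c * (I (x - z) * J z) \<partial>lborel)"
      proof (intro nn_integral_mono)
        fix z
        show "ennreal ((norm (K (x - y)) * norm (g y)) powr p) * indicator (ball y 1) z \<le> ennreal c * (I (x - z) * J z)"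
          using HH[of z y] by (cases "z \<in> ball y 1") (auto simp: dist_norm norm_minus_commute)
      qed
      also have "\<dots> = ennreal c * Q x" unfolding Q_def by (rule nn_integral_cmult) measurable
      finally have "ennreal (1 / v) * (ennreal v * ennreal ((norm (K (x - y)) * norm (g y)) powr p)) \<le> ennreal (1 / v) * (ennreal c * Q x)"
        by (rule mult_left_mono) simp
      then have "ennreal ((norm (K (x - y)) * norm (g y)) powr p) \<le> ennreal (c / v) * Q x"
        using v c by (simp add: mult.assoc[symmetric] ennreal_mult[symmetric])
      also have "\<dots> \<le> ennreal c' * Q x" by (intro mult_right_mono ennreal_leI) (auto simp: c'_def)
      finally show "ennreal ((norm (K (x - y)) * norm (g y)) powr p) \<le> ennreal c' * Q x" .
    qed auto
    have "(\<integral>\<^sup>+x. epowr (\<integral>\<^sup>+y. ennreal (norm (K (x - y)) * norm (g y)) \<partial>lborel) p \<partial>lborel) \<le> (\<integral>\<^sup>+x. ennreal c' * Q x \<partial>lborel)"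
      by (intro nn_integral_mono pt)
    also have "\<dots> = ennreal c' * ((\<integral>\<^sup>+x. I x \<partial>lborel) * (\<integral>\<^sup>+x. J x \<partial>lborel))"
      unfolding Q_def by (subst nn_integral_cmult) (auto simp: nn_integral_convolution)
    also have "\<dots> = ennreal (c' * W * W) * ((\<integral>\<^sup>+x. ennreal (norm (K x) powr p) \<partial>lborel) * (\<integral>\<^sup>+x. ennreal (norm (g x) powr p) \<partial>lborel))"
      unfolding intI intJ using c' W by (simp add: ennreal_mult mult_ac)
    finally show "(\<integral>\<^sup>+x. epowr (\<integral>\<^sup>+y. ennreal (norm (K (x - y)) * norm (g y)) \<partial>lborel) p \<partial>lborel)
      \<le> ennreal (c' * W * W) * ((\<integral>\<^sup>+x. ennreal (norm (K x) powr p) \<partial>lborel) * (\<integral>\<^sup>+x. ennreal (norm (g x) powr p) \<partial>lborel))" .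
  qed
qed

text \<open>For fixed \<open>x\<close>, Jensen with the weight \<open>|K (x - y)|\<close> of mass
  \<open>W\<close>, then Tonelli: the former gives \<open>W^(p-1)\<close>, the latter
  \<open>W\<close>.\<close>

lemma young_inequality:
  fixes K g :: "'a::euclidean_space \<Rightarrow> complex"
  assumes [measurable]: "K \<in> borel_measurable borel" "g \<in> borel_measurable borel" and p: "1 \<le> p"
    and fin: "(\<integral>\<^sup>+x. ennreal (norm (K x)) \<partial>lborel) < \<top>"
  shows "(\<integral>\<^sup>+x. epowr (\<integral>\<^sup>+y. ennreal (norm (K (x - y)) * norm (g y)) \<partial>lborel) p \<partial>lborel)
      \<le> epowr (\<integral>\<^sup>+x. ennreal (norm (K x)) \<partial>lborel) p * (\<integral>\<^sup>+x. ennreal (norm (g x) powr p) \<partial>lborel)"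
proof -
  obtain W where W: "(\<integral>\<^sup>+x. ennreal (norm (K x)) \<partial>lborel) = ennreal W" "0 \<le> W"
    using fin by (cases "\<integral>\<^sup>+x. ennreal (norm (K x)) \<partial>lborel") auto
  have "(\<integral>\<^sup>+x. epowr (\<integral>\<^sup>+y. ennreal (norm (K (x - y)) * norm (g y)) \<partial>lborel) p \<partial>lborel)
      \<le> (\<integral>\<^sup>+x. ennreal (W powr (p - 1)) * (\<integral>\<^sup>+y. ennreal (norm (K (x - y)) * norm (g y) powr p) \<partial>lborel) \<partial>lborel)"
  proof (intro nn_integral_mono jensen_powr)
    fix x
    show "(\<integral>\<^sup>+y. ennreal (norm (K (x - y))) \<partial>lborel) = ennreal W"
      using nn_integral_lborel_reflect[of "\<lambda>y. ennreal (norm (K y))" x] W by simp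
  qed (use p W in auto)
  also have "\<dots> = ennreal (W powr (p - 1)) * (\<integral>\<^sup>+x. (\<integral>\<^sup>+y. ennreal (norm (K (x - y))) * ennreal (norm (g y) powr p) \<partial>lborel) \<partial>lborel)"
    by (subst nn_integral_cmult) (auto simp: ennreal_mult)
  also have "\<dots> = ennreal (W powr (p - 1)) * (ennreal W * (\<integral>\<^sup>+x. ennreal (norm (g x) powr p) \<partial>lborel))"
    by (subst nn_integral_convolution) (auto simp: W)
  also have "ennreal (W powr (p - 1)) * (ennreal W * (\<integral>\<^sup>+x. ennreal (norm (g x) powr p) \<partial>lborel))
      = ennreal (W powr p) * (\<integral>\<^sup>+x. ennreal (norm (g x) powr p) \<partial>lborel)"
  proof (cases "W = 0")
    case False
    then have "W powr (p - 1) * W = W powr p" using W by (simp add: powr_diff)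
    then show ?thesis using W by (simp add: mult.assoc[symmetric] ennreal_mult[symmetric])
  qed simp
  finally show ?thesis using W by (simp add: epowr_ennreal)
qed

lemma norm_convolution_le_nn_integral:
  fixes K g :: "'a::euclidean_space \<Rightarrow> complex"
  assumes [measurable]: "K \<in> borel_measurable borel" "g \<in> borel_measurable borel"
  shows "ennreal (norm (convolution K g x)) \<le> (\<integral>\<^sup>+y. ennreal (norm (K (x - y)) * norm (g y)) \<partial>lborel)"
  using integral_norm_bound_ennreal[of lborel "\<lambda>y. K (x - y) * g y"]
  by (cases "integrable lborel (\<lambda>y. K (x - y) * g y)")
     (auto simp: convolution_lborel norm_mult not_integrable_integral_eq)

text \<open>The exponent \<open>min 1 p\<close> records which argument is at work: the classical
  inequality with an \<open>L^1\<close> kernel from 1 upwards, its replacement with an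
  \<open>L^p\<close> kernel below. Constants depend only on \<open>p\<close> and the two reproducing
  functions.\<close>

theorem convolution_Lp_bound:
  fixes \<Psi> \<Theta> :: "'a::euclidean_space \<Rightarrow> complex"
  assumes \<Psi>: "\<Psi> \<in> schwartz" and \<Theta>: "\<Theta> \<in> schwartz" and p: "0 < p"
  shows "\<exists>C\<ge>0. \<forall>K g. nice_kernel K \<longrightarrow> reproduced_by \<Psi> K \<longrightarrow> reproduced_by \<Theta> g \<longrightarrow>
    Lp_norm p UNIV (convolution K g) \<le> ennreal C * Lp_norm (min 1 p) UNIV K * Lp_norm p UNIV g"
proof -
  have meas: "K \<in> borel_measurable borel" "g \<in> borel_measurable borel" "convolution K g \<in> borel_measurable borel"
    if "nice_kernel K" "reproduced_by \<Theta> g" for K g :: "'a \<Rightarrow> complex"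
    using that by (auto intro: nice_kernel_measurable bounded_cont_measurable bounded_cont_convolution reproduced_by_bounded_cont)
  have K1: "Lp_norm 1 UNIV K = (\<integral>\<^sup>+x. ennreal (norm (K x)) \<partial>lborel)" if "nice_kernel K" for K :: "'a \<Rightarrow> complex"
    using Lp_norm_finite_exponent[of 1 UNIV K] nice_kernel_measurable[OF that] by simp
  have Kfin: "(\<integral>\<^sup>+x. ennreal (norm (K x)) \<partial>lborel) < \<top>" if "nice_kernel K" for K :: "'a \<Rightarrow> complex"
    using nice_kernel_integrable[OF that] by (simp add: integrable_iff_bounded)
  consider "p = \<infinity>" | p' where "p = ennreal p'" "0 < p'" "p' \<le> 1" | p' where "p = ennreal p'" "1 \<le> p'"
    using p by (cases p) (force simp: ennreal_less_zero_iff)+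
  then show ?thesis
  proof cases
    case 1
    show ?thesis
    proof (intro exI[of _ 1] conjI allI impI)
      fix K g :: "'a \<Rightarrow> complex" assume K: "nice_kernel K" and "reproduced_by \<Psi> K" and g: "reproduced_by \<Theta> g"
      note [measurable] = meas[OF K g]
      let ?N = "Lp_norm p UNIV g"
      have "ennreal (norm (convolution K g x)) \<le> Lp_norm 1 UNIV K * ?N" for x
      proof -
        have "ennreal (norm (convolution K g x)) \<le> (\<integral>\<^sup>+y. ennreal (norm (K (x - y)) * norm (g y)) \<partial>lborel)"
          by (rule norm_convolution_le_nn_integral) measurable
        also have "\<dots> \<le> (\<integral>\<^sup>+y. ennreal (norm (K (x - y))) * ?N \<partial>lborel)"
        proof (intro nn_integral_mono_AE)
          have "AE y in lborel. ennreal (norm (g y)) \<le> ?N" using Lp_norm_top_AE[of UNIV g] 1 by simp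
          then show "AE y in lborel. ennreal (norm (K (x - y)) * norm (g y)) \<le> ennreal (norm (K (x - y))) * ?N"
            by eventually_elim (simp add: ennreal_mult mult_left_mono)
        qed
        also have "\<dots> = Lp_norm 1 UNIV K * ?N"
          using nn_integral_lborel_reflect[of "\<lambda>y. ennreal (norm (K y))" x]
          by (simp add: nn_integral_multc K1[OF K])
        finally show ?thesis .
      qed
      then show "Lp_norm p UNIV (convolution K g) \<le> ennreal 1 * Lp_norm (min 1 p) UNIV K * ?N"
        using 1 Lp_norm_top_le[of "convolution K g" "Lp_norm 1 UNIV K * ?N"] by simp
    qed simp
  next
    case (2 p')
    obtain C where C: "0 \<le> C" "\<And>K g. reproduced_by \<Psi> K \<Longrightarrow> reproduced_by \<Theta> g \<Longrightarrow>
      (\<integral>\<^sup>+x. epowr (\<integral>\<^sup>+y. ennreal (norm (K (x - y)) * norm (g y)) \<partial>lborel) p' \<partial>lborel)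
      \<le> ennreal C * ((\<integral>\<^sup>+x. ennreal (norm (K x) powr p') \<partial>lborel) * (\<integral>\<^sup>+x. ennreal (norm (g x) powr p') \<partial>lborel))"
      using quasi_young_inequality[OF \<Psi> \<Theta> 2(2,3)] by blast
    have m: "min 1 p = p" using 2 by (simp add: min_def ennreal_le_1)
    show ?thesis
    proof (intro exI[of _ "C powr (1 / p')"] conjI allI impI)
      fix K g :: "'a \<Rightarrow> complex" assume K: "nice_kernel K" "reproduced_by \<Psi> K" and g: "reproduced_by \<Theta> g"
      note [measurable] = meas[OF K(1) g]
      have "(\<integral>\<^sup>+x. ennreal (norm (convolution K g x) powr p') \<partial>lborel)
        \<le> (\<integral>\<^sup>+x. epowr (\<integral>\<^sup>+y. ennreal (norm (K (x - y)) * norm (g y)) \<partial>lborel) p' \<partial>lborel)"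
        using 2 by (intro nn_integral_mono) (auto simp: epowr_ennreal[symmetric] intro!: epowr_mono norm_convolution_le_nn_integral)
      also note C(2)[OF K(2) g]
      finally have "epowr (\<integral>\<^sup>+x. ennreal (norm (convolution K g x) powr p') \<partial>lborel) (1 / p')
        \<le> epowr (ennreal C * ((\<integral>\<^sup>+x. ennreal (norm (K x) powr p') \<partial>lborel) * (\<integral>\<^sup>+x. ennreal (norm (g x) powr p') \<partial>lborel))) (1 / p')"
        using 2 by (intro epowr_mono) auto
      then show "Lp_norm p UNIV (convolution K g) \<le> ennreal (C powr (1 / p')) * Lp_norm (min 1 p) UNIV K * Lp_norm p UNIV g"
        unfolding m using 2 C(1) by (simp add: Lp_norm_finite_exponent epowr_mult epowr_ennreal mult.assoc)
    qed simp
  next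
    case (3 p')
    then have p0: "0 < p'" by simp
    have m: "min 1 p = 1" using 3 by (simp add: min_def)
    show ?thesis
    proof (intro exI[of _ 1] conjI allI impI)
      fix K g :: "'a \<Rightarrow> complex" assume K: "nice_kernel K" and "reproduced_by \<Psi> K" and g: "reproduced_by \<Theta> g"
      note [measurable] = meas[OF K g]
      have "(\<integral>\<^sup>+x. ennreal (norm (convolution K g x) powr p') \<partial>lborel)
        \<le> (\<integral>\<^sup>+x. epowr (\<integral>\<^sup>+y. ennreal (norm (K (x - y)) * norm (g y)) \<partial>lborel) p' \<partial>lborel)"
        using p0 by (intro nn_integral_mono) (auto simp: epowr_ennreal[symmetric] intro!: epowr_mono norm_convolution_le_nn_integral)
      also have "\<dots> \<le> epowr (\<integral>\<^sup>+x. ennreal (norm (K x)) \<partial>lborel) p' * (\<integral>\<^sup>+x. ennreal (norm (g x) powr p') \<partial>lborel)"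
        by (rule young_inequality) (use 3 Kfin[OF K] in auto)
      finally have "epowr (\<integral>\<^sup>+x. ennreal (norm (convolution K g x) powr p') \<partial>lborel) (1 / p')
        \<le> epowr (epowr (\<integral>\<^sup>+x. ennreal (norm (K x)) \<partial>lborel) p' * (\<integral>\<^sup>+x. ennreal (norm (g x) powr p') \<partial>lborel)) (1 / p')"
        using p0 by (intro epowr_mono) auto
      then show "Lp_norm p UNIV (convolution K g) \<le> ennreal 1 * Lp_norm (min 1 p) UNIV K * Lp_norm p UNIV g"
        unfolding m using 3 p0 by (simp add: Lp_norm_finite_exponent epowr_mult epowr_epowr K1[OF K])
    qed simp
  qed
qed

text \<open>Converts control of the \<open>L^r\<close> quasi-norm, all that a Herz quasi-norm gives,
  into integrability of the kernel. The factor \<open>max 1 (sup_weight 0 \<Psi>)\<close> makes one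
  multiple of the \<open>r\<close>-th power integral dominate both that integral and the supremum,
  as \<open>epowr_integral_le\<close> demands.\<close>

lemma L1_le_Lr:
  fixes \<Psi> :: "'a::euclidean_space \<Rightarrow> complex"
  assumes \<Psi>: "\<Psi> \<in> schwartz" and r: "0 < r" "r \<le> 1"
  shows "\<exists>C\<ge>0. \<forall>K. reproduced_by \<Psi> K \<longrightarrow>
    (\<integral>\<^sup>+x. ennreal (norm (K x)) \<partial>lborel) \<le> ennreal C * Lp_norm (ennreal r) UNIV K"
proof (intro exI[of _ "max 1 (sup_weight 0 \<Psi>) powr (1 / r)"] conjI allI impI)
  fix K assume K: "reproduced_by \<Psi> K"
  have b: "bounded_cont K" and rep: "convolution \<Psi> K = K" using K by (auto simp: reproduced_by_def)
  note Km [measurable] = bounded_cont_measurable[OF b]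
  let ?I = "\<integral>\<^sup>+x. ennreal (norm (K x) powr r) \<partial>lborel"
  obtain A where A: "\<And>x. norm (K x) \<le> A" using bounded_contD[OF b] by blast
  have "epowr (\<integral>\<^sup>+x. ennreal (norm (K x)) \<partial>lborel) r \<le> ennreal (max 1 (sup_weight 0 \<Psi>)) * ?I"
  proof (rule epowr_integral_le[OF _ _ r])
    show "ennreal (norm (K x) powr r) \<le> ennreal (max 1 (sup_weight 0 \<Psi>)) * ?I" for x
    proof -
      have "ennreal (norm (K x) powr r) \<le> ennreal (sup_weight 0 \<Psi>) * ?I"
        by (rule sup_powr_le_integral[OF \<Psi> Km rep _ r, of A 0]) (simp add: A)
      also have "\<dots> \<le> ennreal (max 1 (sup_weight 0 \<Psi>)) * ?I" by (intro mult_right_mono ennreal_leI) auto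
      finally show ?thesis .
    qed
    have "1 * ?I \<le> ennreal (max 1 (sup_weight 0 \<Psi>)) * ?I"
      by (intro mult_right_mono) (auto simp: ennreal_1[symmetric] simp del: ennreal_1 intro!: ennreal_leI)
    then show "?I \<le> ennreal (max 1 (sup_weight 0 \<Psi>)) * ?I" by simp
  qed auto
  from epowr_le_imp[OF this r(1)]
  show "(\<integral>\<^sup>+x. ennreal (norm (K x)) \<partial>lborel) \<le> ennreal (max 1 (sup_weight 0 \<Psi>) powr (1 / r)) * Lp_norm (ennreal r) UNIV K"
    using r by (simp add: epowr_mult epowr_ennreal Lp_norm_finite_exponent)
qed simp

section \<open>Herz quasi-norms of band-limited kernels\<close>

lemma herz_shell_borel [measurable]: "herz_shell k \<in> sets borel"
  unfolding herz_shell_def by (cases "k = 0") auto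

lemma herz_shell_norm_le: "x \<in> herz_shell k \<Longrightarrow> norm x \<le> 2 ^ (k + 1)"
  by (auto simp: herz_shell_def split: if_splits)

lemma herz_shell_norm_ge: "x \<in> herz_shell k \<Longrightarrow> 0 < k \<Longrightarrow> 2 ^ k < norm x"
  by (auto simp: herz_shell_def split: if_splits)

lemma disjoint_herz_shell: "disjoint_family herz_shell"
proof -
  have "x \<notin> herz_shell k" if x: "x \<in> herz_shell j" and "j < k" for x :: 'a and j k
  proof
    assume "x \<in> herz_shell k"
    then have "(2::real) ^ k < norm x" using \<open>j < k\<close> by (intro herz_shell_norm_ge) auto
    also have "\<dots> \<le> 2 ^ (j + 1)" by (rule herz_shell_norm_le[OF x])
    also have "\<dots> \<le> 2 ^ k" using \<open>j < k\<close> by (intro power_increasing) auto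
    finally show False by simp
  qed
  then show ?thesis unfolding disjoint_family_on_def by (metis disjoint_iff linorder_neqE_nat)
qed

lemma UN_herz_shell: "(\<Union>k. herz_shell k) = UNIV"
proof -
  have "\<exists>k. x \<in> herz_shell k" for x :: 'a
  proof (cases "norm x \<le> 2")
    case True
    then have "x \<in> herz_shell 0" by (simp add: herz_shell_def)
    then show ?thesis by blast
  next
    case False
    obtain n :: nat where n: "norm x < 2 ^ n" using real_arch_pow[of 2 "norm x"] by auto
    define m where "m = (LEAST n. norm x \<le> 2 ^ n)"
    have m: "norm x \<le> 2 ^ m" unfolding m_def by (rule LeastI[of _ n]) (use n in simp)
    have "m \<noteq> 0" using m False by (intro notI) simp
    moreover have "m \<noteq> 1" using m False by (intro notI) simp
    ultimately obtain k where k: "m = Suc k" "k \<noteq> 0" by (cases m) auto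
    have "\<not> norm x \<le> 2 ^ k" using not_less_Least[of k "\<lambda>n. norm x \<le> 2 ^ n"] k by (simp add: m_def)
    then have "x \<in> herz_shell k" using m k by (simp add: herz_shell_def)
    then show ?thesis by blast
  qed
  then show ?thesis by blast
qed

lemma nn_integral_herz_shells:
  fixes F :: "'a::euclidean_space \<Rightarrow> ennreal"
  assumes "F \<in> borel_measurable borel"
  shows "(\<integral>\<^sup>+x. F x \<partial>lborel) = (\<Sum>k. \<integral>\<^sup>+x\<in>herz_shell k. F x \<partial>lborel)"
  using nn_integral_disjoint_family[of F lborel herz_shell] assms disjoint_herz_shell
  by (simp add: UN_herz_shell)

lemma epowr_herz_norm:
  assumes r: "0 < r"
  shows "epowr (herz_norm u s (ennreal r) f) r
    = (\<Sum>k. ennreal (2 powr (s * r * real k)) * epowr (Lp_norm u (herz_shell k) f) r)"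
proof -
  have "epowr (herz_norm u s (ennreal r) f) r = (\<Sum>k. epowr (ennreal (2 powr (s * real k)) * Lp_norm u (herz_shell k) f) r)"
    using r by (simp add: herz_norm_def lq_norm_def epowr_epowr infsum_suminf_ennreal)
  also have "\<dots> = (\<Sum>k. ennreal (2 powr (s * r * real k)) * epowr (Lp_norm u (herz_shell k) f) r)"
    using r by (simp add: epowr_mult epowr_ennreal powr_powr mult_ac)
  finally show ?thesis .
qed

section \<open>Exponents \<open>u <= r\<close>: interaction between the shells\<close>

lemma powr_le_powr_imp_le:
  fixes x y :: real
  assumes "x powr a \<le> y" "0 < a" "0 \<le> x"
  shows "x \<le> y powr (1 / a)"
proof -
  have "(x powr a) powr (1 / a) \<le> y powr (1 / a)" using assms by (intro powr_mono2) auto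
  then show ?thesis using assms by (simp add: powr_powr)
qed

text \<open>With truncated subtraction on \<open>nat\<close> the exponent is \<open>|i - j|\<close>.
  The leading 2 is the loss in \<open>weight_shells_le\<close>.\<close>

definition shell_gap :: "nat \<Rightarrow> nat \<Rightarrow> real" where
  "shell_gap i j = 2 * (1 / 2) ^ ((i - j) + (j - i))"

lemma shell_gap_nonneg [simp]: "0 \<le> shell_gap i j"
  by (simp add: shell_gap_def)

lemma shell_gap_commute: "shell_gap i j = shell_gap j i"
  by (simp add: shell_gap_def add.commute)

lemma suminf_shell_gap_le: "(\<Sum>i. ennreal (shell_gap i j)) \<le> ennreal 8"
proof -
  have s1: "summable (\<lambda>i. (1 / 2 :: real) ^ ((i - j) + (j - i)))"
    by (subst summable_iff_shift[of _ j, symmetric]) (simp add: summable_geometric)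
  have "(\<Sum>i. (1 / 2 :: real) ^ ((i - j) + (j - i))) = (\<Sum>i. (1 / 2) ^ i) + (\<Sum>i<j. (1 / 2) ^ (j - i))"
    by (subst suminf_split_initial_segment[OF s1, of j]) simp
  also have "(\<Sum>i<j. (1 / 2 :: real) ^ (j - i)) = (\<Sum>i<j. (1 / 2) ^ Suc i)"
    by (rule sum.reindex_bij_witness[of _ "\<lambda>i. j - Suc i" "\<lambda>i. j - Suc i"])
       (auto simp: Suc_diff_Suc simp del: power_Suc)
  also have "\<dots> \<le> (\<Sum>i. (1 / 2 :: real) ^ Suc i)"
    by (rule sum_le_suminf) (auto intro: summable_mult summable_geometric)
  also have "(\<Sum>i. (1 / 2 :: real) ^ Suc i) = 1" using sums_unique[OF power_half_series] by simp
  also have "(\<Sum>i. (1 / 2 :: real) ^ i) = 2" by (simp add: suminf_geometric)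
  \<comment> \<open>Indices \<open>i >= j\<close> contribute 2 and indices \<open>i < j\<close> at
    most 1, both doubled by the factor in \<open>shell_gap\<close>; 8 is a round upper
    bound.\<close>
  finally have le: "(\<Sum>i. shell_gap i j) \<le> 2 * (2 + 1)"
    using s1 by (simp add: shell_gap_def suminf_mult)
  have "(\<Sum>i. ennreal (shell_gap i j)) = ennreal (\<Sum>i. shell_gap i j)"
    using s1 by (intro suminf_ennreal2) (auto simp: shell_gap_def summable_mult)
  also have "\<dots> \<le> ennreal 8" by (intro ennreal_leI order_trans[OF le]) simp
  finally show ?thesis .
qed

text \<open>Points in shells whose indices differ by at least 2 are farther apart than half the
  inner radius of the outer shell, so the first power of the distance already gives decay
  \<open>2^(-|i-j|)\<close>. For equal or adjacent shells the right side is at least 1.\<close>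

lemma weight_shells_le:
  assumes z: "z \<in> herz_shell j" and y: "y \<in> herz_shell i" and a: "1 \<le> a"
  shows "weight a (z - y) \<le> shell_gap i j"
proof -
  have main: "2 ^ (k - l) \<le> 2 * (1 + norm (x - w))" if "x \<in> herz_shell k" "w \<in> herz_shell l" for x w :: 'a and k l
  proof (cases "l + 2 \<le> k")
    case True
    have "(2::real) ^ (l + 1) \<le> 2 ^ (k - 1)" using True by (intro power_increasing) auto
    moreover have "(2::real) ^ k = 2 * 2 ^ (k - 1)" using True by (cases k) auto
    moreover have "2 ^ k < norm x" "norm w \<le> 2 ^ (l + 1)"
      using True that by (auto intro: herz_shell_norm_ge dest: herz_shell_norm_le)
    moreover have "norm x \<le> norm w + norm (x - w)" using norm_triangle_ineq[of w "x - w"] by simp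
    ultimately have "(2::real) ^ k \<le> 2 * norm (x - w)" by linarith
    moreover have "(2::real) ^ (k - l) \<le> 2 ^ k" by (intro power_increasing) auto
    ultimately have "(2::real) ^ (k - l) \<le> 2 * norm (x - w)" by linarith
    then show ?thesis by simp
  next
    case False
    then have "(2::real) ^ (k - l) \<le> 2 ^ 1" by (intro power_increasing) auto
    then have "(2::real) ^ (k - l) \<le> 2" by simp
    also have "\<dots> \<le> 2 * (1 + norm (x - w))" by simp
    finally show ?thesis .
  qed
  have e: "(i - j) + (j - i) = (if i \<le> j then j - i else i - j)" by simp
  have "2 ^ ((i - j) + (j - i)) \<le> 2 * (1 + norm (z - y))"
    using main[OF z y] main[OF y z] unfolding e by (simp add: norm_minus_commute)
  then have "inverse (1 + norm (z - y)) \<le> shell_gap i j"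
    by (simp add: shell_gap_def power_one_over field_simps add_pos_nonneg)
  moreover have "weight a (z - y) \<le> inverse (1 + norm (z - y))"
  proof -
    have "weight a (z - y) \<le> weight (real 1) (z - y)" using a by (intro weight_mono) simp
    also have "\<dots> = inverse (1 + norm (z - y))" unfolding weight_nat by simp
    finally show ?thesis .
  qed
  ultimately show ?thesis by linarith
qed

text \<open>For \<open>u < r\<close> the \<open>L^r\<close> quasi-norm on a shell needs a supremum
  besides the \<open>L^u\<close> quasi-norm. Peetre's inequality bounds this supremum by all shell
  masses \<open>a i\<close>, discounted by \<open>shell_gap i j\<close>. The discounts are summable
  in either index, so Jensen and a Schur type summation lead back to the sum of the
  \<open>a i\<close> to the power \<open>r/u\<close>, which is the Herz quasi-norm to the power
  \<open>r\<close>.\<close>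

lemma Lr_le_herz_small_exponent:
  fixes \<Psi> :: "'a::euclidean_space \<Rightarrow> complex"
  assumes \<Psi>: "\<Psi> \<in> schwartz" and u: "0 < u" "u \<le> r" and r: "r \<le> 1"
  shows "\<exists>C\<ge>0. \<forall>K. reproduced_by \<Psi> K \<longrightarrow>
    (\<integral>\<^sup>+x. ennreal (norm (K x) powr r) \<partial>lborel) \<le> ennreal C * epowr (herz_norm (ennreal u) 0 (ennreal r) K) r"
proof -
  define \<rho> where "\<rho> = r / u"
  have r0: "0 < r" and \<rho>: "1 \<le> \<rho>" using u by (auto simp: \<rho>_def)
  \<comment> \<open>Makes \<open>n u >= 1\<close>, the decay that \<open>weight_shells_le\<close>
    asks for.\<close>
  define n where "n = nat \<lceil>1 / u\<rceil>"
  have n: "1 \<le> real n * u"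
  proof -
    have "1 / u \<le> real n" unfolding n_def by linarith
    then show ?thesis using u by (simp add: field_simps)
  qed
  define B where "B = sup_weight n \<Psi>"
  have B: "0 \<le> B" unfolding B_def by (rule sup_weight_nonneg[OF \<Psi>])
  \<comment> \<open>The Peetre constant raised to \<open>\<rho> = r/u\<close>, times the Jensen
    factor for gaps of total mass at most 8.\<close>
  define D where "D = B powr \<rho> * 8 powr (\<rho> - 1)"
  have D: "0 \<le> D" by (simp add: D_def)
  show ?thesis
  \<comment> \<open>The 1 comes from the term \<open>b j powr \<rho>\<close>, the
    \<open>D * 8\<close> from \<open>D * S j\<close> after summation over \<open>j\<close>.\<close>
  proof (intro exI[of _ "1 + D * 8"] conjI allI impI)
    show "0 \<le> 1 + D * 8" using D by simp
    fix K assume K: "reproduced_by \<Psi> K"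
    note Km [measurable] = bounded_cont_measurable[OF reproduced_by_bounded_cont[OF K]]
    define a where "a i = (\<integral>\<^sup>+x\<in>herz_shell i. ennreal (norm (K x) powr u) \<partial>lborel)" for i
    define T where "T = (\<Sum>i. epowr (a i) \<rho>)"
    have herz: "epowr (herz_norm (ennreal u) 0 (ennreal r) K) r = T"
      using u r0 by (simp add: epowr_herz_norm T_def a_def Lp_norm_finite_exponent epowr_epowr \<rho>_def)
    show "(\<integral>\<^sup>+x. ennreal (norm (K x) powr r) \<partial>lborel) \<le> ennreal (1 + D * 8) * epowr (herz_norm (ennreal u) 0 (ennreal r) K) r"
      unfolding herz
    proof (cases "T = \<top>")
      case True
      have "0 < 1 + D * 8" using D by simp
      then show "(\<integral>\<^sup>+x. ennreal (norm (K x) powr r) \<partial>lborel) \<le> ennreal (1 + D * 8) * T"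
        using True by (simp add: ennreal_mult_top)
    next
      case False
      have fin: "a i < \<top>" for i
      proof -
        have "epowr (a i) \<rho> \<le> T" unfolding T_def using sum_le_suminf[of "\<lambda>i. epowr (a i) \<rho>" "{i}"] by simp
        then have "epowr (a i) \<rho> \<noteq> \<top>" using False by (auto simp: top_unique)
        then show ?thesis by (simp add: top.not_eq_extremum[symmetric])
      qed
      define b where "b i = enn2real (a i)" for i
      have b: "a i = ennreal (b i)" "0 \<le> b i" for i using fin[of i] by (auto simp: b_def)
      define S where "S j = (\<Sum>i. ennreal (shell_gap i j) * ennreal (b i powr \<rho>))" for j
      have shell: "(\<integral>\<^sup>+x\<in>herz_shell j. ennreal (norm (K x) powr r) \<partial>lborel) \<le> ennreal (b j powr \<rho>) + ennreal D * S j" for j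
      proof (cases "ennreal D * S j = \<top>")
        case True
        then show ?thesis by simp
      next
        case S: False
        then obtain \<sigma> where \<sigma>: "ennreal D * S j = ennreal \<sigma>" "0 \<le> \<sigma>" by (cases "ennreal D * S j") auto
        have pt: "ennreal (norm (K z) powr r) \<le> ennreal D * S j" if z: "z \<in> herz_shell j" for z
        proof -
          have "ennreal (norm (K z) powr u) \<le> ennreal B * (\<integral>\<^sup>+y. ennreal (norm (K y) powr u * weight (real n * u) (z - y)) \<partial>lborel)"
            using peetre_reproduced[OF \<Psi> K u(1), of z n z] u r by (simp add: B_def weight_def)
          also have "(\<integral>\<^sup>+y. ennreal (norm (K y) powr u * weight (real n * u) (z - y)) \<partial>lborel)
            = (\<Sum>i. \<integral>\<^sup>+y\<in>herz_shell i. ennreal (norm (K y) powr u * weight (real n * u) (z - y)) \<partial>lborel)"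
            by (rule nn_integral_herz_shells) measurable
          also have "\<dots> \<le> (\<Sum>i. ennreal (shell_gap i j * b i))"
          proof (intro suminf_le summableI)
            fix i
            have "(\<integral>\<^sup>+y\<in>herz_shell i. ennreal (norm (K y) powr u * weight (real n * u) (z - y)) \<partial>lborel)
              \<le> (\<integral>\<^sup>+y. ennreal (shell_gap i j) * (ennreal (norm (K y) powr u) * indicator (herz_shell i) y) \<partial>lborel)"
            proof (intro nn_integral_mono)
              fix y
              show "ennreal (norm (K y) powr u * weight (real n * u) (z - y)) * indicator (herz_shell i) y
                \<le> ennreal (shell_gap i j) * (ennreal (norm (K y) powr u) * indicator (herz_shell i) y)"
              proof (cases "y \<in> herz_shell i")
                case True
                have "norm (K y) powr u * weight (real n * u) (z - y) \<le> norm (K y) powr u * shell_gap i j"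
                  by (intro mult_left_mono weight_shells_le[OF z True n]) simp
                then show ?thesis using True by (simp add: ennreal_mult[symmetric] mult.commute ennreal_leI)
              qed simp
            qed
            also have "\<dots> = ennreal (shell_gap i j) * a i" unfolding a_def by (rule nn_integral_cmult) measurable
            also have "\<dots> = ennreal (shell_gap i j * b i)" by (simp add: b ennreal_mult)
            finally show "(\<integral>\<^sup>+y\<in>herz_shell i. ennreal (norm (K y) powr u * weight (real n * u) (z - y)) \<partial>lborel) \<le> ennreal (shell_gap i j * b i)" .
          qed
          finally have 1: "ennreal (norm (K z) powr u) \<le> ennreal B * (\<Sum>i. ennreal (shell_gap i j * b i))"
            by (simp add: mult_left_mono)
          have "(\<Sum>i. ennreal (shell_gap i j)) < \<top>"
            by (rule le_less_trans[OF suminf_shell_gap_le]) simp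
          then obtain W where W: "(\<Sum>i. ennreal (shell_gap i j)) = ennreal W" "0 \<le> W"
            using less_top_ennreal by blast
          have W8: "W \<le> 8" using suminf_shell_gap_le[of j] unfolding W by (subst (asm) ennreal_le_iff) auto
          have "ennreal (norm (K z) powr r) = epowr (ennreal (norm (K z) powr u)) \<rho>"
            using u by (simp add: epowr_ennreal powr_powr \<rho>_def)
          also have "\<dots> \<le> epowr (ennreal B * (\<Sum>i. ennreal (shell_gap i j * b i))) \<rho>"
            using \<rho> by (intro epowr_mono 1) simp
          also have "\<dots> = ennreal (B powr \<rho>) * epowr (\<Sum>i. ennreal (shell_gap i j * b i)) \<rho>"
            using \<rho> B by (simp add: epowr_mult epowr_ennreal)
          also have "epowr (\<Sum>i. ennreal (shell_gap i j * b i)) \<rho> \<le> ennreal (W powr (\<rho> - 1)) * (\<Sum>i. ennreal (shell_gap i j * b i powr \<rho>))"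
          proof -
            have "epowr (\<integral>\<^sup>+i. ennreal (shell_gap i j * b i) \<partial>count_space UNIV) \<rho>
              \<le> ennreal (W powr (\<rho> - 1)) * (\<integral>\<^sup>+i. ennreal (shell_gap i j * b i powr \<rho>) \<partial>count_space UNIV)"
              by (rule jensen_powr) (use W b(2) \<rho> in \<open>simp_all add: nn_integral_count_space_nat\<close>)
            then show ?thesis by (simp only: nn_integral_count_space_nat)
          qed
          also have "(\<Sum>i. ennreal (shell_gap i j * b i powr \<rho>)) = S j" by (simp add: S_def ennreal_mult)
          also have "ennreal (W powr (\<rho> - 1)) * S j \<le> ennreal (8 powr (\<rho> - 1)) * S j"
            using W W8 \<rho> by (intro mult_right_mono ennreal_leI powr_mono2) auto
          finally show ?thesis by (simp add: D_def ennreal_mult mult.assoc mult_left_mono)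
        qed
        \<comment> \<open>Balances two bounds: \<open>|K|^r <= m\<close> on the shell and
          \<open>b j <= m^(u/r)\<close>. Writing \<open>|K|^r = |K|^u |K|^(r-u)\<close> and
          integrating gives at most \<open>m^((r-u)/r) m^(u/r) = m\<close>.\<close>
        define m where "m = max \<sigma> (b j powr \<rho>)"
        have m: "0 \<le> m" using \<sigma> by (simp add: m_def)
        have "norm (K z) powr r \<le> norm (K z) powr u * m powr ((r - u) / r)" if z: "z \<in> herz_shell j" for z
        proof -
          have "norm (K z) powr r \<le> m" using pt[OF z] \<sigma> by (simp add: m_def le_max_iff_disj)
          then have "norm (K z) \<le> m powr (1 / r)" by (rule powr_le_powr_imp_le) (use r0 in auto)
          then have "norm (K z) powr (r - u) \<le> (m powr (1 / r)) powr (r - u)" using u by (intro powr_mono2) auto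
          then have "norm (K z) powr u * norm (K z) powr (r - u) \<le> norm (K z) powr u * m powr ((r - u) / r)"
            by (intro mult_left_mono) (auto simp: powr_powr)
          then show ?thesis by (simp add: powr_add[symmetric])
        qed
        then have "(\<integral>\<^sup>+x\<in>herz_shell j. ennreal (norm (K x) powr r) \<partial>lborel)
            \<le> (\<integral>\<^sup>+x. ennreal (m powr ((r - u) / r)) * (ennreal (norm (K x) powr u) * indicator (herz_shell j) x) \<partial>lborel)"
          by (intro nn_integral_mono) (auto simp: indicator_def ennreal_mult[symmetric] mult.commute intro!: ennreal_leI)
        also have "\<dots> = ennreal (m powr ((r - u) / r)) * a j" unfolding a_def by (rule nn_integral_cmult) measurable
        also have "\<dots> = ennreal (m powr ((r - u) / r) * b j)" by (simp add: b ennreal_mult)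
        also have "\<dots> \<le> ennreal m"
        proof (rule ennreal_leI)
          have "b j \<le> m powr (1 / \<rho>)" by (rule powr_le_powr_imp_le) (use \<rho> b in \<open>auto simp: m_def\<close>)
          then have "m powr ((r - u) / r) * b j \<le> m powr ((r - u) / r) * m powr (u / r)"
            by (intro mult_left_mono) (auto simp: \<rho>_def)
          also have "\<dots> = m"
            using m r0 by (simp add: powr_add[symmetric] add_divide_distrib[symmetric])
          finally show "m powr ((r - u) / r) * b j \<le> m" .
        qed
        also have "\<dots> \<le> ennreal (b j powr \<rho>) + ennreal D * S j"
          unfolding \<sigma>(1) using \<sigma>(2) by (simp add: m_def ennreal_plus[symmetric] del: ennreal_plus)
        finally show ?thesis .
      qed
      have Tb: "T = (\<Sum>i. ennreal (b i powr \<rho>))"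
        unfolding T_def using b by (simp add: epowr_ennreal)
      have "(\<integral>\<^sup>+x. ennreal (norm (K x) powr r) \<partial>lborel) = (\<Sum>j. \<integral>\<^sup>+x\<in>herz_shell j. ennreal (norm (K x) powr r) \<partial>lborel)"
        by (rule nn_integral_herz_shells) measurable
      also have "\<dots> \<le> (\<Sum>j. ennreal (b j powr \<rho>) + ennreal D * S j)"
        by (intro suminf_le summableI shell)
      also have "\<dots> = T + ennreal D * (\<Sum>j. S j)"
        by (simp add: Tb suminf_add[symmetric] summableI)
      \<comment> \<open>Summation in the other index: after interchanging the sums the gaps again
        add up to at most 8.\<close>
      also have "(\<Sum>j. S j) \<le> ennreal 8 * T"
      proof -
        have "(\<Sum>j. S j) = (\<integral>\<^sup>+j. (\<Sum>i. ennreal (shell_gap i j) * ennreal (b i powr \<rho>)) \<partial>count_space UNIV)"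
          by (simp only: S_def nn_integral_count_space_nat)
        also have "\<dots> = (\<Sum>i. \<integral>\<^sup>+j. ennreal (shell_gap i j) * ennreal (b i powr \<rho>) \<partial>count_space UNIV)"
          by (rule nn_integral_suminf) simp
        also have "\<dots> = (\<Sum>i. \<Sum>j. ennreal (shell_gap i j) * ennreal (b i powr \<rho>))"
          by (simp only: nn_integral_count_space_nat)
        also have "\<dots> \<le> (\<Sum>i. ennreal 8 * ennreal (b i powr \<rho>))"
        proof (intro suminf_le summableI)
          fix i
          have "(\<Sum>j. ennreal (shell_gap i j) * ennreal (b i powr \<rho>)) = (\<Sum>j. ennreal (shell_gap j i)) * ennreal (b i powr \<rho>)"
            by (simp add: shell_gap_commute[of i])
          also have "\<dots> \<le> ennreal 8 * ennreal (b i powr \<rho>)" by (intro mult_right_mono suminf_shell_gap_le) simp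
          finally show "(\<Sum>j. ennreal (shell_gap i j) * ennreal (b i powr \<rho>)) \<le> ennreal 8 * ennreal (b i powr \<rho>)" .
        qed
        also have "\<dots> = ennreal 8 * T" by (simp add: Tb)
        finally show ?thesis .
      qed
      finally have "(\<integral>\<^sup>+x. ennreal (norm (K x) powr r) \<partial>lborel) \<le> T + ennreal D * (ennreal 8 * T)"
        by (simp add: mult_left_mono add_left_mono)
      also have "\<dots> = ennreal (1 + D * 8) * T"
        using D by (simp add: ennreal_mult distrib_right mult.assoc)
      finally show "(\<integral>\<^sup>+x. ennreal (norm (K x) powr r) \<partial>lborel) \<le> ennreal (1 + D * 8) * T" .
    qed
  qed
qed

section \<open>Exponents \<open>u > r\<close>: volume of the shells\<close>

lemma emeasure_herz_shell_le:
  "emeasure lborel (herz_shell k :: 'a::euclidean_space set)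
    \<le> ennreal (unit_ball_vol (real DIM('a)) * 2 ^ DIM('a) * 2 powr (real DIM('a) * real k))"
proof -
  have "herz_shell k \<subseteq> cball (0::'a) (2 ^ (k + 1))" using herz_shell_norm_le by auto
  then have "emeasure lborel (herz_shell k :: 'a set) \<le> emeasure lborel (cball (0::'a) (2 ^ (k + 1)))"
    by (rule emeasure_mono) simp
  also have "\<dots> = ennreal (unit_ball_vol (real DIM('a)) * (2 ^ (k + 1)) ^ DIM('a))"
    by (rule emeasure_cball) simp
  also have "((2::real) ^ (k + 1)) ^ DIM('a) = 2 ^ DIM('a) * 2 powr (real DIM('a) * real k)"
  proof -
    have "2 powr (real DIM('a) * real k) = (2::real) ^ (DIM('a) * k)"
      by (simp add: powr_realpow[symmetric])
    then show ?thesis by (simp add: power_mult_distrib power_mult[symmetric] mult.commute)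
  qed
  finally show ?thesis by (simp add: mult.assoc)
qed

text \<open>Hoelder on shell \<open>k\<close> with exponent \<open>u/r\<close>: the volume to the
  power \<open>1 - r/u\<close> is of order \<open>2^(k d (1 - r/u)) = 2^(s r k)\<close>, which is
  the origin of \<open>s = d/r - d/u\<close>. The \<open>r\<close>-th powers then add up over the
  shells without loss.\<close>

lemma Lr_le_herz_large_exponent:
  fixes u :: ennreal
  assumes r: "0 < r" and u: "ennreal r < u"
  defines "s \<equiv> real DIM('a::euclidean_space) / r - real DIM('a) * enn2real (inverse u)"
  shows "\<exists>C\<ge>0. \<forall>K::'a \<Rightarrow> complex. bounded_cont K \<longrightarrow>
    (\<integral>\<^sup>+x. ennreal (norm (K x) powr r) \<partial>lborel) \<le> ennreal C * epowr (herz_norm u s (ennreal r) K) r"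
proof -
  define V where "V = unit_ball_vol (real DIM('a)) * 2 ^ DIM('a)"
  have V: "0 \<le> V" by (simp add: V_def)
  \<comment> \<open>Reduces \<open>u = \<infinity>\<close> and \<open>u\<close> finite alike to an
    estimate on a single shell.\<close>
  have sums: ?thesis if C: "0 \<le> C" and shell: "\<And>(K::'a \<Rightarrow> complex) k. bounded_cont K \<Longrightarrow>
     (\<integral>\<^sup>+x\<in>herz_shell k. ennreal (norm (K x) powr r) \<partial>lborel)
       \<le> ennreal C * (ennreal (2 powr (s * r * real k)) * epowr (Lp_norm u (herz_shell k) K) r)" for C
  proof (intro exI[of _ C] conjI allI impI C)
    fix K :: "'a \<Rightarrow> complex" assume K: "bounded_cont K"
    note [measurable] = bounded_cont_measurable[OF K]
    have "(\<integral>\<^sup>+x. ennreal (norm (K x) powr r) \<partial>lborel) = (\<Sum>j. \<integral>\<^sup>+x\<in>herz_shell j. ennreal (norm (K x) powr r) \<partial>lborel)"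
      by (rule nn_integral_herz_shells) measurable
    also have "\<dots> \<le> (\<Sum>k. ennreal C * (ennreal (2 powr (s * r * real k)) * epowr (Lp_norm u (herz_shell k) K) r))"
      by (intro suminf_le summableI shell K)
    also have "\<dots> = ennreal C * epowr (herz_norm u s (ennreal r) K) r"
      by (simp add: epowr_herz_norm[OF r])
    finally show "(\<integral>\<^sup>+x. ennreal (norm (K x) powr r) \<partial>lborel) \<le> ennreal C * epowr (herz_norm u s (ennreal r) K) r" .
  qed
  show ?thesis
  proof (cases u)
    case top
    have s: "s * r = real DIM('a)" using r top by (simp add: s_def)
    show ?thesis
    proof (rule sums[OF V])
      fix K :: "'a \<Rightarrow> complex" and k assume K: "bounded_cont K"
      note [measurable] = bounded_cont_measurable[OF K]
      let ?N = "Lp_norm u (herz_shell k) K"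
      have "(\<integral>\<^sup>+x\<in>herz_shell k. ennreal (norm (K x) powr r) \<partial>lborel) \<le> (\<integral>\<^sup>+x. epowr ?N r * indicator (herz_shell k :: 'a set) x \<partial>lborel)"
      proof (rule nn_integral_mono_AE)
        have "AE x in lborel. x \<in> herz_shell k \<longrightarrow> ennreal (norm (K x)) \<le> ?N"
          using Lp_norm_top_AE[of "herz_shell k" K] top by simp
        then show "AE x in lborel. ennreal (norm (K x) powr r) * indicator (herz_shell k) x \<le> epowr ?N r * indicator (herz_shell k) x"
        proof eventually_elim
          case (elim x)
          then have "x \<in> herz_shell k \<Longrightarrow> epowr (ennreal (norm (K x))) r \<le> epowr ?N r"
            using r by (intro epowr_mono) auto
          then show ?case by (auto simp: epowr_ennreal indicator_def)
        qed
      qed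
      also have "\<dots> = epowr ?N r * emeasure lborel (herz_shell k :: 'a set)"
        by (rule nn_integral_cmult_indicator) simp
      also have "\<dots> \<le> epowr ?N r * ennreal (V * 2 powr (real DIM('a) * real k))"
        using emeasure_herz_shell_le[of k, where 'a = 'a] unfolding V_def by (intro mult_left_mono) auto
      also have "\<dots> = ennreal V * (ennreal (2 powr (s * r * real k)) * epowr ?N r)"
        unfolding s using V by (simp add: ennreal_mult mult_ac)
      finally show "(\<integral>\<^sup>+x\<in>herz_shell k. ennreal (norm (K x) powr r) \<partial>lborel)
        \<le> ennreal V * (ennreal (2 powr (s * r * real k)) * epowr ?N r)" .
    qed
  next
    case (real v)
    have v: "r < v" using u real by (simp add: ennreal_less_iff r less_imp_le)
    define \<rho> where "\<rho> = v / r"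
    have \<rho>: "1 < \<rho>" using v r by (simp add: \<rho>_def)
    have iv: "enn2real (inverse u) = 1 / v" using real v r by (simp add: inverse_ennreal inverse_eq_divide)
    have sr: "s * r = real DIM('a) * (1 - 1 / \<rho>)" using r v by (simp add: s_def iv \<rho>_def field_simps)
    show ?thesis
    proof (rule sums)
      show "0 \<le> V powr (1 - 1 / \<rho>)" by simp
      fix K :: "'a \<Rightarrow> complex" and k assume K: "bounded_cont K"
      note [measurable] = bounded_cont_measurable[OF K]
      let ?A = "\<integral>\<^sup>+x\<in>herz_shell k. ennreal (norm (K x) powr v) \<partial>lborel"
      let ?I = "\<integral>\<^sup>+x\<in>herz_shell k. ennreal (norm (K x) powr r) \<partial>lborel"
      let ?w = "\<lambda>x::'a. indicator (herz_shell k) x :: real"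
      define M where "M = measure lborel (herz_shell k :: 'a set)"
      have fin: "emeasure lborel (herz_shell k :: 'a set) < \<top>"
        by (rule le_less_trans[OF emeasure_herz_shell_le]) simp
      then have M: "emeasure lborel (herz_shell k :: 'a set) = ennreal M"
        unfolding M_def by (intro emeasure_eq_ennreal_measure) simp
      have MV: "M \<le> V * 2 powr (real DIM('a) * real k)"
        using emeasure_herz_shell_le[of k, where 'a = 'a] V unfolding M V_def by simp
      have "epowr (\<integral>\<^sup>+x. ennreal (?w x * norm (K x) powr r) \<partial>lborel) \<rho>
        \<le> ennreal (M powr (\<rho> - 1)) * (\<integral>\<^sup>+x. ennreal (?w x * (norm (K x) powr r) powr \<rho>) \<partial>lborel)"
        by (rule jensen_powr) (use \<rho> M in \<open>auto simp: M_def ennreal_indicator\<close>)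
      moreover have "(\<integral>\<^sup>+x. ennreal (?w x * norm (K x) powr r) \<partial>lborel) = ?I"
        by (intro nn_integral_cong) (auto simp: indicator_def)
      moreover have "(\<integral>\<^sup>+x. ennreal (?w x * (norm (K x) powr r) powr \<rho>) \<partial>lborel) = ?A"
        using r by (intro nn_integral_cong) (auto simp: indicator_def powr_powr \<rho>_def)
      ultimately have "epowr ?I \<rho> \<le> ennreal (M powr (\<rho> - 1)) * ?A" by simp
      also have "\<dots> \<le> ennreal ((V * 2 powr (real DIM('a) * real k)) powr (\<rho> - 1)) * ?A"
        using MV \<rho> by (intro mult_right_mono ennreal_leI powr_mono2) (auto simp: M_def)
      finally have "?I \<le> epowr (ennreal ((V * 2 powr (real DIM('a) * real k)) powr (\<rho> - 1)) * ?A) (1 / \<rho>)"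
        by (rule epowr_le_imp) (use \<rho> in simp)
      also have "\<dots> = ennreal ((V * 2 powr (real DIM('a) * real k)) powr (1 - 1 / \<rho>)) * epowr ?A (1 / \<rho>)"
      proof -
        have "(\<rho> - 1) / \<rho> = 1 - 1 / \<rho>" using \<rho> by (simp add: field_simps)
        then show ?thesis using \<rho> by (simp add: epowr_mult epowr_ennreal powr_powr)
      qed
      also have "epowr ?A (1 / \<rho>) = epowr (Lp_norm u (herz_shell k) K) r"
        using real v r by (simp add: Lp_norm_finite_exponent epowr_epowr \<rho>_def)
      also have "(V * 2 powr (real DIM('a) * real k)) powr (1 - 1 / \<rho>) = V powr (1 - 1 / \<rho>) * 2 powr (s * r * real k)"
      proof -
        have "(2 powr (real DIM('a) * real k)) powr (1 - 1 / \<rho>) = 2 powr (s * r * real k)"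
          unfolding powr_powr sr by (simp only: mult_ac)
        then show ?thesis using V by (simp add: powr_mult)
      qed
      finally show "?I \<le> ennreal (V powr (1 - 1 / \<rho>)) * (ennreal (2 powr (s * r * real k)) * epowr (Lp_norm u (herz_shell k) K) r)"
        by (simp add: ennreal_mult mult.assoc)
    qed
  qed
qed

section \<open>Summing Littlewood--Paley pieces to a tempered distribution\<close>

text \<open>Growth of degree \<open>n\<close> is paid for by \<open>n\<close> orders of decay of
  \<psi>, and \<open>2 d\<close> further orders make the product integrable. The bound is linear in
  a weighted supremum of \<psi>, as continuity of a tempered functional requires.\<close>

lemma bounded_schwartz_pairing:
  fixes g \<psi> :: "'a::euclidean_space \<Rightarrow> complex"
  assumes [measurable]: "g \<in> borel_measurable borel" and g: "\<And>x. norm (g x) \<le> M * (1 + norm x) ^ n" and \<psi>: "\<psi> \<in> schwartz"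
  shows "integrable lborel (\<lambda>x. g x * \<psi> x)"
    and "norm (LINT x|lborel. g x * \<psi> x)
      \<le> M * ((LINT x|lborel. weight (real (2 * DIM('a))) (x::'a)) * sup_weight (2 * DIM('a) + n) \<psi>)"
proof -
  note [measurable] = schwartz_measurable[OF \<psi>]
  let ?d = "2 * DIM('a)"
  have M: "0 \<le> M" using order_trans[OF norm_ge_zero g[of 0]] by simp
  have b: "norm (g x * \<psi> x) \<le> (M * sup_weight (?d + n) \<psi>) * weight (real ?d) x" for x
  proof -
    have "norm (g x) * norm (\<psi> x) \<le> (M * (1 + norm x) ^ n) * (sup_weight (?d + n) \<psi> * weight (real (?d + n)) x)"
      by (intro mult_mono g sup_weight_bound \<psi>) (use M in auto)
    also have "\<dots> = (M * (1 + norm x) ^ n) * (sup_weight (?d + n) \<psi> * (weight (real ?d) x * weight (real n) x))"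
      by (simp only: of_nat_add weight_add)
    also have "\<dots> = (M * sup_weight (?d + n) \<psi>) * weight (real ?d) x * (weight (real n) x * (1 + norm x) ^ n)"
      by (simp only: mult_ac)
    finally show ?thesis by (simp only: norm_mult weight_mult_power mult_1_right)
  qed
  have i: "integrable lborel (\<lambda>x::'a. (M * sup_weight (?d + n) \<psi>) * weight (real ?d) x)"
    by (intro integrable_mult_right integrable_weight) simp
  show int: "integrable lborel (\<lambda>x. g x * \<psi> x)"
    by (rule Bochner_Integration.integrable_bound[OF i]) (use order_trans[OF b abs_ge_self] in auto)
  have "norm (LINT x|lborel. g x * \<psi> x) \<le> (LINT x|lborel. norm (g x * \<psi> x))" by (rule integral_norm_bound)
  also have "\<dots> \<le> (LINT x|lborel. (M * sup_weight (?d + n) \<psi>) * weight (real ?d) (x::'a))"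
    by (intro integral_mono i b integrable_norm int)
  also have "\<dots> = M * ((LINT x|lborel. weight (real ?d) (x::'a)) * sup_weight (?d + n) \<psi>)"
    by (simp del: of_nat_mult)
  finally show "norm (LINT x|lborel. g x * \<psi> x) \<le> M * ((LINT x|lborel. weight (real ?d) (x::'a)) * sup_weight (?d + n) \<psi>)" .
qed

text \<open>Transposition by Fubini. When \<open>K\<close> reproduces \<open>g\<close>, this moves a
  smoothing kernel onto the test function, and the move can be repeated.\<close>

lemma convolution_pairing:
  fixes K g \<psi> :: "'a::euclidean_space \<Rightarrow> complex"
  assumes K: "nice_kernel K" and g: "bounded_cont g" and \<psi>: "\<psi> \<in> schwartz"
  shows "(LINT x|lborel. convolution K g x * \<psi> x) = (LINT x|lborel. g x * convolution \<psi> (\<lambda>y. K (- y)) x)"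
proof -
  note [measurable] = schwartz_measurable[OF \<psi>] nice_kernel_measurable[OF K] bounded_cont_measurable[OF g]
    bounded_cont_measurable[OF bounded_cont_convolution[OF K g]]
  obtain M where M: "0 \<le> M" "\<And>x. norm (g x) \<le> M" using bounded_contD[OF g] by blast
  have "(LINT x|lborel. convolution K g x * \<psi> x) = (LINT x|lborel. LINT y|lborel. K (x - y) * g y * \<psi> x)"
    by (simp add: convolution_lborel)
  also have "\<dots> = (LINT y|lborel. LINT x|lborel. K (x - y) * g y * \<psi> x)"
  proof (rule fubini_dominated(1))
    show "integrable (lborel \<Otimes>\<^sub>M lborel) (\<lambda>(x, y). norm (\<psi> x) * (M * norm (K (- (y - x)))))"
      by (rule integrable_pair_shift[of "\<lambda>x. norm (\<psi> x)" "\<lambda>z. M * norm (K (- z))"])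
         (use schwartz_integrable[OF \<psi>] integrable_lborel_reflect[OF nice_kernel_integrable[OF K], of 0] in auto)
    show "norm (K (x - y) * g y * \<psi> x) \<le> norm (\<psi> x) * (M * norm (K (- (y - x))))" for x y
    proof -
      have "norm (K (x - y)) * norm (\<psi> x) * norm (g y) \<le> norm (K (x - y)) * norm (\<psi> x) * M"
        by (intro mult_left_mono M) auto
      then show ?thesis by (simp add: norm_mult mult_ac)
    qed
  qed measurable
  also have "\<dots> = (LINT y|lborel. g y * convolution \<psi> (\<lambda>y. K (- y)) y)"
  proof (intro Bochner_Integration.integral_cong refl)
    fix y
    have "convolution \<psi> (\<lambda>y. K (- y)) y = convolution (\<lambda>y. K (- y)) \<psi> y"
      by (subst convolution_commute) auto
    also have "\<dots> = (LINT x|lborel. K (x - y) * \<psi> x)" by (simp add: convolution_lborel)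
    finally have "g y * convolution \<psi> (\<lambda>y. K (- y)) y = (LINT x|lborel. g y * (K (x - y) * \<psi> x))" by simp
    then show "(LINT x|lborel. K (x - y) * g y * \<psi> x) = g y * convolution \<psi> (\<lambda>y. K (- y)) y"
      by (simp add: mult_ac)
  qed
  finally show ?thesis .
qed

text \<open>Convolution with a kernel of mean zero at scale \<open>2\<^sup>-\<^sup>k\<close> gains a factor \<open>2\<^sup>-\<^sup>k\<close> at the expense of
  one derivative; \<open>deriv_norm\<close> counts the derivatives spent.\<close>

primrec deriv_norm :: "nat \<Rightarrow> nat \<Rightarrow> ('a::euclidean_space \<Rightarrow> complex) \<Rightarrow> real" where
  "deriv_norm L 0 \<psi> = sup_weight L \<psi>"
| "deriv_norm L (Suc n) \<psi> = (\<Sum>b\<in>Basis. deriv_norm L n (partial_deriv b \<psi>))"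

lemma deriv_norm_le_schwartz_norm:
  assumes \<psi>: "\<psi> \<in> schwartz" and "bs \<in> lists Basis" "length bs + n \<le> N" "L \<le> N"
  shows "deriv_norm L n (partial_derivs bs \<psi>) \<le> real DIM('a::euclidean_space) ^ n * schwartz_norm N (\<psi> :: 'a \<Rightarrow> complex)"
  using assms(2,3)
proof (induction n arbitrary: bs)
  case 0
  then show ?case using sup_weight_le_schwartz_norm[OF \<psi>, of bs N L] assms(4) by simp
next
  case (Suc n)
  have "deriv_norm L (Suc n) (partial_derivs bs \<psi>) = (\<Sum>b\<in>Basis. deriv_norm L n (partial_derivs (b # bs) \<psi>))"
    by simp
  also have "\<dots> \<le> (\<Sum>b\<in>(Basis::'a set). real DIM('a) ^ n * schwartz_norm N \<psi>)"
    by (intro sum_mono Suc.IH) (use Suc.prems in auto)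
  finally show ?case by (simp add: mult.assoc)
qed

lemma mean_zero_convolution_gain:
  fixes \<Psi> \<psi> :: "'a::euclidean_space \<Rightarrow> complex"
  assumes \<Psi>: "\<Psi> \<in> schwartz" and mean: "(LINT x|lborel. \<Psi> x) = 0" and \<psi>: "\<psi> \<in> schwartz" and k: "0 \<le> k"
  shows "sup_weight L (convolution \<psi> (\<lambda>y. dyadic \<Psi> k (- y)))
    \<le> (2 powi (- k) * (LINT v|lborel. (1 + norm v) ^ Suc L * norm (\<Psi> v))) * deriv_norm L 1 \<psi>"
proof (rule sup_weight_le)
  fix x :: 'a
  define e where "e y = dyadic \<Psi> k (- y)" for y
  have eS: "e \<in> schwartz" unfolding e_def using schwartz_reflect[OF schwartz_dyadic[OF \<Psi>, of k], of 0] by simp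
  note [measurable] = schwartz_measurable[OF \<psi>] schwartz_measurable[OF eS] schwartz_measurable[OF \<Psi>]
  define c where "c = (2::real) powi k"
  have c: "1 \<le> c" using k by (simp add: c_def)
  have c0: "- c \<noteq> 0" using c by simp
  have dyadic: "e y = of_real (c ^ DIM('a)) * \<Psi> (0 + (- c) *\<^sub>R y)" for y
    by (simp add: e_def dyadic_def c_def power_int_mult)
  have e0: "(LINT u|lborel. e u) = 0"
  proof -
    have "0 = (\<bar>- c\<bar> ^ DIM('a)) *\<^sub>R (LINT y|lborel. \<Psi> (0 + (- c) *\<^sub>R y))"
      using integral_lborel_affine[OF c0, of \<Psi> 0] mean by simp
    then show ?thesis unfolding dyadic using c by simp
  qed
  let ?S = "\<Sum>b\<in>Basis. sup_weight L (partial_deriv b \<psi>)"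
  have S: "0 \<le> ?S" by (intro sum_nonneg sup_weight_nonneg schwartz_partial_deriv \<psi>)
  have i1: "integrable lborel (\<lambda>u. \<psi> (x - u) * e u)"
    by (rule integrable_schwartz_convolution[OF \<psi> schwartz_all_moments[OF eS]])
  have i2: "integrable lborel (\<lambda>u. \<psi> x * e u)" using schwartz_integrable[OF eS] by auto
  \<comment> \<open>As \<open>e\<close> has mean zero, \<psi> \<open>x\<close> times its integral
    may be subtracted; what remains is the difference controlled by the Lipschitz estimate.\<close>
  have "convolution \<psi> e x = (LINT u|lborel. \<psi> (x - u) * e u) - (LINT u|lborel. \<psi> x * e u)"
    by (simp add: convolution_lborel e0)
  also have "\<dots> = (LINT u|lborel. (\<psi> (x - u) - \<psi> x) * e u)"
    by (subst Bochner_Integration.integral_diff[OF i1 i2, symmetric]) (simp add: left_diff_distrib)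
  finally have eq: "convolution \<psi> e x = (LINT u|lborel. (\<psi> (x - u) - \<psi> x) * e u)" .
  have j: "integrable lborel (\<lambda>u. norm u * (1 + norm u) ^ L * norm (e u))"
  proof (rule Bochner_Integration.integrable_bound[OF schwartz_integrable_power[OF eS, of "Suc L"]])
    show "AE u in lborel. norm (norm u * (1 + norm u) ^ L * norm (e u)) \<le> norm ((1 + norm u) ^ Suc L * norm (e u))"
      by (rule AE_I2) (auto simp: abs_mult intro!: mult_right_mono)
  qed measurable
  have "norm (convolution \<psi> e x) \<le> (LINT u|lborel. norm ((\<psi> (x - u) - \<psi> x) * e u))"
    unfolding eq by (rule integral_norm_bound)
  also have "\<dots> \<le> (LINT u|lborel. (weight (real L) x * ?S) * (norm u * (1 + norm u) ^ L * norm (e u)))"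
  proof (rule integral_mono_AE')
    show "AE u in lborel. norm ((\<psi> (x - u) - \<psi> x) * e u) \<le> (weight (real L) x * ?S) * (norm u * (1 + norm u) ^ L * norm (e u))"
    proof (rule AE_I2)
      fix u :: 'a
      have "norm (\<psi> (x - u) - \<psi> x) * norm (e u) \<le> (norm u * (1 + norm u) ^ L * weight (real L) x * ?S) * norm (e u)"
        by (intro mult_right_mono schwartz_weighted_lipschitz \<psi>) simp
      then show "norm ((\<psi> (x - u) - \<psi> x) * e u) \<le> (weight (real L) x * ?S) * (norm u * (1 + norm u) ^ L * norm (e u))"
        by (simp add: norm_mult mult_ac)
    qed
  qed (use j S in \<open>auto intro!: mult_nonneg_nonneg\<close>)
  also have "\<dots> = (weight (real L) x * ?S) * (LINT u|lborel. norm u * (1 + norm u) ^ L * norm (e u))"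
    by (rule integral_mult_right_zero)
  also have "(LINT u|lborel. norm u * (1 + norm u) ^ L * norm (e u)) \<le> inverse c * (LINT v|lborel. (1 + norm v) ^ Suc L * norm (\<Psi> v))"
  proof -
    have "(LINT v|lborel. (1 + norm v) ^ Suc L * norm (\<Psi> v))
      = (\<bar>- c\<bar> ^ DIM('a)) *\<^sub>R (LINT u|lborel. (1 + norm (0 + (- c) *\<^sub>R u)) ^ Suc L * norm (\<Psi> (0 + (- c) *\<^sub>R u)))"
      by (rule integral_lborel_affine[OF c0])
    also have "\<dots> = (LINT u|lborel. (1 + c * norm u) ^ Suc L * norm (e u))"
      unfolding dyadic using c by (simp add: norm_mult norm_power mult_ac)
    finally have v: "(LINT v|lborel. (1 + norm v) ^ Suc L * norm (\<Psi> v)) = (LINT u|lborel. (1 + c * norm u) ^ Suc L * norm (e u))" .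
    have "integrable lborel (\<lambda>u. c ^ Suc L * ((1 + norm u) ^ Suc L * norm (e u)))"
      by (intro integrable_mult_right schwartz_integrable_power eS)
    then have iv: "integrable lborel (\<lambda>u. (1 + c * norm u) ^ Suc L * norm (e u))"
    proof (rule Bochner_Integration.integrable_bound)
      show "AE u in lborel. norm ((1 + c * norm u) ^ Suc L * norm (e u)) \<le> norm (c ^ Suc L * ((1 + norm u) ^ Suc L * norm (e u)))"
      proof (rule AE_I2)
        fix u :: 'a
        have "(1 + c * norm u) ^ Suc L \<le> (c * (1 + norm u)) ^ Suc L"
          using c by (intro power_mono) (auto simp: distrib_left)
        then have "(1 + c * norm u) ^ Suc L * norm (e u) \<le> (c * (1 + norm u)) ^ Suc L * norm (e u)"
          by (rule mult_right_mono) simp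
        then show "norm ((1 + c * norm u) ^ Suc L * norm (e u)) \<le> norm (c ^ Suc L * ((1 + norm u) ^ Suc L * norm (e u)))"
          using c by (simp add: power_mult_distrib abs_mult mult_ac)
      qed
    qed measurable
    \<comment> \<open>The factor \<open>|u|\<close> from the Lipschitz bound is written as
      \<open>(c |u|) / c\<close>: rescaling turns \<open>c |u|\<close> into a moment of \<Psi> and
      leaves \<open>1 / c = 2^(-k)\<close>.\<close>
    have "(LINT u|lborel. norm u * (1 + norm u) ^ L * norm (e u)) \<le> (LINT u|lborel. inverse c * ((1 + c * norm u) ^ Suc L * norm (e u)))"
    proof (rule integral_mono[OF j])
      show "integrable lborel (\<lambda>u. inverse c * ((1 + c * norm u) ^ Suc L * norm (e u)))" using iv by (rule integrable_mult_right)
      fix u :: 'a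
      have "norm u \<le> c * norm u" using mult_right_mono[OF c norm_ge_zero[of u]] by simp
      then have "(c * norm u) * (1 + norm u) ^ L \<le> (1 + c * norm u) * (1 + c * norm u) ^ L"
        using c by (intro mult_mono power_mono) auto
      then have "inverse c * ((c * norm u) * (1 + norm u) ^ L) \<le> inverse c * ((1 + c * norm u) ^ Suc L)"
        using c by (intro mult_left_mono) auto
      then have "norm u * (1 + norm u) ^ L \<le> inverse c * ((1 + c * norm u) ^ Suc L)"
        using c by (simp only: mult.assoc[symmetric]) simp
      then have "norm u * (1 + norm u) ^ L * norm (e u) \<le> inverse c * ((1 + c * norm u) ^ Suc L) * norm (e u)"
        by (rule mult_right_mono) simp
      then show "norm u * (1 + norm u) ^ L * norm (e u) \<le> inverse c * ((1 + c * norm u) ^ Suc L * norm (e u))"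
        by (simp only: mult.assoc)
    qed
    also have "\<dots> = inverse c * (LINT v|lborel. (1 + norm v) ^ Suc L * norm (\<Psi> v))"
      unfolding v by (rule integral_mult_right_zero)
    finally show ?thesis .
  qed
  finally have "norm (convolution \<psi> e x) \<le> (weight (real L) x * ?S) * (inverse c * (LINT v|lborel. (1 + norm v) ^ Suc L * norm (\<Psi> v)))"
    using S by (simp add: mult_left_mono)
  then have "(1 + norm x) ^ L * norm (convolution \<psi> e x)
      \<le> (1 + norm x) ^ L * ((weight (real L) x * ?S) * (inverse c * (LINT v|lborel. (1 + norm v) ^ Suc L * norm (\<Psi> v))))"
    by (rule mult_left_mono) simp
  also have "\<dots> = (weight (real L) x * (1 + norm x) ^ L) * ((inverse c * (LINT v|lborel. (1 + norm v) ^ Suc L * norm (\<Psi> v))) * ?S)"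
    by (simp only: mult_ac)
  finally show "(1 + norm x) ^ L * norm (convolution \<psi> (\<lambda>y. dyadic \<Psi> k (- y)) x)
      \<le> (2 powi (- k) * (LINT v|lborel. (1 + norm v) ^ Suc L * norm (\<Psi> v))) * deriv_norm L 1 \<psi>"
    unfolding weight_mult_power by (simp add: e_def[symmetric] e_def[abs_def, symmetric] c_def power_int_minus)
qed

lemma deriv_norm_convolution_gain:
  fixes \<Psi> \<psi> :: "'a::euclidean_space \<Rightarrow> complex"
  assumes \<Psi>: "\<Psi> \<in> schwartz" and mean: "(LINT x|lborel. \<Psi> x) = 0" and \<psi>: "\<psi> \<in> schwartz" and k: "0 \<le> k"
  shows "deriv_norm L n (convolution \<psi> (\<lambda>y. dyadic \<Psi> k (- y)))
    \<le> (2 powi (- k) * (LINT v|lborel. (1 + norm v) ^ Suc L * norm (\<Psi> v))) * deriv_norm L (Suc n) \<psi>"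
  using \<psi>
proof (induction n arbitrary: \<psi>)
  case 0
  then show ?case using mean_zero_convolution_gain[OF \<Psi> mean _ k, of \<psi> L] by simp
next
  case (Suc n)
  have e: "all_moments (\<lambda>y. dyadic \<Psi> k (- y))"
    using schwartz_reflect[OF schwartz_dyadic[OF \<Psi>, of k], of 0] by (intro schwartz_all_moments) simp
  let ?c = "2 powi (- k) * (LINT v|lborel. (1 + norm v) ^ Suc L * norm (\<Psi> v))"
  have "deriv_norm L (Suc n) (convolution \<psi> (\<lambda>y. dyadic \<Psi> k (- y)))
    = (\<Sum>b\<in>Basis. deriv_norm L n (convolution (partial_deriv b \<psi>) (\<lambda>y. dyadic \<Psi> k (- y))))"
    using partial_derivs_convolution[OF Suc.prems e, of "[_]"] by simp
  also have "\<dots> \<le> (\<Sum>b\<in>Basis. ?c * deriv_norm L (Suc n) (partial_deriv b \<psi>))"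
    by (intro sum_mono Suc.IH schwartz_partial_deriv Suc.prems)
  also have "\<dots> = ?c * deriv_norm L (Suc (Suc n)) \<psi>" by (simp add: sum_distrib_left)
  finally show ?case .
qed

text \<open>For \<open>|z| <= 1\<close> the weighted Lipschitz bound with an integrable weight, for
  \<open>|z| > 1\<close> the triangle inequality. Rescaled, it measures how slowly a low frequency
  piece varies.\<close>

lemma L1_translation_bound:
  fixes \<Psi> :: "'a::euclidean_space \<Rightarrow> complex"
  assumes \<Psi>: "\<Psi> \<in> schwartz"
  shows "\<exists>C\<ge>0. \<forall>z. (LINT v|lborel. norm (\<Psi> (v - z) - \<Psi> v)) \<le> C * norm z"
proof -
  let ?d = "2 * DIM('a)"
  note [measurable] = schwartz_measurable[OF \<Psi>]
  define S where "S = (\<Sum>b\<in>Basis. sup_weight ?d (partial_deriv b \<Psi>))"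
  have S: "0 \<le> S" unfolding S_def by (intro sum_nonneg sup_weight_nonneg schwartz_partial_deriv \<Psi>)
  define W where "W = (LINT x|lborel. weight (real ?d) (x::'a))"
  have W: "0 \<le> W" by (simp add: W_def)
  define I where "I = (LINT v|lborel. norm (\<Psi> v))"
  have I: "0 \<le> I" by (simp add: I_def)
  have wi: "integrable lborel (weight (real ?d) :: 'a \<Rightarrow> real)" by (rule integrable_weight) simp
  have i: "integrable lborel (\<lambda>v. norm (\<Psi> (v - z) - \<Psi> v))" for z
    using integrable_lborel_shift[OF schwartz_integrable[OF \<Psi>], of z] schwartz_integrable[OF \<Psi>] by auto
  have "(LINT v|lborel. norm (\<Psi> (v - z) - \<Psi> v)) \<le> (2 ^ ?d * S * W + 2 * I) * norm z" for z
  proof (cases "norm z \<le> 1")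
    case True
    have "(LINT v|lborel. norm (\<Psi> (v - z) - \<Psi> v)) \<le> (LINT v|lborel. (norm z * 2 ^ ?d * S) * weight (real ?d) (v::'a))"
    proof (rule integral_mono[OF i])
      show "integrable lborel (\<lambda>v::'a. (norm z * 2 ^ ?d * S) * weight (real ?d) v)" by (intro integrable_mult_right wi)
      fix v
      have "norm (\<Psi> (v - z) - \<Psi> v) \<le> norm z * (1 + norm z) ^ ?d * weight (real ?d) v * S"
        unfolding S_def by (rule schwartz_weighted_lipschitz[OF \<Psi>])
      also have "\<dots> \<le> norm z * 2 ^ ?d * weight (real ?d) v * S"
        using True by (intro mult_right_mono mult_left_mono power_mono S) auto
      finally show "norm (\<Psi> (v - z) - \<Psi> v) \<le> (norm z * 2 ^ ?d * S) * weight (real ?d) v" by (simp only: mult_ac)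
    qed
    also have "\<dots> = (norm z * 2 ^ ?d * S) * W" unfolding W_def by (rule integral_mult_right_zero)
    also have "\<dots> = (2 ^ ?d * S * W) * norm z" by (simp only: mult_ac)
    also have "\<dots> \<le> (2 ^ ?d * S * W + 2 * I) * norm z" using I by (intro mult_right_mono) auto
    finally show ?thesis .
  next
    case False
    have "(LINT v|lborel. norm (\<Psi> (v - z) - \<Psi> v)) \<le> (LINT v|lborel. norm (\<Psi> (v - z)) + norm (\<Psi> v))"
      using integrable_lborel_shift[OF schwartz_integrable[OF \<Psi>], of z] schwartz_integrable[OF \<Psi>]
      by (intro integral_mono[OF i]) (auto intro: norm_triangle_ineq4)
    also have "\<dots> = 2 * I"
      using integrable_lborel_shift[OF schwartz_integrable[OF \<Psi>], of z] schwartz_integrable[OF \<Psi>]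
        integral_lborel_shift[of "\<lambda>v. norm (\<Psi> v)" z] by (simp add: I_def)
    also have "\<dots> \<le> (2 * I) * norm z" using False I mult_left_mono[of 1 "norm z" "2 * I"] by simp
    also have "\<dots> \<le> (2 ^ ?d * S * W + 2 * I) * norm z" using S W by (intro mult_right_mono) auto
    finally show ?thesis .
  qed
  moreover have "0 \<le> 2 ^ ?d * S * W + 2 * I" using S W I by simp
  ultimately show ?thesis by blast
qed

lemma summable_on_geometric_int: "(\<lambda>k::int. (1 / 2 :: real) ^ nat \<bar>k\<bar>) summable_on UNIV"
proof -
  have g: "(\<lambda>n. (1 / 2 :: real) ^ n) summable_on UNIV"
    by (rule norm_summable_imp_summable_on) (simp add: summable_geometric)
  have "(\<lambda>k::int. (1 / 2 :: real) ^ nat \<bar>k\<bar>) summable_on (range int)"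
    using g by (subst summable_on_reindex) (auto simp: comp_def inj_on_def)
  moreover have "(\<lambda>k::int. (1 / 2 :: real) ^ nat \<bar>k\<bar>) summable_on (range (\<lambda>n. - int n))"
    using g by (subst summable_on_reindex) (auto simp: comp_def inj_on_def)
  ultimately have "(\<lambda>k::int. (1 / 2 :: real) ^ nat \<bar>k\<bar>) summable_on (range int \<union> range (\<lambda>n. - int n))"
    by (rule summable_on_union)
  moreover have "range int \<union> range (\<lambda>n. - int n) = UNIV"
  proof -
    have "k \<in> range int \<union> range (\<lambda>n. - int n)" for k
      by (cases k rule: int_cases2) auto
    then show ?thesis by blast
  qed
  ultimately show ?thesis by simp
qed

text \<open>For \<open>k < 0\<close> the constant \<open>g\<^sub>k(0)\<close> is subtracted to make the series converge in \<open>S'\<close>; this does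
  not change the pairing with functions of vanishing moments.\<close>

theorem ex_tempered_sum:
  fixes \<Psi> :: "'a::euclidean_space \<Rightarrow> complex" and g :: "int \<Rightarrow> 'a \<Rightarrow> complex"
  assumes \<Psi>: "\<Psi> \<in> schwartz" and mean: "(LINT x|lborel. \<Psi> x) = 0"
    and g: "\<And>k. bounded_cont (g k)" and rep: "\<And>k. convolution (dyadic \<Psi> k) (g k) = g k"
    and A: "0 \<le> A" and \<beta>: "0 \<le> \<beta>" and gA: "\<And>k x. norm (g k x) \<le> A * 2 powr (real_of_int k * \<beta>)"
  shows "\<exists>G\<in>tempered. \<forall>\<psi>\<in>schwartz_inf. ((\<lambda>k. LINT x|lborel. g k x * \<psi> x) has_sum G \<psi>) UNIV"
proof -
  define d where "d = 2 * DIM('a)"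
  note gm [measurable] = bounded_cont_measurable[OF g]
  define W where "W = (LINT x|lborel. weight (real d) (x::'a))"
  have W: "0 \<le> W" by (simp add: W_def)
  define C where "C = (LINT v|lborel. (1 + norm v) ^ Suc d * norm (\<Psi> v))"
  have C: "0 \<le> C" by (simp add: C_def)
  \<comment> \<open>Each use of \<open>rep\<close> moves one kernel \<open>dyadic \<Psi> k\<close>
    onto the test function and gains \<open>2^(-k) C\<close> for one more derivative; sufficiently
    many uses beat the growth \<open>2^(k \<beta>)\<close>.\<close>
  have pos: "norm (LINT x|lborel. g k x * \<psi> x) \<le> (A * 2 powr (real_of_int k * \<beta>)) * (W * ((2 powi (- k) * C) ^ n * deriv_norm d n \<psi>))"
    if "\<psi> \<in> schwartz" "0 \<le> k" for k n \<psi>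
    using that
  proof (induction n arbitrary: \<psi>)
    case 0
    show ?case
      using bounded_schwartz_pairing(2)[OF gm _ 0(1), of k "A * 2 powr (real_of_int k * \<beta>)" 0] gA[of k]
      by (simp add: W_def d_def)
  next
    case (Suc n)
    have e: "(\<lambda>y. dyadic \<Psi> k (- y)) \<in> schwartz"
      using schwartz_reflect[OF schwartz_dyadic[OF \<Psi>, of k], of 0] by simp
    let ?R = "convolution \<psi> (\<lambda>y. dyadic \<Psi> k (- y))"
    have "(LINT x|lborel. g k x * \<psi> x) = (LINT x|lborel. g k x * ?R x)"
      using convolution_pairing[OF nice_kernel_dyadic[OF \<Psi>] g Suc.prems(1), of k k] by (simp only: rep)
    then have "norm (LINT x|lborel. g k x * \<psi> x)
      \<le> (A * 2 powr (real_of_int k * \<beta>)) * (W * ((2 powi (- k) * C) ^ n * deriv_norm d n ?R))"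
      using Suc.IH[OF schwartz_convolution[OF Suc.prems(1) schwartz_all_moments[OF e]] Suc.prems(2)] by simp
    also have "\<dots> \<le> (A * 2 powr (real_of_int k * \<beta>)) * (W * ((2 powi (- k) * C) ^ n * ((2 powi (- k) * C) * deriv_norm d (Suc n) \<psi>)))"
      using A W C unfolding C_def
      by (intro mult_left_mono deriv_norm_convolution_gain \<Psi> mean Suc.prems) auto
    also have "(2 powi (- k) * C) ^ n * ((2 powi (- k) * C) * deriv_norm d (Suc n) \<psi>) = (2 powi (- k) * C) ^ Suc n * deriv_norm d (Suc n) \<psi>"
      by (simp only: power_Suc2 mult.assoc)
    finally show ?case .
  qed
  obtain C' where C': "0 \<le> C'" "\<And>z. (LINT v|lborel. norm (\<Psi> (v - z) - \<Psi> v)) \<le> C' * norm z"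
    using L1_translation_bound[OF \<Psi>] by blast
  \<comment> \<open>For negative \<open>k\<close> a piece is nearly constant on bounded sets: its
    reproducing kernel has width of order \<open>2^(-k)\<close>, so translation by \<open>x\<close>
    changes that kernel by \<open>O(2^k |x|)\<close> in \<open>L^1\<close>.\<close>
  have lip: "norm (g k x - g k 0) \<le> (A * C' * 2 powi k) * norm x" if k: "k < 0" for k x
  proof -
    define c where "c = (2::real) powi k"
    have c: "0 < c" by (simp add: c_def)
    have K: "nice_kernel (dyadic \<Psi> k)" by (rule nice_kernel_dyadic[OF \<Psi>])
    note [measurable] = nice_kernel_measurable[OF K] schwartz_measurable[OF \<Psi>]
    have gA': "norm (g k y) \<le> A" for y
    proof -
      have "2 powr (real_of_int k * \<beta>) \<le> 2 powr 0" using k \<beta> by (intro powr_mono) (auto simp: mult_nonpos_nonneg)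
      then show ?thesis using gA[of k y] A mult_left_mono[of "2 powr (real_of_int k * \<beta>)" 1 A] by simp
    qed
    have di: "integrable lborel (\<lambda>y. dyadic \<Psi> k (x - y))" for x
      by (rule integrable_lborel_reflect[OF nice_kernel_integrable[OF K]])
    have "g k x - g k 0 = (LINT y|lborel. dyadic \<Psi> k (x - y) * g k y) - (LINT y|lborel. dyadic \<Psi> k (0 - y) * g k y)"
      by (subst (1 2) rep[symmetric]) (simp add: convolution_lborel)
    also have "\<dots> = (LINT y|lborel. (dyadic \<Psi> k (x - y) - dyadic \<Psi> k (0 - y)) * g k y)"
      using Bochner_Integration.integral_diff[OF integrable_conv[OF K g[of k], of x] integrable_conv[OF K g[of k], of 0]]
      by (simp add: left_diff_distrib)
    finally have "norm (g k x - g k 0) \<le> (LINT y|lborel. norm ((dyadic \<Psi> k (x - y) - dyadic \<Psi> k (0 - y)) * g k y))"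
      using integral_norm_bound by metis
    also have "\<dots> \<le> (LINT y|lborel. norm (dyadic \<Psi> k (x - y) - dyadic \<Psi> k (0 - y)) * A)"
    proof (rule integral_mono_AE')
      show "integrable lborel (\<lambda>y. norm (dyadic \<Psi> k (x - y) - dyadic \<Psi> k (0 - y)) * A)"
        by (intro integrable_mult_left integrable_norm Bochner_Integration.integrable_diff di)
      show "AE y in lborel. norm ((dyadic \<Psi> k (x - y) - dyadic \<Psi> k (0 - y)) * g k y) \<le> norm (dyadic \<Psi> k (x - y) - dyadic \<Psi> k (0 - y)) * A"
        by (rule AE_I2) (simp add: norm_mult mult_left_mono gA')
    qed (use A in auto)
    also have "\<dots> = (LINT y|lborel. norm (dyadic \<Psi> k (x - y) - dyadic \<Psi> k (0 - y))) * A"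
      by (rule integral_mult_left_zero)
    also have "(LINT y|lborel. norm (dyadic \<Psi> k (x - y) - dyadic \<Psi> k (0 - y))) = (LINT v|lborel. norm (\<Psi> (v - (- c) *\<^sub>R x) - \<Psi> v))"
    proof -
      have c0: "- c \<noteq> 0" using c by simp
      have "(LINT v|lborel. norm (\<Psi> (v - (- c) *\<^sub>R x) - \<Psi> v))
        = (\<bar>- c\<bar> ^ DIM('a)) *\<^sub>R (LINT y|lborel. norm (\<Psi> (0 + (- c) *\<^sub>R y - (- c) *\<^sub>R x) - \<Psi> (0 + (- c) *\<^sub>R y)))"
        by (rule integral_lborel_affine[OF c0])
      also have "\<dots> = (LINT y|lborel. c ^ DIM('a) * norm (\<Psi> (0 + (- c) *\<^sub>R y - (- c) *\<^sub>R x) - \<Psi> (0 + (- c) *\<^sub>R y)))"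
        using c by simp
      also have "\<dots> = (LINT y|lborel. norm (dyadic \<Psi> k (x - y) - dyadic \<Psi> k (0 - y)))"
      proof (intro Bochner_Integration.integral_cong refl)
        fix y
        have "dyadic \<Psi> k (x - y) - dyadic \<Psi> k (0 - y) = of_real (c ^ DIM('a)) * (\<Psi> (0 + (- c) *\<^sub>R y - (- c) *\<^sub>R x) - \<Psi> (0 + (- c) *\<^sub>R y))"
          by (simp add: dyadic_def c_def power_int_mult algebra_simps)
        then show "c ^ DIM('a) * norm (\<Psi> (0 + (- c) *\<^sub>R y - (- c) *\<^sub>R x) - \<Psi> (0 + (- c) *\<^sub>R y)) = norm (dyadic \<Psi> k (x - y) - dyadic \<Psi> k (0 - y))"
          using c by (simp only: norm_mult norm_of_real) simp
      qed
      finally show ?thesis by simp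
    qed
    also have "\<dots> * A \<le> (C' * norm ((- c) *\<^sub>R x)) * A" by (intro mult_right_mono C'(2) A)
    finally show ?thesis using c by (simp add: c_def[symmetric] mult_ac)
  qed
  define t where "t k \<psi> = (if 0 \<le> k then (LINT x|lborel. g k x * \<psi> x) else (LINT x|lborel. (g k x - g k 0) * \<psi> x))" for k \<psi>
  have ti: "integrable lborel (\<lambda>x. g k x * \<psi> x)" if "\<psi> \<in> schwartz" for k \<psi>
    using bounded_schwartz_pairing(1)[OF gm _ that, of k "A * 2 powr (real_of_int k * \<beta>)" 0] gA[of k] by simp
  have t_add: "t k (\<lambda>x. \<psi> x + \<theta> x) = t k \<psi> + t k \<theta>" if "\<psi> \<in> schwartz" "\<theta> \<in> schwartz" for k \<psi> \<theta>
    using ti[OF that(1), of k] ti[OF that(2), of k] schwartz_integrable[OF that(1)] schwartz_integrable[OF that(2)]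
    by (simp add: t_def distrib_left left_diff_distrib)
  have t_cmult: "t k (\<lambda>x. c * \<psi> x) = c * t k \<psi>" for k c \<psi>
  proof -
    have "(LINT x|lborel. f x * (c * \<psi> x)) = c * (LINT x|lborel. f x * \<psi> x)" for f :: "'a \<Rightarrow> complex"
      using integral_mult_right_zero[of lborel c "\<lambda>x. f x * \<psi> x"] by (simp add: mult.left_commute)
    then show ?thesis by (simp add: t_def)
  qed
  \<comment> \<open>One power of \<open>2^(-k)\<close> is left after compensating
    \<open>2^(k \<beta>)\<close>, so the terms with positive \<open>k\<close> decay
    geometrically.\<close>
  define n where "n = nat \<lceil>\<beta> + 1\<rceil>"
  have n: "\<beta> + 1 \<le> real n" unfolding n_def by linarith
  \<comment> \<open>Accommodates both signs: \<open>n\<close> derivatives with weight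
    \<open>d\<close> for \<open>k >= 0\<close>, no derivative with weight \<open>d + 1\<close> for
    \<open>k < 0\<close>.\<close>
  define N where "N = d + n + 1"
  define E where "E = A * W * (C ^ n * real DIM('a) ^ n) + A * C' * W"
  have E: "0 \<le> E" using A W C C' by (simp add: E_def)
  have t_bound: "norm (t k \<psi>) \<le> E * schwartz_norm N \<psi> * (1 / 2) ^ nat \<bar>k\<bar>" if \<psi>: "\<psi> \<in> schwartz" for k \<psi>
  proof (cases "0 \<le> k")
    case True
    note N0 = schwartz_norm_nonneg[OF \<psi>, of N]
    have "norm (t k \<psi>) \<le> (A * 2 powr (real_of_int k * \<beta>)) * (W * ((2 powi (- k) * C) ^ n * deriv_norm d n \<psi>))"
      using pos[OF \<psi> True] True by (simp add: t_def)
    also have "\<dots> \<le> (A * 2 powr (real_of_int k * \<beta>)) * (W * ((2 powi (- k) * C) ^ n * (real DIM('a) ^ n * schwartz_norm N \<psi>)))"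
      using deriv_norm_le_schwartz_norm[OF \<psi>, of "[]" n N d] A W C by (intro mult_left_mono) (auto simp: N_def)
    also have "\<dots> = (A * W * (C ^ n * real DIM('a) ^ n) * schwartz_norm N \<psi>) * (2 powr (real_of_int k * \<beta>) * (2 powi (- k)) ^ n)"
      by (simp add: power_mult_distrib mult_ac)
    also have "2 powr (real_of_int k * \<beta>) * (2 powi (- k)) ^ n = 2 powr (real_of_int k * (\<beta> - real n))"
      by (simp add: powr_real_of_int'[symmetric] powr_power powr_add[symmetric] algebra_simps)
    also have "\<dots> \<le> 2 powr (real_of_int k * (- 1))"
      using True n by (intro powr_mono mult_left_mono) auto
    also have "2 powr (real_of_int k * (- 1)) = (1 / 2) ^ nat \<bar>k\<bar>"
      using True by (simp add: powr_minus powr_realpow'[symmetric] power_one_over inverse_eq_divide powr_real_of_int)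
    finally have "norm (t k \<psi>) \<le> (A * W * (C ^ n * real DIM('a) ^ n) * schwartz_norm N \<psi>) * (1 / 2) ^ nat \<bar>k\<bar>"
      using A W C N0 by (simp add: mult_left_mono)
    also have "\<dots> \<le> E * schwartz_norm N \<psi> * (1 / 2) ^ nat \<bar>k\<bar>"
      using A W C' N0 by (intro mult_right_mono) (auto simp: E_def)
    finally show ?thesis .
  next
    case False
    then have k: "k < 0" by simp
    note N0 = schwartz_norm_nonneg[OF \<psi>, of N]
    have "norm (g k x - g k 0) \<le> (A * C' * 2 powi k) * (1 + norm x) ^ 1" for x
    proof -
      have "(A * C' * 2 powi k) * norm x \<le> (A * C' * 2 powi k) * (1 + norm x)"
        using A C' by (intro mult_left_mono) auto
      then show ?thesis using lip[OF k, of x] by simp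
    qed
    then have "norm (t k \<psi>) \<le> (A * C' * 2 powi k) * (W * sup_weight (d + 1) \<psi>)"
      using bounded_schwartz_pairing(2)[of "\<lambda>x. g k x - g k 0" "A * C' * 2 powi k" 1 \<psi>] \<psi> False
      by (simp add: t_def W_def d_def)
    also have "\<dots> \<le> (A * C' * 2 powi k) * (W * schwartz_norm N \<psi>)"
      using sup_weight_le_schwartz_norm[OF \<psi>, of "[]" N "d + 1"] A C' W by (intro mult_left_mono) (auto simp: N_def)
    also have "\<dots> = (A * C' * W * schwartz_norm N \<psi>) * 2 powi k" by (simp only: mult_ac)
    also have "(2::real) powi k = (1 / 2) ^ nat \<bar>k\<bar>"
      using k by (simp add: power_int_def power_one_over inverse_eq_divide)
    also have "(A * C' * W * schwartz_norm N \<psi>) * (1 / 2) ^ nat \<bar>k\<bar> \<le> E * schwartz_norm N \<psi> * (1 / 2) ^ nat \<bar>k\<bar>"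
      using A W C N0 by (intro mult_right_mono) (auto simp: E_def)
    finally show ?thesis .
  qed
  define Q where "Q = (\<Sum>\<^sub>\<infinity>k::int. (1 / 2 :: real) ^ nat \<bar>k\<bar>)"
  have sn: "(\<lambda>k. norm (t k \<psi>)) summable_on UNIV" if \<psi>: "\<psi> \<in> schwartz" for \<psi>
    by (rule summable_on_comparison_test[OF summable_on_cmult_right[OF summable_on_geometric_int]])
       (use t_bound[OF \<psi>] in auto)
  have st: "(\<lambda>k. t k \<psi>) summable_on UNIV" if \<psi>: "\<psi> \<in> schwartz" for \<psi>
    by (rule abs_summable_summable[OF sn[OF \<psi>]])
  define G where "G \<psi> = (\<Sum>\<^sub>\<infinity>k. t k \<psi>)" for \<psi>
  have "G \<in> tempered"
    unfolding tempered_def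
  proof (intro CollectI conjI ballI allI exI)
    show "G (\<lambda>x. \<psi> x + \<theta> x) = G \<psi> + G \<theta>" if "\<psi> \<in> schwartz" "\<theta> \<in> schwartz" for \<psi> \<theta>
      using infsum_add[OF st[OF that(1)] st[OF that(2)]] by (simp add: G_def t_add[OF that])
    show "G (\<lambda>x. c * \<psi> x) = c * G \<psi>" for c \<psi>
      by (simp add: G_def t_cmult infsum_cmult_right')
    fix \<psi> :: "'a \<Rightarrow> complex" assume \<psi>: "\<psi> \<in> schwartz"
    have "norm (G \<psi>) \<le> (\<Sum>\<^sub>\<infinity>k. norm (t k \<psi>))"
      unfolding G_def by (rule norm_infsum_bound[OF sn[OF \<psi>]])
    also have "\<dots> \<le> (\<Sum>\<^sub>\<infinity>k. E * schwartz_norm N \<psi> * (1 / 2) ^ nat \<bar>k\<bar>)"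
      by (rule infsum_mono[OF sn[OF \<psi>] summable_on_cmult_right[OF summable_on_geometric_int]]) (rule t_bound[OF \<psi>])
    also have "\<dots> = (E * schwartz_norm N \<psi>) * Q" unfolding Q_def by (rule infsum_cmult_right')
    finally show "norm (G \<psi>) \<le> (E * Q) * schwartz_norm N \<psi>" by (simp add: mult_ac)
  qed
  moreover have "((\<lambda>k. LINT x|lborel. g k x * \<psi> x) has_sum G \<psi>) UNIV" if \<psi>: "\<psi> \<in> schwartz_inf" for \<psi>
  proof -
    have S: "\<psi> \<in> schwartz" using \<psi> by (simp add: schwartz_inf_def)
    have "(LINT x|lebesgue. 1 * \<psi> x) = 0"
      using \<psi> unfolding schwartz_inf_def by (auto dest!: spec[of _ "\<lambda>x. 1"])
    then have z: "(LINT x|lborel. \<psi> x) = 0"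
      using integral_lebesgue_lborel[OF schwartz_measurable[OF S]] by simp
    have "t k \<psi> = (LINT x|lborel. g k x * \<psi> x)" for k
      using ti[OF S, of k] schwartz_integrable[OF S] by (simp add: t_def left_diff_distrib z)
    then show ?thesis using has_sum_infsum[OF st[OF S]] by (simp add: G_def)
  qed
  ultimately show ?thesis by blast
qed

section \<open>Multiplier kernels\<close>

text \<open>A symbol is Lebesgue measurable and bounded almost everywhere, whereas the estimates use
  Borel functions and pointwise bounds. Kernels are integrals of the symbol, so a change on a null
  set does not affect them.\<close>

lemma L_infinity_borel_representative:
  assumes "m \<in> L_infinity"
  shows "\<exists>m0 M. m0 \<in> borel_measurable borel \<and> (\<forall>x. norm (m0 x) \<le> M) \<and> (AE x in lborel. m x = m0 x)"
proof -
  have m: "m \<in> borel_measurable lebesgue" and fin: "Lp_norm \<infinity> UNIV m < \<infinity>"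
    using assms by (auto simp: L_infinity_def)
  obtain M where M: "Lp_norm \<infinity> UNIV m = ennreal M" "0 \<le> M" using fin by (cases "Lp_norm \<infinity> UNIV m") auto
  have AE_M: "AE x in lborel. norm (m x) \<le> M"
    using Lp_norm_top_AE[of UNIV m] M by simp
  have "(\<lambda>x. Re (m x)) \<in> borel_measurable lebesgue" "(\<lambda>x. Im (m x)) \<in> borel_measurable lebesgue"
    using m by measurable
  from this[THEN completion_ex_borel_measurable_real]
  obtain a b where [measurable]: "a \<in> borel_measurable borel" "b \<in> borel_measurable borel"
    and ab: "AE x in lborel. Re (m x) = a x" "AE x in lborel. Im (m x) = b x" by auto
  \<comment> \<open>Truncation at \<open>M\<close> turns the essential bound into a pointwise one
    and changes the function only on a null set.\<close>
  define m0 where "m0 x = (if norm (Complex (a x) (b x)) \<le> M then Complex (a x) (b x) else 0)" for x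
  have "(\<lambda>x. Complex (a x) (b x)) \<in> borel_measurable borel"
    unfolding Complex_eq by measurable
  then have "m0 \<in> borel_measurable borel" unfolding m0_def by measurable
  moreover have "norm (m0 x) \<le> M" for x using M by (simp add: m0_def)
  moreover have "AE x in lborel. m x = m0 x"
    using ab AE_M
  proof eventually_elim
    case (elim x)
    then have "m x = Complex (a x) (b x)" by (simp add: complex_eq_iff)
    with elim show ?case by (simp add: m0_def)
  qed
  ultimately show ?thesis by blast
qed

lemma AE_lborel_scaleR:
  fixes P :: "'a::euclidean_space \<Rightarrow> bool"
  assumes "AE x in lborel. P x" and c: "c \<noteq> 0"
  shows "AE x in lborel. P (c *\<^sub>R x)"
proof -
  obtain N where N: "{x. \<not> P x} \<subseteq> N" "N \<in> sets borel" "emeasure lborel N = 0"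
    using AE_E[OF assms(1)] by auto
  note [measurable] = N(2)
  have "ennreal (\<bar>c\<bar> ^ DIM('a)) * (\<integral>\<^sup>+x. indicator N (0 + c *\<^sub>R x) \<partial>lborel) = (\<integral>\<^sup>+x. indicator N x \<partial>(lborel :: 'a measure))"
    by (rule nn_integral_lborel_affine[OF _ c, symmetric]) measurable
  also have "\<dots> = 0" using N by simp
  finally have "(\<integral>\<^sup>+x. indicator N (c *\<^sub>R x) \<partial>(lborel :: 'a measure)) = 0" using c by simp
  then have "AE x in (lborel :: 'a measure). indicator N (c *\<^sub>R x) = (0::ennreal)"
    by (subst (asm) nn_integral_0_iff_AE) auto
  then show ?thesis by eventually_elim (use N(1) in \<open>auto simp: indicator_def split: if_splits\<close>)
qed

lemma inv_fourier_cong_AE: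
  fixes f g :: "'a::euclidean_space \<Rightarrow> complex"
  assumes f: "f \<in> borel_measurable lebesgue" and g: "g \<in> borel_measurable borel" and e: "AE x in lborel. f x = g x"
  shows "inv_fourier f = inv_fourier g"
proof
  fix x :: 'a
  have c: "(\<lambda>\<xi>. cis (2 * pi * (x \<bullet> \<xi>))) \<in> borel_measurable lebesgue"
    by (intro measurable_completion) (simp add: cis_conv_exp)
  have g': "g \<in> borel_measurable lebesgue" using g by (intro measurable_completion) simp
  have "AE \<xi> in lebesgue. f \<xi> * cis (2 * pi * (x \<bullet> \<xi>)) = g \<xi> * cis (2 * pi * (x \<bullet> \<xi>))"
    using AE_completion[OF e] by eventually_elim simp
  then show "inv_fourier f x = inv_fourier g x"
    unfolding inv_fourier_def by (intro integral_cong_AE borel_measurable_times f g' c)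
qed

lemma cutoff_support:
  assumes "cutoff \<phi>" "\<phi> \<xi> \<noteq> 0" shows "1 / 4 \<le> norm \<xi> \<and> norm \<xi> \<le> 4"
proof -
  have "\<xi> \<in> closure {\<xi>. \<phi> \<xi> \<noteq> 0}" using assms(2) closure_subset by fastforce
  then show ?thesis using assms(1) unfolding cutoff_def by blast
qed

lemma cutoff_measurable: "cutoff \<phi> \<Longrightarrow> \<phi> \<in> borel_measurable borel"
  unfolding cutoff_def by (intro borel_measurable_continuous_onI smooth_continuous) blast

lemma integrable_cutoff_mult:
  fixes m :: "'a::euclidean_space \<Rightarrow> complex"
  assumes \<phi>: "cutoff \<phi>" and [measurable]: "m \<in> borel_measurable borel" and M: "\<And>x. norm (m x) \<le> M"
  shows "integrable lborel (\<lambda>\<xi>. m \<xi> * of_real (\<phi> \<xi>))"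
proof (rule Bochner_Integration.integrable_bound)
  note [measurable] = cutoff_measurable[OF \<phi>]
  show "integrable lborel (\<lambda>\<xi>. M *\<^sub>R (indicator (cball 0 4) \<xi> :: real))"
    by (intro integrable_scaleR_right integrable_real_indicator) 
       (simp_all add: emeasure_lborel_cball_finite[unfolded infinity_ennreal_def])
  show "(\<lambda>\<xi>. m \<xi> * of_real (\<phi> \<xi>)) \<in> borel_measurable lborel" by measurable
  show "AE \<xi> in lborel. norm (m \<xi> * of_real (\<phi> \<xi>)) \<le> norm (M *\<^sub>R (indicator (cball 0 4) \<xi> :: real))"
  proof (rule AE_I2)
    fix \<xi>
    have M0: "0 \<le> M" by (rule order_trans[OF norm_ge_zero M])
    have "norm (m \<xi>) * \<bar>\<phi> \<xi>\<bar> \<le> M * 1"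
      using \<phi> M by (intro mult_mono M) (auto simp: cutoff_def M0)
    then show "norm (m \<xi> * of_real (\<phi> \<xi>)) \<le> norm (M *\<^sub>R (indicator (cball 0 4) \<xi> :: real))"
      using cutoff_support[OF \<phi>, of \<xi>] M0 by (cases "\<phi> \<xi> = 0") (auto simp: norm_mult)
  qed
qed

section \<open>Dilations of kernels, convolutions and Lebesgue quasi-norms\<close>

lemma inv_fourier_dilate:
  fixes n :: "'a::euclidean_space \<Rightarrow> complex"
  assumes n: "n \<in> borel_measurable borel"
  shows "inv_fourier (\<lambda>\<xi>. n (\<xi> /\<^sub>R (2 powi k))) = dyadic (inv_fourier n) k"
proof
  fix x :: 'a
  note [measurable] = n
  define c where "c = (2::real) powi k"
  have c: "c \<noteq> 0" "0 < c" by (auto simp: c_def)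
  have "inv_fourier (\<lambda>\<xi>. n (\<xi> /\<^sub>R c)) x = (LINT \<xi>|lborel. n (\<xi> /\<^sub>R c) * cis (2 * pi * (x \<bullet> \<xi>)))"
    by (rule inv_fourier_lborel) measurable
  also have "\<dots> = (\<bar>c\<bar> ^ DIM('a)) *\<^sub>R (LINT \<xi>|lborel. n ((0 + c *\<^sub>R \<xi>) /\<^sub>R c) * cis (2 * pi * (x \<bullet> (0 + c *\<^sub>R \<xi>))))"
    by (rule integral_lborel_affine[OF c(1)])
  also have "\<dots> = of_real (c ^ DIM('a)) * inv_fourier n (c *\<^sub>R x)"
    using c by (simp add: inv_fourier_lborel scaleR_conv_of_real)
  also have "\<dots> = dyadic (inv_fourier n) k x"
    by (simp add: dyadic_def c_def power_int_mult)
  finally show "inv_fourier (\<lambda>\<xi>. n (\<xi> /\<^sub>R (2 powi k))) x = dyadic (inv_fourier n) k x" by (simp add: c_def)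
qed

text \<open>Brings a convolution at scale \<open>k\<close> to unit scale, where one reproducing
  function serves all \<open>k\<close>.\<close>

lemma convolution_dyadic:
  fixes K h :: "'a::euclidean_space \<Rightarrow> complex"
  assumes [measurable]: "K \<in> borel_measurable borel" "h \<in> borel_measurable borel"
  shows "convolution (dyadic K k) h x = convolution K (\<lambda>y. h (y /\<^sub>R (2 powi k))) ((2 powi k) *\<^sub>R x)"
proof -
  define c where "c = (2::real) powi k"
  have c: "c \<noteq> 0" "0 < c" by (auto simp: c_def)
  have [measurable]: "dyadic K k \<in> borel_measurable borel" unfolding dyadic_def[abs_def] by measurable
  have "convolution K (\<lambda>y. h (y /\<^sub>R c)) (c *\<^sub>R x) = (LINT y|lborel. K (c *\<^sub>R x - y) * h (y /\<^sub>R c))"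
    by (rule convolution_lborel) measurable
  also have "\<dots> = (\<bar>c\<bar> ^ DIM('a)) *\<^sub>R (LINT y|lborel. K (c *\<^sub>R x - (0 + c *\<^sub>R y)) * h ((0 + c *\<^sub>R y) /\<^sub>R c))"
    by (rule integral_lborel_affine[OF c(1)])
  also have "\<dots> = of_real (c ^ DIM('a)) * (LINT y|lborel. K (c *\<^sub>R (x - y)) * h y)"
    using c by (simp add: scaleR_diff_right scaleR_conv_of_real[of "_ ^ _"])
  also have "\<dots> = (LINT y|lborel. of_real (c ^ DIM('a)) * (K (c *\<^sub>R (x - y)) * h y))"
    by (rule integral_mult_right_zero[symmetric])
  also have "\<dots> = (LINT y|lborel. dyadic K k (x - y) * h y)"
    by (simp add: dyadic_def c_def power_int_mult mult.assoc)
  also have "\<dots> = convolution (dyadic K k) h x" by (rule convolution_lborel[symmetric]) measurable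
  finally show ?thesis by (simp add: c_def)
qed

text \<open>The factor depends only on \<open>c\<close>, \<open>p\<close> and the dimension, so it
  is the same for a piece and for its image and cancels later. For \<open>p = \<infinity>\<close> it
  is 1, and equality follows from the inequalities for \<open>c\<close> and for
  \<open>1 / c\<close>.\<close>

lemma Lp_norm_dilate:
  fixes h :: "'a::euclidean_space \<Rightarrow> complex"
  assumes h [measurable]: "h \<in> borel_measurable borel" and c: "0 < c" and p: "0 < p"
  shows "Lp_norm p UNIV h = ennreal (c powr (real DIM('a) * enn2real (inverse p))) * Lp_norm p UNIV (\<lambda>x. h (c *\<^sub>R x))"
proof (cases "p = \<infinity>")
  case True
  have le: "Lp_norm \<infinity> UNIV (\<lambda>x. g (b *\<^sub>R x)) \<le> Lp_norm \<infinity> UNIV g"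
    if [measurable]: "g \<in> borel_measurable borel" and b: "b \<noteq> 0" for g :: "'a \<Rightarrow> complex" and b
  proof -
    have "AE x in lborel. ennreal (norm (g x)) \<le> Lp_norm \<infinity> UNIV g" using Lp_norm_top_AE[of UNIV g] by simp
    from AE_completion[OF AE_lborel_scaleR[OF this b]]
    have ae: "AE x in lebesgue. ennreal (norm (g (b *\<^sub>R x))) \<le> Lp_norm \<infinity> UNIV g" .
    have "(\<lambda>x. ennreal (norm (g (b *\<^sub>R x)))) \<in> borel_measurable lebesgue" by (intro measurable_completion) measurable
    from esssup_I[OF this ae] show ?thesis
      unfolding Lp_norm_def[of \<infinity> UNIV "\<lambda>x. g (b *\<^sub>R x)"] by (simp add: lebesgue_on_UNIV_eq)
  qed
  have [measurable]: "(\<lambda>x. h (c *\<^sub>R x)) \<in> borel_measurable borel" by measurable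
  have "Lp_norm \<infinity> UNIV h \<le> Lp_norm \<infinity> UNIV (\<lambda>x. h (c *\<^sub>R x))"
    using le[of "\<lambda>x. h (c *\<^sub>R x)" "inverse c"] c by simp
  with le[OF h, of c] c have "Lp_norm \<infinity> UNIV h = Lp_norm \<infinity> UNIV (\<lambda>x. h (c *\<^sub>R x))" by (intro antisym) auto
  then show ?thesis using True c by simp
next
  case False
  then obtain p' where p': "p = ennreal p'" "0 \<le> p'" by (cases p) auto
  with p have p0: "0 < p'" by (simp add: ennreal_less_zero_iff)
  have "(\<integral>\<^sup>+x. ennreal (norm (h x) powr p') \<partial>lborel) = ennreal (\<bar>c\<bar> ^ DIM('a)) * (\<integral>\<^sup>+x. ennreal (norm (h (0 + c *\<^sub>R x)) powr p') \<partial>lborel)"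
    by (rule nn_integral_lborel_affine) (use c in auto)
  moreover have "(c ^ DIM('a)) powr (1 / p') = c powr (real DIM('a) * enn2real (inverse p))"
    using c p' p0 by (simp add: powr_realpow[symmetric] powr_powr inverse_ennreal inverse_eq_divide)
  ultimately show ?thesis
    using c p0 p' by (simp add: Lp_norm_finite_exponent epowr_mult epowr_ennreal)
qed

section \<open>Littlewood--Paley pieces of a distribution\<close>

lemma rep_mod_poly:
  assumes G: "G \<in> tempered"
  shows "rep (mod_poly `` {G}) \<in> tempered" and "\<psi> \<in> schwartz_inf \<Longrightarrow> rep (mod_poly `` {G}) \<psi> = G \<psi>"
proof -
  have "polynomial_function (\<lambda>x::'a. 0::complex)" by simp
  then have "(G, G) \<in> mod_poly" unfolding mod_poly_def using G by force
  then have "G \<in> mod_poly `` {G}" by blast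
  then have "rep (mod_poly `` {G}) \<in> mod_poly `` {G}" unfolding rep_def by (rule someI[of "\<lambda>f. f \<in> mod_poly `` {G}"])
  then have r: "(G, rep (mod_poly `` {G})) \<in> mod_poly" by blast
  have D: "H \<in> tempered \<and> (\<exists>P :: 'a \<Rightarrow> complex. polynomial_function P \<and>
      (\<forall>\<psi>\<in>schwartz. G \<psi> - H \<psi> = (LINT x|lebesgue. P x * \<psi> x)))" if "(G, H) \<in> mod_poly" for H
    using that by (simp add: mod_poly_def)
  show "rep (mod_poly `` {G}) \<in> tempered" using D[OF r] by blast
  assume \<psi>: "\<psi> \<in> schwartz_inf"
  obtain P :: "'a \<Rightarrow> complex" where P: "polynomial_function P"
    "\<forall>\<psi>\<in>schwartz. G \<psi> - rep (mod_poly `` {G}) \<psi> = (LINT x|lebesgue. P x * \<psi> x)"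
    using D[OF r] by blast
  have "\<psi> \<in> schwartz" "(LINT x|lebesgue. P x * \<psi> x) = 0"
    using \<psi> P(1) by (auto simp: schwartz_inf_def)
  with P(2) have "G \<psi> - rep (mod_poly `` {G}) \<psi> = 0" by metis
  then show "rep (mod_poly `` {G}) \<psi> = G \<psi>" by simp
qed

lemma rep_tempered: "F \<in> tempered_mod_poly \<Longrightarrow> rep F \<in> tempered"
  unfolding tempered_mod_poly_def by (elim quotientE) (simp add: rep_mod_poly(1))

lemma LP_piece_translate:
  "LP_piece \<Phi> k F x = rep F (\<lambda>y. dyadic \<Phi> k (- (y - x)))"
  by (simp add: LP_piece_def)

lemma schwartz_dyadic_reflect: "\<Phi> \<in> schwartz \<Longrightarrow> (\<lambda>y. dyadic \<Phi> k (- y)) \<in> schwartz"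
  using schwartz_reflect[OF schwartz_dyadic[of \<Phi> k], of 0] by simp

lemma LP_piece_continuous:
  assumes "\<Phi> \<in> schwartz" "F \<in> tempered_mod_poly" shows "continuous_on UNIV (LP_piece \<Phi> k F)"
  using tempered_translation_growth(2)[OF rep_tempered[OF assms(2)] schwartz_dyadic_reflect[OF assms(1), of k]]
  by (simp add: LP_piece_translate[abs_def])

lemma LP_piece_growth:
  assumes "\<Phi> \<in> schwartz" "F \<in> tempered_mod_poly"
  shows "\<exists>A n. \<forall>x. norm (LP_piece \<Phi> k F x) \<le> A * (1 + norm x) ^ n"
  using tempered_translation_growth(1)[OF rep_tempered[OF assms(2)] schwartz_dyadic_reflect[OF assms(1), of k]]
  unfolding LP_piece_translate by blast

text \<open>Associativity with a distribution as third factor: \<open>tempered_convolution\<close>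
  for the reflected kernel and the density \<open>u \<mapsto> \<eta> (x - u)\<close>. It transfers
  identities between kernels to identities between pieces.\<close>

lemma convolution_LP_piece:
  fixes \<Phi> \<eta> :: "'a::euclidean_space \<Rightarrow> complex"
  assumes \<Phi>: "\<Phi> \<in> schwartz" and F: "F \<in> tempered_mod_poly" and \<eta>: "\<eta> \<in> schwartz"
  shows "convolution \<eta> (LP_piece \<Phi> k F) x = rep F (\<lambda>y. convolution \<eta> (dyadic \<Phi> k) (x - y))"
proof -
  let ?\<theta> = "\<lambda>y. dyadic \<Phi> k (- y)"
  have \<theta>: "?\<theta> \<in> schwartz" by (rule schwartz_dyadic_reflect[OF \<Phi>])
  have e: "(\<lambda>u. \<eta> (x - u)) \<in> schwartz" by (rule schwartz_reflect[OF \<eta>])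
  note [measurable] = schwartz_measurable[OF \<theta>] schwartz_measurable[OF e] schwartz_measurable[OF \<eta>]
    schwartz_measurable[OF schwartz_dyadic[OF \<Phi>, of k]]
    borel_measurable_continuous_onI[OF LP_piece_continuous[OF \<Phi> F, of k]]
  have "convolution ?\<theta> (\<lambda>u. \<eta> (x - u)) = (\<lambda>y. convolution \<eta> (dyadic \<Phi> k) (x - y))"
  proof
    fix y
    have "convolution ?\<theta> (\<lambda>u. \<eta> (x - u)) y = (LINT u|lborel. \<eta> ((x - y) - (u - y)) * dyadic \<Phi> k (u - y))"
      by (simp add: convolution_lborel mult.commute)
    also have "\<dots> = (LINT v|lborel. \<eta> ((x - y) - v) * dyadic \<Phi> k v)"
      by (rule integral_lborel_shift[of "\<lambda>v. \<eta> ((x - y) - v) * dyadic \<Phi> k v"])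
    finally show "convolution ?\<theta> (\<lambda>u. \<eta> (x - u)) y = convolution \<eta> (dyadic \<Phi> k) (x - y)"
      by (simp add: convolution_lborel)
  qed
  then have "rep F (\<lambda>y. convolution \<eta> (dyadic \<Phi> k) (x - y)) = (LINT u|lborel. \<eta> (x - u) * rep F (\<lambda>y. ?\<theta> (y - u)))"
    using tempered_convolution[OF rep_tempered[OF F] \<theta> schwartz_all_moments[OF e]] by simp
  also have "\<dots> = convolution \<eta> (LP_piece \<Phi> k F) x"
    by (simp add: convolution_lborel LP_piece_translate)
  finally show ?thesis by simp
qed

lemma tempered_zero: "f \<in> tempered \<Longrightarrow> f (\<lambda>x. 0) = 0"
  using tempered_cmult[of f "\<lambda>x. 0" 0] schwartz_zero by simp

lemma convolution_sum_right:
  assumes K: "nice_kernel K" and "finite I" and g: "\<And>i. i \<in> I \<Longrightarrow> bounded_cont (g i)"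
  shows "bounded_cont (\<lambda>y. \<Sum>i\<in>I. g i y)"
    and "convolution K (\<lambda>y. \<Sum>i\<in>I. g i y) x = (\<Sum>i\<in>I. convolution K (g i) x)"
proof -
  have "bounded_cont (\<lambda>y. \<Sum>i\<in>I. g i y) \<and> convolution K (\<lambda>y. \<Sum>i\<in>I. g i y) x = (\<Sum>i\<in>I. convolution K (g i) x)"
    using assms(2) g
  proof (induction I)
    case empty
    show ?case using nice_kernel_measurable[OF K] by (auto simp: bounded_cont_def convolution_lborel)
  next
    case (insert i I)
    then show ?case using bounded_cont_add[of "g i" "\<lambda>y. \<Sum>i\<in>I. g i y"] convolution_add_right[OF K, of "g i" "\<lambda>y. \<Sum>i\<in>I. g i y" x]
      by simp
  qed
  then show "bounded_cont (\<lambda>y. \<Sum>i\<in>I. g i y)" "convolution K (\<lambda>y. \<Sum>i\<in>I. g i y) x = (\<Sum>i\<in>I. convolution K (g i) x)"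
    by auto
qed

lemma convolution_lp_sum:
  assumes \<Phi>: "\<Phi> \<in> schwartz" and h: "bounded_cont h" and "finite J"
  shows "convolution (lp_sum \<Phi> J) h x = (\<Sum>j\<in>J. convolution (dyadic \<Phi> j) h x)"
  using assms(3)
proof (induction J)
  case empty
  then show ?case using bounded_cont_measurable[OF h] by (simp add: lp_sum_def[abs_def] convolution_lborel)
next
  case (insert j J)
  then show ?case
    using convolution_add_left[OF nice_kernel_dyadic[OF \<Phi>, of j] schwartz_nice_kernel[OF schwartz_lp_sum[OF \<Phi> insert.hyps(1)]] h, of x]
    by (simp add: lp_sum_insert)
qed

lemma LP_piece_reproduced:
  fixes \<Phi> :: "'a::euclidean_space \<Rightarrow> complex"
  assumes LP: "littlewood_paley \<Phi>" and F: "F \<in> tempered_mod_poly"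
  shows "convolution (lp_sum \<Phi> {k - 1..k + 1}) (LP_piece \<Phi> k F) = LP_piece \<Phi> k F"
  using convolution_LP_piece[OF lp_schwartz[OF LP] F schwartz_lp_sum[OF lp_schwartz[OF LP]], of "{k - 1..k + 1}" k]
  by (simp add: fun_eq_iff lp_sum_dyadic[OF LP] LP_piece_def)

lemma LP_piece_commute:
  fixes \<Phi> :: "'a::euclidean_space \<Rightarrow> complex"
  assumes LP: "littlewood_paley \<Phi>" and F: "F \<in> tempered_mod_poly"
  shows "convolution (dyadic \<Phi> j) (LP_piece \<Phi> k F) = convolution (dyadic \<Phi> k) (LP_piece \<Phi> j F)"
proof -
  note \<Phi> = lp_schwartz[OF LP]
  have "convolution (dyadic \<Phi> j) (dyadic \<Phi> k) = convolution (dyadic \<Phi> k) (dyadic \<Phi> j)"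
    by (rule convolution_commute[OF schwartz_measurable[OF schwartz_dyadic[OF \<Phi>]] schwartz_measurable[OF schwartz_dyadic[OF \<Phi>]]])
  then show ?thesis by (simp add: fun_eq_iff convolution_LP_piece[OF \<Phi> F schwartz_dyadic[OF \<Phi>]])
qed

lemma LP_piece_orthogonal:
  fixes \<Phi> :: "'a::euclidean_space \<Rightarrow> complex"
  assumes LP: "littlewood_paley \<Phi>" and F: "F \<in> tempered_mod_poly" and jk: "2 \<le> \<bar>j - k\<bar>"
  shows "convolution (dyadic \<Phi> j) (LP_piece \<Phi> k F) = (\<lambda>x. 0)"
  by (simp add: fun_eq_iff convolution_LP_piece[OF lp_schwartz[OF LP] F schwartz_dyadic[OF lp_schwartz[OF LP]]]
      lp_dyadic_orthogonal[OF LP jk] tempered_zero[OF rep_tempered[OF F]])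

text \<open>Dilation to unit frequency removes \<open>k\<close> from the reproducing function, which
  is what makes the constants uniform in \<open>k\<close>.\<close>

lemma LP_piece_rescaled_reproduced:
  fixes \<Phi> :: "'a::euclidean_space \<Rightarrow> complex"
  assumes LP: "littlewood_paley \<Phi>" and F: "F \<in> tempered_mod_poly"
  shows "convolution (lp_sum \<Phi> {- 1..1}) (\<lambda>y. LP_piece \<Phi> k F (y /\<^sub>R (2 powi k))) = (\<lambda>y. LP_piece \<Phi> k F (y /\<^sub>R (2 powi k)))"
proof
  fix z :: 'a
  note \<Phi> = lp_schwartz[OF LP]
  have \<Psi>: "lp_sum \<Phi> {- 1..1} \<in> schwartz" by (rule schwartz_lp_sum[OF \<Phi>]) simp
  have "convolution (lp_sum \<Phi> {- 1..1}) (\<lambda>y. LP_piece \<Phi> k F (y /\<^sub>R (2 powi k))) z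
    = convolution (dyadic (lp_sum \<Phi> {- 1..1}) k) (LP_piece \<Phi> k F) (z /\<^sub>R (2 powi k))"
    using convolution_dyadic[OF schwartz_measurable[OF \<Psi>] borel_measurable_continuous_onI[OF LP_piece_continuous[OF \<Phi> F, of k]], of k "z /\<^sub>R (2 powi k)"]
    by simp
  also have "\<dots> = LP_piece \<Phi> k F (z /\<^sub>R (2 powi k))"
    unfolding dyadic_lp_sum by (simp add: LP_piece_reproduced[OF LP F])
  finally show "convolution (lp_sum \<Phi> {- 1..1}) (\<lambda>y. LP_piece \<Phi> k F (y /\<^sub>R (2 powi k))) z = LP_piece \<Phi> k F (z /\<^sub>R (2 powi k))" .
qed

text \<open>Bernstein at unit frequency; undoing the dilation yields \<open>2^(k d/p)\<close>. A
  piece is known beforehand only to grow polynomially, and a finite \<open>L^p\<close> quasi-norm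
  upgrades it to a bounded function.\<close>

lemma LP_piece_bounds:
  fixes \<Phi> :: "'a::euclidean_space \<Rightarrow> complex"
  assumes LP: "littlewood_paley \<Phi>" and p: "0 < p"
  shows "\<exists>C\<ge>0. \<forall>F\<in>tempered_mod_poly. \<forall>k x.
    ennreal (norm (LP_piece \<Phi> k F x)) \<le> ennreal (C * 2 powr (real_of_int k * (real DIM('a) * enn2real (inverse p)))) * Lp_norm p UNIV (LP_piece \<Phi> k F)"
proof -
  note \<Phi> = lp_schwartz[OF LP]
  let ?\<Psi> = "lp_sum \<Phi> {- 1..1}"
  have \<Psi>: "?\<Psi> \<in> schwartz" by (rule schwartz_lp_sum[OF \<Phi>]) simp
  obtain C where C: "0 \<le> C" and bern: "\<And>g A n x. g \<in> borel_measurable borel \<Longrightarrow> convolution ?\<Psi> g = g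
      \<Longrightarrow> (\<forall>x. norm (g x) \<le> A * (1 + norm x) ^ n) \<Longrightarrow> ennreal (norm (g x)) \<le> ennreal C * Lp_norm p UNIV g"
    using bernstein[OF \<Psi> p] by blast
  show ?thesis
  proof (intro exI[of _ C] conjI ballI allI C)
    fix F :: "'a functional set" and k and x :: 'a assume F: "F \<in> tempered_mod_poly"
    define P where "P = LP_piece \<Phi> k F"
    define c where "c = (2::real) powi k"
    have c: "0 < c" by (simp add: c_def)
    have Pm [measurable]: "P \<in> borel_measurable borel"
      unfolding P_def by (intro borel_measurable_continuous_onI LP_piece_continuous \<Phi> F)
    define g where "g y = P (y /\<^sub>R c)" for y
    have gm [measurable]: "g \<in> borel_measurable borel" unfolding g_def by measurable
    have rep: "convolution ?\<Psi> g = g"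
      using LP_piece_rescaled_reproduced[OF LP F, of k] by (simp add: g_def[abs_def] P_def c_def)
    obtain A n where A: "\<And>x. norm (P x) \<le> A * (1 + norm x) ^ n"
      using LP_piece_growth[OF \<Phi> F, of k] unfolding P_def by blast
    have A0: "0 \<le> A" using order_trans[OF norm_ge_zero A[of 0]] by simp
    \<comment> \<open>This growth constant depends on \<open>k\<close>, harmlessly, since the
      constant in \<open>bern\<close> ignores the growth data.\<close>
    have growth: "norm (g y) \<le> (A * (1 + inverse c) ^ n) * (1 + norm y) ^ n" for y
    proof -
      have "1 + norm (y /\<^sub>R c) \<le> (1 + inverse c) * (1 + norm y)"
        using c by (simp add: algebra_simps)
      then have "A * (1 + norm (y /\<^sub>R c)) ^ n \<le> A * ((1 + inverse c) * (1 + norm y)) ^ n"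
        by (intro mult_left_mono power_mono A0) auto
      then show ?thesis using A[of "y /\<^sub>R c"] by (simp add: g_def power_mult_distrib mult.assoc)
    qed
    have "ennreal (norm (P x)) = ennreal (norm (g (c *\<^sub>R x)))" using c by (simp add: g_def)
    also have "\<dots> \<le> ennreal C * Lp_norm p UNIV g" using bern[OF gm rep] growth by blast
    also have "Lp_norm p UNIV g = ennreal (c powr (real DIM('a) * enn2real (inverse p))) * Lp_norm p UNIV P"
      using Lp_norm_dilate[OF gm c p] c by (simp add: g_def)
    also have "c powr (real DIM('a) * enn2real (inverse p)) = 2 powr (real_of_int k * (real DIM('a) * enn2real (inverse p)))"
      by (simp add: c_def powr_real_of_int'[symmetric] powr_powr)
    finally show "ennreal (norm (LP_piece \<Phi> k F x))
      \<le> ennreal (C * 2 powr (real_of_int k * (real DIM('a) * enn2real (inverse p)))) * Lp_norm p UNIV (LP_piece \<Phi> k F)"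
      using C by (simp add: P_def ennreal_mult mult.assoc)
  qed
qed

section \<open>The multiplier theorem\<close>

text \<open>The first form compares neighbouring kernels on the Fourier side, the second rescales a
  kernel to unit frequency, and the third identifies the rescaled kernel with a term of
  \<open>mult_norm\<close>.\<close>

lemma mult_kernel_representation:
  fixes m m0 :: "'a::euclidean_space \<Rightarrow> complex"
  assumes \<phi>: "cutoff \<phi>" and m: "m \<in> borel_measurable lebesgue" and [measurable]: "m0 \<in> borel_measurable borel"
    and ae: "AE x in lborel. m x = m0 x"
  shows "mult_kernel \<phi> m k = inv_fourier (\<lambda>\<xi>. m0 \<xi> * of_real (\<phi> (\<xi> /\<^sub>R (2 powi k))))"
    and "mult_kernel \<phi> m k = dyadic (inv_fourier (\<lambda>\<xi>. m0 ((2 powi k) *\<^sub>R \<xi>) * of_real (\<phi> \<xi>))) k"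
    and "inv_fourier (\<lambda>\<xi>. m ((2 powi k) *\<^sub>R \<xi>) * of_real (\<phi> \<xi>)) = inv_fourier (\<lambda>\<xi>. m0 ((2 powi k) *\<^sub>R \<xi>) * of_real (\<phi> \<xi>))"
proof -
  note [measurable] = cutoff_measurable[OF \<phi>]
  have c: "(2::real) powi k \<noteq> 0" by simp
  have \<phi>1: "(\<lambda>\<xi>. complex_of_real (\<phi> (\<xi> /\<^sub>R (2 powi k)))) \<in> borel_measurable lebesgue"
    and \<phi>2: "(\<lambda>\<xi>. complex_of_real (\<phi> \<xi>)) \<in> borel_measurable lebesgue"
    by (intro measurable_completion; measurable)+
  show 1: "mult_kernel \<phi> m k = inv_fourier (\<lambda>\<xi>. m0 \<xi> * of_real (\<phi> (\<xi> /\<^sub>R (2 powi k))))"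
    unfolding mult_kernel_def
  proof (rule inv_fourier_cong_AE)
    show "(\<lambda>\<xi>. m \<xi> * of_real (\<phi> (\<xi> /\<^sub>R (2 powi k)))) \<in> borel_measurable lebesgue"
      by (intro borel_measurable_times m \<phi>1)
    show "AE \<xi> in lborel. m \<xi> * of_real (\<phi> (\<xi> /\<^sub>R (2 powi k))) = m0 \<xi> * of_real (\<phi> (\<xi> /\<^sub>R (2 powi k)))"
      using ae by eventually_elim simp
  qed measurable
  show "mult_kernel \<phi> m k = dyadic (inv_fourier (\<lambda>\<xi>. m0 ((2 powi k) *\<^sub>R \<xi>) * of_real (\<phi> \<xi>))) k"
    unfolding 1 using inv_fourier_dilate[of "\<lambda>\<xi>. m0 ((2 powi k) *\<^sub>R \<xi>) * of_real (\<phi> \<xi>)" k] by simp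
  show "inv_fourier (\<lambda>\<xi>. m ((2 powi k) *\<^sub>R \<xi>) * of_real (\<phi> \<xi>)) = inv_fourier (\<lambda>\<xi>. m0 ((2 powi k) *\<^sub>R \<xi>) * of_real (\<phi> \<xi>))"
  proof (rule inv_fourier_cong_AE)
    have "(\<lambda>\<xi>. m ((2 powi k) *\<^sub>R \<xi>)) \<in> borel_measurable lebesgue"
      using measurable_comp[OF lebesgue_measurable_scaling m, of "2 powi k"] by (simp add: comp_def)
    then show "(\<lambda>\<xi>. m ((2 powi k) *\<^sub>R \<xi>) * of_real (\<phi> \<xi>)) \<in> borel_measurable lebesgue"
      by (intro borel_measurable_times \<phi>2)
    show "AE \<xi> in lborel. m ((2 powi k) *\<^sub>R \<xi>) * of_real (\<phi> \<xi>) = m0 ((2 powi k) *\<^sub>R \<xi>) * of_real (\<phi> \<xi>)"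
      using AE_lborel_scaleR[OF ae c] by eventually_elim simp
  qed measurable
qed

lemma nice_kernel_dilate:
  fixes K :: "'a::euclidean_space \<Rightarrow> complex"
  assumes K: "nice_kernel K"
  shows "nice_kernel (dyadic K k)" and "(LINT x|lborel. norm (dyadic K k x)) = (LINT x|lborel. norm (K x))"
proof -
  define c where "c = (2::real) powi k"
  have c: "c \<noteq> 0" "0 < c" by (auto simp: c_def)
  have e: "dyadic K k = (\<lambda>x. of_real (c ^ DIM('a)) * K (0 + c *\<^sub>R x))"
    by (rule ext) (simp add: dyadic_def c_def power_int_mult)
  note b = nice_kernel_bounded_cont[OF K]
  obtain B where B: "\<And>x. norm (K x) \<le> B" using bounded_contD[OF b] by blast
  have "bounded_cont (dyadic K k)"
    unfolding e
  proof (rule bounded_contI)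
    show "continuous_on UNIV (\<lambda>x. of_real (c ^ DIM('a)) * K (0 + c *\<^sub>R x))"
      by (intro continuous_intros continuous_on_compose2[OF bounded_cont_continuous[OF b]]) auto
    show "norm (of_real (c ^ DIM('a)) * K (0 + c *\<^sub>R x)) \<le> c ^ DIM('a) * B" for x
      unfolding norm_mult norm_of_real using c B by (intro mult_mono) auto
  qed
  moreover have "integrable lborel (dyadic K k)"
    unfolding e by (intro integrable_mult_right integrable_lborel_affine nice_kernel_integrable K c)
  ultimately show "nice_kernel (dyadic K k)" by (simp add: nice_kernel_def)
  have "(LINT x|lborel. norm (K x)) = (\<bar>c\<bar> ^ DIM('a)) *\<^sub>R (LINT x|lborel. norm (K (0 + c *\<^sub>R x)))"
    by (rule integral_lborel_affine[OF c(1)])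
  then show "(LINT x|lborel. norm (dyadic K k x)) = (LINT x|lborel. norm (K x))"
    unfolding e using c by (simp add: norm_mult norm_power)
qed

text \<open>Convolving the series with the \<open>k\<close>-th dyadic function kills all but three
  terms, the other spectra being disjoint. In these three \<mu> \<open>j\<close> may be exchanged
  for \<mu> \<open>k\<close> by \<open>\<mu>eq\<close>, and the remaining blocks of the
  \<open>k\<close>-th piece add up to that piece.\<close>

lemma multiplier_image_piece:
  fixes \<Phi> :: "'a::euclidean_space \<Rightarrow> complex"
  assumes LP: "littlewood_paley \<Phi>" and F: "F \<in> tempered_mod_poly"
    and P: "\<And>k. bounded_cont (LP_piece \<Phi> k F)"
    and \<mu>: "\<And>k. nice_kernel (\<mu> k)"
    and \<mu>eq: "\<And>j k. \<bar>j - k\<bar> < 2 \<Longrightarrow>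
      convolution (\<mu> j) (convolution (dyadic \<Phi> j) (dyadic \<Phi> k)) = convolution (\<mu> k) (convolution (dyadic \<Phi> j) (dyadic \<Phi> k))"
  shows "((\<lambda>j. convolution (dyadic \<Phi> k) (convolution (\<mu> j) (LP_piece \<Phi> j F)) x)
      has_sum convolution (\<mu> k) (LP_piece \<Phi> k F) x) UNIV"
proof -
  note \<Phi> = lp_schwartz[OF LP]
  define J where "J = {k - 1..k + 1}"
  have J: "finite J" by (simp add: J_def)
  define P' where "P' j = LP_piece \<Phi> j F" for j
  have bP: "bounded_cont (P' j)" for j unfolding P'_def by (rule P)
  have D: "nice_kernel (dyadic \<Phi> j)" for j by (rule nice_kernel_dyadic[OF \<Phi>])
  \<comment> \<open>A bounded function standing in for \<open>F\<close> near frequency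
    \<open>2^k\<close>: the \<open>k\<close>-th piece of \<open>F\<close> is
    \<open>dyadic \<Phi> k\<close> convolved with \<open>f0\<close>. Ordinary associativity then
    applies although \<open>F\<close> itself is not a function.\<close>
  define f0 where "f0 y = (\<Sum>i\<in>J. P' i y)" for y
  have f0: "bounded_cont f0"
    unfolding f0_def using bP by (intro convolution_sum_right(1)[OF D J])
  have sumJ: "(\<Sum>i\<in>J. convolution (dyadic \<Phi> i) (P' k) y) = P' k y" for y
    using convolution_lp_sum[OF \<Phi> bP J, of k y] LP_piece_reproduced[OF LP F, of k] by (simp add: J_def P'_def)
  have Pk: "P' k = convolution (dyadic \<Phi> k) f0"
  proof
    fix y
    have "convolution (dyadic \<Phi> k) f0 y = (\<Sum>i\<in>J. convolution (dyadic \<Phi> k) (P' i) y)"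
      unfolding f0_def using bP by (intro convolution_sum_right(2)[OF D J])
    also have "\<dots> = (\<Sum>i\<in>J. convolution (dyadic \<Phi> i) (P' k) y)"
      unfolding P'_def by (simp add: LP_piece_commute[OF LP F, of k])
    finally show "P' k y = convolution (dyadic \<Phi> k) f0 y" by (simp add: sumJ)
  qed
  have DP: "convolution (dyadic \<Phi> j) (P' k) = convolution (convolution (dyadic \<Phi> j) (dyadic \<Phi> k)) f0" for j
    unfolding Pk by (rule convolution_assoc[OF D D f0])
  have swap: "convolution (dyadic \<Phi> k) (convolution (\<mu> j) (P' j)) = convolution (\<mu> j) (convolution (dyadic \<Phi> k) (P' j))" for j
    unfolding convolution_assoc[OF D \<mu> bP] convolution_assoc[OF \<mu> D bP]
    using convolution_commute[OF nice_kernel_measurable[OF D, of k] nice_kernel_measurable[OF \<mu>, of j]] by simp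
  have far: "convolution (dyadic \<Phi> k) (convolution (\<mu> j) (P' j)) x = 0" if "j \<notin> J" for j
  proof -
    have "2 \<le> \<bar>k - j\<bar>" using that by (auto simp: J_def)
    then have "convolution (dyadic \<Phi> k) (P' j) = (\<lambda>x. 0)"
      unfolding P'_def by (rule LP_piece_orthogonal[OF LP F])
    then show ?thesis unfolding swap by (simp add: Defs.convolution_def)
  qed
  have near: "convolution (dyadic \<Phi> k) (convolution (\<mu> j) (P' j)) = convolution (\<mu> k) (convolution (dyadic \<Phi> j) (P' k))" if "j \<in> J" for j
  proof -
    have jk: "\<bar>j - k\<bar> < 2" using that by (auto simp: J_def)
    have DD: "nice_kernel (convolution (dyadic \<Phi> j) (dyadic \<Phi> k))" by (intro nice_kernel_convolution D)
    have "convolution (dyadic \<Phi> k) (convolution (\<mu> j) (P' j)) = convolution (\<mu> j) (convolution (dyadic \<Phi> j) (P' k))"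
    proof -
      have "convolution (dyadic \<Phi> k) (P' j) = convolution (dyadic \<Phi> j) (P' k)"
        unfolding P'_def by (rule LP_piece_commute[OF LP F])
      then show ?thesis unfolding swap by simp
    qed
    also have "\<dots> = convolution (\<mu> j) (convolution (convolution (dyadic \<Phi> j) (dyadic \<Phi> k)) f0)"
      unfolding DP ..
    also have "\<dots> = convolution (\<mu> k) (convolution (convolution (dyadic \<Phi> j) (dyadic \<Phi> k)) f0)"
      unfolding convolution_assoc[OF \<mu> DD f0] \<mu>eq[OF jk] ..
    also have "\<dots> = convolution (\<mu> k) (convolution (dyadic \<Phi> j) (P' k))"
      unfolding DP ..
    finally show ?thesis .
  qed
  have "(\<Sum>j\<in>J. convolution (dyadic \<Phi> k) (convolution (\<mu> j) (P' j)) x) = (\<Sum>j\<in>J. convolution (\<mu> k) (convolution (dyadic \<Phi> j) (P' k)) x)"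
    by (rule sum.cong) (simp_all add: near)
  also have "\<dots> = convolution (\<mu> k) (\<lambda>y. \<Sum>j\<in>J. convolution (dyadic \<Phi> j) (P' k) y) x"
    by (rule convolution_sum_right(2)[OF \<mu> J, symmetric]) (rule bounded_cont_convolution[OF D bP])
  also have "\<dots> = convolution (\<mu> k) (P' k) x" by (simp add: sumJ)
  finally have "((\<lambda>j. convolution (dyadic \<Phi> k) (convolution (\<mu> j) (P' j)) x) has_sum convolution (\<mu> k) (P' k) x) J"
    using J by (simp add: has_sum_finite_iff)
  then have "((\<lambda>j. convolution (dyadic \<Phi> k) (convolution (\<mu> j) (P' j)) x) has_sum convolution (\<mu> k) (P' k) x) UNIV"
    by (subst has_sum_cong_neutral[of J UNIV]) (use far in auto)
  then show ?thesis by (simp add: P'_def)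
qed

lemma convolution_bounded_cont_reflect:
  assumes K: "nice_kernel K" and h: "bounded_cont h"
  shows "(LINT y|lebesgue. h y * K (x - y)) = convolution K h x"
proof -
  note [measurable] = nice_kernel_measurable[OF K] bounded_cont_measurable[OF h]
  show ?thesis by (simp add: convolution_lborel integral_lebesgue_lborel mult.commute)
qed

lemma integrable_lebesgue_of_lborel:
  fixes f :: "'a::euclidean_space \<Rightarrow> complex"
  shows "integrable lborel f \<Longrightarrow> integrable lebesgue f"
  by (subst integrable_completion) (auto dest: borel_measurable_integrable)

text \<open>The two ranges of \<open>u\<close> differ only in how the Herz quasi-norm dominates the
  \<open>L^r\<close> quasi-norm of a unit frequency kernel. That comparison is the hypothesis
  \<open>herz\<close>; the rest of the argument is common.\<close>

theorem multiplier_besov: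
  fixes \<phi> :: "'a::euclidean_space \<Rightarrow> real" and \<Phi> :: "'a \<Rightarrow> complex" and p q u :: ennreal
  assumes \<phi>: "cutoff \<phi>" and LP: "littlewood_paley \<Phi>" and p: "0 < p" and q: "0 < q"
    and r: "min 1 p = ennreal r" "0 < r" "r \<le> 1"
    and herz: "\<exists>C\<ge>0. \<forall>K. reproduced_by (lp_sum \<Phi> {- 2..2}) K \<longrightarrow>
      Lp_norm (ennreal r) UNIV K \<le> ennreal C * herz_norm u s (ennreal r) K"
  shows "\<exists>C::real. \<forall>m\<in>L_infinity. mult_norm \<phi> u s (ennreal r) m < \<infinity> \<longrightarrow>
    (\<forall>F\<in>besov_space \<Phi> p q.
       (\<exists>G. is_multiplier_image \<phi> \<Phi> m F G) \<and>
       (\<forall>G. is_multiplier_image \<phi> \<Phi> m F G \<longrightarrow>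
          besov_norm \<Phi> p q G \<le> ennreal C * mult_norm \<phi> u s (ennreal r) m * besov_norm \<Phi> p q F))"
proof -
  note \<Phi> = lp_schwartz[OF LP]
  define \<Psi>1 where "\<Psi>1 = lp_sum \<Phi> {- 1..1}"
  define \<Psi>2 where "\<Psi>2 = lp_sum \<Phi> {- 2..2}"
  have \<Psi>1: "\<Psi>1 \<in> schwartz" and \<Psi>2: "\<Psi>2 \<in> schwartz"
    unfolding \<Psi>1_def \<Psi>2_def by (auto intro: schwartz_lp_sum \<Phi>)
  obtain CH where CH: "0 \<le> CH" "\<And>K. reproduced_by \<Psi>2 K \<Longrightarrow> Lp_norm (ennreal r) UNIV K \<le> ennreal CH * herz_norm u s (ennreal r) K"
    using herz unfolding \<Psi>2_def by blast
  obtain C1 where C1: "0 \<le> C1" "\<And>K g. nice_kernel K \<Longrightarrow> reproduced_by \<Psi>2 K \<Longrightarrow> reproduced_by \<Psi>1 g \<Longrightarrow>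
      Lp_norm p UNIV (convolution K g) \<le> ennreal C1 * Lp_norm (ennreal r) UNIV K * Lp_norm p UNIV g"
    using convolution_Lp_bound[OF \<Psi>2 \<Psi>1 p] unfolding r(1) by blast
  obtain C2 where C2: "0 \<le> C2" "\<And>K. reproduced_by \<Psi>2 K \<Longrightarrow> (\<integral>\<^sup>+x. ennreal (norm (K x)) \<partial>lborel) \<le> ennreal C2 * Lp_norm (ennreal r) UNIV K"
    using L1_le_Lr[OF \<Psi>2 r(2,3)] by blast
  define \<beta> where "\<beta> = real DIM('a) * enn2real (inverse p)"
  have \<beta>: "0 \<le> \<beta>" by (simp add: \<beta>_def)
  obtain C3 where C3: "0 \<le> C3" "\<And>F k x. F \<in> tempered_mod_poly \<Longrightarrow>
      ennreal (norm (LP_piece \<Phi> k F x)) \<le> ennreal (C3 * 2 powr (real_of_int k * \<beta>)) * Lp_norm p UNIV (LP_piece \<Phi> k F)"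
    using LP_piece_bounds[OF LP p] unfolding \<beta>_def by blast
  show ?thesis
  \<comment> \<open>\<open>C1\<close> is the convolution constant and \<open>CH\<close> the Herz
    constant; both belong to unit frequency and involve neither \<open>m\<close> nor
    \<open>F\<close> nor \<open>k\<close>.\<close>
  proof (intro exI[of _ "C1 * CH"] ballI impI)
    fix m :: "'a \<Rightarrow> complex" and F
    assume mL: "m \<in> L_infinity" and fin: "mult_norm \<phi> u s (ennreal r) m < \<infinity>" and FB: "F \<in> besov_space \<Phi> p q"
    have m: "m \<in> borel_measurable lebesgue" using mL by (simp add: L_infinity_def)
    have F: "F \<in> tempered_mod_poly" and Ffin: "besov_norm \<Phi> p q F < \<infinity>" using FB by (auto simp: besov_space_def)
    obtain m0 M where m0 [measurable]: "m0 \<in> borel_measurable borel" and M: "\<And>x. norm (m0 x) \<le> M"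
      and ae: "AE x in lborel. m x = m0 x" using L_infinity_borel_representative[OF mL] by blast
    obtain \<kappa> where \<kappa>: "mult_norm \<phi> u s (ennreal r) m = ennreal \<kappa>" "0 \<le> \<kappa>"
      using fin by (cases "mult_norm \<phi> u s (ennreal r) m") auto
    obtain b where b: "besov_norm \<Phi> p q F = ennreal b" "0 \<le> b"
      using Ffin by (cases "besov_norm \<Phi> p q F") auto
    define n where "n k \<xi> = m0 ((2 powi k) *\<^sub>R \<xi>) * of_real (\<phi> \<xi>)" for k \<xi>
    define K where "K k = inv_fourier (n k)" for k
    define \<mu> where "\<mu> k = mult_kernel \<phi> m k" for k
    define P where "P k = LP_piece \<Phi> k F" for k
    have n: "integrable lborel (n k)" for k
      unfolding n_def by (rule integrable_cutoff_mult[OF \<phi> _ M]) measurable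
    have K: "reproduced_by \<Psi>2 (K k)" for k
      unfolding reproduced_by_def K_def \<Psi>2_def
    proof
      show "bounded_cont (inv_fourier (n k))" by (rule bounded_cont_inv_fourier[OF n])
      show "convolution (lp_sum \<Phi> {- 2..2}) (inv_fourier (n k)) = inv_fourier (n k)"
        by (rule lp_sum_inv_fourier[OF LP n]) (use cutoff_support[OF \<phi>] in \<open>auto simp: n_def\<close>)
    qed
    have LpK: "Lp_norm (ennreal r) UNIV (K k) \<le> ennreal (CH * \<kappa>)" for k
    proof -
      have "herz_norm u s (ennreal r) (K k) \<le> mult_norm \<phi> u s (ennreal r) m"
        unfolding mult_norm_def K_def n_def mult_kernel_representation(3)[OF \<phi> m m0 ae] by (rule SUP_upper) simp
      then have "ennreal CH * herz_norm u s (ennreal r) (K k) \<le> ennreal CH * ennreal \<kappa>"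
        unfolding \<kappa> by (rule mult_left_mono) simp
      then show ?thesis using CH(2)[OF K, of k] CH(1) \<kappa>(2) by (simp add: ennreal_mult)
    qed
    have L1K: "(\<integral>\<^sup>+x. ennreal (norm (K k x)) \<partial>lborel) \<le> ennreal (C2 * (CH * \<kappa>))" for k
      using order_trans[OF C2(2)[OF K, of k] mult_left_mono[OF LpK, of "ennreal C2" k]] C2(1) CH(1) \<kappa>(2)
      by (simp add: ennreal_mult)
    \<comment> \<open>Boundedness of \<open>m\<close> alone does not make the kernel integrable;
      this comes from the finite Herz quasi-norm by way of \<open>L1_le_Lr\<close>.\<close>
    have nK: "nice_kernel (K k)" for k
    proof -
      have bK: "bounded_cont (K k)" using K by (rule reproduced_by_bounded_cont)
      have "(\<integral>\<^sup>+x. ennreal (norm (K k x)) \<partial>lborel) < \<infinity>" by (rule le_less_trans[OF L1K]) simp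
      then have "integrable lborel (K k)"
        using bounded_cont_measurable[OF bK] by (simp add: integrable_iff_bounded)
      with bK show ?thesis by (simp add: nice_kernel_def)
    qed
    have \<mu>K: "\<mu> k = dyadic (K k) k" for k
      unfolding \<mu>_def K_def n_def by (rule mult_kernel_representation(2)[OF \<phi> m m0 ae])
    have n\<mu>: "nice_kernel (\<mu> k)" for k unfolding \<mu>K by (rule nice_kernel_dilate(1)[OF nK])
    define A where "A = C2 * (CH * \<kappa>)"
    have A: "0 \<le> A" using C2 CH \<kappa> by (simp add: A_def)
    have L1\<mu>: "(LINT x|lborel. norm (\<mu> k x)) \<le> A" for k
    proof -
      have "ennreal (LINT x|lborel. norm (K k x)) = (\<integral>\<^sup>+x. ennreal (norm (K k x)) \<partial>lborel)"
        using nice_kernel_integrable[OF nK] by (intro nn_integral_eq_integral[symmetric]) auto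
      then have "ennreal (LINT x|lborel. norm (K k x)) \<le> ennreal A" using L1K[of k] by (simp add: A_def)
      then show ?thesis unfolding \<mu>K nice_kernel_dilate(2)[OF nK] using A by simp
    qed
    have Pb: "norm (P k x) \<le> C3 * b * 2 powr (real_of_int k * \<beta>)" for k x
    proof -
      have "Lp_norm p UNIV (P k) \<le> ennreal b"
        using le_lq_norm[OF q, of "\<lambda>k. Lp_norm p UNIV (LP_piece \<Phi> k F)" k] b by (simp add: besov_norm_def P_def)
      then have "ennreal (C3 * 2 powr (real_of_int k * \<beta>)) * Lp_norm p UNIV (P k) \<le> ennreal (C3 * 2 powr (real_of_int k * \<beta>)) * ennreal b"
        by (rule mult_left_mono) simp
      then have "ennreal (norm (P k x)) \<le> ennreal (C3 * 2 powr (real_of_int k * \<beta>) * b)"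
        using C3(2)[OF F, of k x] C3(1) b(2) unfolding P_def by (simp add: ennreal_mult)
      then show ?thesis using C3(1) b(2) by (simp add: mult_ac)
    qed
    have P: "bounded_cont (P k)" for k
      using Pb by (intro bounded_contI) (auto simp: P_def intro: LP_piece_continuous \<Phi> F)
    define h where "h k = convolution (\<mu> k) (P k)" for k
    have h: "bounded_cont (h k)" for k unfolding h_def by (rule bounded_cont_convolution[OF n\<mu> P])
    have hb: "norm (h k x) \<le> (A * (C3 * b)) * 2 powr (real_of_int k * \<beta>)" for k x
    proof -
      have "norm (h k x) \<le> (LINT y|lborel. norm (\<mu> k y)) * (C3 * b * 2 powr (real_of_int k * \<beta>))"
        unfolding h_def by (rule norm_convolution_le[OF n\<mu> P Pb])
      also have "\<dots> \<le> A * (C3 * b * 2 powr (real_of_int k * \<beta>))"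
        using C3 b by (intro mult_right_mono L1\<mu>) auto
      finally show ?thesis by (simp add: mult.assoc)
    qed
    have n\<Psi>: "nice_kernel (dyadic \<Psi>1 k)" for k by (rule nice_kernel_dyadic[OF \<Psi>1])
    have hrep: "convolution (dyadic \<Psi>1 k) (h k) = h k" for k
    proof -
      have "convolution (dyadic \<Psi>1 k) (h k) = convolution (\<mu> k) (convolution (dyadic \<Psi>1 k) (P k))"
        unfolding h_def convolution_assoc[OF n\<Psi> n\<mu> P] convolution_assoc[OF n\<mu> n\<Psi> P]
        using convolution_commute[OF nice_kernel_measurable[OF n\<Psi>, of k] nice_kernel_measurable[OF n\<mu>, of k]] by simp
      also have "convolution (dyadic \<Psi>1 k) (P k) = P k"
        unfolding \<Psi>1_def dyadic_lp_sum P_def by (rule LP_piece_reproduced[OF LP F])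
      finally show ?thesis by (simp add: h_def)
    qed
    \<comment> \<open>The spectrum of \<Phi>, hence that of \<open>\<Psi>1\<close>, avoids the
      origin; the vanishing mean is what makes the high frequency part of the series
      converge.\<close>
    have mean: "(LINT x|lborel. \<Psi>1 x) = 0"
    proof -
      have "fourier \<Phi> 0 = 0" using lp_support(1)[OF LP, of 0] by force
      then have "fourier \<Psi>1 0 = 0"
        unfolding \<Psi>1_def by (simp add: fourier_lp_sum[OF \<Phi>])
      then show ?thesis using schwartz_measurable[OF \<Psi>1] by (simp add: fourier_lborel)
    qed
    obtain G0 where G0: "G0 \<in> tempered"
      and G0_sum: "\<And>\<psi>. \<psi> \<in> schwartz_inf \<Longrightarrow> ((\<lambda>k. LINT x|lborel. h k x * \<psi> x) has_sum G0 \<psi>) UNIV"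
      using ex_tempered_sum[OF \<Psi>1 mean h hrep _ \<beta> hb] A C3 b by auto
    define G where "G = mod_poly `` {G0}"
    have "is_multiplier_image \<phi> \<Phi> m F G"
      unfolding is_multiplier_image_def
    proof (intro conjI F allI ballI)
      show "G \<in> tempered_mod_poly" unfolding tempered_mod_poly_def G_def by (rule quotientI[OF G0])
      show "integrable lebesgue (mult_kernel \<phi> m k)" for k
        using n\<mu>[of k] unfolding \<mu>_def by (intro integrable_lebesgue_of_lborel nice_kernel_integrable)
      show "integrable lebesgue (\<lambda>y. mult_kernel \<phi> m k (x - y) * LP_piece \<Phi> k F y)" for k x
        using integrable_conv[OF n\<mu>[of k] P[of k], of x] unfolding \<mu>_def P_def by (rule integrable_lebesgue_of_lborel)
      fix \<psi> :: "'a \<Rightarrow> complex" assume \<psi>: "\<psi> \<in> schwartz_inf"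
      then have S: "\<psi> \<in> schwartz" by (simp add: schwartz_inf_def)
      note [measurable] = schwartz_measurable[OF S] bounded_cont_measurable[OF h]
      have "integrable lborel (\<lambda>x. h k x * \<psi> x)" for k
        using bounded_schwartz_pairing(1)[OF bounded_cont_measurable[OF h[of k]] _ S, of "(A * (C3 * b)) * 2 powr (real_of_int k * \<beta>)" 0] hb[of k]
        by simp
      then show "integrable lebesgue (\<lambda>x. convolution (mult_kernel \<phi> m k) (LP_piece \<Phi> k F) x * \<psi> x)" for k
        using integrable_lebesgue_of_lborel[of "\<lambda>x. h k x * \<psi> x"] by (simp add: h_def \<mu>_def P_def)
      have "(LINT x|lebesgue. h k x * \<psi> x) = (LINT x|lborel. h k x * \<psi> x)" for k
        by (rule integral_lebesgue_lborel) measurable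
      then show "((\<lambda>k. LINT x|lebesgue. convolution (mult_kernel \<phi> m k) (LP_piece \<Phi> k F) x * \<psi> x) has_sum rep G \<psi>) UNIV"
        using G0_sum[OF \<psi>] rep_mod_poly(2)[OF G0 \<psi>] by (simp add: h_def \<mu>_def P_def G_def)
    qed
    moreover have "besov_norm \<Phi> p q H \<le> ennreal (C1 * CH) * mult_norm \<phi> u s (ennreal r) m * besov_norm \<Phi> p q F"
      if H: "is_multiplier_image \<phi> \<Phi> m F H" for H
    proof -
      have H_sum: "((\<lambda>k. LINT x|lebesgue. h k x * \<psi> x) has_sum rep H \<psi>) UNIV" if "\<psi> \<in> schwartz_inf" for \<psi>
        using H that unfolding is_multiplier_image_def h_def \<mu>_def P_def by blast
      \<comment> \<open>Where the transform of \<open>?X\<close> is nonzero, both rescaled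
        frequencies lie in the annulus on which \<phi> is 1, so both symbols equal \<open>m0\<close>
        there.\<close>
      have \<mu>eq: "convolution (\<mu> j) (convolution (dyadic \<Phi> j) (dyadic \<Phi> k)) = convolution (\<mu> k) (convolution (dyadic \<Phi> j) (dyadic \<Phi> k))" for j k
      proof -
        let ?X = "convolution (dyadic \<Phi> j) (dyadic \<Phi> k)"
        have X: "nice_kernel ?X" by (intro nice_kernel_convolution nice_kernel_dyadic \<Phi>)
        define \<nu> where "\<nu> i \<xi> = m0 \<xi> * of_real (\<phi> (\<xi> /\<^sub>R (2 powi i)))" for i \<xi>
        have \<nu>i: "integrable lborel (\<nu> i)" for i
        proof -
          have "\<nu> i = (\<lambda>\<xi>. n i (0 + inverse (2 powi i) *\<^sub>R \<xi>))" by (rule ext) (simp add: \<nu>_def n_def)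
          then show ?thesis using integrable_lborel_affine[OF n[of i], of "inverse (2 powi i)" 0] by simp
        qed
        have \<mu>\<nu>: "\<mu> i = inv_fourier (\<nu> i)" for i
          unfolding \<mu>_def \<nu>_def by (rule mult_kernel_representation(1)[OF \<phi> m m0 ae])
        have "\<nu> j \<xi> * fourier ?X \<xi> = \<nu> k \<xi> * fourier ?X \<xi>" for \<xi>
        proof (cases "fourier ?X \<xi> = 0")
          case False
          then have nz: "fourier \<Phi> (\<xi> /\<^sub>R (2 powi j)) \<noteq> 0" "fourier \<Phi> (\<xi> /\<^sub>R (2 powi k)) \<noteq> 0"
            by (auto simp: fourier_convolution[OF nice_kernel_dyadic[OF \<Phi>] nice_kernel_dyadic[OF \<Phi>]]
                fourier_dyadic[OF schwartz_measurable[OF \<Phi>]])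
          have one: "\<phi> \<xi>' = 1" if "fourier \<Phi> \<xi>' \<noteq> 0" for \<xi>'
            using lp_support[OF LP that] \<phi> unfolding cutoff_def by (auto simp: less_imp_le)
          show ?thesis using one[OF nz(1)] one[OF nz(2)] by (simp add: \<nu>_def)
        qed simp
        then have "inv_fourier (\<lambda>\<xi>. \<nu> j \<xi> * fourier ?X \<xi>) = inv_fourier (\<lambda>\<xi>. \<nu> k \<xi> * fourier ?X \<xi>)" by (simp only:)
        then have "convolution ?X (\<mu> j) = convolution ?X (\<mu> k)"
          unfolding \<mu>\<nu> convolution_inv_fourier[OF X \<nu>i] .
        then show ?thesis
          unfolding convolution_commute[OF nice_kernel_measurable[OF n\<mu>] nice_kernel_measurable[OF X]] .
      qed
      \<comment> \<open>Testing the defining series of an arbitrary image \<open>H\<close> with the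
        reflected kernel gives the series summed in \<open>multiplier_image_piece\<close>;
        uniqueness of sums determines every piece of \<open>H\<close>.\<close>
      have piece: "LP_piece \<Phi> k H = h k" for k
      proof
        fix x
        have "((\<lambda>j. convolution (dyadic \<Phi> k) (h j) x) has_sum h k x) UNIV"
          unfolding h_def P_def by (rule multiplier_image_piece[OF LP F P[unfolded P_def] n\<mu> \<mu>eq])
        moreover have "((\<lambda>j. convolution (dyadic \<Phi> k) (h j) x) has_sum LP_piece \<Phi> k H x) UNIV"
          using H_sum[OF dyadic_reflect_schwartz_inf[OF LP, of k x]]
          by (simp add: convolution_bounded_cont_reflect[OF nice_kernel_dyadic[OF \<Phi>] h] LP_piece_def)
        ultimately show "LP_piece \<Phi> k H x = h k x" by (metis has_sum_unique)
      qed
      \<comment> \<open>Passing to unit scale multiplies the quasi-norms of the piece and of its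
        image by the same factor \<open>a = 2^(k d/p)\<close>, which is divided out at the
        end.\<close>
      have est: "Lp_norm p UNIV (LP_piece \<Phi> k H) \<le> ennreal (C1 * CH * \<kappa>) * Lp_norm p UNIV (LP_piece \<Phi> k F)" for k
      proof -
        define c where "c = (2::real) powi k"
        have c: "0 < c" by (simp add: c_def)
        define g where "g y = P k (y /\<^sub>R c)" for y
        have gb: "bounded_cont g"
          unfolding g_def
        proof (rule bounded_contI)
          show "continuous_on UNIV (\<lambda>y. P k (y /\<^sub>R c))"
            by (intro continuous_on_compose2[OF bounded_cont_continuous[OF P]] continuous_intros) auto
        qed (rule Pb)
        have g: "reproduced_by \<Psi>1 g"
          using gb LP_piece_rescaled_reproduced[OF LP F, of k]
          by (simp add: reproduced_by_def \<Psi>1_def g_def[abs_def] P_def c_def)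
        have gm: "g \<in> borel_measurable borel" "convolution (K k) g \<in> borel_measurable borel"
          using gb bounded_cont_convolution[OF nK gb] by (auto intro: bounded_cont_measurable)
        define a where "a = c powr \<beta>"
        have a: "0 < a" using c by (simp add: a_def)
        have hg: "h k = (\<lambda>x. convolution (K k) g (c *\<^sub>R x))"
          by (rule ext) (simp add: h_def \<mu>K convolution_dyadic[OF nice_kernel_measurable[OF nK] bounded_cont_measurable[OF P]] g_def[abs_def] c_def)
        have "ennreal a * Lp_norm p UNIV (h k) = Lp_norm p UNIV (convolution (K k) g)"
          using Lp_norm_dilate[OF gm(2) c p] by (simp add: a_def \<beta>_def hg)
        also have "\<dots> \<le> ennreal C1 * Lp_norm (ennreal r) UNIV (K k) * Lp_norm p UNIV g"
          by (rule C1(2)[OF nK K g])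
        also have "\<dots> \<le> ennreal C1 * ennreal (CH * \<kappa>) * Lp_norm p UNIV g"
          by (intro mult_right_mono mult_left_mono LpK) auto
        also have "Lp_norm p UNIV g = ennreal a * Lp_norm p UNIV (P k)"
          using Lp_norm_dilate[OF gm(1) c p] c by (simp add: a_def \<beta>_def g_def)
        finally have "ennreal (1 / a) * (ennreal a * Lp_norm p UNIV (h k))
          \<le> ennreal (1 / a) * (ennreal C1 * ennreal (CH * \<kappa>) * (ennreal a * Lp_norm p UNIV (P k)))"
          by (rule mult_left_mono) simp
        also have "\<dots> = (ennreal (1 / a) * ennreal a) * (ennreal C1 * ennreal (CH * \<kappa>) * Lp_norm p UNIV (P k))"
          by (simp only: mult_ac)
        also have "ennreal (1 / a) * ennreal a = 1" using a by (simp add: ennreal_mult[symmetric])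
        finally have "(ennreal (1 / a) * ennreal a) * Lp_norm p UNIV (h k) \<le> ennreal C1 * ennreal (CH * \<kappa>) * Lp_norm p UNIV (P k)"
          by (simp add: mult.assoc)
        then have "Lp_norm p UNIV (h k) \<le> ennreal C1 * ennreal (CH * \<kappa>) * Lp_norm p UNIV (P k)"
          using a by (simp add: ennreal_mult[symmetric])
        then show ?thesis using C1(1) CH(1) \<kappa>(2) by (simp add: piece P_def ennreal_mult mult.assoc)
      qed
      have "besov_norm \<Phi> p q H \<le> ennreal (C1 * CH * \<kappa>) * besov_norm \<Phi> p q F"
        unfolding besov_norm_def by (rule lq_norm_cmult_le[OF q _ est]) simp
      then show ?thesis using C1(1) CH(1) \<kappa> by (simp add: ennreal_mult)
    qed
    ultimately show "(\<exists>G. is_multiplier_image \<phi> \<Phi> m F G) \<and>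
      (\<forall>G. is_multiplier_image \<phi> \<Phi> m F G \<longrightarrow>
          besov_norm \<Phi> p q G \<le> ennreal (C1 * CH) * mult_norm \<phi> u s (ennreal r) m * besov_norm \<Phi> p q F)"
      by blast
  qed
qed

theorem theorem2p1:
  fixes \<phi> :: "'a::euclidean_space \<Rightarrow> real"
    and \<Phi> :: "'a \<Rightarrow> complex"
    and p q u r :: ennreal
  assumes "cutoff \<phi>" and "littlewood_paley \<Phi>"
    and "0 < p" and "0 < q" and "r = min 1 p"
  shows
    "(0 < u \<and> u \<le> r \<longrightarrow>
       (\<exists>C::real. \<forall>m\<in>L_infinity. mult_norm \<phi> u 0 r m < \<infinity> \<longrightarrow>
          (\<forall>F\<in>besov_space \<Phi> p q.
             (\<exists>G. is_multiplier_image \<phi> \<Phi> m F G) \<and>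
             (\<forall>G. is_multiplier_image \<phi> \<Phi> m F G \<longrightarrow>
                besov_norm \<Phi> p q G \<le> ennreal C * mult_norm \<phi> u 0 r m * besov_norm \<Phi> p q F)))) \<and>
     (r < u \<longrightarrow>
       (\<exists>C::real. \<forall>m\<in>L_infinity.
          (let s = real DIM('a) * enn2real (inverse r) - real DIM('a) * enn2real (inverse u);
               K = mult_norm \<phi> u s r m
           in K < \<infinity> \<longrightarrow>
             (\<forall>F\<in>besov_space \<Phi> p q.
                (\<exists>G. is_multiplier_image \<phi> \<Phi> m F G) \<and>
                (\<forall>G. is_multiplier_image \<phi> \<Phi> m F G \<longrightarrow>
                   besov_norm \<Phi> p q G \<le> ennreal C * K * besov_norm \<Phi> p q F)))))"
proof -
  have "r \<le> 1" using assms(5) by simp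
  then have "r < \<top>" using le_less_trans ennreal_one_less_top by blast
  then obtain r' where r': "r = ennreal r'" "0 \<le> r'" by (cases r) auto
  have "0 < r" using assms(3,5) by simp
  then have r0: "0 < r'" using r' by (simp add: ennreal_less_zero_iff)
  have r1: "r' \<le> 1" using \<open>r \<le> 1\<close> r' by simp
  have mr: "min 1 p = ennreal r'" using assms(5) r' by simp
  note main = multiplier_besov[OF assms(1,2,3,4) mr r0 r1]
  have \<Psi>: "lp_sum \<Phi> {- 2..2} \<in> schwartz" by (rule schwartz_lp_sum[OF lp_schwartz[OF assms(2)]]) simp
  \<comment> \<open>The Herz comparisons concern \<open>r\<close>-th powers, which add over shells;
    the \<open>r\<close>-th root brings them into the form of the hypothesis
    \<open>herz\<close>.\<close>
  have root: "\<exists>C\<ge>0. \<forall>K. reproduced_by (lp_sum \<Phi> {- 2..2}) K \<longrightarrow> Lp_norm (ennreal r') UNIV K \<le> ennreal C * herz_norm u s (ennreal r') K"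
    if "\<exists>C\<ge>0. \<forall>K. reproduced_by (lp_sum \<Phi> {- 2..2}) K \<longrightarrow>
      (\<integral>\<^sup>+x. ennreal (norm (K x) powr r') \<partial>lborel) \<le> ennreal C * epowr (herz_norm u s (ennreal r') K) r'" for s
  proof -
    obtain C where C: "0 \<le> C" "\<And>K. reproduced_by (lp_sum \<Phi> {- 2..2}) K \<Longrightarrow>
      (\<integral>\<^sup>+x. ennreal (norm (K x) powr r') \<partial>lborel) \<le> ennreal C * epowr (herz_norm u s (ennreal r') K) r'"
      using \<open>\<exists>C\<ge>0. _\<close> by blast
    show ?thesis
    proof (intro exI[of _ "C powr (1 / r')"] conjI allI impI)
      fix K assume K: "reproduced_by (lp_sum \<Phi> {- 2..2}) K"
      have "epowr (\<integral>\<^sup>+x. ennreal (norm (K x) powr r') \<partial>lborel) (1 / r') \<le> epowr (ennreal C * epowr (herz_norm u s (ennreal r') K) r') (1 / r')"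
        by (intro epowr_mono C(2)[OF K]) (use r0 in simp)
      then show "Lp_norm (ennreal r') UNIV K \<le> ennreal (C powr (1 / r')) * herz_norm u s (ennreal r') K"
        using r0 C(1) bounded_cont_measurable[OF reproduced_by_bounded_cont[OF K]]
        by (simp add: Lp_norm_finite_exponent epowr_mult epowr_ennreal epowr_epowr)
    qed simp
  qed
  show ?thesis
  proof (intro conjI impI)
    assume u: "0 < u \<and> u \<le> r"
    then have "u < \<top>" using \<open>r < \<top>\<close> le_less_trans by blast
    then obtain u' where u': "u = ennreal u'" "0 \<le> u'" by (cases u) auto
    have "0 < u'" "u' \<le> r'" using u u' r' by (auto simp: ennreal_less_zero_iff)
    from main[OF root[of 0]] Lr_le_herz_small_exponent[OF \<Psi> this r1]
    show "\<exists>C::real. \<forall>m\<in>L_infinity. mult_norm \<phi> u 0 r m < \<infinity> \<longrightarrow>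
          (\<forall>F\<in>besov_space \<Phi> p q.
             (\<exists>G. is_multiplier_image \<phi> \<Phi> m F G) \<and>
             (\<forall>G. is_multiplier_image \<phi> \<Phi> m F G \<longrightarrow>
                besov_norm \<Phi> p q G \<le> ennreal C * mult_norm \<phi> u 0 r m * besov_norm \<Phi> p q F))"
      unfolding u'(1) r'(1) by blast
  next
    assume u: "r < u"
    define s where "s = real DIM('a) * enn2real (inverse r) - real DIM('a) * enn2real (inverse u)"
    \<comment> \<open>As \<open>r\<close> is real and positive its inverse becomes a real quotient,
      while the inverse of \<open>u\<close> stays in \<open>ennreal\<close>, where
      \<open>u = \<infinity>\<close> contributes 0.\<close>
    have s: "s = real DIM('a) / r' - real DIM('a) * enn2real (inverse u)"
      using r0 by (simp add: s_def r' inverse_ennreal inverse_eq_divide)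
    have "\<exists>C\<ge>0. \<forall>K. reproduced_by (lp_sum \<Phi> {- 2..2}) K \<longrightarrow>
      (\<integral>\<^sup>+x. ennreal (norm (K x) powr r') \<partial>lborel) \<le> ennreal C * epowr (herz_norm u s (ennreal r') K) r'"
      using Lr_le_herz_large_exponent[OF r0 u[unfolded r'(1)], where 'a = 'a] reproduced_by_bounded_cont
      unfolding s by blast
    from main[OF root[OF this]]
    show "\<exists>C::real. \<forall>m\<in>L_infinity.
          (let s = real DIM('a) * enn2real (inverse r) - real DIM('a) * enn2real (inverse u);
               K = mult_norm \<phi> u s r m
           in K < \<infinity> \<longrightarrow>
             (\<forall>F\<in>besov_space \<Phi> p q.
                (\<exists>G. is_multiplier_image \<phi> \<Phi> m F G) \<and>
                (\<forall>G. is_multiplier_image \<phi> \<Phi> m F G \<longrightarrow>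
                   besov_norm \<Phi> p q G \<le> ennreal C * K * besov_norm \<Phi> p q F)))"
      unfolding Let_def s_def[symmetric] r'(1)[symmetric] .
  qed
qed

end
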